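(* There exist universal constants $C,\xi>0$ such that the following holds. Let $Q$ be the generator of a mixing continuous-time Markov chain on a finite set $\mathbf{V}$, $|\mathbf{V}|\ge2$, with unique stationary distribution $\pi$. Let $q_{\max}$ be the maximum transition rate out of a state, $\pi_{\max}=\max_{x}\pi(x)$, $t_{\mathrm{mix}}^Q$ the mixing time, $\mathsf{m}(Q)$ the expected meeting time of two independent chains evolving according to $Q$ both started from $\pi$, and $\mathsf{C}$ the full coalescence time of coalescing random walks evolving according to $Q$ and started with one walker at each state. Put $$\alpha(Q)=(1+q_{\max}\,t_{\mathrm{mix}}^Q)\,\pi_{\max}.$$ If $\big(\alpha(Q)\ln(1/\alpha(Q))\ln^4|\mathbf{V}|\big)^{1/6}\le\xi$, then $$d_W\Big(\mathrm{Law}\Big(\frac{\mathsf{C}}{\mathsf{m}(Q)}\Big),\ \mathrm{Law}\Big(\sum_{i\ge 2}\mathsf{Z}_i\Big)\Big)\le C\Big(\alpha(Q)\ln\Big(\frac{1}{\alpha(Q)}\Big)\ln^4|\mathbf{V}|\Big)^{1/6},$$ where $\mathsf{Z}_2,\mathsf{Z}_3,\dots$ are independent with $\mathbf{P}(\mathsf{Z}_i\ge t)=e^{-t\binom{i}{2}}$ for all $t\ge0$, $i\ge2$. In particular, $$\Big|\frac{\mathbf{E}[\mathsf{C}]}{\mathsf{m}(Q)}-2\Big|\le C\Big(\alpha(Q)\ln\Big(\frac{1}{\alpha(Q)}\Big)\ln^4|\mathbf{V}|\Big)^{1/6}.$$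
   Context: A chain with generator $Q$ on $\mathbf{V}$ is specified by rates $q(x,y)\ge 0$ ($x\ne y$): it jumps from $x$ to $y$ at rate $q(x,y)$. $q_{\max}=\max_x\sum_{y\neq x}q(x,y)$. The chain is mixing if it has a unique stationary distribution $\pi$ and $\mathrm{Law}_x(X_t)\to\pi$ as $t\to\infty$ for each $x$. No reversibility is assumed. Mixing time: $t_{\mathrm{mix}}^Q$ is the smallest $T\ge0$ with $\max_{x}d_{\mathrm{TV}}(\mathrm{Law}_x(X_T),\pi)\le 1/4$, $d_{\mathrm{TV}}(p,q)=\frac12\sum_s|p(s)-q(s)|$. Meeting time of two chains: $M=\inf\{t\ge0: X_t(1)=X_t(2)\}$; $\mathsf{m}(Q)=\mathbf{E}_{\pi\otimes\pi}[M]$ for independent $X(1),X(2)$. Coalescing random walks: one walker starts at each state of $\mathbf{V}$; walkers move independently according to $Q$, except that when two walkers are at the same state at the same time they coalesce into one, which continues to move according to $Q$. $\mathsf{C}$ is the first time at which only one walker remains. $d_W$ is the $L_1$ Wasserstein distance between laws on $\mathbf{R}$ with finite first moment: $d_W(\lambda_1,\lambda_2)=\int_{\mathbf{R}}|\lambda_1(x,+\infty)-\lambda_2(x,+\infty)|\,dx$. "Universal constants" do not depend on $Q$, $\mathbf{V}$ or any other object.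
   Formalization: The added hypothesis α(Q) ≤ 1/e is needed: α ln(1/α) vanishes at α = 1, where a two-state chain violates the bound, and for α > 1 the sixth root is of a negative number. The finite set V is taken, up to relabelling, as a set of natural numbers. *)

theory Defs
  imports "HOL-Probability.Probability"
begin

section \<open>Continuous-time Markov chains on a finite set\<close>

text \<open>
  State spaces are explicit finite sets \<open>S\<close> and rates are functions \<open>q x y\<close>, of which only the
  values at \<open>x, y \<in> S\<close>, \<open>x \<noteq> y\<close>, matter.  The transition function is the matrix exponential
  of the generator, written out as its power series.
\<close>

definition rates :: "'s set \<Rightarrow> ('s \<Rightarrow> 's \<Rightarrow> real) \<Rightarrow> bool" where
  "rates S q \<longleftrightarrow> (\<forall>x\<in>S. \<forall>y\<in>S. x \<noteq> y \<longrightarrow> 0 \<le> q x y)"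

definition generator :: "'s set \<Rightarrow> ('s \<Rightarrow> 's \<Rightarrow> real) \<Rightarrow> 's \<Rightarrow> 's \<Rightarrow> real" where
  "generator S q x y = (if x = y then - (\<Sum>z\<in>S - {x}. q x z) else q x y)"

primrec generator_power :: "'s set \<Rightarrow> ('s \<Rightarrow> 's \<Rightarrow> real) \<Rightarrow> nat \<Rightarrow> 's \<Rightarrow> 's \<Rightarrow> real" where
  "generator_power S q 0 x y = (if x = y then 1 else 0)"
| "generator_power S q (Suc n) x y = (\<Sum>z\<in>S. generator S q x z * generator_power S q n z y)"

definition transition :: "'s set \<Rightarrow> ('s \<Rightarrow> 's \<Rightarrow> real) \<Rightarrow> real \<Rightarrow> 's \<Rightarrow> 's \<Rightarrow> real" where
  "transition S q t x y = (\<Sum>n. t ^ n / fact n * generator_power S q n x y)"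

definition stationary :: "'s set \<Rightarrow> ('s \<Rightarrow> 's \<Rightarrow> real) \<Rightarrow> ('s \<Rightarrow> real) \<Rightarrow> bool" where
  "stationary S q \<pi> \<longleftrightarrow> (\<forall>x\<in>S. 0 \<le> \<pi> x) \<and> (\<Sum>x\<in>S. \<pi> x) = 1 \<and>
     (\<forall>t\<ge>0. \<forall>y\<in>S. (\<Sum>x\<in>S. \<pi> x * transition S q t x y) = \<pi> y)"

definition mixing :: "'s set \<Rightarrow> ('s \<Rightarrow> 's \<Rightarrow> real) \<Rightarrow> ('s \<Rightarrow> real) \<Rightarrow> bool" where
  "mixing S q \<pi> \<longleftrightarrow> stationary S q \<pi> \<and>
     (\<forall>\<rho>. stationary S q \<rho> \<longrightarrow> (\<forall>x\<in>S. \<rho> x = \<pi> x)) \<and>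
     (\<forall>x\<in>S. \<forall>y\<in>S. ((\<lambda>t. transition S q t x y) \<longlongrightarrow> \<pi> y) at_top)"

definition d_TV :: "'s set \<Rightarrow> ('s \<Rightarrow> real) \<Rightarrow> ('s \<Rightarrow> real) \<Rightarrow> real" where
  "d_TV S p p' = (1/2) * (\<Sum>s\<in>S. \<bar>p s - p' s\<bar>)"

definition t_mix :: "'s set \<Rightarrow> ('s \<Rightarrow> 's \<Rightarrow> real) \<Rightarrow> ('s \<Rightarrow> real) \<Rightarrow> real" where
  "t_mix S q \<pi> = (LEAST T. 0 \<le> T \<and> (MAX x\<in>S. d_TV S (transition S q T x) \<pi>) \<le> 1/4)"

definition q_max :: "'s set \<Rightarrow> ('s \<Rightarrow> 's \<Rightarrow> real) \<Rightarrow> real" where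
  "q_max S q = (MAX x\<in>S. \<Sum>y\<in>S - {x}. q x y)"

definition alpha :: "'s set \<Rightarrow> ('s \<Rightarrow> 's \<Rightarrow> real) \<Rightarrow> ('s \<Rightarrow> real) \<Rightarrow> real" where
  "alpha S q \<pi> = (1 + q_max S q * t_mix S q \<pi>) * (MAX x\<in>S. \<pi> x)"

text \<open>
  The sixth root is meaningful as an error term only for small \<open>\<alpha>\<close>: the product
  \<open>\<alpha> * ln (1 / \<alpha>)\<close> increases on \<open>(0, 1/e]\<close>, then decreases, vanishes at \<open>\<alpha> = 1\<close> and is
  negative beyond, where the root is undefined (\<^const>\<open>powr\<close> still returns a value).  The theorem
  therefore assumes \<open>\<alpha> \<le> 1/e\<close>.
\<close>

definition mf_error :: "'s set \<Rightarrow> ('s \<Rightarrow> 's \<Rightarrow> real) \<Rightarrow> ('s \<Rightarrow> real) \<Rightarrow> real" where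
  "mf_error S q \<pi> =
     (alpha S q \<pi> * ln (1 / alpha S q \<pi>) * ln (real (card S)) ^ 4) powr (1/6)"

section \<open>Path laws\<close>

text \<open>
  A chain is given by its law on the space of right-continuous \<open>S\<close>-valued paths indexed by
  \<open>t \<ge> 0\<close>, with the \<open>\<sigma>\<close>-algebra generated by the coordinates.  The finite-dimensional
  distributions determine such a law uniquely.  Every process with right-continuous paths induces
  one, so speaking about laws does not restrict the underlying probability space.
\<close>

definition path_space :: "'s set \<Rightarrow> (real \<Rightarrow> 's) measure" where
  "path_space S = restrict_space (\<Pi>\<^sub>M t\<in>{0..}. count_space S)
     {\<omega>. \<forall>t\<ge>0. \<exists>e>0. \<forall>s\<in>{t..<t + e}. \<omega> s = \<omega> t}"

definition chain_law ::
    "'s set \<Rightarrow> ('s \<Rightarrow> 's \<Rightarrow> real) \<Rightarrow> ('s \<Rightarrow> real) \<Rightarrow> (real \<Rightarrow> 's) measure \<Rightarrow> bool" where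
  "chain_law S q \<mu> P \<longleftrightarrow> prob_space P \<and> sets P = sets (path_space S) \<and>
     (\<forall>(n::nat) t x. t 0 = 0 \<and> (\<forall>i<n. t i \<le> t (Suc i)) \<and> (\<forall>i\<le>n. x i \<in> S) \<longrightarrow>
        measure P {\<omega> \<in> space P. \<forall>i\<le>n. \<omega> (t i) = x i} =
        \<mu> (x 0) * (\<Prod>i<n. transition S q (t (Suc i) - t i) (x i) (x (Suc i))))"

section \<open>Meeting and coalescence\<close>

definition meeting_time :: "(real \<Rightarrow> 's) \<Rightarrow> (real \<Rightarrow> 's) \<Rightarrow> ennreal" where
  "meeting_time \<omega> \<omega>' = (INF t\<in>{t. 0 \<le> t \<and> \<omega> t = \<omega>' t}. ennreal t)"

text \<open>The product measure makes the two paths independent, each with law \<open>P\<close>.\<close>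

definition mean_meeting_time :: "(real \<Rightarrow> 's) measure \<Rightarrow> real" where
  "mean_meeting_time P = enn2real (\<integral>\<^sup>+\<omega>. meeting_time (fst \<omega>) (snd \<omega>) \<partial>(P \<Otimes>\<^sub>M P))"

text \<open>
  The state of the coalescing walks is the set \<open>A\<close> of sites occupied by the remaining walkers.
  The walker at \<open>x \<in> A\<close> jumps to \<open>y\<close> at rate \<open>q x y\<close>, independently of the others, and merges
  with the walker at \<open>y\<close> if there is one; either way \<open>A\<close> becomes \<open>insert y (A - {x})\<close>.
\<close>

definition coalescing_rate :: "'v set \<Rightarrow> ('v \<Rightarrow> 'v \<Rightarrow> real) \<Rightarrow> 'v set \<Rightarrow> 'v set \<Rightarrow> real" where
  "coalescing_rate V q A B = (\<Sum>x\<in>A. \<Sum>y\<in>{y \<in> V - {x}. insert y (A - {x}) = B}. q x y)"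

definition coalescing_law ::
    "'v set \<Rightarrow> ('v \<Rightarrow> 'v \<Rightarrow> real) \<Rightarrow> (real \<Rightarrow> 'v set) measure \<Rightarrow> bool" where
  "coalescing_law V q P \<longleftrightarrow>
     chain_law (Pow V - {{}}) (coalescing_rate V q) (\<lambda>A. if A = V then 1 else 0) P"

definition coalescence_time :: "(real \<Rightarrow> 'v set) \<Rightarrow> ennreal" where
  "coalescence_time \<eta> = (INF t\<in>{t. 0 \<le> t \<and> card (\<eta> t) = 1}. ennreal t)"

text \<open>Almost surely the coalescence time is finite, so \<^const>\<open>enn2real\<close> does not affect its law.\<close>

definition scaled_coalescence_law :: "(real \<Rightarrow> 'v set) measure \<Rightarrow> real \<Rightarrow> real measure" where
  "scaled_coalescence_law P m = distr P borel (\<lambda>\<eta>. enn2real (coalescence_time \<eta>) / m)"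

definition mean_coalescence_time :: "(real \<Rightarrow> 'v set) measure \<Rightarrow> real" where
  "mean_coalescence_time P = enn2real (\<integral>\<^sup>+\<eta>. coalescence_time \<eta> \<partial>P)"

section \<open>The limit law and the Wasserstein distance\<close>

definition exponential_sum_law :: "real measure" where
  "exponential_sum_law =
     distr (\<Pi>\<^sub>M i\<in>{2..}. density lborel (exponential_density (real (i choose 2)))) borel
       (\<lambda>z. \<Sum>i. z (i + 2))"

definition d_W :: "real measure \<Rightarrow> real measure \<Rightarrow> ennreal" where
  "d_W \<mu> \<nu> = (\<integral>\<^sup>+x. ennreal \<bar>measure \<mu> {x<..} - measure \<nu> {x<..}\<bar> \<partial>lborel)"

end

theory Submission imports Defs begin

text \<open>
  Walkers that start from equilibrium meet pairwise at nearly independent exponential times, so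
  \<open>i\<close> walkers lose one at rate about \<open>(i choose 2) / m\<close>, where \<open>m\<close> is the mean meeting time.

  Observe the chain in time steps that tend to zero, and group time into blocks that are long
  compared with \<open>t_mix\<close> and short compared with \<open>m\<close>.  At the beginning of each block the walkers
  mix; during the rest some pair of \<open>i\<close> walkers meets with probability close to \<open>(i choose 2)\<close>
  times that of a single pair.  By Bonferroni's inequality the error consists of two meetings in
  one block, and an equilibrium walker meets a given walker within time \<open>t\<close> with probability at
  most \<open>\<pi>_max (1 + 2 q_max t)\<close>; this is where \<open>\<alpha>\<close> enters.  Hence the number of walkers is
  dominated by a death chain, whose absorption time is in turn dominated by the sum of
  exponential variables.  While more than about \<open>ln n / \<epsilon>\<close> walkers remain, their expected number
  decreases geometrically and fast.  This bounds the tail of \<open>C / m\<close> from above by that of the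
  limit law, up to \<open>O(\<epsilon>)\<close> in \<open>L\<^sub>1\<close>.

  For the other direction a bound on the mean suffices:  if \<open>c i\<close> is the mean coalescence time
  from \<open>i\<close> equilibrium walkers, then \<open>c i - c (i - 1)\<close> is at least the mean time to the first
  meeting, about \<open>m / (i choose 2)\<close>, so that \<open>E C \<ge> (2 - O(\<epsilon>)) m\<close>.  The negative part of the
  difference of the tails is then controlled by its positive part and its integral.
\<close>


text \<open>The exponent 6 is dictated by the lower bound on the mean. Its recursion runs up to
  \<open>k\<close> of order \<open>1 / \<epsilon>\<close> walkers, because the part of the sum of
  \<open>1 / (i choose 2)\<close> beyond \<open>k\<close> is \<open>2 / k\<close>. Each stage may
  lose, up to constants, \<open>k ^ 4 * eta * ln n\<close> times \<open>m\<close> to a second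
  meeting soon after the first: \<open>k ^ 4\<close> counts pairs of pairs, and
  \<open>m * ln n\<close> bounds the mean remaining time. Hence \<open>k ^ 5 * eta * ln n\<close>
  has to be of order \<open>\<epsilon>\<close>, and \<open>eta\<close> of order
  \<open>\<epsilon> ^ 6\<close>. Here \<open>eta\<close>, the chance that an equilibrium walker
  meets a given one during one mixing period, is of order \<open>\<alpha> * ln n\<close>: the period
  is about \<open>12 * ln n\<close> times \<open>t_mix\<close>, which leaves a distance from
  equilibrium of at most \<open>n ^ (-8)\<close>, negligible against the meeting probability of two
  equilibrium walkers, which is at least \<open>1 / n\<close>.

  On a grid all laws have finite support, so hitting probabilities are functions defined by
  recursion in time, and couplings turn into monotonicity proofs by induction; path space enters
  only in the limit. The constants do not depend on the mesh, so the estimates survive it.\<close>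

abbreviation expect :: "'a pmf \<Rightarrow> ('a \<Rightarrow> real) \<Rightarrow> real" where
  "expect p f \<equiv> measure_pmf.expectation p f"

section \<open>Expectations under finitely supported distributions\<close>

lemma expect_mono:
  assumes "finite (set_pmf p)" "\<And>x. x \<in> set_pmf p \<Longrightarrow> f x \<le> g x"
  shows "expect p f \<le> expect p g"
  using assms by (intro integral_mono_AE) (auto simp: AE_measure_pmf_iff integrable_measure_pmf_finite)

lemma expect_cong:
  assumes "\<And>x. x \<in> set_pmf p \<Longrightarrow> f x = g x"
  shows "expect p f = expect p g"
  using assms by (intro integral_cong_AE) (auto simp: AE_measure_pmf_iff)

lemma expect_add:
  assumes "finite (set_pmf p)"
  shows "expect p (\<lambda>x. f x + g x) = expect p f + expect p g"
  using assms by (intro Bochner_Integration.integral_add) (auto intro: integrable_measure_pmf_finite)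

lemma expect_diff:
  assumes "finite (set_pmf p)"
  shows "expect p (\<lambda>x. f x - g x) = expect p f - expect p g"
  using assms by (intro Bochner_Integration.integral_diff) (auto intro: integrable_measure_pmf_finite)

lemma expect_sum:
  assumes "finite (set_pmf p)"
  shows "expect p (\<lambda>x. \<Sum>i\<in>S. f i x) = (\<Sum>i\<in>S. expect p (f i))"
  using assms by (intro Bochner_Integration.integral_sum) (auto intro: integrable_measure_pmf_finite)

lemma expect_ge:
  assumes "finite (set_pmf p)" "\<And>x. x \<in> set_pmf p \<Longrightarrow> c \<le> f x"
  shows "c \<le> expect p f"
  using expect_mono[OF assms(1), of "\<lambda>_. c" f] assms(2) by simp

lemma expect_le:
  assumes "finite (set_pmf p)" "\<And>x. x \<in> set_pmf p \<Longrightarrow> f x \<le> c"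
  shows "expect p f \<le> c"
  using expect_mono[OF assms(1), of f "\<lambda>_. c"] assms(2) by simp

lemma expect_sum_set:
  assumes "finite A" "set_pmf p \<subseteq> A"
  shows "expect p f = (\<Sum>a\<in>A. pmf p a * f a)"
  using assms by (subst integral_measure_pmf[of A]) auto

lemma expect_bind:
  assumes "finite (set_pmf p)" "\<And>x. x \<in> set_pmf p \<Longrightarrow> finite (set_pmf (k x))"
  shows "expect (bind_pmf p k) f = expect p (\<lambda>x. expect (k x) f)"
proof -
  have "expect (bind_pmf p k) f = (\<Sum>a\<in>set_pmf p. pmf p a *\<^sub>R expect (k a) f)"
    using assms by (intro pmf_expectation_bind) auto
  also have "\<dots> = expect p (\<lambda>x. expect (k x) f)"
    using assms by (subst expect_sum_set[of "set_pmf p"]) auto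
  finally show ?thesis .
qed

lemma expect_suminf:
  assumes "finite (set_pmf p)" "\<And>x. x \<in> set_pmf p \<Longrightarrow> summable (\<lambda>t. f t x)"
  shows "expect p (\<lambda>x. \<Sum>t. f t x) = (\<Sum>t. expect p (f t))" "summable (\<lambda>t. expect p (f t))"
proof -
  have *: "expect p (\<lambda>x. g x) = (\<Sum>x\<in>set_pmf p. pmf p x * g x)" for g :: "'a \<Rightarrow> real"
    using assms by (intro expect_sum_set) auto
  show "expect p (\<lambda>x. \<Sum>t. f t x) = (\<Sum>t. expect p (f t))"
    using assms by (simp add: * suminf_sum suminf_mult)
  show "summable (\<lambda>t. expect p (f t))"
    using assms by (simp add: * summable_sum summable_mult)
qed

section \<open>Sums of monotone sequences over blocks\<close>

lemma sum_lessThan_block: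
  fixes a :: "nat \<Rightarrow> real"
  shows "(\<Sum>t<Suc N*b. a t) = (\<Sum>t<N*b. a t) + (\<Sum>t<b. a (N*b+t))"
proof -
  have "(\<Sum>t<N*b+c. a t) = (\<Sum>t<N*b. a t) + (\<Sum>t<c. a (N*b+t))" for c
    by (induction c) auto
  from this[of b] show ?thesis by (simp add: add.commute)
qed

lemma sum_le_block_sum:
  fixes a :: "nat \<Rightarrow> real"
  assumes "antimono a"
  shows "(\<Sum>t<N*b. a t) \<le> real b * (\<Sum>j<N. a (j*b))"
proof (induction N)
  case (Suc N)
  have "(\<Sum>t<Suc N*b. a t) = (\<Sum>t<N*b. a t) + (\<Sum>t<b. a (N*b+t))"
    by (rule sum_lessThan_block)
  also have "(\<Sum>t<b. a (N*b+t)) \<le> (\<Sum>t<b. a (N*b))"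
    using assms by (intro sum_mono) (auto simp: antimono_def)
  finally show ?case using Suc by (simp add: algebra_simps)
qed simp

lemma block_sum_le_sum:
  fixes a :: "nat \<Rightarrow> real"
  assumes "antimono a"
  shows "real b * (\<Sum>j<N. a (Suc j*b)) \<le> (\<Sum>t<N*b. a t)"
proof (induction N)
  case (Suc N)
  have *: "(\<Sum>t<Suc N*b. a t) = (\<Sum>t<N*b. a t) + (\<Sum>t<b. a (N*b+t))"
    by (rule sum_lessThan_block)
  have "(\<Sum>t<b. a (Suc N*b)) \<le> (\<Sum>t<b. a (N*b+t))"
    using assms by (intro sum_mono) (auto simp: antimono_def)
  then show ?case using Suc * by (simp add: algebra_simps)
qed simp

section \<open>Hitting times of finite Markov chains\<close>

primrec steps :: "('a \<Rightarrow> 'a pmf) \<Rightarrow> nat \<Rightarrow> 'a \<Rightarrow> 'a pmf" where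
  "steps \<kappa> 0 x = return_pmf x"
| "steps \<kappa> (Suc t) x = bind_pmf (\<kappa> x) (steps \<kappa> t)"

lemma steps_0: "steps \<kappa> 0 = return_pmf"
  by (rule ext) simp

text \<open>With \<open>T\<close> the hitting time of \<open>B\<close>, \<open>payoff \<kappa> B \<beta> t x\<close> is the expectation of
  \<open>\<beta> (X T)\<close> on the event \<open>T \<le> t\<close>, and \<open>alive \<kappa> B f t x\<close> that of \<open>f (X t)\<close> on \<open>T > t\<close>.\<close>

primrec payoff :: "('a \<Rightarrow> 'a pmf) \<Rightarrow> 'a set \<Rightarrow> ('a \<Rightarrow> real) \<Rightarrow> nat \<Rightarrow> 'a \<Rightarrow> real" where
  "payoff \<kappa> B \<beta> 0 x = (if x \<in> B then \<beta> x else 0)"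
| "payoff \<kappa> B \<beta> (Suc t) x = (if x \<in> B then \<beta> x else expect (\<kappa> x) (payoff \<kappa> B \<beta> t))"

primrec alive :: "('a \<Rightarrow> 'a pmf) \<Rightarrow> 'a set \<Rightarrow> ('a \<Rightarrow> real) \<Rightarrow> nat \<Rightarrow> 'a \<Rightarrow> real" where
  "alive \<kappa> B f 0 x = (if x \<in> B then 0 else f x)"
| "alive \<kappa> B f (Suc t) x = (if x \<in> B then 0 else expect (\<kappa> x) (alive \<kappa> B f t))"

abbreviation hit :: "('a \<Rightarrow> 'a pmf) \<Rightarrow> 'a set \<Rightarrow> nat \<Rightarrow> 'a \<Rightarrow> real" where
  "hit \<kappa> B \<equiv> payoff \<kappa> B (\<lambda>_. 1)"

abbreviation surv :: "('a \<Rightarrow> 'a pmf) \<Rightarrow> 'a set \<Rightarrow> nat \<Rightarrow> 'a \<Rightarrow> real" where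
  "surv \<kappa> B \<equiv> alive \<kappa> B (\<lambda>_. 1)"

lemma payoff_in: "x \<in> B \<Longrightarrow> payoff \<kappa> B \<beta> t x = \<beta> x"
  by (cases t) auto

lemma alive_in: "x \<in> B \<Longrightarrow> alive \<kappa> B f t x = 0"
  by (cases t) auto

locale finite_kernel =
  fixes \<kappa> :: "'a \<Rightarrow> 'a pmf"
  assumes fin: "finite (set_pmf (\<kappa> x))"
begin

lemma finite_steps: "finite (set_pmf (steps \<kappa> t x))"
  by (induction t arbitrary: x) (auto simp: fin)

lemma expect_steps_Suc: "expect (steps \<kappa> (Suc t) x) f = expect (\<kappa> x) (\<lambda>y. expect (steps \<kappa> t y) f)"
  by (simp add: expect_bind fin finite_steps)

lemma expect_steps_add:
  "expect (steps \<kappa> (t + u) x) f = expect (steps \<kappa> t x) (\<lambda>y. expect (steps \<kappa> u y) f)"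
  by (induction t arbitrary: x) (simp_all add: expect_steps_Suc del: steps.simps(2))

lemma payoff_nonneg:
  assumes "\<And>x. 0 \<le> \<beta> x" shows "0 \<le> payoff \<kappa> B \<beta> t x"
  using assms by (induction t arbitrary: x) (auto intro!: expect_ge fin)

lemma payoff_le:
  assumes "\<And>x. \<beta> x \<le> M" "0 \<le> M" shows "payoff \<kappa> B \<beta> t x \<le> M"
  using assms by (induction t arbitrary: x) (auto intro!: expect_le fin)

lemma payoff_sum:
  assumes "finite S"
  shows "payoff \<kappa> B (\<lambda>x. \<Sum>i\<in>S. \<beta> i x) t x = (\<Sum>i\<in>S. payoff \<kappa> B (\<beta> i) t x)"
proof (induction t arbitrary: x)
  case (Suc t)
  have "payoff \<kappa> B (\<lambda>x. \<Sum>i\<in>S. \<beta> i x) t = (\<lambda>x. \<Sum>i\<in>S. payoff \<kappa> B (\<beta> i) t x)"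
    by (rule ext) (rule Suc)
  then show ?case by (auto simp: expect_sum fin)
qed auto

lemma payoff_Suc_ge:
  assumes "\<And>x. 0 \<le> \<beta> x" shows "payoff \<kappa> B \<beta> t x \<le> payoff \<kappa> B \<beta> (Suc t) x"
proof (induction t arbitrary: x)
  case 0 then show ?case using payoff_nonneg[OF assms] by (auto intro!: expect_ge fin simp: assms)
next
  case (Suc t) then show ?case by (auto intro!: expect_mono fin simp del: payoff.simps(2) simp add: payoff.simps(2)[of _ _ _ "Suc t"] payoff.simps(2)[of _ _ _ t])
qed

lemma payoff_mono_time:
  assumes "\<And>x. 0 \<le> \<beta> x" "t \<le> u" shows "payoff \<kappa> B \<beta> t x \<le> payoff \<kappa> B \<beta> u x"
  using lift_Suc_mono_le[of "\<lambda>t. payoff \<kappa> B \<beta> t x", OF payoff_Suc_ge[OF assms(1)] assms(2)] .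

lemma alive_nonneg:
  assumes "\<And>x. 0 \<le> f x" shows "0 \<le> alive \<kappa> B f t x"
  using assms by (induction t arbitrary: x) (auto intro!: expect_ge fin)

lemma alive_mono:
  assumes "\<And>x. f x \<le> g x" shows "alive \<kappa> B f t x \<le> alive \<kappa> B g t x"
  using assms by (induction t arbitrary: x) (auto intro!: expect_mono fin)

lemma alive_const: "alive \<kappa> B (\<lambda>_. c) t x = c * surv \<kappa> B t x"
proof (induction t arbitrary: x)
  case (Suc t)
  have "alive \<kappa> B (\<lambda>_. c) t = (\<lambda>x. c * surv \<kappa> B t x)" by (rule ext) (rule Suc)
  then show ?case by simp
qed auto

lemma alive_le_steps:
  assumes "\<And>x. 0 \<le> f x" shows "alive \<kappa> B f t x \<le> expect (steps \<kappa> t x) f"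
proof (induction t arbitrary: x)
  case (Suc t)
  have "expect (\<kappa> x) (alive \<kappa> B f t) \<le> expect (steps \<kappa> (Suc t) x) f"
    unfolding expect_steps_Suc by (intro expect_mono fin Suc)
  moreover have "0 \<le> expect (steps \<kappa> (Suc t) x) f" by (intro expect_ge finite_steps assms)
  ultimately show ?case by (simp del: steps.simps)
qed (auto simp: assms)

lemma alive_add: "alive \<kappa> B f (t + u) x = alive \<kappa> B (alive \<kappa> B f u) t x"
proof (induction t arbitrary: x)
  case (Suc t)
  have "alive \<kappa> B f (t + u) = alive \<kappa> B (alive \<kappa> B f u) t" by (rule ext) (rule Suc)
  then show ?case by simp
qed (auto simp: alive_in)

lemma payoff_add:
  "payoff \<kappa> B \<beta> (t + u) x = payoff \<kappa> B \<beta> t x + alive \<kappa> B (payoff \<kappa> B \<beta> u) t x"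
proof (induction t arbitrary: x)
  case (Suc t)
  have "payoff \<kappa> B \<beta> (t + u) = (\<lambda>x. payoff \<kappa> B \<beta> t x + alive \<kappa> B (payoff \<kappa> B \<beta> u) t x)"
    by (rule ext) (rule Suc)
  then show ?case by (simp add: expect_add fin)
qed (auto simp: payoff_in)

lemma hit_add_surv: "hit \<kappa> B t x + surv \<kappa> B t x = 1"
proof (induction t arbitrary: x)
  case (Suc t)
  have "expect (\<kappa> x) (hit \<kappa> B t) + expect (\<kappa> x) (surv \<kappa> B t) = 1"
    by (subst expect_add[symmetric]) (auto simp: fin Suc)
  then show ?case by auto
qed auto

lemma hit_nonneg: "0 \<le> hit \<kappa> B t x" by (rule payoff_nonneg) auto
lemma hit_le_1: "hit \<kappa> B t x \<le> 1" by (rule payoff_le) auto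
lemma surv_nonneg: "0 \<le> surv \<kappa> B t x" by (rule alive_nonneg) auto
lemma surv_le_1: "surv \<kappa> B t x \<le> 1" using hit_add_surv[of B t x] hit_nonneg[of B t x] by linarith

lemma surv_antimono: "antimono (\<lambda>t. surv \<kappa> B t x)"
proof (rule antimonoI)
  fix t u :: nat assume "t \<le> u"
  from payoff_mono_time[OF _ this, of "\<lambda>_. 1" B x] hit_add_surv[of B t x] hit_add_surv[of B u x]
  show "surv \<kappa> B u x \<le> surv \<kappa> B t x" by auto
qed

lemma hit_mono_set:
  assumes "A \<subseteq> B" shows "hit \<kappa> A t x \<le> hit \<kappa> B t x"
proof (induction t arbitrary: x)
  case (Suc t)
  have "expect (\<kappa> x) (hit \<kappa> A t) \<le> expect (\<kappa> x) (hit \<kappa> B t)" by (intro expect_mono fin Suc)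
  moreover have "expect (\<kappa> x) (hit \<kappa> A t) \<le> 1" by (intro expect_le fin hit_le_1)
  ultimately show ?case using assms by auto
qed (use assms in auto)

lemma surv_geometric:
  assumes "\<And>x. surv \<kappa> B b x \<le> \<rho>" "0 \<le> \<rho>"
  shows "surv \<kappa> B (j * b) x \<le> \<rho> ^ j"
proof (induction j arbitrary: x)
  case (Suc j)
  have "surv \<kappa> B (Suc j * b) x = alive \<kappa> B (surv \<kappa> B (j * b)) b x"
    by (simp flip: alive_add)
  also have "\<dots> \<le> alive \<kappa> B (\<lambda>_. \<rho> ^ j) b x"
    by (intro alive_mono Suc)
  also have "\<dots> = \<rho> ^ j * surv \<kappa> B b x" by (rule alive_const)
  also have "\<dots> \<le> \<rho> ^ j * \<rho>" using assms by (intro mult_left_mono) auto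
  finally show ?case by (simp add: mult.commute)
qed (simp add: surv_le_1)

text \<open>Survival during the first \<open>s\<close> steps is dropped as a requirement, which only
  enlarges the probability; what remains is an expectation under \<open>steps\<close>, to which the
  one-sided mixing bound applies directly.\<close>

lemma surv_block:
  assumes "\<And>f x. (\<And>y. 0 \<le> f y \<and> f y \<le> 1) \<Longrightarrow> expect (steps \<kappa> s x) f \<le> expect \<mu> f + \<delta>"
    and "finite (set_pmf \<mu>)"
  shows "surv \<kappa> B (s + \<tau>) x \<le> 1 - (expect \<mu> (hit \<kappa> B \<tau>) - \<delta>)"
proof -
  have "surv \<kappa> B (s + \<tau>) x = alive \<kappa> B (surv \<kappa> B \<tau>) s x" by (rule alive_add)
  also have "\<dots> \<le> expect (steps \<kappa> s x) (surv \<kappa> B \<tau>)" by (intro alive_le_steps surv_nonneg)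
  also have "\<dots> \<le> expect \<mu> (surv \<kappa> B \<tau>) + \<delta>" by (intro assms) (auto simp: surv_nonneg surv_le_1)
  also have "surv \<kappa> B \<tau> = (\<lambda>x. 1 - hit \<kappa> B \<tau> x)" using hit_add_surv[of B \<tau>] by (auto simp: fun_eq_iff algebra_simps)
  finally show ?thesis using assms(2) by (simp add: expect_diff)
qed

text \<open>The mixing bound is one-sided, yet its instance for \<open>1 - f / M\<close> is the
  reverse inequality for \<open>f\<close>.\<close>

lemma steps_two_sided:
  assumes "\<And>f x. (\<And>y. 0 \<le> f y \<and> f y \<le> 1) \<Longrightarrow> expect (steps \<kappa> s x) f \<le> expect \<mu> f + \<delta>"
    and "finite (set_pmf \<mu>)" "\<And>y. 0 \<le> f y \<and> f y \<le> M" "0 \<le> M"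
  shows "expect (steps \<kappa> s x) f \<le> expect \<mu> f + \<delta> * M"
    and "expect \<mu> f - \<delta> * M \<le> expect (steps \<kappa> s x) f"
proof -
  have "expect (steps \<kappa> s x) f \<le> expect \<mu> f + \<delta> * M \<and> expect \<mu> f - \<delta> * M \<le> expect (steps \<kappa> s x) f"
  proof (cases "M = 0")
    case True
    then have "f = (\<lambda>_. 0)" using assms(3) by (auto simp: fun_eq_iff intro: antisym)
    then show ?thesis using True by simp
  next
    case False
    then have M: "0 < M" using assms(4) by simp
    have 1: "expect (steps \<kappa> s x) (\<lambda>y. f y / M) \<le> expect \<mu> (\<lambda>y. f y / M) + \<delta>"
      using M assms(3) by (intro assms(1)) auto
    have 2: "expect (steps \<kappa> s x) (\<lambda>y. 1 - f y / M) \<le> expect \<mu> (\<lambda>y. 1 - f y / M) + \<delta>"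
      using M assms(3) by (intro assms(1)) auto
    have 3: "expect \<mu> f / M \<le> expect (steps \<kappa> s x) f / M + \<delta>"
      using 2 by (simp add: expect_diff finite_steps assms(2))
    show ?thesis using 1 mult_right_mono[OF 3, of M] M by (simp add: distrib_left pos_divide_le_eq mult.commute)
  qed
  then show "expect (steps \<kappa> s x) f \<le> expect \<mu> f + \<delta> * M"
    "expect \<mu> f - \<delta> * M \<le> expect (steps \<kappa> s x) f" by auto
qed

end

text \<open>A hit in the block \<open>(j s, (j + 1) s]\<close> with \<open>j \<ge> 1\<close> requires survival up to \<open>(j - 1) s\<close>; in
  between the chain mixes, so the payoff collected in the block is at most that survival
  probability times the payoff collected from equilibrium in one block.\<close>

lemma (in finite_kernel) payoff_blocks:
  assumes mix: "\<And>f x. (\<And>y. 0 \<le> f y \<and> f y \<le> 1) \<Longrightarrow> expect (steps \<kappa> s x) f \<le> expect \<mu> f + \<delta>"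
    and fin\<mu>: "finite (set_pmf \<mu>)" and \<beta>: "\<And>y. 0 \<le> \<beta> y \<and> \<beta> y \<le> M" and "0 \<le> M" "0 \<le> \<delta>" "0 < s"
    and ET: "\<And>N. (\<Sum>t<N. expect \<mu> (surv \<kappa> B t)) \<le> m"
  shows "expect \<mu> (payoff \<kappa> B \<beta> (J * s)) \<le> (expect \<mu> (payoff \<kappa> B \<beta> s) + \<delta> * M) * (2 + m / s)"
proof -
  define R where "R = payoff \<kappa> B \<beta>"
  define \<rho> where "\<rho> = expect \<mu> (R s) + \<delta> * M"
  have R0: "0 \<le> R t x" for t x unfolding R_def using \<beta> by (intro payoff_nonneg) auto
  have RM: "R t x \<le> M" for t x unfolding R_def using \<beta> \<open>0 \<le> M\<close> by (intro payoff_le) auto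
  have \<rho>0: "0 \<le> \<rho>" unfolding \<rho>_def using R0 assms by (intro add_nonneg_nonneg expect_ge) auto
  define a where "a j = expect \<mu> (surv \<kappa> B j)" for j
  have a_anti: "antimono a" unfolding a_def
    by (intro antimonoI expect_mono fin\<mu> antimonoD[OF surv_antimono])
  have a0: "0 \<le> a j" for j unfolding a_def by (intro expect_ge fin\<mu> surv_nonneg)
  have a1: "a j \<le> 1" for j unfolding a_def by (intro expect_le fin\<mu> surv_le_1)
  have step: "expect \<mu> (R (Suc (Suc j) * s)) \<le> expect \<mu> (R (Suc j * s)) + \<rho> * a (j * s)" for j
  proof -
    have "R (Suc (Suc j) * s) x \<le> R (Suc j * s) x + \<rho> * surv \<kappa> B (j * s) x" for x
    proof -
      have "R (Suc (Suc j) * s) x = R (Suc j * s) x + alive \<kappa> B (R s) (j * s + s) x"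
        unfolding R_def using payoff_add[of B \<beta> "Suc j * s" s x] by (simp add: add.commute add.left_commute)
      also have "alive \<kappa> B (R s) (j * s + s) x = alive \<kappa> B (alive \<kappa> B (R s) s) (j * s) x"
        by (rule alive_add)
      also have "\<dots> \<le> alive \<kappa> B (\<lambda>_. \<rho>) (j * s) x"
      proof (rule alive_mono)
        fix y
        have "alive \<kappa> B (R s) s y \<le> expect (steps \<kappa> s y) (R s)" by (intro alive_le_steps R0)
        also have "\<dots> \<le> \<rho>" unfolding \<rho>_def
          using R0 RM \<open>0 \<le> M\<close> by (intro steps_two_sided mix fin\<mu>) auto
        finally show "alive \<kappa> B (R s) s y \<le> \<rho>" .
      qed
      also have "\<dots> = \<rho> * surv \<kappa> B (j * s) x" by (rule alive_const)
      finally show ?thesis by simp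
    qed
    then have "expect \<mu> (R (Suc (Suc j) * s)) \<le> expect \<mu> (\<lambda>x. R (Suc j * s) x + \<rho> * surv \<kappa> B (j * s) x)"
      by (intro expect_mono fin\<mu>)
    also have "\<dots> = expect \<mu> (R (Suc j * s)) + \<rho> * a (j * s)"
      by (simp add: expect_add fin\<mu> a_def)
    finally show ?thesis .
  qed
  have main: "expect \<mu> (R (Suc J * s)) \<le> \<rho> * (1 + (\<Sum>j<J. a (j * s)))" for J
  proof (induction J)
    case 0
    show ?case using \<open>0 \<le> \<delta>\<close> \<open>0 \<le> M\<close> by (simp add: \<rho>_def)
  next
    case (Suc J)
    then show ?case using step[of J] by (simp add: algebra_simps)
  qed
  have "(\<Sum>j<J. a (j * s)) \<le> 1 + m / s" for J
  proof (cases J)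
    case 0
    have "0 \<le> m" using ET[of 0] by simp
    then show ?thesis using 0 by simp
  next
    case (Suc J')
    \<comment> \<open>Comparing a block sum with the full sum requires each term to sit at the end
      of its block. The term at time 0 has no block before it and is bounded by 1; this is the
      second unit in \<open>2 + m / s\<close>, the other one being the first block in
      \<open>main\<close>.\<close>
    have "(\<Sum>j<J. a (j * s)) = a 0 + (\<Sum>j<J'. a (Suc j * s))"
      unfolding Suc by (subst sum.lessThan_Suc_shift) simp
    moreover have "real s * (\<Sum>j<J'. a (Suc j * s)) \<le> m"
      using block_sum_le_sum[OF a_anti, of s J'] ET[of "J' * s"] unfolding a_def by linarith
    then have "(\<Sum>j<J'. a (Suc j * s)) \<le> m / s" using \<open>0 < s\<close> by (simp add: pos_le_divide_eq mult.commute)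
    ultimately show ?thesis using a1[of 0] by linarith
  qed
  then have "\<rho> * (1 + (\<Sum>j<J. a (j * s))) \<le> \<rho> * (2 + m / s)" for J
    using \<rho>0 by (intro mult_left_mono) (auto simp: algebra_simps)
  then have *: "expect \<mu> (R (Suc J * s)) \<le> \<rho> * (2 + m / s)" for J
    using main order.trans by blast
  have "expect \<mu> (R (J * s)) \<le> expect \<mu> (R (Suc J * s))"
    unfolding R_def using \<beta> by (intro expect_mono fin\<mu> payoff_mono_time) auto
  with *[of J] show ?thesis unfolding \<rho>_def R_def by linarith
qed

text \<open>The geometric bound is available only at multiples of \<open>b\<close>; monotonicity
  fills the gaps at the price of the factor \<open>b\<close>.\<close>

lemma antimono_block_sum:
  fixes a :: "nat \<Rightarrow> real"
  assumes "antimono a" "\<And>t. 0 \<le> a t" "\<And>j. a (j * b) \<le> c * \<rho> ^ j" "0 \<le> \<rho>" "\<rho> < 1" "0 < b" "0 \<le> c"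
  shows "summable a" "suminf a \<le> real b * c / (1 - \<rho>)" "(\<Sum>t<N. a t) \<le> real b * c / (1 - \<rho>)"
proof -
  have *: "(\<Sum>t<N. a t) \<le> real b * c / (1 - \<rho>)" for N
  proof -
    have "(\<Sum>t<N. a t) \<le> (\<Sum>t<N*b. a t)" using assms(2,6) by (intro sum_mono2) auto
    also have "\<dots> \<le> real b * (\<Sum>j<N. a (j * b))" by (rule sum_le_block_sum[OF assms(1)])
    also have "\<dots> \<le> real b * (\<Sum>j<N. c * \<rho> ^ j)" by (intro mult_left_mono sum_mono assms(3)) auto
    also have "(\<Sum>j<N. c * \<rho> ^ j) = c * (\<Sum>j<N. \<rho> ^ j)" by (simp add: sum_distrib_left)
    also have "(\<Sum>j<N. \<rho> ^ j) \<le> (\<Sum>j. \<rho> ^ j)" using assms by (intro sum_le_suminf summable_geometric) auto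
    also have "(\<Sum>j. \<rho> ^ j) = 1 / (1 - \<rho>)" using assms by (intro suminf_geometric) auto
    finally show ?thesis using assms by (simp add: mult_left_mono)
  qed
  show "(\<Sum>t<N. a t) \<le> real b * c / (1 - \<rho>)" by (rule *)
  show s: "summable a" using * assms(2) by (intro summableI_nonneg_bounded) auto
  show "suminf a \<le> real b * c / (1 - \<rho>)" using * by (intro suminf_le_const s)
qed

text \<open>Here \<open>c\<close> plays the role of the expected value of a functional that grows by \<open>1\<close> per step
  until \<open>B\<close> is hit and is then at least \<open>a - M \<beta>\<close>.\<close>

lemma (in finite_kernel) expected_cost_ge:
  assumes X: "\<And>x. x \<in> X \<Longrightarrow> set_pmf (\<kappa> x) \<subseteq> X" "x \<in> X"
    and c: "\<And>x. x \<in> X - B \<Longrightarrow> c x = 1 + expect (\<kappa> x) c" "\<And>x. x \<in> X \<Longrightarrow> 0 \<le> c x"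
    "\<And>x. x \<in> X \<inter> B \<Longrightarrow> c x \<ge> a - M * \<beta> x"
  shows "c x \<ge> (\<Sum>u<t. surv \<kappa> B u x) + a * hit \<kappa> B t x - M * payoff \<kappa> B \<beta> t x"
  using X(2)
proof (induction t arbitrary: x)
  case (Suc t)
  show ?case
  proof (cases "x \<in> B")
    case True
    then show ?thesis using c(3)[of x] Suc.prems by (simp add: alive_in payoff_in)
  next
    case False
    have "(\<Sum>u<Suc t. surv \<kappa> B u x) = 1 + (\<Sum>u<t. expect (\<kappa> x) (surv \<kappa> B u))"
      using False by (subst sum.lessThan_Suc_shift) simp
    also have "\<dots> = 1 + expect (\<kappa> x) (\<lambda>y. \<Sum>u<t. surv \<kappa> B u y)" by (simp add: expect_sum fin)
    finally have "(\<Sum>u<Suc t. surv \<kappa> B u x) + a * hit \<kappa> B (Suc t) x - M * payoff \<kappa> B \<beta> (Suc t) x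
      = 1 + expect (\<kappa> x) (\<lambda>y. (\<Sum>u<t. surv \<kappa> B u y) + a * hit \<kappa> B t y - M * payoff \<kappa> B \<beta> t y)"
      using False by (simp add: expect_add expect_diff fin)
    also have "\<dots> \<le> 1 + expect (\<kappa> x) c"
      using X(1)[OF Suc.prems] by (intro add_left_mono expect_mono fin Suc.IH) auto
    finally show ?thesis using c(1)[of x] False Suc.prems by simp
  qed
next
  case 0
  then show ?case using c(2)[of x] c(3)[of x] by auto
qed

text \<open>A visit to \<open>B\<close> outside \<open>A\<close> stops the chain on the left with
  payoff 0, while on the right it moves on and may still collect. In \<open>cost_recursion\<close>
  this replaces the first collision of any pair by the meeting of a given pair.\<close>

lemma (in finite_kernel) payoff_subset:
  assumes "A \<subseteq> B" "\<And>x. 0 \<le> \<gamma> x"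
  shows "payoff \<kappa> B (\<lambda>x. if x \<in> A then \<gamma> x else 0) t x \<le> payoff \<kappa> A \<gamma> t x"
proof (induction t arbitrary: x)
  case (Suc t)
  have "expect (\<kappa> x) (payoff \<kappa> B (\<lambda>x. if x \<in> A then \<gamma> x else 0) t) \<le> expect (\<kappa> x) (payoff \<kappa> A \<gamma> t)"
    by (intro expect_mono fin Suc)
  moreover have "0 \<le> expect (\<kappa> x) (payoff \<kappa> A \<gamma> t)" by (intro expect_ge fin payoff_nonneg assms)
  ultimately show ?case using assms by auto
qed (use assms in auto)


section \<open>Independent walkers\<close>

lemma expect_swap:
  assumes "finite (set_pmf p)" "finite (set_pmf r)"
  shows "expect p (\<lambda>x. expect r (\<lambda>y. f x y)) = expect r (\<lambda>y. expect p (\<lambda>x. f x y))"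
proof -
  have "expect p (\<lambda>x. expect r (\<lambda>y. f x y))
      = (\<Sum>x\<in>set_pmf p. \<Sum>y\<in>set_pmf r. pmf p x * pmf r y * f x y)"
    using assms by (simp add: expect_sum_set sum_distrib_left mult.assoc)
  also have "\<dots> = (\<Sum>y\<in>set_pmf r. \<Sum>x\<in>set_pmf p. pmf p x * pmf r y * f x y)"
    by (rule sum.swap)
  also have "\<dots> = expect r (\<lambda>y. expect p (\<lambda>x. f x y))"
    using assms by (simp add: expect_sum_set sum_distrib_left mult_ac)
  finally show ?thesis .
qed

lemma finite_set_Pi_pmf:
  assumes "finite I" "\<And>i. i \<in> I \<Longrightarrow> finite (set_pmf (p i))"
  shows "finite (set_pmf (Pi_pmf I d p))"
  using assms by (subst set_Pi_pmf) (auto simp: o_def)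

lemma Pi_pmf_range:
  assumes "finite I" "z \<in> set_pmf (Pi_pmf I d p)" "i \<in> I"
  shows "z i \<in> set_pmf (p i)"
  using assms by (auto simp: set_Pi_pmf PiE_dflt_def)

lemma expect_Pi_insert:
  assumes "finite I" "i \<notin> I" "\<And>j. j \<in> insert i I \<Longrightarrow> finite (set_pmf (p j))"
  shows "expect (Pi_pmf (insert i I) d p) f
    = expect (p i) (\<lambda>y. expect (Pi_pmf I d p) (\<lambda>z. f (z(i := y))))"
proof -
  have "Pi_pmf (insert i I) d p = bind_pmf (p i) (\<lambda>y. map_pmf (\<lambda>z. z(i := y)) (Pi_pmf I d p))"
    using assms by (subst Pi_pmf_insert') (auto simp: map_pmf_def)
  then show ?thesis
    using assms by (simp add: expect_bind finite_set_Pi_pmf)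
qed

lemma expect_Pi_pair:
  assumes "finite I" "a \<in> I" "b \<in> I" "a \<noteq> b" "\<And>j. j \<in> I \<Longrightarrow> finite (set_pmf (p j))"
  shows "expect (Pi_pmf I d p) (\<lambda>z. f (z a) (z b)) = expect (p a) (\<lambda>x. expect (p b) (\<lambda>y. f x y))"
proof -
  have I: "I = insert a (insert b (I - {a, b}))" using assms by auto
  have "expect (Pi_pmf (insert a (insert b (I - {a, b}))) d p) (\<lambda>z. f (z a) (z b))
    = expect (p a) (\<lambda>x. expect (Pi_pmf (insert b (I - {a, b})) d p) (\<lambda>z. f ((z(a := x)) a) ((z(a := x)) b)))"
    using assms by (intro expect_Pi_insert) auto
  also have "\<dots> = expect (p a) (\<lambda>x. expect (p b) (\<lambda>y. expect (Pi_pmf (I - {a, b}) d p) (\<lambda>z. f x y)))"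
    using assms by (subst expect_Pi_insert) auto
  finally show ?thesis using I by simp
qed

text \<open>The coordinates are exchanged one at a time, each exchange costing
  \<open>\<delta>\<close>; the partially integrated function still takes values in [0,1].\<close>

lemma expect_Pi_le:
  assumes "finite I" "\<And>i. i \<in> I \<Longrightarrow> finite (set_pmf (p i))" "\<And>i. i \<in> I \<Longrightarrow> finite (set_pmf (r i))"
    and "\<And>i g. i \<in> I \<Longrightarrow> (\<And>y. 0 \<le> g y \<and> g y \<le> 1) \<Longrightarrow> expect (p i) g \<le> expect (r i) g + \<delta>"
    and "\<And>y. 0 \<le> f y \<and> f y \<le> 1"
  shows "expect (Pi_pmf I d p) f \<le> expect (Pi_pmf I d r) f + real (card I) * \<delta>"
  using assms
proof (induction I arbitrary: f rule: finite_induct)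
  case (insert i I)
  let ?g = "\<lambda>y. expect (Pi_pmf I d p) (\<lambda>z. f (z(i := y)))"
  have g: "0 \<le> ?g y \<and> ?g y \<le> 1" for y
    using insert.prems(4) insert.prems(1) insert.hyps
    by (auto intro!: expect_ge expect_le finite_set_Pi_pmf)
  have "expect (Pi_pmf (insert i I) d p) f = expect (p i) ?g"
    using insert.prems insert.hyps by (intro expect_Pi_insert) auto
  also have "\<dots> \<le> expect (r i) ?g + \<delta>" using g by (intro insert.prems(3)) auto
  also have "expect (r i) ?g \<le> expect (r i) (\<lambda>y. expect (Pi_pmf I d r) (\<lambda>z. f (z(i := y))) + real (card I) * \<delta>)"
    using insert.prems insert.hyps by (intro expect_mono insert.IH) auto
  also have "\<dots> = expect (Pi_pmf (insert i I) d r) f + real (card I) * \<delta>"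
    using insert.prems insert.hyps by (subst expect_Pi_insert) (auto simp: expect_add)
  finally show ?case using insert.hyps by (simp add: algebra_simps)
qed simp

section \<open>Meetings of pairs and collisions in a family of walkers\<close>

primrec pair_hit :: "('a \<Rightarrow> 'a pmf) \<Rightarrow> nat \<Rightarrow> 'a \<Rightarrow> 'a \<Rightarrow> real" where
  "pair_hit P 0 x y = (if x = y then 1 else 0)"
| "pair_hit P (Suc t) x y =
    (if x = y then 1 else expect (P x) (\<lambda>x'. expect (P y) (\<lambda>y'. pair_hit P t x' y')))"

definition indep :: "(nat \<Rightarrow> nat pmf) \<Rightarrow> nat set \<Rightarrow> (nat \<Rightarrow> nat) \<Rightarrow> (nat \<Rightarrow> nat) pmf" where
  "indep P I x = Pi_pmf I 0 (\<lambda>i. P (x i))"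

definition meet :: "nat \<Rightarrow> nat \<Rightarrow> (nat \<Rightarrow> nat) set" where
  "meet a b = {x. x a = x b}"

definition collision :: "nat set \<Rightarrow> (nat \<Rightarrow> nat) set" where
  "collision I = {x. \<not> inj_on x I}"

definition pairs :: "nat set \<Rightarrow> (nat \<times> nat) set" where
  "pairs I = {(a, b). a \<in> I \<and> b \<in> I \<and> a < b}"

lemma finite_pairs: "finite I \<Longrightarrow> finite (pairs I)"
  by (rule finite_subset[of _ "I \<times> I"]) (auto simp: pairs_def)

lemma card_pairs:
  assumes "finite I" shows "card (pairs I) = card I choose 2"
  using assms
proof (induction I rule: finite_linorder_max_induct)
  case empty
  then show ?case by (simp add: pairs_def)
next
  case (insert b I)
  have *: "pairs (insert b I) = pairs I \<union> (\<lambda>a. (a, b)) ` I"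
    using insert.hyps by (force simp: pairs_def)
  have "b \<notin> I" using insert by auto
  have "card (pairs (insert b I)) = card (pairs I) + card ((\<lambda>a. (a, b)) ` I)"
    unfolding * using insert \<open>b \<notin> I\<close> by (intro card_Un_disjoint finite_pairs) (auto simp: pairs_def)
  also have "card ((\<lambda>a. (a, b)) ` I) = card I" by (intro card_image) (auto simp: inj_on_def)
  finally show ?case using insert \<open>b \<notin> I\<close> by (simp add: numeral_2_eq_2)
qed

lemma collision_iff_pairs: "x \<in> collision I \<longleftrightarrow> (\<exists>(a, b)\<in>pairs I. x a = x b)"
proof
  assume "x \<in> collision I"
  then obtain a b where "a \<in> I" "b \<in> I" "x a = x b" "a \<noteq> b" by (auto simp: collision_def inj_on_def)
  then show "\<exists>(a, b)\<in>pairs I. x a = x b" by (cases a b rule: linorder_cases) (force simp: pairs_def)+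
qed (auto simp: collision_def pairs_def inj_on_def)

text \<open>In the application time is counted in steps of a small mesh \<open>h\<close>, and
  \<open>q\<close> is \<open>h\<close> times a bound on the jump rates. \<open>P\<close> leads into
  \<open>V\<close> from every natural number, so the walkers are in \<open>V\<close> after one step
  wherever they start.\<close>

locale walk =
  fixes V :: "nat set" and P :: "nat \<Rightarrow> nat pmf" and \<pi> :: "nat pmf" and pm q :: real
  assumes finV: "finite V" and PV: "set_pmf (P x) \<subseteq> V" and \<pi>V: "set_pmf \<pi> \<subseteq> V"
    and stat: "bind_pmf \<pi> P = \<pi>" and pm: "pmf \<pi> x \<le> pm"
    and q: "x \<in> V \<Longrightarrow> 1 - pmf (P x) x \<le> q"
begin

lemma finP: "finite (set_pmf (P x))" using PV finV by (rule finite_subset)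
lemma fin\<pi>: "finite (set_pmf \<pi>)" using \<pi>V finV by (rule finite_subset)

sublocale base: finite_kernel P by unfold_locales (rule finP)

lemma fin_indep: "finite I \<Longrightarrow> finite (set_pmf (indep P I x))"
  unfolding indep_def by (intro finite_set_Pi_pmf finP)

lemma finite_kernel_indep: "finite I \<Longrightarrow> finite_kernel (indep P I)"
  by unfold_locales (rule fin_indep)

abbreviation eqm :: "nat set \<Rightarrow> (nat \<Rightarrow> nat) pmf" where
  "eqm I \<equiv> Pi_pmf I 0 (\<lambda>_. \<pi>)"

lemma fin_eqm: "finite I \<Longrightarrow> finite (set_pmf (eqm I))"
  by (intro finite_set_Pi_pmf fin\<pi>)

lemma pm_nonneg: "0 \<le> pm" using pm[of 0] pmf_nonneg[of \<pi> 0] by linarith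

lemma q_nonneg: "0 \<le> q"
proof -
  obtain x where "x \<in> V" using \<pi>V set_pmf_not_empty[of \<pi>] by blast
  then show ?thesis using q[of x] pmf_le_1[of "P x" x] by linarith
qed

lemma expect_stat: "expect \<pi> (\<lambda>x. expect (P x) f) = expect \<pi> f"
  using expect_bind[of \<pi> P f, OF fin\<pi> finP] by (simp only: stat)

lemma expect_stat_steps: "expect \<pi> (\<lambda>x. expect (steps P t x) f) = expect \<pi> f"
proof (induction t)
  case (Suc t)
  have "expect \<pi> (\<lambda>x. expect (steps P (Suc t) x) f)
    = expect \<pi> (\<lambda>x. expect (P x) (\<lambda>y. expect (steps P t y) f))"
    by (intro expect_cong base.expect_steps_Suc)
  also have "\<dots> = expect \<pi> (\<lambda>y. expect (steps P t y) f)" by (rule expect_stat)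
  finally show ?case by (simp only: Suc)
qed simp

lemma steps_in_V: "x \<in> V \<Longrightarrow> set_pmf (steps P t x) \<subseteq> V"
proof (induction t arbitrary: x)
  case (Suc t)
  have "set_pmf (steps P t y) \<subseteq> V" if "y \<in> set_pmf (P x)" for y
    using that PV[of x] by (intro Suc.IH) auto
  then show ?case by auto
qed simp

abbreviation hp :: "nat \<Rightarrow> nat \<Rightarrow> nat \<Rightarrow> real" where "hp \<equiv> pair_hit P"

lemma hp_same [simp]: "hp t x x = 1"
  by (cases t) auto

lemma hp_sym: "hp t x y = hp t y x"
proof (induction t arbitrary: x y)
  case (Suc t)
  have "hp t = (\<lambda>x y. hp t y x)" by (intro ext Suc)
  then have "expect (P x) (\<lambda>x'. expect (P y) (hp t x')) = expect (P x) (\<lambda>x'. expect (P y) (\<lambda>y'. hp t y' x'))"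
    by metis
  then show ?case using expect_swap[OF finP finP] by (auto split: if_splits)
qed auto

lemma expect_indep_pair:
  assumes "finite I" "a \<in> I" "b \<in> I" "a \<noteq> b"
  shows "expect (indep P I x) (\<lambda>z. f (z a) (z b)) = expect (P (x a)) (\<lambda>u. expect (P (x b)) (\<lambda>v. f u v))"
  unfolding indep_def using assms by (intro expect_Pi_pair finP) auto

text \<open>Ties the pair function \<open>hp\<close> to the walkers of an arbitrary family: the
  other walkers integrate out, so the meeting probability of two of them depends on their two
  positions only.\<close>

lemma hit_meet:
  assumes "finite I" "a \<in> I" "b \<in> I" "a \<noteq> b"
  shows "hit (indep P I) (meet a b) t x = hp t (x a) (x b)"
proof (induction t arbitrary: x)
  case (Suc t)
  have "hit (indep P I) (meet a b) t = (\<lambda>x. hp t (x a) (x b))" by (intro ext Suc)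
  then show ?case using expect_indep_pair[OF assms, of x "hp t"] by (simp add: meet_def)
qed (auto simp: meet_def)

lemma hp_bounds: "0 \<le> hp t x y" "hp t x y \<le> 1" "t \<le> u \<Longrightarrow> hp t x y \<le> hp u x y"
proof -
  interpret fk: finite_kernel "indep P {0, Suc 0}" by (rule finite_kernel_indep) auto
  have *: "hp t x y = hit (indep P {0, Suc 0}) (meet 0 (Suc 0)) t ((\<lambda>_. y)(0 := x))" for t
    by (subst hit_meet) auto
  show "0 \<le> hp t x y" "hp t x y \<le> 1" "t \<le> u \<Longrightarrow> hp t x y \<le> hp u x y"
    unfolding * by (auto intro: fk.hit_nonneg fk.hit_le_1 fk.payoff_mono_time)
qed

definition entry :: "nat \<Rightarrow> nat \<Rightarrow> real" where
  "entry x y = (if x = y then 0 else expect (P x) (pmf (P y)))"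

lemma expect_indicator_eq: "expect p (\<lambda>y. if x = y then 1 else 0) = pmf p x"
proof -
  have "expect p (\<lambda>y. if x = y then 1 else 0) = expect p (indicator {x})"
    by (intro expect_cong) auto
  then show ?thesis by (simp add: measure_pmf_single)
qed

text \<open>Suppose both walkers land on \<open>z\<close> from different sites. Either the walker
  from \<open>x\<close> has moved, and by stationarity the equilibrium walker is at \<open>z\<close>
  with probability \<open>pmf \<pi> z\<close>; or it has stayed at \<open>x\<close>, and the other
  one has entered \<open>x\<close>. Each case contributes at most \<open>pm * q\<close>.\<close>

lemma expect_entry_le:
  assumes "x \<in> V" shows "expect \<pi> (entry x) \<le> 2 * pm * q"
proof -
  have fx: "finite (set_pmf (P x))" by (rule finP)
  define f where "f z = (if x = z then 0 else 1::real)" for z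
  have Ef: "expect p f = 1 - pmf p x" if "finite (set_pmf p)" for p
  proof -
    have "f = (\<lambda>y. 1 - (if x = y then 1 else 0))" by (auto simp: f_def)
    then show ?thesis using that by (simp add: expect_diff expect_indicator_eq)
  qed
  have stat_pmf: "expect \<pi> (\<lambda>y. pmf (P y) z) = pmf \<pi> z" for z
    using stat by (metis pmf_bind)
  have "entry x y \<le> expect (P x) (\<lambda>z. f z * pmf (P y) z) + f y * pmf (P y) x" for y
  proof (cases "x = y")
    case True
    then show ?thesis by (auto simp: entry_def f_def intro!: expect_ge fx)
  next
    case False
    have "expect (P x) (pmf (P y)) \<le> expect (P x) (\<lambda>z. f z * pmf (P y) z + pmf (P y) x)"
      by (intro expect_mono fx) (auto simp: f_def)
    then show ?thesis using False by (simp add: entry_def f_def expect_add fx)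
  qed
  then have "expect \<pi> (entry x) \<le> expect \<pi> (\<lambda>y. expect (P x) (\<lambda>z. f z * pmf (P y) z) + f y * pmf (P y) x)"
    by (intro expect_mono fin\<pi>)
  also have "\<dots> = expect \<pi> (\<lambda>y. expect (P x) (\<lambda>z. f z * pmf (P y) z)) + expect \<pi> (\<lambda>y. f y * pmf (P y) x)"
    by (intro expect_add fin\<pi>)
  also have "expect \<pi> (\<lambda>y. expect (P x) (\<lambda>z. f z * pmf (P y) z)) = expect (P x) (\<lambda>z. f z * pmf \<pi> z)"
    by (subst expect_swap) (simp_all add: fin\<pi> finP stat_pmf)
  also have "\<dots> \<le> expect (P x) (\<lambda>z. pm * f z)"
    by (intro expect_mono fx) (auto simp: f_def pm mult.commute)
  also have "\<dots> = pm * (1 - pmf (P x) x)" by (simp add: Ef fx)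
  also have "\<dots> \<le> pm * q" using q[OF assms] pm_nonneg by (intro mult_left_mono) auto
  \<comment> \<open>The stationary flow into \<open>x\<close> from other sites equals the flow out
    of \<open>x\<close>.\<close>
  also have "expect \<pi> (\<lambda>y. f y * pmf (P y) x) = pmf \<pi> x * (1 - pmf (P x) x)"
  proof -
    have "(\<lambda>y. f y * pmf (P y) x) = (\<lambda>y. pmf (P y) x - pmf (P x) x * (if x = y then 1 else 0))"
      by (auto simp: f_def)
    then show ?thesis by (simp add: expect_diff fin\<pi> stat_pmf expect_indicator_eq right_diff_distrib)
  qed
  also have "\<dots> \<le> pm * q" using q[OF assms] pm[of x] q_nonneg pm_nonneg pmf_le_1[of "P x" x]
    by (intro mult_mono) auto
  finally show ?thesis by simp
qed

text \<open>Two walkers that meet are together at the start or step onto a common site from different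
  sites; the expected number of such steps is computed without conditioning on the past.\<close>

lemma hp_le_entries:
  "hp t x y \<le> (if x = y then 1 else 0)
    + (\<Sum>u<t. expect (steps P u x) (\<lambda>x'. expect (steps P u y) (\<lambda>y'. entry x' y')))"
proof (induction t arbitrary: x y)
  case (Suc t)
  define E where "E u x y = expect (steps P u x) (\<lambda>x'. expect (steps P u y) (\<lambda>y'. entry x' y'))" for u x y
  have entry0: "0 \<le> entry x y" for x y unfolding entry_def by (auto intro!: expect_ge finP)
  have E0: "0 \<le> E u x y" for u x y unfolding E_def
    by (intro expect_ge base.finite_steps entry0)
  have ES: "expect (P x) (\<lambda>x'. expect (P y) (\<lambda>y'. E u x' y')) = E (Suc u) x y" for u
  proof -
    have "expect (P x) (\<lambda>x'. expect (P y) (\<lambda>y'. E u x' y'))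
      = expect (P x) (\<lambda>x'. expect (steps P u x') (\<lambda>x''. expect (P y) (\<lambda>y'. expect (steps P u y') (entry x''))))"
      unfolding E_def by (subst expect_swap) (auto simp: finP base.finite_steps)
    then show ?thesis unfolding E_def base.expect_steps_Suc .
  qed
  show ?case
  proof (cases "x = y")
    case True
    then show ?thesis using E0 by (simp add: E_def[symmetric] sum_nonneg del: sum.lessThan_Suc)
  next
    case False
    have "hp (Suc t) x y = expect (P x) (\<lambda>x'. expect (P y) (\<lambda>y'. hp t x' y'))" using False by simp
    also have "\<dots> \<le> expect (P x) (\<lambda>x'. expect (P y) (\<lambda>y'. (if x' = y' then 1 else 0) + (\<Sum>u<t. E u x' y')))"
      unfolding E_def by (intro expect_mono finP Suc)
    also have "\<dots> = entry x y + (\<Sum>u<t. E (Suc u) x y)"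
      using False by (simp add: expect_add expect_sum finP expect_indicator_eq entry_def ES)
    also have "entry x y = E 0 x y" by (simp add: E_def)
    also have "E 0 x y + (\<Sum>u<t. E (Suc u) x y) = (\<Sum>u<Suc t. E u x y)"
      by (simp only: sum.lessThan_Suc_shift)
    finally show ?thesis using False by (simp add: E_def)
  qed
qed simp

definition eta :: "nat \<Rightarrow> real" where "eta t = pm * (1 + 2 * q * t)"

lemma eta_nonneg: "0 \<le> eta t" unfolding eta_def using pm_nonneg q_nonneg by simp

text \<open>Whatever the walker from \<open>x\<close> does, the other one is in equilibrium at every
  single time. So each of the \<open>t\<close> steps contributes at most the bound of
  \<open>expect_entry_le\<close>, and the start contributes \<open>pmf \<pi> x\<close>.\<close>

lemma expect_hp_le_eta:
  assumes "x \<in> V" shows "expect \<pi> (hp t x) \<le> eta t"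
proof -
  have "expect \<pi> (hp t x) \<le> expect \<pi> (\<lambda>y. (if x = y then 1 else 0)
    + (\<Sum>u<t. expect (steps P u x) (\<lambda>x'. expect (steps P u y) (\<lambda>y'. entry x' y'))))"
    by (intro expect_mono fin\<pi> hp_le_entries)
  also have "\<dots> = pmf \<pi> x + (\<Sum>u<t. expect \<pi> (\<lambda>y. expect (steps P u x) (\<lambda>x'. expect (steps P u y) (\<lambda>y'. entry x' y'))))"
    by (simp add: expect_add expect_sum fin\<pi> expect_indicator_eq)
  also have "(\<lambda>u. expect \<pi> (\<lambda>y. expect (steps P u x) (\<lambda>x'. expect (steps P u y) (\<lambda>y'. entry x' y'))))
    = (\<lambda>u. expect (steps P u x) (\<lambda>x'. expect \<pi> (entry x')))"
    by (subst expect_swap) (auto simp: fin\<pi> base.finite_steps expect_stat_steps)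
  also have "(\<Sum>u<t. expect (steps P u x) (\<lambda>x'. expect \<pi> (entry x'))) \<le> (\<Sum>u<t. 2 * pm * q)"
    using steps_in_V[OF assms]
    by (intro sum_mono expect_le base.finite_steps expect_entry_le) auto
  finally show ?thesis using pm[of x] by (simp add: eta_def algebra_simps)
qed

definition meetp :: "nat \<Rightarrow> real" where
  "meetp t = expect \<pi> (\<lambda>x. expect \<pi> (hp t x))"

lemma meetp_nonneg: "0 \<le> meetp t"
  unfolding meetp_def by (intro expect_ge fin\<pi> hp_bounds)

lemma meetp_mono: "t \<le> u \<Longrightarrow> meetp t \<le> meetp u"
  unfolding meetp_def by (intro expect_mono fin\<pi> hp_bounds)

lemma meetp_le_eta: "meetp t \<le> eta t"
  unfolding meetp_def using \<pi>V by (intro expect_le fin\<pi> expect_hp_le_eta) auto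

lemma expect_eqm_hp:
  assumes "finite I" "a \<in> I" "b \<in> I" "a \<noteq> b"
  shows "expect (eqm I) (\<lambda>x. hp t (x a) (x b)) = meetp t"
  unfolding meetp_def using assms by (intro expect_Pi_pair fin\<pi>) auto

text \<open>Whatever happens until walkers \<open>a\<close> and \<open>b\<close> meet, an equilibrium walker \<open>d\<close> not involved
  is then still in equilibrium, also if \<open>c\<close> is one of \<open>a\<close>, \<open>b\<close>.\<close>

lemma expect_two_meetings_aux:
  assumes I: "finite I" "d \<in> I" "a \<in> I - {d}" "b \<in> I - {d}" "c \<in> I - {d}" "a \<noteq> b"
    and x: "\<And>i. i \<in> I - {d} \<Longrightarrow> x i \<in> V"
  shows "expect \<pi> (\<lambda>y. payoff (indep P I) (meet a b) (\<lambda>z. hp T (z c) (z d)) t (x(d := y)))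
    \<le> hp t (x a) (x b) * eta T"
  using x
proof (induction t arbitrary: x)
  case 0
  then show ?case using I expect_hp_le_eta[of "x c" T] by (auto simp: meet_def)
next
  case (Suc t)
  define G where "G t = payoff (indep P I) (meet a b) (\<lambda>z. hp T (z c) (z d)) t" for t
  define I' where "I' = I - {d}"
  have II': "I = insert d I'" "finite I'" "d \<notin> I'" using I by (auto simp: I'_def)
  show ?case
  proof (cases "x a = x b")
    case True
    then show ?thesis using I expect_hp_le_eta[of "x c" T] Suc.prems by (auto simp: meet_def)
  next
    case False
    have ind: "expect (indep P I (x(d := y))) (G t)
      = expect (P y) (\<lambda>w. expect (Pi_pmf I' 0 (\<lambda>i. P (x i))) (\<lambda>z. G t (z(d := w))))" for y
    proof -
      have "expect (indep P I (x(d := y))) (G t) = expect (Pi_pmf (insert d I') 0 (\<lambda>i. P ((x(d := y)) i))) (G t)"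
        by (simp only: indep_def II')
      also have "\<dots> = expect (P ((x(d := y)) d)) (\<lambda>w. expect (Pi_pmf I' 0 (\<lambda>i. P ((x(d := y)) i))) (\<lambda>z. G t (z(d := w))))"
        by (intro expect_Pi_insert II' finP)
      also have "Pi_pmf I' 0 (\<lambda>i. P ((x(d := y)) i)) = Pi_pmf I' 0 (\<lambda>i. P (x i))"
        using II' by (intro Pi_pmf_cong) auto
      finally show ?thesis by (simp only: fun_upd_same)
    qed
    have "expect \<pi> (\<lambda>y. G (Suc t) (x(d := y))) = expect \<pi> (\<lambda>y. expect (indep P I (x(d := y))) (G t))"
      using False I by (auto simp: G_def meet_def)
    \<comment> \<open>Averaging the step of \<open>d\<close> over its equilibrium position gives
      back \<open>\<pi>\<close>, so \<open>d\<close> can be integrated out afresh after the others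
      have moved.\<close>
    also have "\<dots> = expect \<pi> (\<lambda>w. expect (Pi_pmf I' 0 (\<lambda>i. P (x i))) (\<lambda>z. G t (z(d := w))))"
      unfolding ind by (rule expect_stat)
    also have "\<dots> = expect (Pi_pmf I' 0 (\<lambda>i. P (x i))) (\<lambda>z. expect \<pi> (\<lambda>w. G t (z(d := w))))"
      by (intro expect_swap fin\<pi> finite_set_Pi_pmf finP II')
    also have "\<dots> \<le> expect (Pi_pmf I' 0 (\<lambda>i. P (x i))) (\<lambda>z. hp t (z a) (z b) * eta T)"
    proof (intro expect_mono finite_set_Pi_pmf finP II')
      fix z assume "z \<in> set_pmf (Pi_pmf I' 0 (\<lambda>i. P (x i)))"
      then have "i \<in> I - {d} \<Longrightarrow> z i \<in> V" for i using PV Pi_pmf_range[OF II'(2)] by (force simp: I'_def)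
      then show "expect \<pi> (\<lambda>w. G t (z(d := w))) \<le> hp t (z a) (z b) * eta T"
        unfolding G_def by (rule Suc.IH)
    qed
    also have "\<dots> = expect (Pi_pmf I' 0 (\<lambda>i. P (x i))) (\<lambda>z. hp t (z a) (z b)) * eta T" by simp
    also have "expect (Pi_pmf I' 0 (\<lambda>i. P (x i))) (\<lambda>z. hp t (z a) (z b)) = hp (Suc t) (x a) (x b)"
      using I False by (subst expect_Pi_pair) (auto simp: I'_def finP)
    finally show ?thesis by (simp add: G_def)
  qed
qed

lemma expect_two_meetings:
  assumes I: "finite I" "d \<in> I" "a \<in> I - {d}" "b \<in> I - {d}" "c \<in> I - {d}" "a \<noteq> b"
  shows "expect (eqm I) (payoff (indep P I) (meet a b) (\<lambda>z. hp T (z c) (z d)) t) \<le> meetp t * eta T"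
proof -
  define G where "G = payoff (indep P I) (meet a b) (\<lambda>z. hp T (z c) (z d)) t"
  define I' where "I' = I - {d}"
  have II': "I = insert d I'" "finite I'" "d \<notin> I'" using I by (auto simp: I'_def)
  have "expect (eqm I) G = expect \<pi> (\<lambda>y. expect (eqm I') (\<lambda>z. G (z(d := y))))"
    unfolding II'(1) using II' by (intro expect_Pi_insert fin\<pi>)
  also have "\<dots> = expect (eqm I') (\<lambda>z. expect \<pi> (\<lambda>y. G (z(d := y))))"
    by (intro expect_swap fin\<pi> fin_eqm II')
  also have "\<dots> \<le> expect (eqm I') (\<lambda>z. hp t (z a) (z b) * eta T)"
  proof (intro expect_mono fin_eqm II')
    fix z assume "z \<in> set_pmf (eqm I')"
    then have "i \<in> I - {d} \<Longrightarrow> z i \<in> V" for i using \<pi>V Pi_pmf_range[OF II'(2)] by (force simp: I'_def)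
    then show "expect \<pi> (\<lambda>w. G (z(d := w))) \<le> hp t (z a) (z b) * eta T"
      unfolding G_def by (rule expect_two_meetings_aux[OF I])
  qed
  also have "\<dots> = meetp t * eta T"
    using I expect_eqm_hp[of I' a b t] by (simp add: I'_def)
  finally show ?thesis by (simp add: G_def)
qed

text \<open>Distinct pairs never share both members, so one member of \<open>e'\<close> lies outside
  \<open>e\<close> and can play the equilibrium walker of \<open>expect_two_meetings\<close>. If it
  is the smaller one, \<open>hp_sym\<close> exchanges the roles.\<close>

lemma expect_two_pairs:
  assumes I: "finite I" "e \<in> pairs I" "e' \<in> pairs I" "e \<noteq> e'"
  shows "expect (eqm I) (payoff (indep P I) (meet (fst e) (snd e)) (\<lambda>z. hp T (z (fst e')) (z (snd e'))) t)
    \<le> meetp t * eta T"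
proof -
  obtain a b c d where e: "e = (a, b)" "e' = (c, d)" by (metis surj_pair)
  show ?thesis
  proof (cases "d \<in> {a, b}")
    case False
    then show ?thesis using I unfolding e by (auto simp: pairs_def intro!: expect_two_meetings)
  next
    case True
    then have "c \<notin> {a, b}" using I e by (auto simp: pairs_def)
    then have "expect (eqm I) (payoff (indep P I) (meet a b) (\<lambda>z. hp T (z d) (z c)) t) \<le> meetp t * eta T"
      using I unfolding e by (intro expect_two_meetings) (auto simp: pairs_def)
    then show ?thesis unfolding e by (simp add: hp_sym)
  qed
qed

lemma hit_collision_le:
  assumes I: "finite I"
  shows "hit (indep P I) (collision I) t x \<le> (\<Sum>e\<in>pairs I. hp t (x (fst e)) (x (snd e)))"
proof (induction t arbitrary: x)
  case 0
  show ?case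
  proof (cases "x \<in> collision I")
    case True
    then obtain e where "e \<in> pairs I" "x (fst e) = x (snd e)" by (auto simp: collision_iff_pairs)
    then have "1 \<le> (\<Sum>e\<in>pairs I. hp 0 (x (fst e)) (x (snd e)))"
      using member_le_sum[of e "pairs I" "\<lambda>e. hp 0 (x (fst e)) (x (snd e))"] I by (auto simp: finite_pairs)
    then show ?thesis by (simp add: True)
  qed (auto intro: sum_nonneg)
next
  case (Suc t)
  show ?case
  proof (cases "x \<in> collision I")
    case True
    then obtain e where "e \<in> pairs I" "x (fst e) = x (snd e)" by (auto simp: collision_iff_pairs)
    then have "1 \<le> (\<Sum>e\<in>pairs I. hp (Suc t) (x (fst e)) (x (snd e)))"
      using member_le_sum[of e "pairs I" "\<lambda>e. hp (Suc t) (x (fst e)) (x (snd e))"] I hp_bounds(1)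
      by (simp add: finite_pairs del: pair_hit.simps)
    then show ?thesis by (simp add: True del: pair_hit.simps)
  next
    case False
    have "expect (indep P I x) (hit (indep P I) (collision I) t)
      \<le> expect (indep P I x) (\<lambda>x. \<Sum>e\<in>pairs I. hp t (x (fst e)) (x (snd e)))"
      by (intro expect_mono fin_indep I Suc)
    also have "\<dots> = (\<Sum>e\<in>pairs I. expect (indep P I x) (\<lambda>x. hp t (x (fst e)) (x (snd e))))"
      by (intro expect_sum fin_indep I)
    also have "\<dots> = (\<Sum>e\<in>pairs I. hp (Suc t) (x (fst e)) (x (snd e)))"
    proof (intro sum.cong refl)
      fix e assume e: "e \<in> pairs I"
      then have "x (fst e) \<noteq> x (snd e)" using False by (auto simp: collision_iff_pairs)
      then show "expect (indep P I x) (\<lambda>x. hp t (x (fst e)) (x (snd e))) = hp (Suc t) (x (fst e)) (x (snd e))"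
        using e I by (subst expect_indep_pair) (auto simp: pairs_def)
    qed
    finally show ?thesis using False by simp
  qed
qed

text \<open>With \<open>card S\<close> coinciding pairs and \<open>A\<close> the sum of all
  \<open>hp T\<close>, each coinciding pair is charged \<open>A - 1\<close> for the remaining ones.
  It therefore suffices that \<open>1 >= A - card S * (A - 1)\<close>, that is
  \<open>(card S - 1) * (A - 1) >= 0\<close>.\<close>

lemma hit_collision_ge_collided:
  assumes I: "finite I" and "t \<le> T" and x: "x \<in> collision I"
  shows "1 \<ge> (\<Sum>e\<in>pairs I. hp t (x (fst e)) (x (snd e)))
    - (\<Sum>e\<in>pairs I. \<Sum>e'\<in>pairs I - {e}.
        payoff (indep P I) (meet (fst e) (snd e)) (\<lambda>z. hp T (z (fst e')) (z (snd e'))) t x)"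
proof -
  interpret fk: finite_kernel "indep P I" by (rule finite_kernel_indep[OF I])
  define G where "G e e' = payoff (indep P I) (meet (fst e) (snd e)) (\<lambda>z. hp T (z (fst e')) (z (snd e'))) t x" for e e'
  define a where "a e = hp T (x (fst e)) (x (snd e))" for e
  define S where "S = {e \<in> pairs I. x (fst e) = x (snd e)}"
  have S: "finite S" "S \<noteq> {}" "S \<subseteq> pairs I"
    using x finite_pairs[OF I] by (auto simp: S_def collision_iff_pairs)
  have a: "0 \<le> a e" "a e \<le> 1" for e unfolding a_def by (rule hp_bounds)+
  have aS: "a e = 1" if "e \<in> S" for e using that by (simp add: a_def S_def)
  define A where "A = (\<Sum>e\<in>pairs I. a e)"
  obtain e0 where "e0 \<in> S" using S by auto
  then have "1 \<le> A" unfolding A_def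
    using member_le_sum[of e0 "pairs I" a] S a aS by (auto simp: finite_pairs I)
  moreover have "1 \<le> real (card S)" using S by (simp add: Suc_le_eq card_gt_0_iff)
  ultimately have "0 \<le> (real (card S) - 1) * (A - 1)" by simp
  moreover have "(\<Sum>e\<in>pairs I. hp t (x (fst e)) (x (snd e))) \<le> A"
    unfolding A_def a_def using \<open>t \<le> T\<close> by (intro sum_mono hp_bounds)
  moreover have "(\<Sum>e\<in>pairs I. \<Sum>e'\<in>pairs I - {e}. G e e') \<ge> card S * (A - 1)"
  proof -
    have "card S * (A - 1) = (\<Sum>e\<in>S. \<Sum>e'\<in>pairs I - {e}. G e e')"
    proof -
      have "(\<Sum>e'\<in>pairs I - {e}. G e e') = A - 1" if "e \<in> S" for e
      proof -
        have "(\<Sum>e'\<in>pairs I - {e}. G e e') = (\<Sum>e'\<in>pairs I - {e}. a e')"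
          using that by (intro sum.cong refl) (auto simp: G_def a_def S_def payoff_in meet_def)
        also have "\<dots> = A - 1" using S that aS[OF that] by (subst sum_diff1) (auto simp: finite_pairs I A_def)
        finally show ?thesis .
      qed
      then show ?thesis by simp
    qed
    also have "\<dots> \<le> (\<Sum>e\<in>pairs I. \<Sum>e'\<in>pairs I - {e}. G e e')"
      using S by (intro sum_mono2 sum_nonneg) (auto simp: finite_pairs I G_def intro!: fk.payoff_nonneg hp_bounds)
    finally show ?thesis .
  qed
  ultimately show ?thesis unfolding G_def by (simp add: algebra_simps)
qed

text \<open>Bonferroni's inequality in a form that closes under recursion in time: \<open>e\<close>
  is charged, at its meeting time, with the probability that \<open>e'\<close> meets within a
  horizon \<open>T\<close> from then on. The horizon stays fixed while the remaining time
  \<open>t\<close> shrinks, hence \<open>t <= T\<close>.\<close>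

lemma hit_collision_ge:
  assumes I: "finite I" and "t \<le> T"
  shows "hit (indep P I) (collision I) t x \<ge> (\<Sum>e\<in>pairs I. hp t (x (fst e)) (x (snd e)))
    - (\<Sum>e\<in>pairs I. \<Sum>e'\<in>pairs I - {e}.
        payoff (indep P I) (meet (fst e) (snd e)) (\<lambda>z. hp T (z (fst e')) (z (snd e'))) t x)"
  using \<open>t \<le> T\<close>
proof (induction t arbitrary: x)
  case (Suc t)
  interpret fk: finite_kernel "indep P I" by (rule finite_kernel_indep[OF I])
  define G where "G e e' t = payoff (indep P I) (meet (fst e) (snd e)) (\<lambda>z. hp T (z (fst e')) (z (snd e'))) t" for e e' t
  have step: "hit (indep P I) (collision I) (Suc t) x \<ge> (\<Sum>e\<in>pairs I. hp (Suc t) (x (fst e)) (x (snd e)))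
    - (\<Sum>e\<in>pairs I. \<Sum>e'\<in>pairs I - {e}. G e e' (Suc t) x)" if "x \<notin> collision I"
  proof -
    have GS: "G e e' (Suc t) x = expect (indep P I x) (G e e' t)" if "e \<in> pairs I" for e e'
      using \<open>x \<notin> collision I\<close> that by (auto simp: G_def collision_iff_pairs meet_def)
    have hS: "hp (Suc t) (x (fst e)) (x (snd e)) = expect (indep P I x) (\<lambda>x. hp t (x (fst e)) (x (snd e)))"
      if "e \<in> pairs I" for e
    proof -
      have "x (fst e) \<noteq> x (snd e)" using \<open>x \<notin> collision I\<close> that by (auto simp: collision_iff_pairs)
      then show ?thesis using that I by (subst expect_indep_pair) (auto simp: pairs_def)
    qed
    have "(\<Sum>e\<in>pairs I. hp (Suc t) (x (fst e)) (x (snd e))) - (\<Sum>e\<in>pairs I. \<Sum>e'\<in>pairs I - {e}. G e e' (Suc t) x)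
      = expect (indep P I x) (\<lambda>x. (\<Sum>e\<in>pairs I. hp t (x (fst e)) (x (snd e)))
        - (\<Sum>e\<in>pairs I. \<Sum>e'\<in>pairs I - {e}. G e e' t x))"
      by (simp add: expect_diff expect_sum fin_indep I GS hS del: pair_hit.simps(2) cong: sum.cong)
    also have "\<dots> \<le> expect (indep P I x) (hit (indep P I) (collision I) t)"
      unfolding G_def using Suc.prems by (intro expect_mono fin_indep I Suc.IH) auto
    finally show ?thesis using that by simp
  qed
  show ?case
  proof (cases "x \<in> collision I")
    case True
    then show ?thesis using hit_collision_ge_collided[OF I Suc.prems True] by (simp only: payoff_in)
  next
    case False
    from step[OF this] show ?thesis unfolding G_def .
  qed
next
  case 0
  show ?case
  proof (cases "x \<in> collision I")
    case True
    then show ?thesis using hit_collision_ge_collided[OF I 0 True] by simp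
  next
    case False
    then have "(\<Sum>e\<in>pairs I. hp 0 (x (fst e)) (x (snd e))) = 0"
      by (intro sum.neutral) (auto simp: collision_iff_pairs)
    moreover have "0 \<le> (\<Sum>e\<in>pairs I. \<Sum>e'\<in>pairs I - {e}.
        payoff (indep P I) (meet (fst e) (snd e)) (\<lambda>z. hp T (z (fst e')) (z (snd e'))) 0 x)"
      by (intro sum_nonneg) (auto intro: hp_bounds)
    ultimately show ?thesis using False by simp
  qed
qed

lemma expect_hit_collision_ge:
  assumes I: "finite I"
  defines "C \<equiv> real (card I choose 2)"
  shows "expect (eqm I) (hit (indep P I) (collision I) t) \<ge> C * meetp t - C * (C - 1) * meetp t * eta t"
proof -
  have C: "real (card (pairs I)) = C" using I by (simp add: card_pairs C_def)
  have "expect (eqm I) (hit (indep P I) (collision I) t) \<ge> expect (eqm I) (\<lambda>x.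
    (\<Sum>e\<in>pairs I. hp t (x (fst e)) (x (snd e))) - (\<Sum>e\<in>pairs I. \<Sum>e'\<in>pairs I - {e}.
        payoff (indep P I) (meet (fst e) (snd e)) (\<lambda>z. hp t (z (fst e')) (z (snd e'))) t x))"
    by (intro expect_mono fin_eqm I hit_collision_ge order.refl)
  also have "expect (eqm I) (\<lambda>x.
    (\<Sum>e\<in>pairs I. hp t (x (fst e)) (x (snd e))) - (\<Sum>e\<in>pairs I. \<Sum>e'\<in>pairs I - {e}.
        payoff (indep P I) (meet (fst e) (snd e)) (\<lambda>z. hp t (z (fst e')) (z (snd e'))) t x))
    = (\<Sum>e\<in>pairs I. expect (eqm I) (\<lambda>x. hp t (x (fst e)) (x (snd e)))) -
      (\<Sum>e\<in>pairs I. \<Sum>e'\<in>pairs I - {e}. expect (eqm I)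
        (payoff (indep P I) (meet (fst e) (snd e)) (\<lambda>z. hp t (z (fst e')) (z (snd e'))) t))"
    by (simp add: expect_diff expect_sum fin_eqm I)
  also have "(\<Sum>e\<in>pairs I. expect (eqm I) (\<lambda>x. hp t (x (fst e)) (x (snd e)))) = (\<Sum>e\<in>pairs I. meetp t)"
    using I by (intro sum.cong refl expect_eqm_hp) (auto simp: pairs_def)
  also have "(\<Sum>e\<in>pairs I. meetp t) = C * meetp t" by (simp add: C)
  finally have "C * meetp t - (\<Sum>e\<in>pairs I. \<Sum>e'\<in>pairs I - {e}. expect (eqm I)
        (payoff (indep P I) (meet (fst e) (snd e)) (\<lambda>z. hp t (z (fst e')) (z (snd e'))) t))
    \<le> expect (eqm I) (hit (indep P I) (collision I) t)" .
  moreover have "(\<Sum>e\<in>pairs I. \<Sum>e'\<in>pairs I - {e}. expect (eqm I)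
        (payoff (indep P I) (meet (fst e) (snd e)) (\<lambda>z. hp t (z (fst e')) (z (snd e'))) t))
    \<le> (\<Sum>e\<in>pairs I. \<Sum>e'\<in>pairs I - {e}. meetp t * eta t)"
    using I by (intro sum_mono expect_two_pairs) auto
  moreover have "(\<Sum>e\<in>pairs I. \<Sum>e'\<in>pairs I - {e}. meetp t * eta t) = C * (C - 1) * meetp t * eta t"
  proof -
    have "(\<Sum>e'\<in>pairs I - {e}. meetp t * eta t) = (C - 1) * meetp t * eta t" if "e \<in> pairs I" for e
    proof -
      have "1 \<le> card (pairs I)" using that finite_pairs[OF I] by (metis One_nat_def Suc_leI card_gt_0_iff empty_iff)
      then have "real (card (pairs I - {e})) = C - 1"
        using that finite_pairs[OF I] C by (simp add: of_nat_diff)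
      then show ?thesis by simp
    qed
    then have "(\<Sum>e\<in>pairs I. \<Sum>e'\<in>pairs I - {e}. meetp t * eta t) = (\<Sum>e\<in>pairs I. (C - 1) * meetp t * eta t)"
      by (rule sum.cong[OF refl])
    then show ?thesis by (simp add: C)
  qed
  ultimately show ?thesis by linarith
qed

lemma expect_hit_collision_le:
  assumes I: "finite I"
  shows "expect (eqm I) (hit (indep P I) (collision I) t) \<le> real (card I choose 2) * meetp t"
proof -
  have "expect (eqm I) (hit (indep P I) (collision I) t)
    \<le> expect (eqm I) (\<lambda>x. \<Sum>e\<in>pairs I. hp t (x (fst e)) (x (snd e)))"
    by (intro expect_mono fin_eqm I hit_collision_le)
  also have "\<dots> = (\<Sum>e\<in>pairs I. expect (eqm I) (\<lambda>x. hp t (x (fst e)) (x (snd e))))"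
    by (intro expect_sum fin_eqm I)
  also have "\<dots> = (\<Sum>e\<in>pairs I. meetp t)"
    using I by (intro sum.cong refl expect_eqm_hp) (auto simp: pairs_def)
  finally show ?thesis by (simp add: card_pairs I)
qed

text \<open>At time 0 the configuration may be arbitrary outside \<open>I\<close>. One step resets
  these coordinates to the default 0, so the product form holds from time 1 on.\<close>

lemma steps_indep_Suc:
  assumes I: "finite I"
  shows "steps (indep P I) (Suc t) x = Pi_pmf I 0 (\<lambda>i. steps P (Suc t) (x i))"
proof (induction t arbitrary: x)
  case 0
  show ?case by (simp add: bind_return_pmf' indep_def steps_0)
next
  case (Suc t)
  have "steps (indep P I) (Suc (Suc t)) x
    = bind_pmf (indep P I x) (\<lambda>y. Pi_pmf I 0 (\<lambda>i. steps P (Suc t) (y i)))"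
    unfolding steps.simps(2)[of _ "Suc t"] by (intro bind_pmf_cong refl) (rule Suc)
  also have "\<dots> = Pi_pmf I 0 (\<lambda>i. bind_pmf (P (x i)) (steps P (Suc t)))"
    unfolding indep_def by (rule Pi_pmf_bind[OF I, symmetric])
  finally show ?case by (simp only: steps.simps(2)[symmetric])
qed

lemma steps_indep_mixing:
  assumes I: "finite I" and "0 < s"
    and mix: "\<And>f x. (\<And>y. 0 \<le> f y \<and> f y \<le> 1) \<Longrightarrow> expect (steps P s x) f \<le> expect \<pi> f + \<delta>"
    and f: "\<And>y. 0 \<le> f y \<and> f y \<le> 1"
  shows "expect (steps (indep P I) s x) f \<le> expect (eqm I) f + real (card I) * \<delta>"
proof -
  obtain s' where s: "s = Suc s'" using \<open>0 < s\<close> by (cases s) auto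
  show ?thesis unfolding s steps_indep_Suc[OF I] using mix[unfolded s] f
    by (intro expect_Pi_le I base.finite_steps fin\<pi>) auto
qed
end


section \<open>Coalescing walkers\<close>

lemma image_fun_upd: "i \<notin> I \<Longrightarrow> (z(i := y)) ` insert i I = insert y (z ` I)"
  by (auto simp: image_def)

text \<open>Walkers at distinct sites may be labelled by their sites. This lets a family indexed by
  \<open>I\<close> be read off the flow of all sites that drives \<open>coal\<close>, and lets
  equilibrium families of equal size be exchanged.\<close>

lemma expect_Pi_image_reindex:
  assumes "finite I" "inj_on h I" "\<And>j. finite (set_pmf (p j))"
  shows "expect (Pi_pmf I d (\<lambda>i. p (h i))) (\<lambda>z. F (z ` I)) = expect (Pi_pmf (h ` I) d p) (\<lambda>z. F (z ` h ` I))"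
  using assms(1,2)
proof (induction I arbitrary: F rule: finite_induct)
  case (insert i I)
  have hi: "h i \<notin> h ` I" using insert by auto
  have "expect (Pi_pmf (insert i I) d (\<lambda>i. p (h i))) (\<lambda>z. F (z ` insert i I))
    = expect (p (h i)) (\<lambda>y. expect (Pi_pmf I d (\<lambda>i. p (h i))) (\<lambda>z. F ((z(i := y)) ` insert i I)))"
    using insert assms(3) by (intro expect_Pi_insert) auto
  also have "\<dots> = expect (p (h i)) (\<lambda>y. expect (Pi_pmf I d (\<lambda>i. p (h i))) (\<lambda>z. F (insert y (z ` I))))"
    using insert.hyps by (simp only: image_fun_upd not_False_eq_True)
  also have "\<dots> = expect (p (h i)) (\<lambda>y. expect (Pi_pmf (h ` I) d p) (\<lambda>z. F (insert y (z ` h ` I))))"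
    using insert.prems by (intro expect_cong insert.IH) (auto simp: inj_on_def)
  also have "\<dots> = expect (p (h i)) (\<lambda>y. expect (Pi_pmf (h ` I) d p) (\<lambda>z. F ((z(h i := y)) ` insert (h i) (h ` I))))"
    using hi by (simp only: image_fun_upd not_False_eq_True)
  also have "\<dots> = expect (Pi_pmf (insert (h i) (h ` I)) d p) (\<lambda>z. F (z ` insert (h i) (h ` I)))"
    using hi insert.hyps assms(3) by (intro expect_Pi_insert[symmetric]) auto
  finally show ?case by simp
qed simp

lemma expect_Pi_image_subset:
  assumes "finite V" "A \<subseteq> V"
  shows "expect (Pi_pmf A d p) (\<lambda>z. F (z ` A)) = expect (Pi_pmf V d p) (\<lambda>z. F (z ` A))"
proof -
  have "(\<lambda>x. if x \<in> A then z x else d) ` A = z ` A" for z :: "'a \<Rightarrow> 'b" by (intro image_cong) auto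
  then show ?thesis using assms by (subst Pi_pmf_subset[OF assms]) simp
qed

text \<open>All sites move independently and each walker follows its site, so walkers that share a site
  stay together.\<close>

definition coal :: "nat set \<Rightarrow> (nat \<Rightarrow> nat pmf) \<Rightarrow> nat set \<Rightarrow> nat set pmf" where
  "coal V P A = map_pmf (\<lambda>z. z ` A) (Pi_pmf V 0 P)"

definition multiple :: "nat set \<Rightarrow> real" where
  "multiple A = (if 2 \<le> card A then 1 else 0)"

definition fewer :: "nat \<Rightarrow> nat set \<Rightarrow> real" where
  "fewer i A = (if card A < i then 1 else 0)"

text \<open>The probability that a chain on \<open>i, i - 1, \<dots>\<close> that steps down from \<open>l\<close> with probability
  \<open>r (l choose 2)\<close> is still above \<open>1\<close> after \<open>j\<close> steps.\<close>

primrec death :: "real \<Rightarrow> nat \<Rightarrow> nat \<Rightarrow> real" where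
  "death r 0 i = (if 2 \<le> i then 1 else 0)"
| "death r (Suc j) i = (1 - r * real (i choose 2)) * death r j i + r * real (i choose 2) * death r j (i - 1)"

context
  fixes r :: real and K :: nat
  assumes r: "0 \<le> r" "i \<le> K \<Longrightarrow> r * real (i choose 2) \<le> 1"
begin

lemma death_nonneg: "i \<le> K \<Longrightarrow> 0 \<le> death r j i"
  using r by (induction j arbitrary: i) (auto intro!: add_nonneg_nonneg mult_nonneg_nonneg)

text \<open>One step from \<open>i\<close> can only lower the value at \<open>i\<close>, and one
  step from \<open>Suc i\<close> ends at \<open>i\<close> or \<open>Suc i\<close>; so the earlier
  value \<open>death r j i\<close> separates the two sides.\<close>

lemma death_mono: "Suc i \<le> K \<Longrightarrow> death r j i \<le> death r j (Suc i)"
proof (induction j arbitrary: i)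
  case (Suc j)
  define p where "p = r * real (i choose 2)"
  define p' where "p' = r * real (Suc i choose 2)"
  have p: "0 \<le> p" "p \<le> 1" "0 \<le> p'" "p' \<le> 1" using r Suc.prems by (auto simp: p_def p'_def)
  have 1: "death r j (i - 1) \<le> death r j i"
    using Suc.IH[of "i - 1"] Suc.prems by (cases i) auto
  have "death r (Suc j) i = death r j i - p * (death r j i - death r j (i - 1))"
    by (simp add: p_def algebra_simps)
  also have "\<dots> \<le> death r j i" using 1 p by simp
  also have "\<dots> \<le> death r j i + (1 - p') * (death r j (Suc i) - death r j i)"
    using Suc.IH[OF Suc.prems] p by simp
  also have "\<dots> = death r (Suc j) (Suc i)" by (simp add: p'_def algebra_simps del: binomial_Suc_Suc)
  finally show ?case .
qed simp

lemma death_mono_le: "i \<le> i' \<Longrightarrow> i' \<le> K \<Longrightarrow> death r j i \<le> death r j i'"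
  by (induction i' rule: dec_induct) (auto intro: order.trans[OF _ death_mono])

lemma death_1: "i \<le> 1 \<Longrightarrow> death r j i = 0"
  by (induction j arbitrary: i) (auto simp: binomial_eq_0)

lemma death_2: "death r j 2 = (1 - r) ^ j"
  by (induction j) (auto simp: death_1)

end

section \<open>The coalescing kernel: monotonicity, subadditivity, comparison with independent
  walkers\<close>

context walk
begin

abbreviation kc :: "nat set \<Rightarrow> nat set pmf" where "kc \<equiv> coal V P"

abbreviation flow :: "(nat \<Rightarrow> nat) pmf" where "flow \<equiv> Pi_pmf V 0 P"

lemma fin_flow: "finite (set_pmf flow)" by (intro finite_set_Pi_pmf finV finP)

lemma flow_range: "z \<in> set_pmf flow \<Longrightarrow> A \<subseteq> V \<Longrightarrow> z ` A \<subseteq> V"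
  using Pi_pmf_range[OF finV, of z 0 P] PV by blast

sublocale kc: finite_kernel kc
  by unfold_locales (simp add: coal_def fin_flow)

abbreviation U :: "nat \<Rightarrow> (nat set \<Rightarrow> real) \<Rightarrow> nat set \<Rightarrow> real" where
  "U t f A \<equiv> expect (steps kc t A) f"

lemma expect_kc: "expect (kc A) f = expect flow (\<lambda>z. f (z ` A))"
  by (simp add: coal_def)

lemma U_Suc: "U (Suc t) f A = expect flow (\<lambda>z. U t f (z ` A))"
  unfolding kc.expect_steps_Suc expect_kc ..

lemma finite_sub: "A \<subseteq> V \<Longrightarrow> finite A" using finV finite_subset by blast

lemma steps_kc_range: "A \<subseteq> V \<Longrightarrow> B \<in> set_pmf (steps kc t A) \<Longrightarrow> B \<subseteq> V \<and> card B \<le> card A"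
proof (induction t arbitrary: A)
  case (Suc t)
  from Suc.prems obtain z where z: "z \<in> set_pmf flow" "B \<in> set_pmf (steps kc t (z ` A))"
    by (auto simp: coal_def[of V P A])
  then have "B \<subseteq> V \<and> card B \<le> card (z ` A)" using Suc flow_range by blast
  then show ?case using card_image_le[OF finite_sub[OF Suc.prems(1)], of z] by auto
qed simp

lemma U_mono_fun:
  assumes "\<And>B. B \<subseteq> V \<Longrightarrow> card B \<le> card A \<Longrightarrow> f B \<le> g B" "A \<subseteq> V"
  shows "U t f A \<le> U t g A"
  using assms steps_kc_range by (intro expect_mono kc.finite_steps) blast

text \<open>Both sets are moved by the same flow, and images preserve inclusion. This is the
  monotone coupling; \<open>U_Un\<close> uses in the same way that the image of a union is the union
  of the images.\<close>

lemma U_mono_set: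
  assumes f: "\<And>A B. A \<subseteq> B \<Longrightarrow> B \<subseteq> V \<Longrightarrow> f A \<le> f B" and "A \<subseteq> B" "B \<subseteq> V"
  shows "U t f A \<le> U t f B"
  using assms(2,3)
proof (induction t arbitrary: A B)
  case (Suc t)
  then show ?case unfolding U_Suc
    by (intro expect_mono fin_flow Suc.IH image_mono flow_range) auto
qed (simp add: f)

lemma multiple_mono: "A \<subseteq> B \<Longrightarrow> B \<subseteq> V \<Longrightarrow> multiple A \<le> multiple B"
  using card_mono[OF finite_sub, of B A] by (auto simp: multiple_def)

lemma U_Un:
  assumes f: "\<And>A B. A \<subseteq> V \<Longrightarrow> B \<subseteq> V \<Longrightarrow> f (A \<union> B) \<le> f A + f B" and "A \<subseteq> V" "B \<subseteq> V"
  shows "U t f (A \<union> B) \<le> U t f A + U t f B"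
  using assms(2,3)
proof (induction t arbitrary: A B)
  case (Suc t)
  have "U (Suc t) f (A \<union> B) = expect flow (\<lambda>z. U t f (z ` A \<union> z ` B))" by (simp only: U_Suc image_Un)
  also have "\<dots> \<le> expect flow (\<lambda>z. U t f (z ` A) + U t f (z ` B))"
    using Suc.prems by (intro expect_mono fin_flow Suc.IH flow_range)
  also have "\<dots> = U (Suc t) f A + U (Suc t) f B" by (simp only: U_Suc expect_add fin_flow)
  finally show ?case .
qed (simp add: f)

abbreviation v :: "nat \<Rightarrow> nat set \<Rightarrow> real" where "v t A \<equiv> U t multiple A"

lemma v_nonneg: "0 \<le> v t A" by (intro expect_ge kc.finite_steps) (simp add: multiple_def)
lemma v_le_1: "v t A \<le> 1" by (intro expect_le kc.finite_steps) (simp add: multiple_def)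

text \<open>If several walkers are left from \<open>insert y A\<close>, then several are left from
  \<open>A\<close> alone, or the walker from \<open>y\<close> has not joined that from
  \<open>x\<close>.\<close>

lemma v_insert:
  assumes "x \<in> A" "insert y A \<subseteq> V"
  shows "v t (insert y A) \<le> v t A + v t {x, y}"
  using assms
proof (induction t arbitrary: x y A)
  case 0
  have "finite A" using 0 finite_sub[of A] by auto
  have "card (insert y A) < 2 \<or> 2 \<le> card A \<or> 2 \<le> card {x, y}"
  proof (rule ccontr)
    assume *: "\<not> ?thesis"
    then have "x = y" by (cases "x = y") auto
    then have "insert y A = A" using 0 by auto
    then show False using * by (simp only:) linarith
  qed
  then show ?case by (auto simp: multiple_def)
next
  case (Suc t)
  have "v (Suc t) (insert y A) = expect flow (\<lambda>z. v t (insert (z y) (z ` A)))" by (simp only: U_Suc image_insert)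
  also have "\<dots> \<le> expect flow (\<lambda>z. v t (z ` A) + v t {z x, z y})"
  proof (intro expect_mono fin_flow Suc.IH)
    fix z assume "z \<in> set_pmf flow"
    then show "insert (z y) (z ` A) \<subseteq> V" using flow_range[OF _ Suc.prems(2), of z] by simp
  qed (use Suc.prems in auto)
  also have "\<dots> = v (Suc t) A + v (Suc t) {x, y}" by (simp only: U_Suc expect_add fin_flow image_insert image_empty)
  finally show ?case .
qed

text \<open>Everything has coalesced once every walker has joined that of \<open>x\<close>. A star
  around \<open>x\<close> costs one term per walker instead of one per pair, which keeps the
  prefactor in \<open>v_le_geometric\<close> at \<open>card V\<close>.\<close>

lemma v_le_pairs:
  assumes "finite Y" "insert x Y \<subseteq> V"
  shows "v t (insert x Y) \<le> (\<Sum>y\<in>Y. v t {x, y})"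
  using assms
proof (induction Y rule: finite_induct)
  case empty
  have "v t {x} \<le> 0"
  proof -
    have "v t {x} \<le> U t (\<lambda>_. 0) {x}" using empty by (intro U_mono_fun) (auto simp: multiple_def)
    then show ?thesis by simp
  qed
  then show ?case by simp
next
  case (insert y Y)
  have "v t (insert x (insert y Y)) = v t (insert y (insert x Y))" by (simp add: insert_commute)
  also have "\<dots> \<le> v t (insert x Y) + v t {x, y}" using insert.prems by (intro v_insert) auto
  finally show ?case using insert by auto
qed

lemma v_antimono: assumes "A \<subseteq> V" shows "antimono (\<lambda>t. v t A)"
proof -
  have "v (Suc t) A \<le> v t A" for t
  proof -
    have "v (Suc t) A = U t (\<lambda>B. expect (kc B) multiple) A"
      using kc.expect_steps_add[of t 1 A multiple] by (simp add: steps_0 bind_return_pmf')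
    also have "\<dots> \<le> v t A"
    proof (rule U_mono_fun[OF _ assms])
      fix B assume "B \<subseteq> V"
      show "expect (kc B) multiple \<le> multiple B" unfolding expect_kc
      proof (intro expect_le fin_flow)
        fix z show "multiple (z ` B) \<le> multiple B"
          using card_image_le[OF finite_sub[OF \<open>B \<subseteq> V\<close>], of z] by (auto simp: multiple_def)
      qed
    qed
    finally show ?thesis .
  qed
  then show ?thesis unfolding antimono_iff_le_Suc by blast
qed

text \<open>Independent and coalescing walkers differ only in what walkers at a common site do; from
  distinct sites, one step of either system occupies the same random set in law.\<close>

lemma expect_indep_image:
  assumes "finite I" "inj_on x I" "x ` I \<subseteq> V"
  shows "expect (indep P I x) (\<lambda>z. f (z ` I)) = expect (kc (x ` I)) f"
proof -
  have "expect (indep P I x) (\<lambda>z. f (z ` I)) = expect (Pi_pmf (x ` I) 0 P) (\<lambda>z. f (z ` x ` I))"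
    unfolding indep_def using assms by (intro expect_Pi_image_reindex finP)
  also have "\<dots> = expect flow (\<lambda>z. f (z ` x ` I))"
    using finV assms by (intro expect_Pi_image_subset)
  finally show ?thesis by (simp add: expect_kc)
qed

lemma indep_range:
  assumes "finite I" "z \<in> set_pmf (indep P I x)" shows "z ` I \<subseteq> V"
  using assms Pi_pmf_range[of I z 0 "\<lambda>i. P (x i)"] PV unfolding indep_def by blast

lemma steps_indep_range:
  assumes "finite I" "z \<in> set_pmf (steps (indep P I) t x)" "x ` I \<subseteq> V" shows "z ` I \<subseteq> V"
  using assms(2,3)
proof (induction t arbitrary: x)
  case (Suc t)
  then obtain y where y: "y \<in> set_pmf (indep P I x)" "z \<in> set_pmf (steps (indep P I) t y)" by auto
  from Suc.IH[OF y(2) indep_range[OF assms(1) y(1)]] show ?case .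
qed simp

lemma eqm_range:
  assumes "finite I" "z \<in> set_pmf (eqm I)" shows "z ` I \<subseteq> V"
  using assms Pi_pmf_range[of I z 0 "\<lambda>i. \<pi>"] \<pi>V by blast

lemma collision_card:
  assumes "finite I" shows "x \<in> collision I \<longleftrightarrow> card (x ` I) < card I"
  using assms card_image_le[of I x] inj_on_iff_eq_card[of I x] by (auto simp: collision_def)

text \<open>Up to the first collision the two systems occupy the same sites, and from that time on
  the coalescing one has lost a walker for good.\<close>

lemma U_fewer_ge_hit:
  assumes I: "finite I" and "x ` I \<subseteq> V"
  shows "U t (fewer (card I)) (x ` I) \<ge> hit (indep P I) (collision I) t x"
  using assms(2)
proof (induction t arbitrary: x)
  case 0
  then show ?case using collision_card[OF I, of x] by (simp add: fewer_def)
next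
  case (Suc t)
  show ?case
  proof (cases "x \<in> collision I")
    case True
    then have "card (x ` I) < card I" using collision_card[OF I] by simp
    then have "U (Suc t) (fewer (card I)) (x ` I) \<ge> U (Suc t) (\<lambda>_. 1) (x ` I)"
      using Suc.prems by (intro U_mono_fun) (auto simp: fewer_def)
    then show ?thesis using True by simp
  next
    case False
    have "expect (indep P I x) (hit (indep P I) (collision I) t)
      \<le> expect (indep P I x) (\<lambda>z. U t (fewer (card I)) (z ` I))"
      using indep_range[OF I] by (intro expect_mono fin_indep I Suc.IH) auto
    also have "\<dots> = U (Suc t) (fewer (card I)) (x ` I)"
      using False Suc.prems unfolding kc.expect_steps_Suc
      by (intro expect_indep_image I) (auto simp: collision_def)
    finally show ?thesis using False by simp
  qed
qed

text \<open>The systems agree until the first collision; after it the two values of \<open>c\<close>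
  differ by at most \<open>M\<close>.\<close>

lemma U_ge_independent:
  assumes I: "finite I" and "x ` I \<subseteq> V" and c: "\<And>A. A \<subseteq> V \<Longrightarrow> 0 \<le> c A \<and> c A \<le> M"
  shows "U t c (x ` I) \<ge> expect (steps (indep P I) t x) (\<lambda>z. c (z ` I)) - M * hit (indep P I) (collision I) t x"
  using assms(2)
proof (induction t arbitrary: x)
  case 0
  have "0 \<le> M" using c[OF 0] by auto
  then show ?case by simp
next
  case (Suc t)
  interpret fk: finite_kernel "indep P I" by (rule finite_kernel_indep[OF I])
  show ?case
  proof (cases "x \<in> collision I")
    case True
    have "expect (steps (indep P I) (Suc t) x) (\<lambda>z. c (z ` I)) \<le> M"
      using c steps_indep_range[OF I _ Suc.prems] by (intro expect_le fk.finite_steps) blast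
    moreover have "0 \<le> U (Suc t) c (x ` I)"
      using c steps_kc_range[OF Suc.prems] by (intro expect_ge kc.finite_steps) blast
    ultimately show ?thesis using True by simp
  next
    case False
    have "U (Suc t) c (x ` I) = expect (indep P I x) (\<lambda>z. U t c (z ` I))"
      using False Suc.prems unfolding kc.expect_steps_Suc
      by (intro expect_indep_image[symmetric] I) (auto simp: collision_def)
    also have "\<dots> \<ge> expect (indep P I x) (\<lambda>y. expect (steps (indep P I) t y) (\<lambda>z. c (z ` I)) - M * hit (indep P I) (collision I) t y)"
      using indep_range[OF I] by (intro expect_mono fin_indep I Suc.IH) auto
    also have "expect (indep P I x) (\<lambda>y. expect (steps (indep P I) t y) (\<lambda>z. c (z ` I)) - M * hit (indep P I) (collision I) t y)
      = expect (steps (indep P I) (Suc t) x) (\<lambda>z. c (z ` I)) - M * hit (indep P I) (collision I) (Suc t) x"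
      using False unfolding fk.expect_steps_Suc by (simp add: expect_diff fin_indep I)
    finally show ?thesis .
  qed
qed

section \<open>The number of walkers and its comparison with the death chain\<close>

abbreviation num :: "nat \<Rightarrow> nat set \<Rightarrow> real" where "num t A \<equiv> U t (\<lambda>B. real (card B)) A"

lemma num_le: "A \<subseteq> V \<Longrightarrow> num t A \<le> card A"
  using steps_kc_range by (intro expect_le kc.finite_steps) auto

lemma num_Un: "A \<subseteq> V \<Longrightarrow> B \<subseteq> V \<Longrightarrow> num t (A \<union> B) \<le> num t A + num t B"
proof (rule U_Un)
  fix A B :: "nat set"
  show "real (card (A \<union> B)) \<le> real (card A) + real (card B)"
    using card_Un_le[of A B] by linarith
qed

text \<open>All walkers at once would form too many pairs for Bonferroni's inequality to be of use.
  Disjoint groups of \<open>g\<close> keep the number of pairs small, and by subadditivity the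
  losses inside the groups add up.\<close>

lemma num_le_groups:
  assumes p: "\<And>G. G \<subseteq> V \<Longrightarrow> card G = g \<Longrightarrow> p \<le> U b (fewer g) G"
  shows "A \<subseteq> V \<Longrightarrow> m * g \<le> card A \<Longrightarrow> num b A \<le> real (card A) - real m * p"
proof (induction m arbitrary: A)
  case 0
  then show ?case using num_le by simp
next
  case (Suc m)
  have "g \<le> card A" using Suc.prems by simp
  then obtain G where G: "G \<subseteq> A" "card G = g" "finite G" by (rule obtain_subset_with_card_n)
  have GV: "G \<subseteq> V" using G Suc.prems by auto
  have A: "A = G \<union> (A - G)" using G by auto
  have cA: "card (A - G) = card A - g" using G by (simp add: card_Diff_subset)
  have "num b G \<le> U b (\<lambda>B. real g - fewer g B) G"
    using GV G by (intro U_mono_fun) (auto simp: fewer_def)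
  also have "\<dots> = real g - U b (fewer g) G" by (simp add: expect_diff kc.finite_steps)
  finally have 1: "num b G \<le> real g - p" using p[OF GV G(2)] by simp
  have 2: "num b (A - G) \<le> real (card (A - G)) - real m * p"
    using Suc.prems cA by (intro Suc.IH) auto
  have "num b A \<le> num b G + num b (A - G)"
    using num_Un[of G "A - G" b] GV Suc.prems A by auto
  moreover have "real (card (A - G)) = real (card A) - real g" using cA \<open>g \<le> card A\<close> by (simp add: of_nat_diff)
  ultimately show ?case using 1 2 by (simp add: distrib_right)
qed

text \<open>Configurations with fewer than \<open>K\<close> walkers count as 0. As the number of
  walkers never increases, they stay at 0, so the decay rate has to be known only from
  \<open>K\<close> walkers upwards.\<close>

lemma crowded_decay:
  assumes dec: "\<And>A. A \<subseteq> V \<Longrightarrow> K \<le> card A \<Longrightarrow> num b A \<le> \<rho> * real (card A)" and "0 \<le> \<rho>" and "A \<subseteq> V"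
  shows "U (j * b) (\<lambda>B. if K \<le> card B then real (card B) else 0) A \<le> (if K \<le> card A then \<rho> ^ j * real (card A) else 0)"
  using assms(3)
proof (induction j arbitrary: A)
  case (Suc j)
  let ?f = "\<lambda>B. if K \<le> card B then real (card B) else 0"
  have "U (Suc j * b) ?f A = U b (U (j * b) ?f) A" by (simp only: mult_Suc kc.expect_steps_add)
  also have "\<dots> \<le> U b (\<lambda>B. if K \<le> card A then \<rho> ^ j * real (card B) else 0) A"
  proof (rule U_mono_fun[OF _ Suc.prems])
    fix B assume "B \<subseteq> V" "card B \<le> card A"
    then show "U (j * b) ?f B \<le> (if K \<le> card A then \<rho> ^ j * real (card B) else 0)"
      using Suc.IH[of B] \<open>0 \<le> \<rho>\<close> by (auto split: if_splits intro: order.trans)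
  qed
  also have "\<dots> \<le> (if K \<le> card A then \<rho> ^ Suc j * real (card A) else 0)"
    using dec[OF Suc.prems] mult_left_mono[of "num b A" "\<rho> * real (card A)" "\<rho> ^ j"] \<open>0 \<le> \<rho>\<close>
    by (auto simp: mult_ac)
  finally show ?case .
qed simp

text \<open>Only one loss per block is counted. Since \<open>death\<close> increases with the number
  of walkers, a block with several losses does at least as well.\<close>

lemma v_le_death:
  assumes r: "0 \<le> r" "\<And>i. i \<le> K \<Longrightarrow> r * real (i choose 2) \<le> 1"
    and p: "\<And>G. G \<subseteq> V \<Longrightarrow> 2 \<le> card G \<Longrightarrow> card G \<le> K \<Longrightarrow> r * real (card G choose 2) \<le> U b (fewer (card G)) G"
    and "A \<subseteq> V" "card A \<le> K"
  shows "v (j * b) A \<le> death r j (card A)"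
  using assms(4,5)
proof (induction j arbitrary: A)
  case (Suc j)
  define i where "i = card A"
  define d where "d = death r j i - death r j (i - 1)"
  have "0 \<le> d" unfolding d_def using death_mono_le[OF r(1) r(2), of K "i - 1" i j] Suc.prems by (auto simp: i_def)
  show ?case
  proof (cases "2 \<le> i")
    case False
    then have "v (Suc j * b) A \<le> U (Suc j * b) (\<lambda>_. 0) A"
      using Suc.prems by (intro U_mono_fun) (auto simp: multiple_def i_def)
    then show ?thesis using False death_1[OF r(1) r(2), of K i "Suc j"] by (simp add: i_def)
  next
    case True
    have "v (Suc j * b) A = U b (v (j * b)) A" by (simp only: mult_Suc kc.expect_steps_add)
    also have "\<dots> \<le> U b (\<lambda>B. death r j i - d * fewer i B) A"
    proof (rule U_mono_fun[OF _ Suc.prems(1)])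
      fix B assume B: "B \<subseteq> V" "card B \<le> card A"
      have "v (j * b) B \<le> death r j (card B)" using B Suc.prems by (intro Suc.IH) auto
      also have "\<dots> \<le> death r j i - d * fewer i B"
      proof (cases "card B < i")
        case True
        then show ?thesis using death_mono_le[OF r(1) r(2), of K "card B" "i - 1" j] Suc.prems
          by (simp add: fewer_def d_def i_def)
      next
        case False
        then show ?thesis using B by (simp add: fewer_def i_def)
      qed
      finally show "v (j * b) B \<le> death r j i - d * fewer i B" .
    qed
    also have "\<dots> = death r j i - d * U b (fewer i) A" by (simp add: expect_diff kc.finite_steps)
    also have "\<dots> \<le> death r j i - d * (r * real (i choose 2))"
      using p[of A] Suc.prems True \<open>0 \<le> d\<close> by (auto simp: i_def intro!: mult_left_mono)
    also have "\<dots> = death r (Suc j) i" by (simp add: d_def algebra_simps)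
    finally show ?thesis by (simp add: i_def)
  qed
qed (auto simp: multiple_def)

text \<open>A crude bound for any number of walkers: \<open>v_le_pairs\<close> reduces it to two
  walkers, for which \<open>death\<close> is an exact power.\<close>

lemma v_le_geometric:
  assumes r: "0 \<le> r" "r \<le> 1"
    and p: "\<And>G. G \<subseteq> V \<Longrightarrow> card G = 2 \<Longrightarrow> r \<le> U b (fewer 2) G" and A: "A \<subseteq> V"
  shows "v (j * b) A \<le> real (card V) * (1 - r) ^ j"
proof (cases "A = {}")
  case True
  have "v (j * b) A \<le> U (j * b) (\<lambda>_. 0) A" using True by (intro U_mono_fun) (auto simp: multiple_def)
  then show ?thesis using r by (auto intro: order.trans)
next
  case False
  then obtain x where x: "x \<in> A" by auto
  have "v (j * b) A = v (j * b) (insert x A)" using x by (simp add: insert_absorb)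
  also have "\<dots> \<le> (\<Sum>y\<in>A. v (j * b) {x, y})" using x A finite_sub by (intro v_le_pairs) auto
  also have "\<dots> \<le> (\<Sum>y\<in>A. (1 - r) ^ j)"
  proof (rule sum_mono)
    fix y assume y: "y \<in> A"
    have K: "r * real (i choose 2) \<le> 1" if "i \<le> 2" for i
      using r that by (cases "i = 2") (auto simp: binomial_eq_0)
    have "v (j * b) {x, y} \<le> death r j (card {x, y})"
    proof (rule v_le_death[OF r(1) K])
      show "r * real (card G choose 2) \<le> U b (fewer (card G)) G" if "G \<subseteq> V" "2 \<le> card G" "card G \<le> 2" for G
      proof -
        have "card G = 2" using that by linarith
        then show ?thesis using p[of G] that by simp
      qed
    qed (use x y A in \<open>auto simp: card_insert_if\<close>)
    also have "\<dots> \<le> death r j 2" by (rule death_mono_le[OF r(1) K]) (auto simp: card_insert_if)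
    also have "\<dots> = (1 - r) ^ j" by (rule death_2[OF r(1) K]) auto
    finally show "v (j * b) {x, y} \<le> (1 - r) ^ j" .
  qed
  also have "\<dots> = real (card A) * (1 - r) ^ j" by simp
  also have "\<dots> \<le> real (card V) * (1 - r) ^ j" using card_mono[OF finV A] r by (intro mult_right_mono) auto
  finally show ?thesis .
qed
end


section \<open>The mean coalescence time from below\<close>

locale mixing_walk = walk +
  fixes s :: nat and \<delta> :: real
  assumes s_pos: "0 < s" and \<delta>_nonneg: "0 \<le> \<delta>"
    and mix: "(\<And>y. 0 \<le> f y \<and> f y \<le> 1) \<Longrightarrow> expect (steps P s x) f \<le> expect \<pi> f + \<delta>"
begin

lemma mix_later:
  assumes "s \<le> t" "\<And>y. 0 \<le> f y \<and> f y \<le> 1"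
  shows "expect (steps P t x) f \<le> expect \<pi> f + \<delta>"
proof -
  have "expect (steps P t x) f = expect (steps P (t - s) x) (\<lambda>y. expect (steps P s y) f)"
    using base.expect_steps_add[of "t - s" s x f] assms by simp
  also have "\<dots> \<le> expect \<pi> f + \<delta>" using assms by (intro expect_le base.finite_steps mix)
  finally show ?thesis .
qed

lemma indep_mix:
  assumes "finite I" "s \<le> t" "\<And>y. 0 \<le> f y \<and> f y \<le> 1"
  shows "expect (steps (indep P I) t x) f \<le> expect (eqm I) f + real (card I) * \<delta>"
  using assms s_pos by (intro steps_indep_mixing mix_later) auto

text \<open>The mean number of steps until a single walker is left, as the sum of the tail
  probabilities.\<close>

definition cost :: "nat set \<Rightarrow> real" where "cost A = (\<Sum>t. v t A)"

definition cbar :: "nat \<Rightarrow> real" where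
  "cbar i = expect (eqm {..<i}) (\<lambda>x. cost (x ` {..<i}))"

text \<open>The mean number of steps to the first collision of \<open>i\<close> equilibrium walkers,
  again as a tail sum.\<close>

definition ET :: "nat \<Rightarrow> real" where
  "ET i = (\<Sum>t. expect (eqm {..<i}) (surv (indep P {..<i}) (collision {..<i}) t))"

text \<open>Allows any label set: after a collision in \<open>I\<close> the survivors are indexed by
  \<open>I\<close> without one element rather than by an initial segment.\<close>

lemma cbar_eq:
  assumes "finite I" "card I = i"
  shows "expect (eqm I) (\<lambda>x. cost (x ` I)) = cbar i"
proof -
  obtain h where h: "bij_betw h {..<i} I"
    using assms ex_bij_betw_nat_finite[of I] by (auto simp: lessThan_atLeast0)
  then have hI: "h ` {..<i} = I" "inj_on h {..<i}" by (auto simp: bij_betw_def)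
  have "cbar i = expect (Pi_pmf (h ` {..<i}) 0 (\<lambda>_. \<pi>)) (\<lambda>z. cost (z ` h ` {..<i}))"
    unfolding cbar_def using hI by (intro expect_Pi_image_reindex fin\<pi>) auto
  then show ?thesis by (simp only: hI)
qed

context
  fixes m :: real
  assumes m: "(\<Sum>t<N. 1 - meetp t) \<le> m"
begin

text \<open>All five facts rest on one comparison: the first collision comes no later than the
  meeting of the walkers 0 and 1, whose mean time is at most \<open>m\<close>.\<close>

lemma summable_surv:
  assumes "2 \<le> i"
  defines "I \<equiv> {..<i}"
  shows "summable (\<lambda>t. expect (eqm I) (surv (indep P I) (collision I) t))"
    "(\<Sum>t<N. expect (eqm I) (surv (indep P I) (collision I) t)) \<le> m"
    "(\<Sum>t<N. expect (eqm I) (surv (indep P I) (collision I) t)) \<le> ET i"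
    "(\<lambda>N. \<Sum>t<N. expect (eqm I) (surv (indep P I) (collision I) t)) \<longlonglongrightarrow> ET i"
    "(\<lambda>t. expect (eqm I) (hit (indep P I) (collision I) t)) \<longlonglongrightarrow> 1"
proof -
  have I: "finite I" "0 \<in> I" "1 \<in> I" using assms by (auto simp: I_def)
  interpret fk: finite_kernel "indep P I" by (rule finite_kernel_indep[OF I(1)])
  define a where "a t = expect (eqm I) (surv (indep P I) (collision I) t)" for t
  have surv: "surv (indep P I) (collision I) t x = 1 - hit (indep P I) (collision I) t x" for t x
    using fk.hit_add_surv[of "collision I" t x] by linarith
  have a_hit: "a t = 1 - expect (eqm I) (hit (indep P I) (collision I) t)" for t
    unfolding a_def surv by (simp add: expect_diff fin_eqm I)
  have a_le: "a t \<le> 1 - meetp t" for t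
  proof -
    have "meet 0 1 \<subseteq> collision I" using I by (auto simp: meet_def collision_def inj_on_def)
    then have "expect (eqm I) (hit (indep P I) (meet 0 1) t) \<le> expect (eqm I) (hit (indep P I) (collision I) t)"
      by (intro expect_mono fin_eqm I fk.hit_mono_set)
    moreover have "expect (eqm I) (hit (indep P I) (meet 0 1) t) = meetp t"
    proof -
      have "hit (indep P I) (meet 0 1) t = (\<lambda>x. hp t (x 0) (x 1))" using I by (intro ext hit_meet) auto
      then show ?thesis using I expect_eqm_hp[of I 0 1 t] by simp
    qed
    ultimately show ?thesis by (simp add: a_hit)
  qed
  have a0: "0 \<le> a t" for t unfolding a_def by (intro expect_ge fin_eqm I fk.surv_nonneg)
  have sum_a: "(\<Sum>t<N. a t) \<le> m" for N using sum_mono[of "{..<N}" a "\<lambda>t. 1 - meetp t"] a_le m[of N] by auto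
  then show "(\<Sum>t<N. expect (eqm I) (surv (indep P I) (collision I) t)) \<le> m" unfolding a_def .
  have summ: "summable a" using a0 sum_a by (intro summableI_nonneg_bounded)
  then show "summable (\<lambda>t. expect (eqm I) (surv (indep P I) (collision I) t))" unfolding a_def .
  have ET: "ET i = suminf a" unfolding ET_def a_def I_def ..
  show "(\<Sum>t<N. expect (eqm I) (surv (indep P I) (collision I) t)) \<le> ET i"
    unfolding ET a_def[symmetric] using summ a0 by (intro sum_le_suminf) auto
  show "(\<lambda>N. \<Sum>t<N. expect (eqm I) (surv (indep P I) (collision I) t)) \<longlonglongrightarrow> ET i"
    unfolding ET a_def[symmetric] using summ by (rule summable_LIMSEQ)
  have "(\<lambda>t. 1 - a t) \<longlonglongrightarrow> 1 - 0" by (intro tendsto_diff tendsto_const summable_LIMSEQ_zero summ)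
  then show "(\<lambda>t. expect (eqm I) (hit (indep P I) (collision I) t)) \<longlonglongrightarrow> 1" by (simp add: a_hit)
qed

text \<open>In the long run a collision is certain, while \<open>payoff_blocks\<close> bounds its
  probability by that of a collision in one equilibrium block times about the number
  \<open>ET i / \<tau>\<close> of blocks survived. So \<open>ET i\<close> cannot be small.\<close>

lemma ET_lower:
  assumes "2 \<le> i" "s \<le> \<tau>"
  shows "1 \<le> (real (i choose 2) * meetp \<tau> + i * \<delta>) * (2 + ET i / \<tau>)"
proof -
  define I where "I = {..<i}"
  have I: "finite I" "card I = i" by (auto simp: I_def)
  interpret fk: finite_kernel "indep P I" by (rule finite_kernel_indep[OF I(1)])
  have "expect (eqm I) (hit (indep P I) (collision I) (J * \<tau>))
    \<le> (expect (eqm I) (hit (indep P I) (collision I) \<tau>) + i * \<delta> * 1) * (2 + ET i / \<tau>)" for J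
  proof (rule fk.payoff_blocks)
    show "expect (steps (indep P I) \<tau> x) f \<le> expect (eqm I) f + i * \<delta>" if "\<And>y. 0 \<le> f y \<and> f y \<le> 1" for f x
      using indep_mix[OF I(1) assms(2) that] I(2) by simp
  qed (use I assms s_pos \<delta>_nonneg summable_surv(3)[OF assms(1)] in \<open>auto simp: fin_eqm I_def\<close>)
  then have "expect (eqm I) (hit (indep P I) (collision I) (J * \<tau>))
    \<le> (real (i choose 2) * meetp \<tau> + i * \<delta>) * (2 + ET i / \<tau>)" for J
  proof (rule order.trans)
    have "0 \<le> ET i" using summable_surv(3)[OF assms(1), of 0] by simp
    then show "(expect (eqm I) (hit (indep P I) (collision I) \<tau>) + i * \<delta> * 1) * (2 + ET i / \<tau>)
      \<le> (real (i choose 2) * meetp \<tau> + i * \<delta>) * (2 + ET i / \<tau>)"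
      using expect_hit_collision_le[OF I(1), of \<tau>] I(2) by (intro mult_right_mono) auto
  qed
  moreover have "(\<lambda>J. expect (eqm I) (hit (indep P I) (collision I) (J * \<tau>))) \<longlonglongrightarrow> 1"
  proof -
    have "filterlim (\<lambda>J. J * \<tau>) at_top sequentially"
      using assms s_pos by (intro filterlim_subseq) (auto simp: strict_mono_def)
    from filterlim_compose[OF summable_surv(5)[OF assms(1)] this] show ?thesis by (simp add: I_def)
  qed
  ultimately show ?thesis by (intro LIMSEQ_le_const2) auto
qed

end

context
  fixes M m :: real
  assumes summable_v: "A \<subseteq> V \<Longrightarrow> summable (\<lambda>t. v t A)" and cost_le: "A \<subseteq> V \<Longrightarrow> cost A \<le> M"
    and m: "(\<Sum>t<N. 1 - meetp t) \<le> m"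
begin

lemma cost_nonneg: "A \<subseteq> V \<Longrightarrow> 0 \<le> cost A"
  unfolding cost_def by (intro suminf_nonneg summable_v v_nonneg)

lemma U_cost: "A \<subseteq> V \<Longrightarrow> U u cost A = (\<Sum>t. v (t + u) A)" "A \<subseteq> V \<Longrightarrow> summable (\<lambda>t. v (t + u) A)"
proof -
  assume A: "A \<subseteq> V"
  show "summable (\<lambda>t. v (t + u) A)" using summable_v[OF A] by (subst summable_iff_shift)
  have "U u cost A = (\<Sum>t. U u (v t) A)"
    unfolding cost_def using steps_kc_range[OF A] by (intro expect_suminf kc.finite_steps summable_v) auto
  also have "(\<lambda>t. U u (v t) A) = (\<lambda>t. v (t + u) A)"
    by (subst add.commute) (simp add: kc.expect_steps_add)
  finally show "U u cost A = (\<Sum>t. v (t + u) A)" .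
qed

lemma U_cost_le: "A \<subseteq> V \<Longrightarrow> U u cost A \<le> cost A"
proof -
  assume A: "A \<subseteq> V"
  have "cost A = (\<Sum>t. v (t + u) A) + (\<Sum>t<u. v t A)"
    unfolding cost_def by (rule suminf_split_initial_segment[OF summable_v[OF A]])
  then show ?thesis using U_cost(1)[OF A, of u] by (simp add: sum_nonneg v_nonneg)
qed

lemma cost_step:
  assumes "A \<subseteq> V" "2 \<le> card A" shows "cost A = 1 + expect (kc A) cost"
proof -
  have "cost A = (\<Sum>t. v (t + 1) A) + v 0 A"
    unfolding cost_def using suminf_split_initial_segment[OF summable_v[OF assms(1)], of 1] by simp
  also have "(\<Sum>t. v (t + 1) A) = U 1 cost A" using U_cost(1)[OF assms(1), of 1] by simp
  also have "U 1 cost A = expect (kc A) cost" by (simp add: steps_0 bind_return_pmf')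
  finally show ?thesis using assms by (simp add: multiple_def)
qed

text \<open>Restart the clock when the first collision among \<open>i\<close> equilibrium walkers happens. The
  \<open>i - 1\<close> survivors either collide again within \<open>s\<close>, which \<^const>\<open>payoff\<close> charges to pairs
  of pairs, or are then close to \<open>i - 1\<close> equilibrium walkers.\<close>

lemma cost_recursion:
  assumes "2 \<le> i"
  defines "C \<equiv> real (i choose 2)"
  shows "cbar i \<ge> ET i + cbar (i - 1)
    - M * (i * \<delta> + C\<^sup>2 * (meetp s * eta s + i * \<delta>) * (2 + m / s))"
proof -
  define I where "I = {..<i}"
  have I: "finite I" "card I = i" by (auto simp: I_def)
  interpret fk: finite_kernel "indep P I" by (rule finite_kernel_indep[OF I(1)])
  have M0: "0 \<le> M" using cost_nonneg[of "{}"] cost_le[of "{}"] by auto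
  have m0: "0 \<le> m" using m[of 0] by simp
  have C: "real (card (pairs I)) = C" using I by (simp add: card_pairs C_def)
  \<comment> \<open>\<open>a\<close> is what \<open>i - 1\<close> walkers still cost after
    \<open>s\<close> steps without a further collision. \<open>\<beta>\<close> is the price of such
    a collision, a sum over all candidates for the pair \<open>e\<close> that has just met and for
    the next pair \<open>e'\<close>.\<close>
  define a where "a = cbar (i - 1) - i * \<delta> * M"
  define \<beta>0 where "\<beta>0 e e' x = (if x \<in> meet (fst e) (snd e) then hp s (x (fst e')) (x (snd e')) else 0)"
    for e e' :: "nat \<times> nat" and x :: "nat \<Rightarrow> nat"
  define \<beta> where "\<beta> x = (\<Sum>e\<in>pairs I. \<Sum>e'\<in>pairs I - {e}. \<beta>0 e e' x)" for x
  have \<beta>0: "0 \<le> \<beta>0 e e' x" "\<beta>0 e e' x \<le> 1" for e e' x by (auto simp: \<beta>0_def hp_bounds)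
  have \<beta>_nonneg: "0 \<le> \<beta> x" for x unfolding \<beta>_def by (intro sum_nonneg \<beta>0)
  have \<beta>_le: "\<beta> x \<le> C\<^sup>2" for x
  proof -
    have "\<beta> x \<le> (\<Sum>e\<in>pairs I. \<Sum>e'\<in>pairs I. 1)" unfolding \<beta>_def
    proof (rule sum_mono)
      fix e assume "e \<in> pairs I"
      have "(\<Sum>e'\<in>pairs I - {e}. \<beta>0 e e' x) \<le> (\<Sum>e'\<in>pairs I - {e}. 1)" by (intro sum_mono \<beta>0)
      also have "\<dots> \<le> (\<Sum>e'\<in>pairs I. 1)" by (intro sum_mono2 finite_pairs I) auto
      finally show "(\<Sum>e'\<in>pairs I - {e}. \<beta>0 e e' x) \<le> (\<Sum>e'\<in>pairs I. 1)" .
    qed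
    then show ?thesis by (simp add: C power2_eq_square)
  qed
  have collided: "cost (x ` I) \<ge> a - M * \<beta> x" if x: "x ` I \<subseteq> V" "x \<in> collision I" for x
  proof -
    obtain e where e: "e \<in> pairs I" "x (fst e) = x (snd e)" using x(2) by (auto simp: collision_iff_pairs)
    define I' where "I' = I - {snd e}"
    have I': "finite I'" "card I' = i - 1" using e I by (auto simp: I'_def pairs_def)
    have xI': "x ` I' = x ` I"
    proof
      show "x ` I \<subseteq> x ` I'"
      proof
        fix y assume "y \<in> x ` I"
        then obtain j where "j \<in> I" "y = x j" by auto
        then show "y \<in> x ` I'" using e by (cases "j = snd e") (auto simp: I'_def pairs_def intro!: image_eqI[of _ _ "fst e"])
      qed
    qed (auto simp: I'_def)
    interpret fk': finite_kernel "indep P I'" by (rule finite_kernel_indep[OF I'(1)])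
    \<comment> \<open>The bounds on \<open>cost\<close> hold inside \<open>V\<close> only. Cutting
      it off outside makes the mixing estimate applicable and changes nothing, since the walkers
      never leave \<open>V\<close>.\<close>
    define f where "f z = (if z ` I' \<subseteq> V then cost (z ` I') else 0)" for z
    have f: "0 \<le> f z \<and> f z \<le> M" for z using cost_nonneg cost_le M0 by (auto simp: f_def)
    have "cbar (i - 1) = expect (eqm I') (\<lambda>z. cost (z ` I'))" by (rule cbar_eq[OF I', symmetric])
    also have "\<dots> = expect (eqm I') f" using eqm_range[OF I'(1)] by (intro expect_cong) (auto simp: f_def)
    finally have "cbar (i - 1) - real (card I') * \<delta> * M \<le> expect (steps (indep P I') s x) f"
      using fk'.steps_two_sided(2)[of s "eqm I'" "real (card I') * \<delta>" f M x, OF indep_mix[OF I'(1) order.refl]]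
        fin_eqm[OF I'(1)] f M0 by auto
    also have "expect (steps (indep P I') s x) f = expect (steps (indep P I') s x) (\<lambda>z. cost (z ` I'))"
      using steps_indep_range[OF I'(1)] x(1) unfolding xI'[symmetric] by (intro expect_cong) (auto simp: f_def)
    finally have 1: "cbar (i - 1) - real (card I') * \<delta> * M \<le> expect (steps (indep P I') s x) (\<lambda>z. cost (z ` I'))" .
    have "real (card I') * \<delta> * M \<le> i * \<delta> * M"
      using I'(2) \<delta>_nonneg M0 by (intro mult_right_mono) auto
    with 1 have 1: "a \<le> expect (steps (indep P I') s x) (\<lambda>z. cost (z ` I'))" unfolding a_def by linarith
    have "hit (indep P I') (collision I') s x \<le> (\<Sum>e'\<in>pairs I'. hp s (x (fst e')) (x (snd e')))"
      by (rule hit_collision_le[OF I'(1)])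
    \<comment> \<open>\<open>e\<close> is together at \<open>x\<close>, so
      \<open>\<beta>0 e e' x\<close> is the meeting probability of \<open>e'\<close> itself.\<close>
    also have "\<dots> = (\<Sum>e'\<in>pairs I'. \<beta>0 e e' x)" using e by (simp add: \<beta>0_def meet_def)
    also have "\<dots> \<le> (\<Sum>e'\<in>pairs I - {e}. \<beta>0 e e' x)"
    proof (intro sum_mono2 \<beta>0)
      show "finite (pairs I - {e})" using finite_pairs[OF I(1)] by simp
    qed (auto simp: pairs_def I'_def)
    also have "\<dots> \<le> \<beta> x" unfolding \<beta>_def using e(1)
      by (intro member_le_sum[of e "pairs I" "\<lambda>e. \<Sum>e'\<in>pairs I - {e}. \<beta>0 e e' x"] sum_nonneg \<beta>0) (auto simp: finite_pairs I)
    finally have 2: "M * hit (indep P I') (collision I') s x \<le> M * \<beta> x" using M0 by (rule mult_left_mono)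
    have "U s cost (x ` I') \<ge> expect (steps (indep P I') s x) (\<lambda>z. cost (z ` I')) - M * hit (indep P I') (collision I') s x"
      using x(1) cost_nonneg cost_le unfolding xI'[symmetric] by (intro U_ge_independent I') auto
    with 1 2 have "U s cost (x ` I) \<ge> a - M * \<beta> x" unfolding xI' by linarith
    then show ?thesis using U_cost_le[OF x(1), of s] by linarith
  qed
  have "cbar i \<ge> (\<Sum>u<N * s. expect (eqm I) (surv (indep P I) (collision I) u))
      + a * expect (eqm I) (hit (indep P I) (collision I) (N * s)) - M * expect (eqm I) (payoff (indep P I) (collision I) \<beta> (N * s))" for N
  proof -
    have "cost (x ` I) \<ge> (\<Sum>u<N * s. surv (indep P I) (collision I) u x)
      + a * hit (indep P I) (collision I) (N * s) x - M * payoff (indep P I) (collision I) \<beta> (N * s) x"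
      if "x ` I \<subseteq> V" for x
    proof (rule fk.expected_cost_ge[where X = "{x. x ` I \<subseteq> V}"])
      show "cost (x ` I) = 1 + expect (indep P I x) (\<lambda>x. cost (x ` I))" if "x \<in> {x. x ` I \<subseteq> V} - collision I" for x
      proof -
        have x: "inj_on x I" "x ` I \<subseteq> V" using that by (auto simp: collision_def)
        have "card (x ` I) = i" using x(1) I by (simp add: card_image)
        then show ?thesis using cost_step[OF x(2)] assms(1) expect_indep_image[OF I(1) x] by simp
      qed
      show "set_pmf (indep P I x) \<subseteq> {x. x ` I \<subseteq> V}" for x using indep_range[OF I(1)] by blast
    qed (use that collided cost_nonneg in auto)
    then have "expect (eqm I) (\<lambda>x. cost (x ` I)) \<ge> expect (eqm I) (\<lambda>x. (\<Sum>u<N * s. surv (indep P I) (collision I) u x)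
      + a * hit (indep P I) (collision I) (N * s) x - M * payoff (indep P I) (collision I) \<beta> (N * s) x)"
      using eqm_range[OF I(1)] by (intro expect_mono fin_eqm I) auto
    then show ?thesis
      by (simp add: expect_diff expect_add expect_sum fin_eqm I cbar_eq)
  qed
  moreover have pay: "expect (eqm I) (payoff (indep P I) (collision I) \<beta> (N * s)) \<le> C\<^sup>2 * (meetp s * eta s + i * \<delta>) * (2 + m / s)" for N
  proof -
    have "expect (eqm I) (payoff (indep P I) (collision I) \<beta> (N * s))
      \<le> (expect (eqm I) (payoff (indep P I) (collision I) \<beta> s) + i * \<delta> * C\<^sup>2) * (2 + m / s)"
    proof (rule fk.payoff_blocks)
      show "expect (steps (indep P I) s x) f \<le> expect (eqm I) f + i * \<delta>" if "\<And>y. 0 \<le> f y \<and> f y \<le> 1" for f x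
        using indep_mix[OF I(1) order.refl that] I(2) by simp
    qed (use I s_pos \<delta>_nonneg summable_surv(2)[OF m assms(1)] \<beta>_nonneg \<beta>_le in \<open>auto simp: fin_eqm I_def\<close>)
    also have "expect (eqm I) (payoff (indep P I) (collision I) \<beta> s) \<le> C\<^sup>2 * (meetp s * eta s)"
    proof -
      have "payoff (indep P I) (collision I) \<beta> s x = (\<Sum>e\<in>pairs I. \<Sum>e'\<in>pairs I - {e}. payoff (indep P I) (collision I) (\<beta>0 e e') s x)" for x
        unfolding \<beta>_def by (simp add: fk.payoff_sum finite_pairs I)
      then have "expect (eqm I) (payoff (indep P I) (collision I) \<beta> s)
        = (\<Sum>e\<in>pairs I. \<Sum>e'\<in>pairs I - {e}. expect (eqm I) (payoff (indep P I) (collision I) (\<beta>0 e e') s))"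
        by (simp add: expect_sum fin_eqm I cong: expect_cong)
      also have "\<dots> \<le> (\<Sum>e\<in>pairs I. \<Sum>e'\<in>pairs I - {e}. meetp s * eta s)"
      proof (intro sum_mono)
        fix e e' assume e: "e \<in> pairs I" "e' \<in> pairs I - {e}"
        have "meet (fst e) (snd e) \<subseteq> collision I"
          using e(1) unfolding meet_def collision_iff_pairs subset_eq by (auto intro!: bexI[of _ e] split: prod.splits)
        then have "expect (eqm I) (payoff (indep P I) (collision I) (\<beta>0 e e') s)
          \<le> expect (eqm I) (payoff (indep P I) (meet (fst e) (snd e)) (\<lambda>z. hp s (z (fst e')) (z (snd e'))) s)"
          unfolding \<beta>0_def by (intro expect_mono fin_eqm I fk.payoff_subset hp_bounds)
        also have "\<dots> \<le> meetp s * eta s" using e by (intro expect_two_pairs I) auto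
        finally show "expect (eqm I) (payoff (indep P I) (collision I) (\<beta>0 e e') s) \<le> meetp s * eta s" .
      qed
      also have "\<dots> \<le> (\<Sum>e\<in>pairs I. \<Sum>e'\<in>pairs I. meetp s * eta s)"
        using meetp_nonneg eta_nonneg by (intro sum_mono sum_mono2) (auto simp: finite_pairs I)
      also have "\<dots> = C\<^sup>2 * (meetp s * eta s)" by (simp add: C power2_eq_square)
      finally show ?thesis .
    qed
    finally have "expect (eqm I) (payoff (indep P I) (collision I) \<beta> (N * s))
      \<le> (C\<^sup>2 * (meetp s * eta s) + i * \<delta> * C\<^sup>2) * (2 + m / s)"
      using m0 by (simp add: mult_right_mono)
    then show ?thesis by (simp add: algebra_simps)
  qed
  ultimately have "cbar i \<ge> (\<Sum>u<N * s. expect (eqm I) (surv (indep P I) (collision I) u))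
      + a * expect (eqm I) (hit (indep P I) (collision I) (N * s)) - M * (C\<^sup>2 * (meetp s * eta s + i * \<delta>) * (2 + m / s))" for N
    using mult_left_mono[OF pay M0] by (meson diff_left_mono order.trans)
  moreover have "(\<lambda>N. (\<Sum>u<N * s. expect (eqm I) (surv (indep P I) (collision I) u))
      + a * expect (eqm I) (hit (indep P I) (collision I) (N * s)) - M * (C\<^sup>2 * (meetp s * eta s + i * \<delta>) * (2 + m / s)))
    \<longlonglongrightarrow> ET i + a * 1 - M * (C\<^sup>2 * (meetp s * eta s + i * \<delta>) * (2 + m / s))"
  proof -
    have lim: "filterlim (\<lambda>N. N * s) at_top sequentially"
      using s_pos by (intro filterlim_subseq) (auto simp: strict_mono_def)
    show ?thesis unfolding I_def
      by (intro tendsto_intros filterlim_compose[OF summable_surv(4)[OF m assms(1)] lim]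
        filterlim_compose[OF summable_surv(5)[OF m assms(1)] lim])
  qed
  ultimately have "ET i + a * 1 - M * (C\<^sup>2 * (meetp s * eta s + i * \<delta>) * (2 + m / s)) \<le> cbar i"
    by (intro LIMSEQ_le_const2) auto
  then show ?thesis by (simp add: a_def algebra_simps)
qed

end
end


section \<open>Quantitative estimates in discrete time\<close>

context mixing_walk
begin

lemma card_V_pos: "0 < card V"
  using \<pi>V finV set_pmf_not_empty[of \<pi>] by (auto simp: card_gt_0_iff)

lemma sum_pmf_V: "(\<Sum>x\<in>V. pmf \<pi> x) = 1"
  using \<pi>V finV by (rule sum_pmf_eq_1[rotated])

lemma pm_ge: "1 / real (card V) \<le> pm"
proof -
  have "1 \<le> (\<Sum>x\<in>V. pm)" unfolding sum_pmf_V[symmetric] by (intro sum_mono pm)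
  then show ?thesis using card_V_pos by (simp add: field_simps)
qed

text \<open>Already at time 0 two equilibrium walkers coincide with a probability equal to the sum
  of the squares of \<open>pmf \<pi>\<close>, which is bounded below by expanding squares around
  \<open>1 / n\<close>. This makes mixing errors of size \<open>n ^ (-8)\<close> relatively
  small.\<close>

lemma meetp_ge: "1 / real (card V) \<le> meetp t"
proof -
  define n where "n = real (card V)"
  have n: "0 < n" using card_V_pos by (simp add: n_def)
  have "hp 0 x = (\<lambda>y. if x = y then 1 else 0)" for x by (rule ext) simp
  then have "meetp 0 = expect \<pi> (pmf \<pi>)" unfolding meetp_def by (simp add: expect_indicator_eq)
  also have "\<dots> = (\<Sum>x\<in>V. pmf \<pi> x * pmf \<pi> x)" using \<pi>V finV by (intro expect_sum_set) auto
  also have "\<dots> \<ge> (\<Sum>x\<in>V. 2 / n * pmf \<pi> x - 1 / n\<^sup>2)"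
  proof (rule sum_mono)
    fix x
    have "(pmf \<pi> x - 1 / n)\<^sup>2 = pmf \<pi> x * pmf \<pi> x - (2 / n * pmf \<pi> x - 1 / n\<^sup>2)"
      by (simp add: power2_eq_square algebra_simps)
    then show "2 / n * pmf \<pi> x - 1 / n\<^sup>2 \<le> pmf \<pi> x * pmf \<pi> x"
      using zero_le_power2[of "pmf \<pi> x - 1 / n"] by linarith
  qed
  also have "(\<Sum>x\<in>V. 2 / n * pmf \<pi> x - 1 / n\<^sup>2) = 2 / n * (\<Sum>x\<in>V. pmf \<pi> x) - n * (1 / n\<^sup>2)"
    by (simp add: sum_subtractf sum_distrib_left n_def)
  also have "\<dots> = 1 / n" using n by (simp add: sum_pmf_V power2_eq_square field_simps)
  finally show ?thesis using meetp_mono[of 0 t] by (simp add: n_def)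
qed

lemma expect_surv_pair:
  "expect (eqm {..<2}) (surv (indep P {..<2}) (collision {..<2}) t) = 1 - meetp t"
proof -
  interpret fk: finite_kernel "indep P {..<2}" by (rule finite_kernel_indep) simp
  have c: "collision {..<2} = meet 0 1"
  proof -
    have "{..<2::nat} = {0, 1}" by auto
    then show ?thesis by (auto simp: collision_def meet_def)
  qed
  have "surv (indep P {..<2}) (collision {..<2}) t = (\<lambda>x. 1 - hp t (x 0) (x 1))"
  proof
    fix x show "surv (indep P {..<2}) (collision {..<2}) t x = 1 - hp t (x 0) (x 1)"
      using fk.hit_add_surv[of "meet 0 1" t x] hit_meet[of "{..<2}" 0 1 t x] by (simp add: c)
  qed
  then show ?thesis using expect_eqm_hp[of "{..<2}" 0 1 t] by (simp add: expect_diff fin_eqm)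
qed

lemma surv_block_collision:
  assumes "finite I" "s \<le> \<sigma>"
  shows "surv (indep P I) (collision I) (\<sigma> + \<tau>) x
    \<le> 1 - (expect (eqm I) (hit (indep P I) (collision I) \<tau>) - real (card I) * \<delta>)"
proof -
  interpret fk: finite_kernel "indep P I" by (rule finite_kernel_indep[OF assms(1)])
  show ?thesis by (intro fk.surv_block indep_mix assms fin_eqm) auto
qed

definition m :: real where "m = (\<Sum>t. 1 - meetp t)"

text \<open>From any two positions, \<open>s\<close> steps of mixing and \<open>\<tau>\<close>
  further steps lead to a meeting with probability at least
  \<open>meetp \<tau> - 2 * \<delta>\<close>, one \<open>\<delta>\<close> for each walker; the
  number of such blocks is therefore dominated by a geometric variable.\<close>

lemma mean_meeting_bounds:
  assumes "2 * \<delta> < meetp \<tau>"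
  shows "summable (\<lambda>t. 1 - meetp t)" "m * (meetp \<tau> - 2 * \<delta>) \<le> s + \<tau>"
proof -
  interpret fk: finite_kernel "indep P {..<2}" by (rule finite_kernel_indep) simp
  define \<rho> where "\<rho> = 1 - (meetp \<tau> - 2 * \<delta>)"
  have hit: "expect (eqm {..<2}) (hit (indep P {..<2}) (collision {..<2}) \<tau>) = meetp \<tau>"
  proof -
    have "hit (indep P {..<2}) (collision {..<2}) \<tau> = (\<lambda>x. 1 - surv (indep P {..<2}) (collision {..<2}) \<tau> x)"
      using fk.hit_add_surv[of "collision {..<2}" \<tau>] by (auto simp: fun_eq_iff algebra_simps)
    then show ?thesis using expect_surv_pair[of \<tau>] by (simp add: expect_diff fin_eqm)
  qed
  have block: "surv (indep P {..<2}) (collision {..<2}) (s + \<tau>) x \<le> \<rho>" for x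
    using surv_block_collision[of "{..<2}" s \<tau> x] by (simp add: hit \<rho>_def)
  have \<rho>: "0 \<le> \<rho>" "\<rho> < 1" using order.trans[OF fk.surv_nonneg block] assms by (auto simp: \<rho>_def)
  have *: "1 - meetp (j * (s + \<tau>)) \<le> 1 * \<rho> ^ j" for j
    unfolding expect_surv_pair[symmetric] mult_1 by (intro expect_le fin_eqm fk.surv_geometric block \<rho>) auto
  have anti: "antimono (\<lambda>t. 1 - meetp t)" by (intro antimonoI) (simp add: meetp_mono)
  have nn: "0 \<le> 1 - meetp t" for t
    unfolding expect_surv_pair[symmetric] by (intro expect_ge fin_eqm fk.surv_nonneg) auto
  have s\<tau>: "0 < s + \<tau>" using s_pos by simp
  show "summable (\<lambda>t. 1 - meetp t)"
    by (rule antimono_block_sum(1)[OF anti nn * \<rho> s\<tau>]) simp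
  have "m \<le> real (s + \<tau>) * 1 / (1 - \<rho>)" unfolding m_def
    by (rule antimono_block_sum(2)[OF anti nn * \<rho> s\<tau>]) simp
  moreover have "0 < 1 - \<rho>" using \<rho> by simp
  ultimately have "m * (1 - \<rho>) \<le> real (s + \<tau>)" by (simp add: pos_le_divide_eq)
  then show "m * (meetp \<tau> - 2 * \<delta>) \<le> s + \<tau>" by (simp add: \<rho>_def)
qed

lemma ET_2: "ET 2 = m"
  unfolding ET_def m_def expect_surv_pair ..

end

text \<open>A block of length \<open>b = s + \<tau>\<close> leaves time \<open>s\<close> to mix, up to an error \<open>\<delta>\<close>, and time
  \<open>\<tau> = L s\<close> to meet. Up to \<open>2 g\<close> walkers are compared with a death chain; for more than that
  the expected number of walkers decays fast enough.\<close>

locale mf_walk = mixing_walk +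
  fixes \<epsilon> :: real and L g k :: nat and n :: real
  assumes n_def: "n = real (card V)"
    and eps: "0 < \<epsilon>" "\<epsilon> \<le> 1/100" and ln_n: "1 \<le> ln n"
    and small: "eta s * ln n ^ 3 \<le> 30 * \<epsilon> ^ 6" and \<delta>_le: "\<delta> * n ^ 8 \<le> 1"
    and L: "1 / \<epsilon> \<le> L" "L \<le> 2 / \<epsilon>" and g: "ln n / \<epsilon> \<le> g" "g \<le> 2 * ln n / \<epsilon>"
    and k: "1 / \<epsilon> \<le> k" "k \<le> 2 / \<epsilon>"
begin

abbreviation \<tau> :: nat where "\<tau> \<equiv> L * s"
abbreviation b :: nat where "b \<equiv> s + L * s"
text \<open>The mixing error in relative terms: \<open>2 * \<delta>\<close> is at most
  \<open>2 / n ^ 8\<close>, and a meeting probability is at least \<open>1 / n\<close>.\<close>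

definition \<kappa> :: real where "\<kappa> = 2 / n ^ 7"

lemma n_pos: "0 < n" using card_V_pos by (simp add: n_def)

lemma inv_n_le: "1 / n \<le> 30 * \<epsilon> ^ 6"
proof -
  have "1 / n \<le> eta s"
  proof -
    have "pm \<le> eta s" using pm_nonneg q_nonneg by (simp add: eta_def algebra_simps)
    then show ?thesis using pm_ge by (simp add: n_def)
  qed
  also have "eta s * 1 \<le> eta s * ln n ^ 3" using ln_n eta_nonneg by (intro mult_left_mono one_le_power) auto
  finally show ?thesis using small by simp
qed

lemma inv_n_le_eta: "1 / n \<le> eta s"
proof -
  have "pm \<le> eta s" using pm_nonneg q_nonneg by (simp add: eta_def algebra_simps)
  then show ?thesis using pm_ge by (simp add: n_def)
qed

lemma n_ge: "n \<ge> 2 / \<epsilon>" "n \<ge> 1000"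
proof -
  have e: "\<epsilon> ^ 6 \<le> \<epsilon> / 100 ^ 5"
    using power_mono[of \<epsilon> "1/100" 5] eps mult_left_mono[of "\<epsilon> ^ 5" "(1/100) ^ 5" \<epsilon>]
    by (simp add: power_divide flip: power_Suc)
  have "1 / n \<le> \<epsilon> / 2" using inv_n_le e eps by simp
  then show "n \<ge> 2 / \<epsilon>" using n_pos eps by (simp add: field_simps)
  have "1 / n \<le> 1 / 1000" using inv_n_le e eps by simp
  then show "n \<ge> 1000" using n_pos by (simp add: field_simps)
qed

lemma \<kappa>: "0 < \<kappa>" "\<kappa> \<le> \<epsilon> / 100" "2 * \<delta> \<le> \<kappa> * meetp t"
proof -
  show "0 < \<kappa>" using n_pos by (simp add: \<kappa>_def)
  have "\<kappa> \<le> 2 / n"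
    unfolding \<kappa>_def using n_ge power_increasing[of 1 7 n] by (intro divide_left_mono) auto
  also have "\<dots> \<le> 60 * \<epsilon> ^ 6" using inv_n_le by simp
  also have "\<epsilon> ^ 6 \<le> \<epsilon> * (1/100) ^ 5"
    using power_mono[of \<epsilon> "1/100" 5] eps mult_left_mono[of "\<epsilon> ^ 5" "(1/100) ^ 5" \<epsilon>] by (simp flip: power_Suc)
  finally show "\<kappa> \<le> \<epsilon> / 100" using eps by (simp add: power_divide)
  have "\<delta> \<le> 1 / n ^ 8" using \<delta>_le n_pos by (simp add: field_simps)
  then have "2 * \<delta> \<le> \<kappa> * (1 / n)" by (simp add: \<kappa>_def power_Suc[symmetric] eval_nat_numeral mult_ac)
  also have "\<dots> \<le> \<kappa> * meetp t" using meetp_ge[of t] \<open>0 < \<kappa>\<close> by (intro mult_left_mono) (auto simp: n_def)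
  finally show "2 * \<delta> \<le> \<kappa> * meetp t" .
qed

lemma \<kappa>_small: "\<kappa> \<le> 1/10000" using \<kappa>(2) eps by simp

lemma meetp_pos: "0 < meetp t"
proof -
  have "0 < 1 / real (card V)" using n_pos by (simp add: n_def)
  then show ?thesis using meetp_ge[of t] by linarith
qed

lemma two_\<delta>_less: "2 * \<delta> < meetp t"
proof -
  have "\<kappa> * meetp t < 1 * meetp t" using \<kappa>_small meetp_pos[of t] by (intro mult_strict_right_mono) auto
  then show ?thesis using \<kappa>(3)[of t] by linarith
qed

lemma summable_meetp: "summable (\<lambda>t. 1 - meetp t)" by (rule mean_meeting_bounds(1)[OF two_\<delta>_less[of 0]])

lemma L_pos: "0 < L" using L eps by (metis divide_pos_pos less_le_trans of_nat_0_less_iff zero_less_one)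

text \<open>Lengthening the time by the factor \<open>L >= 1\<close> multiplies \<open>eta\<close>
  by at most \<open>L\<close>; this spends one of the six powers of
  \<open>\<epsilon>\<close>.\<close>

lemma eta_\<tau>: "eta \<tau> \<le> 2 / \<epsilon> * eta s" "eta \<tau> * ln n ^ 3 \<le> 60 * \<epsilon> ^ 5" "eta \<tau> \<le> 60 * \<epsilon> ^ 5"
proof -
  have "eta \<tau> = pm * (1 + L * (2 * q * s))" by (simp add: eta_def)
  also have "\<dots> \<le> pm * (L * 1 + L * (2 * q * s))" using L_pos pm_nonneg by (intro mult_left_mono add_right_mono) auto
  also have "\<dots> = L * eta s" by (simp add: eta_def algebra_simps)
  also have "\<dots> \<le> 2 / \<epsilon> * eta s" using L eta_nonneg by (intro mult_right_mono) auto
  finally show 1: "eta \<tau> \<le> 2 / \<epsilon> * eta s" .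
  have "eta \<tau> * ln n ^ 3 \<le> 2 / \<epsilon> * eta s * ln n ^ 3" using 1 ln_n by (intro mult_right_mono) auto
  also have "\<dots> \<le> 2 / \<epsilon> * (30 * \<epsilon> ^ 6)" using small eps by (simp add: mult.assoc mult_left_mono divide_right_mono)
  also have "\<dots> = 60 * \<epsilon> ^ 5" using eps by (simp add: eval_nat_numeral)
  finally show 2: "eta \<tau> * ln n ^ 3 \<le> 60 * \<epsilon> ^ 5" .
  have "eta \<tau> * 1 \<le> eta \<tau> * ln n ^ 3" using ln_n eta_nonneg by (intro mult_left_mono one_le_power) auto
  then show "eta \<tau> \<le> 60 * \<epsilon> ^ 5" using 2 by simp
qed

lemma eps4: "\<epsilon> ^ 4 \<le> 1 / 10 ^ 8" "\<epsilon> ^ 5 \<le> \<epsilon> / 10 ^ 8" "\<epsilon> ^ 3 \<le> \<epsilon> / 10 ^ 4"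
proof -
  show 4: "\<epsilon> ^ 4 \<le> 1 / 10 ^ 8" using power_mono[of \<epsilon> "1/100" 4] eps by (simp add: power_divide)
  have "\<epsilon> * \<epsilon> ^ 4 \<le> \<epsilon> * (1 / 10 ^ 8)" using 4 eps by (intro mult_left_mono) auto
  then show "\<epsilon> ^ 5 \<le> \<epsilon> / 10 ^ 8" by (simp add: eval_nat_numeral)
  have "\<epsilon> * \<epsilon> ^ 2 \<le> \<epsilon> * (1 / 100) ^ 2" using eps by (intro mult_left_mono power_mono) auto
  then show "\<epsilon> ^ 3 \<le> \<epsilon> / 10 ^ 4" by (simp add: eval_nat_numeral)
qed

lemma eta_\<tau>_small: "eta \<tau> \<le> \<epsilon> / 10 ^ 6"
  using eta_\<tau>(3) eps4 eps by simp

lemma \<tau>_pos: "0 < \<tau>" "s \<le> \<tau>" using L_pos s_pos by auto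

text \<open>The case of two walkers in \<open>ET_lower\<close>, where \<open>ET 2\<close> is
  \<open>m\<close> itself. Together with \<open>m_le\<close> it shows that two equilibrium walkers
  meet at a rate close to \<open>1 / m\<close>; as that rate is at most
  \<open>eta \<tau> / \<tau>\<close>, a block is short compared with \<open>m\<close>.\<close>

lemma m_ge: "1 - \<kappa> - 2 * eta \<tau> \<le> meetp \<tau> * m / \<tau>" "\<tau> \<le> 2 * eta \<tau> * m" "0 < m"
proof -
  define p where "p = meetp \<tau>"
  have p: "0 < p" "p \<le> eta \<tau>" using meetp_pos meetp_le_eta by (auto simp: p_def)
  have bound: "(\<Sum>t<N. 1 - meetp t) \<le> m" for N
    unfolding m_def using meetp_le_eta hp_bounds
    by (intro sum_le_suminf summable_meetp) (auto simp: meetp_def intro!: expect_le fin\<pi>)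
  have mm: "0 \<le> m" using bound[of 0] by simp
  have "1 \<le> (real (2 choose 2) * meetp \<tau> + real 2 * \<delta>) * (2 + ET 2 / \<tau>)"
    by (rule ET_lower[OF bound]) (use \<tau>_pos in auto)
  then have "1 \<le> (p + 2 * \<delta>) * (2 + m / \<tau>)" by (simp add: ET_2 p_def)
  also have "\<dots> \<le> (p * (1 + \<kappa>)) * (2 + m / \<tau>)"
    using \<kappa>(3)[of \<tau>] mm by (intro mult_right_mono) (auto simp: p_def algebra_simps)
  finally have 1: "1 \<le> (1 + \<kappa>) * (2 * p + p * m / \<tau>)" by (simp add: algebra_simps)
  \<comment> \<open>Multiplying by \<open>1 - \<kappa>\<close> removes the factor
    \<open>1 + \<kappa>\<close>, because their product is at most 1.\<close>
  have "(1 - \<kappa>) * 1 \<le> (1 - \<kappa>) * ((1 + \<kappa>) * (2 * p + p * m / \<tau>))"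
    using 1 \<kappa>_small by (intro mult_left_mono) auto
  also have "\<dots> = (1 - \<kappa>\<^sup>2) * (2 * p + p * m / \<tau>)" by (simp add: power2_eq_square algebra_simps)
  also have "\<dots> \<le> 1 * (2 * p + p * m / \<tau>)" using p mm by (intro mult_right_mono) auto
  finally have "1 - \<kappa> - 2 * p \<le> p * m / \<tau>" by simp
  then show 2: "1 - \<kappa> - 2 * eta \<tau> \<le> meetp \<tau> * m / \<tau>" using p by (simp add: p_def)
  have "1 / 2 \<le> 1 - \<kappa> - 2 * eta \<tau>" using \<kappa>_small eta_\<tau>_small eps by simp
  also note 2
  also have "meetp \<tau> * m / \<tau> \<le> eta \<tau> * m / \<tau>"
    using p mm by (intro divide_right_mono mult_right_mono) (auto simp: p_def)
  finally show "\<tau> \<le> 2 * eta \<tau> * m" using \<tau>_pos by (simp add: field_simps)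
  then have "0 < 2 * eta \<tau> * m" using \<tau>_pos by (meson less_le_trans of_nat_0_less_iff)
  then show "0 < m" using mm eta_nonneg[of \<tau>] by (auto simp: zero_less_mult_iff)
qed

lemma m_le: "m * meetp t * (1 - \<kappa>) \<le> s + t"
proof -
  have "m * meetp t * (1 - \<kappa>) = m * (meetp t - \<kappa> * meetp t)" by (simp add: algebra_simps)
  also have "\<dots> \<le> m * (meetp t - 2 * \<delta>)" using \<kappa>(3)[of t] m_ge(3) by (intro mult_left_mono) auto
  also have "\<dots> \<le> s + t" by (rule mean_meeting_bounds(2)[OF two_\<delta>_less])
  finally show ?thesis .
qed

text \<open>\<open>L >= 1 / \<epsilon>\<close> makes the mixing part at most the fraction
  \<open>\<epsilon>\<close> of a block.\<close>

lemma \<tau>_ge_b: "real \<tau> \<ge> (1 - \<epsilon>) * b"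
proof -
  have "1 \<le> \<epsilon> * L" using L eps by (simp add: field_simps)
  then have "1 * real s \<le> (\<epsilon> * L) * s" by (intro mult_right_mono) auto
  moreover have "real s * (1 - \<epsilon>) \<le> real s * 1" using eps by (intro mult_left_mono) auto
  ultimately have "s * (1 - \<epsilon>) \<le> \<epsilon> * \<tau>" by (simp add: mult.assoc)
  then show ?thesis by (simp add: algebra_simps)
qed

definition C :: "nat \<Rightarrow> real" where "C i = real (i choose 2)"

lemma C_eq: "C i = real i * (real i - 1) / 2"
proof (induction i)
  case (Suc i)
  then show ?case by (simp add: C_def numeral_2_eq_2) (simp add: field_simps)
qed (simp add: C_def)

lemma C_ge: "2 \<le> i \<Longrightarrow> 1 \<le> C i" "2 \<le> i \<Longrightarrow> real i / 2 \<le> C i" "2 \<le> i \<Longrightarrow> (real i)\<^sup>2 / 4 \<le> C i"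
proof -
  assume i: "2 \<le> i"
  show 2: "real i / 2 \<le> C i" unfolding C_eq using mult_left_mono[of 1 "real i - 1" "real i"] i by simp
  then show "1 \<le> C i" using i by simp
  show "(real i)\<^sup>2 / 4 \<le> C i" unfolding C_eq power2_eq_square
    using mult_left_mono[of "real i / 2" "real i - 1" "real i"] i by simp
qed

lemma C_le: "C i \<le> (real i)\<^sup>2 / 2"
  unfolding C_eq power2_eq_square by (simp add: algebra_simps)

lemma g_pos: "2 \<le> g"
proof -
  have "100 \<le> ln n / \<epsilon>" using ln_n eps by (simp add: field_simps)
  then show ?thesis using g by linarith
qed

text \<open>Measures second meetings relative to the first one. For \<open>i\<close> up to
  \<open>2 * g\<close> there are at most \<open>8 * (ln n) ^ 2 / \<epsilon> ^ 2\<close> pairs, which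
  the bound \<open>60 * \<epsilon> ^ 5\<close> on \<open>eta \<tau> * ln n ^ 3\<close> outweighs.
  This permits the death chain to start from as many as \<open>2 * g\<close> walkers.\<close>

lemma C_eta: assumes "i \<le> 2 * g" shows "C i * eta \<tau> \<le> \<epsilon> / 10"
proof -
  have "real i \<le> 4 * ln n / \<epsilon>" using assms g by linarith
  then have "(real i)\<^sup>2 \<le> (4 * ln n / \<epsilon>)\<^sup>2" by (intro power_mono) auto
  then have "C i \<le> 8 * (ln n)\<^sup>2 / \<epsilon>\<^sup>2" using C_le[of i] by (simp add: power_divide power_mult_distrib)
  then have "C i * eta \<tau> \<le> 8 * (ln n)\<^sup>2 / \<epsilon>\<^sup>2 * eta \<tau>" using eta_nonneg by (intro mult_right_mono) auto
  also have "\<dots> = 8 / \<epsilon>\<^sup>2 * (eta \<tau> * (ln n)\<^sup>2)" by simp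
  also have "\<dots> \<le> 8 / \<epsilon>\<^sup>2 * (60 * \<epsilon> ^ 5)"
  proof (rule mult_left_mono)
    have "eta \<tau> * (ln n)\<^sup>2 \<le> eta \<tau> * ln n ^ 3" using ln_n eta_nonneg by (intro mult_left_mono power_increasing) auto
    then show "eta \<tau> * (ln n)\<^sup>2 \<le> 60 * \<epsilon> ^ 5" using eta_\<tau>(2) by linarith
  qed simp
  also have "\<dots> = 480 * \<epsilon> ^ 3" using eps by (simp add: eval_nat_numeral field_simps)
  also have "\<dots> \<le> \<epsilon> / 10" using eps4 eps by simp
  finally show ?thesis .
qed

text \<open>\<open>r\<close> is the length of a block in units of the mean meeting time, reduced by
  a factor that absorbs the errors made in one block. An upper bound is assumed instead of an
  equation because \<open>m\<close> depends on the mesh, while a single \<open>r\<close> has to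
  serve all fine meshes.\<close>

context
  fixes r :: real
  assumes r: "0 < r" "r \<le> (1 - 2 * \<epsilon>) * b / m"
begin

lemma r_le: "r \<le> 4 * eta \<tau>" "i \<le> 2 * g \<Longrightarrow> r * C i \<le> 1" "r \<le> 1"
proof -
  have "real b \<le> 2 * real \<tau>" using \<tau>_pos(2) unfolding of_nat_add by linarith
  also have "\<dots> \<le> 4 * eta \<tau> * m" using m_ge(2) by linarith
  finally have "real b / m \<le> 4 * eta \<tau>" using m_ge(3) by (simp add: field_simps)
  moreover have "(1 - 2 * \<epsilon>) * b / m \<le> 1 * (real b / m)"
    using eps m_ge(3) unfolding times_divide_eq_right[symmetric] by (intro mult_right_mono) auto
  ultimately show 1: "r \<le> 4 * eta \<tau>" using r(2) by linarith
  then show "r \<le> 1" using eta_\<tau>_small eps by simp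
  assume "i \<le> 2 * g"
  have "r * C i \<le> 4 * eta \<tau> * C i" using 1 by (intro mult_right_mono) (auto simp: C_def)
  also have "\<dots> \<le> 1" using C_eta[OF \<open>i \<le> 2 * g\<close>] eps by (simp add: mult_ac)
  finally show "r * C i \<le> 1" .
qed

text \<open>After \<open>s\<close> steps of mixing, the collision bound from equilibrium applies to
  the other \<open>\<tau>\<close>. The relative losses are \<open>\<epsilon>\<close> for the mixing
  time, \<open>\<epsilon> / 10\<close> for second meetings, \<open>\<kappa>\<close> for the distance
  from equilibrium, and \<open>\<kappa> + 2 * eta \<tau>\<close> for replacing
  \<open>meetp \<tau>\<close> by \<open>\<tau> / m\<close>; the factor
  \<open>1 - 2 * \<epsilon>\<close> in \<open>r\<close> covers them all.\<close>

lemma block_loss: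
  assumes G: "G \<subseteq> V" "2 \<le> card G" "card G \<le> 2 * g"
  shows "r * C (card G) \<le> U b (fewer (card G)) G"
proof -
  define i where "i = card G"
  have i: "2 \<le> i" "i \<le> 2 * g" using G by (auto simp: i_def)
  have fG: "finite G" using finite_sub G by blast
  interpret fk: finite_kernel "indep P G" by (rule finite_kernel_indep[OF fG])
  define p where "p = meetp \<tau>"
  have p: "0 < p" using meetp_pos by (simp add: p_def)
  have "U b (fewer i) (id ` G) \<ge> hit (indep P G) (collision G) b id"
    unfolding i_def using G by (intro U_fewer_ge_hit fG) auto
  then have "U b (fewer i) G \<ge> 1 - surv (indep P G) (collision G) b id"
    using fk.hit_add_surv[of "collision G" b id] by simp
  also have "1 - surv (indep P G) (collision G) b id \<ge> expect (eqm G) (hit (indep P G) (collision G) \<tau>) - i * \<delta>"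
    using surv_block_collision[OF fG order.refl, of \<tau> id] by (simp add: i_def)
  finally have "U b (fewer i) G \<ge> C i * p - C i * (C i - 1) * p * eta \<tau> - i * \<delta>"
    using expect_hit_collision_ge[OF fG, of \<tau>] by (simp add: i_def C_def p_def)
  moreover have "i * \<delta> \<le> C i * (\<kappa> * p)"
  proof -
    have "i * \<delta> = (real i / 2) * (2 * \<delta>)" by simp
    also have "\<dots> \<le> C i * (\<kappa> * p)"
    proof (rule mult_mono)
      show "2 * \<delta> \<le> \<kappa> * p" using \<kappa>(3)[of \<tau>] by (simp add: p_def)
    qed (use C_ge(2)[OF i(1)] \<delta>_nonneg in \<open>auto simp: C_def\<close>)
    finally show ?thesis .
  qed
  moreover have "C i * (C i - 1) * p * eta \<tau> \<le> C i * p * (\<epsilon> / 10)"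
  proof -
    have "(C i - 1) * eta \<tau> \<le> C i * eta \<tau>" using eta_nonneg by (intro mult_right_mono) auto
    then have "(C i - 1) * eta \<tau> \<le> \<epsilon> / 10" using C_eta[OF i(2)] by linarith
    then have "(C i * p) * ((C i - 1) * eta \<tau>) \<le> (C i * p) * (\<epsilon> / 10)"
      using p by (intro mult_left_mono) (auto simp: C_def)
    then show ?thesis by (simp add: mult_ac)
  qed
  ultimately have 1: "U b (fewer i) G \<ge> C i * p * (1 - \<epsilon> / 10 - \<kappa>)" by (simp add: algebra_simps)
  have "r * C i \<le> C i * p * (1 - \<epsilon> / 10 - \<kappa>)"
  proof -
    have pb: "(1 - \<kappa> - 2 * eta \<tau>) * (\<tau> / m) \<le> p"
      using m_ge(1,3) \<tau>_pos by (simp add: p_def field_simps)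
    have "(1 - \<kappa> - 2 * eta \<tau>) * ((1 - \<epsilon>) * b / m) \<le> (1 - \<kappa> - 2 * eta \<tau>) * (\<tau> / m)"
      using \<tau>_ge_b m_ge(3) \<kappa>_small eta_\<tau>_small eps by (intro mult_left_mono divide_right_mono) auto
    with pb have "(1 - \<kappa> - 2 * eta \<tau>) * ((1 - \<epsilon>) * b / m) \<le> p" by linarith
    then have "(1 - \<kappa> - 2 * eta \<tau>) * ((1 - \<epsilon>) * b / m) * (1 - \<epsilon> / 10 - \<kappa>) \<le> p * (1 - \<epsilon> / 10 - \<kappa>)"
      using \<kappa>_small eps by (intro mult_right_mono) auto
    moreover have "(1 - 2 * \<epsilon>) * b / m \<le> (1 - \<kappa> - 2 * eta \<tau>) * ((1 - \<epsilon>) * b / m) * (1 - \<epsilon> / 10 - \<kappa>)"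
    proof -
      have e: "1 - \<epsilon> / 5 \<le> 1 - \<kappa> - 2 * eta \<tau>" "1 - \<epsilon> / 5 \<le> 1 - \<epsilon> / 10 - \<kappa>"
        using \<kappa>(2) eta_\<tau>_small eps by auto
      have "1 - 2 * \<epsilon> \<le> (1 - \<epsilon> / 5) * (1 - \<epsilon>) * (1 - \<epsilon> / 5)"
      proof -
        have "(1 - \<epsilon> / 5) * (1 - \<epsilon>) * (1 - \<epsilon> / 5) - (1 - 2 * \<epsilon>)
          = \<epsilon> * (3 / 5 + 11/25 * \<epsilon> - \<epsilon>\<^sup>2 / 25)" by (simp add: field_simps power2_eq_square)
        moreover have "\<epsilon>\<^sup>2 \<le> 1" using eps by (simp add: power_le_one)
        then have "0 \<le> \<epsilon> * (3 / 5 + 11/25 * \<epsilon> - \<epsilon>\<^sup>2 / 25)" using eps by (intro mult_nonneg_nonneg) auto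
        ultimately show ?thesis by linarith
      qed
      also have "\<dots> \<le> (1 - \<kappa> - 2 * eta \<tau>) * (1 - \<epsilon>) * (1 - \<epsilon> / 10 - \<kappa>)"
        using e eps by (intro mult_mono mult_nonneg_nonneg) auto
      finally have "(1 - 2 * \<epsilon>) * (b / m) \<le> (1 - \<kappa> - 2 * eta \<tau>) * (1 - \<epsilon>) * (1 - \<epsilon> / 10 - \<kappa>) * (b / m)"
        using m_ge(3) by (intro mult_right_mono) auto
      then show ?thesis by (simp add: mult_ac)
    qed
    ultimately have "r \<le> p * (1 - \<epsilon> / 10 - \<kappa>)" using r by linarith
    then have "C i * r \<le> C i * (p * (1 - \<epsilon> / 10 - \<kappa>))" by (intro mult_left_mono) (auto simp: C_def)
    then show ?thesis by (simp add: mult_ac)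
  qed
  with 1 show ?thesis by (simp add: i_def)
qed

lemma v_geometric: "A \<subseteq> V \<Longrightarrow> v (j * b) A \<le> n * (1 - r) ^ j"
  unfolding n_def
proof (rule v_le_geometric)
  fix G assume "G \<subseteq> V" "card G = 2"
  then show "r \<le> U b (fewer 2) G" using block_loss[of G] g_pos by (simp add: C_def)
qed (use r r_le in auto)

text \<open>There are at least \<open>card A / (2 * g)\<close> disjoint groups of size
  \<open>g\<close>, each losing on average \<open>r * C g\<close>, hence at least
  \<open>r * g ^ 2 / 4\<close>, walkers; the product is \<open>r * g / 8\<close> times
  \<open>card A\<close>.\<close>

lemma num_decay:
  assumes A: "A \<subseteq> V" "2 * g \<le> card A"
  shows "num b A \<le> (1 - r * g / 8) * real (card A)"
proof -
  define l where "l = card A div g"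
  have lg: "l * g \<le> card A" by (simp add: l_def)
  have "card A < Suc l * g" using g_pos by (simp add: l_def dividend_less_div_times)
  then have h: "real (card A) < real ((l + 1) * g)" by (metis Suc_eq_plus1 of_nat_less_iff)
  have "2 * g < Suc l * g" using assms \<open>card A < Suc l * g\<close> by linarith
  then have "1 \<le> l" by simp
  then have "(l + 1) * g \<le> 2 * l * g" by (intro mult_right_mono) auto
  then have "real ((l + 1) * g) \<le> real (2 * l * g)" by (rule of_nat_mono)
  with h have "real (card A) \<le> real (2 * l * g)" by linarith
  then have l: "real (card A) \<le> 2 * l * g" by simp
  have "num b A \<le> real (card A) - real l * (r * C g)"
  proof (rule num_le_groups[OF _ A(1) lg])
    fix G assume "G \<subseteq> V" "card G = g"
    then show "r * C g \<le> U b (fewer g) G" using block_loss[of G] g_pos by simp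
  qed
  moreover have "real l * (r * C g) \<ge> r * g / 8 * card A"
  proof -
    have "r * g / 8 * card A \<le> r * g / 8 * (2 * l * g)" using l r by (intro mult_left_mono) auto
    also have "\<dots> = l * (r * ((real g)\<^sup>2 / 4))" by (simp add: power2_eq_square)
    also have "\<dots> \<le> l * (r * C g)" using C_ge(3)[OF g_pos] r by (intro mult_left_mono) auto
    finally show ?thesis .
  qed
  ultimately show ?thesis by (simp add: algebra_simps)
qed

text \<open>\<open>J\<close> blocks thin out the crowd: its expected size falls from
  \<open>n\<close> to at most \<open>n ^ (-2)\<close>, where 24 is the 8 of \<open>num_decay\<close>
  times 3 powers of \<open>n\<close>. If it is still there, the crude bound
  \<open>v_geometric\<close> with its factor \<open>n\<close> suffices; otherwise the death chain
  takes over from \<open>2 * g\<close> walkers.\<close>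

theorem v_upper:
  assumes J: "24 * ln n / g \<le> J * r"
  shows "v ((J + j) * b) V \<le> (1 - r) ^ j / n + death r j (2 * g)"
proof -
  define K where "K = 2 * g"
  define \<rho> where "\<rho> = 1 - r * g / 8"
  define crowd where "crowd B = (if K \<le> card B then real (card B) else 0)" for B :: "nat set"
  have K: "2 \<le> K" using g_pos by (simp add: K_def)
  have r1: "r * real (i choose 2) \<le> 1" if "i \<le> K" for i using r_le(2)[of i] that by (simp add: C_def K_def)
  have \<rho>0: "0 \<le> \<rho>"
  proof -
    have "real g \<le> 2 * C g" using C_ge(2)[OF g_pos] by simp
    then have "r * g \<le> r * (2 * C g)" using r by (intro mult_left_mono) auto
    also have "\<dots> \<le> 2" using r_le(2)[of g] by simp
    finally show ?thesis by (simp add: \<rho>_def)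
  qed
  have "\<rho> ^ J \<le> exp (- (r * g / 8)) ^ J" using \<rho>0 exp_ge_add_one_self[of "- (r * g / 8)"] by (intro power_mono) (auto simp: \<rho>_def)
  also have "\<dots> = exp (- (J * r * g / 8))" by (simp add: mult.assoc flip: exp_of_nat_mult)
  also have "\<dots> \<le> exp (- (3 * ln n))"
    using J g_pos by (simp add: field_simps)
  also have "\<dots> = 1 / n ^ 3" using n_pos exp_of_nat_mult[of 3 "ln n"] by (simp add: exp_minus inverse_eq_divide)
  finally have \<rho>J: "\<rho> ^ J \<le> 1 / n ^ 3" .
  have "v ((J + j) * b) V = U (J * b) (v (j * b)) V"
    by (simp only: add_mult_distrib kc.expect_steps_add)
  also have "\<dots> \<le> U (J * b) (\<lambda>B. n * (1 - r) ^ j * crowd B + death r j K) V"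
  proof (rule U_mono_fun[OF _ order.refl])
    fix B assume B: "B \<subseteq> V"
    have d0: "0 \<le> death r j K" using r r1 by (intro death_nonneg[of r K]) auto
    show "v (j * b) B \<le> n * (1 - r) ^ j * crowd B + death r j K"
    proof (cases "K \<le> card B")
      case True
      have "v (j * b) B \<le> n * (1 - r) ^ j * 1" using v_geometric[OF B] by simp
      also have "\<dots> \<le> n * (1 - r) ^ j * crowd B" using True K n_pos r_le by (intro mult_left_mono) (auto simp: crowd_def)
      finally show ?thesis using d0 by simp
    next
      case False
      have "v (j * b) B \<le> death r j (card B)"
      proof (rule v_le_death[OF _ r1])
        show "r * real (card G choose 2) \<le> U b (fewer (card G)) G" if "G \<subseteq> V" "2 \<le> card G" "card G \<le> K" for G
          using block_loss[OF that(1,2)] that(3) by (simp add: C_def K_def)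
      qed (use r B False in auto)
      also have "\<dots> \<le> death r j K" using r r1 False by (intro death_mono_le[of r K]) auto
      finally show ?thesis using False by (simp add: crowd_def)
    qed
  qed
  also have "\<dots> = n * (1 - r) ^ j * U (J * b) crowd V + death r j K"
    by (simp add: expect_add kc.finite_steps)
  also have "U (J * b) crowd V \<le> \<rho> ^ J * n"
  proof -
    have "U (J * b) crowd V \<le> (if K \<le> card V then \<rho> ^ J * real (card V) else 0)"
      unfolding crowd_def by (rule crowded_decay[OF _ \<rho>0 order.refl]) (use num_decay in \<open>auto simp: K_def \<rho>_def\<close>)
    also have "\<dots> \<le> \<rho> ^ J * n" using \<rho>0 by (simp add: n_def)
    finally show ?thesis .
  qed
  also have "\<rho> ^ J * n \<le> 1 / n ^ 3 * n" using \<rho>J n_pos by (intro mult_right_mono) auto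
  finally have "v ((J + j) * b) V \<le> n * (1 - r) ^ j * (1 / n ^ 3 * n) + death r j K"
    using n_pos r_le by (simp add: mult_left_mono)
  also have "n * (1 - r) ^ j * (1 / n ^ 3 * n) = (1 - r) ^ j / n" using n_pos by (simp add: eval_nat_numeral)
  finally show ?thesis by (simp add: K_def)
qed

lemma summable_v: "A \<subseteq> V \<Longrightarrow> summable (\<lambda>t. v t A)"
  using r r_le(3) n_pos s_pos by (intro antimono_block_sum(1)[OF v_antimono v_nonneg v_geometric]) auto

text \<open>About \<open>ln n / r\<close> blocks use up the prefactor \<open>n\<close> of
  \<open>v_geometric\<close>; up to then \<open>v\<close> is bounded by 1, afterwards by a geometric
  series.\<close>

lemma cost_bound: assumes A: "A \<subseteq> V" shows "cost A \<le> b * (ln n / r + 1 / r + 1)"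
proof -
  define j where "j = nat \<lceil>ln n / r\<rceil>"
  have "0 \<le> ln n / r" using ln_n r by simp
  then have j: "ln n / r \<le> j" "j \<le> ln n / r + 1" unfolding j_def by linarith+
  have "n * (1 - r) ^ j \<le> 1"
  proof -
    have "(1 - r) ^ j \<le> exp (- r) ^ j" using r_le exp_ge_add_one_self[of "- r"] by (intro power_mono) auto
    also have "\<dots> = exp (- (j * r))" by (simp flip: exp_of_nat_mult)
    also have "\<dots> \<le> exp (- ln n)" using j(1) r by (simp add: field_simps)
    also have "\<dots> = 1 / n" using n_pos by (simp add: exp_minus inverse_eq_divide)
    finally show ?thesis using n_pos by (simp add: field_simps)
  qed
  define a where "a t = v (t + j * b) A" for t
  have a: "antimono a" unfolding a_def using v_antimono[OF A] by (auto simp: antimono_def)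
  have "a (i * b) \<le> 1 * (1 - r) ^ i" for i
  proof -
    have "a (i * b) \<le> n * (1 - r) ^ (i + j)"
      unfolding a_def using v_geometric[OF A, of "i + j"] by (simp add: add_mult_distrib)
    also have "\<dots> = (1 - r) ^ i * (n * (1 - r) ^ j)" by (simp add: power_add)
    also have "\<dots> \<le> (1 - r) ^ i * 1" using \<open>n * (1 - r) ^ j \<le> 1\<close> r_le by (intro mult_left_mono) auto
    finally show ?thesis by simp
  qed
  then have "suminf a \<le> real b * 1 / (1 - (1 - r))"
    using r r_le s_pos by (intro antimono_block_sum(2)[OF a]) (auto simp: a_def v_nonneg)
  moreover have "cost A = suminf a + (\<Sum>t<j * b. v t A)"
    unfolding cost_def a_def by (rule suminf_split_initial_segment[OF summable_v[OF A]])
  moreover have "(\<Sum>t<j * b. v t A) \<le> (\<Sum>t<j * b. 1)" by (intro sum_mono v_le_1)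
  ultimately have "cost A \<le> b * (1 / r) + b * real j" by (simp add: mult.commute)
  also have "\<dots> \<le> b * (1 / r) + b * (ln n / r + 1)" using j by (intro add_left_mono mult_left_mono) auto
  finally show ?thesis by (simp add: algebra_simps)
qed

end
end


section \<open>The lower bound for the mean coalescence time\<close>

context mf_walk
begin

lemma sum_meetp_le: "(\<Sum>t<N. 1 - meetp t) \<le> m"
  unfolding m_def using hp_bounds
  by (intro sum_le_suminf summable_meetp) (auto simp: meetp_def intro!: expect_le fin\<pi>)

lemma b_le: "real b \<le> m"
proof -
  have "real b \<le> 2 * real \<tau>" using \<tau>_pos(2) unfolding of_nat_add by linarith
  also have "\<dots> \<le> 4 * eta \<tau> * m" using m_ge(2) by linarith
  also have "\<dots> \<le> 1 * m" using eta_\<tau>_small eps m_ge(3) by (intro mult_right_mono) auto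
  finally show ?thesis by simp
qed

text \<open>Solves \<open>ET_lower\<close> for \<open>ET i\<close>, with \<open>meetp \<tau>\<close>
  bounded from above through \<open>m_le\<close>. The subtracted \<open>2 * \<tau>\<close> are the
  two extra blocks in the factor \<open>2 + ET i / \<tau>\<close>.\<close>

lemma ET_ge:
  assumes "2 \<le> i" shows "m * (1 - 2 * \<epsilon>) / C i - 2 * \<tau> \<le> ET i"
proof -
  define p where "p = meetp \<tau>"
  have p: "0 < p" using meetp_pos by (simp add: p_def)
  define X where "X = 2 * real \<tau> + ET i"
  have t: "0 < real \<tau>" using \<tau>_pos by simp
  have Ci: "1 \<le> C i" by (rule C_ge(1)[OF assms])
  have bp: "0 < real b" using s_pos by (simp add: add_pos_nonneg)
  have ET0: "0 \<le> ET i" using summable_surv(3)[OF sum_meetp_le assms, of 0] by simp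
  have X0: "0 \<le> X" using ET0 by (simp add: X_def)
  have "real i * \<delta> \<le> C i * (\<kappa> * p)"
  proof -
    have "real i * \<delta> = (real i / 2) * (2 * \<delta>)" by simp
    also have "\<dots> \<le> C i * (\<kappa> * p)"
    proof (rule mult_mono)
      show "2 * \<delta> \<le> \<kappa> * p" using \<kappa>(3)[of \<tau>] by (simp add: p_def)
    qed (use C_ge(2)[OF assms] \<delta>_nonneg in \<open>auto simp: C_def\<close>)
    finally show ?thesis .
  qed
  then have h1: "C i * p + real i * \<delta> \<le> C i * p * (1 + \<kappa>)" by (simp add: algebra_simps)
  have h2: "2 + ET i / \<tau> = X / \<tau>"
    using t unfolding X_def by (subst add_divide_distrib) (simp only: nonzero_mult_div_cancel_right less_imp_neq[symmetric] not_False_eq_True)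
  have "1 \<le> (C i * p + real i * \<delta>) * (2 + ET i / \<tau>)"
    unfolding C_def p_def by (rule ET_lower[OF sum_meetp_le assms \<tau>_pos(2)])
  also have "\<dots> \<le> C i * p * (1 + \<kappa>) * (X / \<tau>)"
    unfolding h2 using h1 X0 t by (intro mult_right_mono) auto
  finally have "1 \<le> C i * p * (1 + \<kappa>) * X / \<tau>" by (simp only: times_divide_eq_right)
  then have 1: "\<tau> \<le> C i * p * (1 + \<kappa>) * X" using t by (simp only: pos_le_divide_eq mult_1)
  have "m * (1 - \<kappa>) * \<tau> \<le> m * (1 - \<kappa>) * (C i * p * (1 + \<kappa>) * X)"
    using 1 m_ge(3) \<kappa>_small by (intro mult_left_mono) auto
  also have "\<dots> = (m * p * (1 - \<kappa>)) * (C i * (1 + \<kappa>) * X)" by simp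
  also have "\<dots> \<le> b * (C i * (1 + \<kappa>) * X)"
    using m_le[of \<tau>] Ci \<kappa>(1) X0 by (intro mult_right_mono) (auto simp: p_def)
  finally have 2: "m * (1 - \<kappa>) * \<tau> \<le> b * (C i * (1 + \<kappa>) * X)" .
  have "m * (1 - \<kappa>) * ((1 - \<epsilon>) * b) \<le> m * (1 - \<kappa>) * \<tau>"
    using \<tau>_ge_b m_ge(3) \<kappa>_small by (intro mult_left_mono) auto
  with 2 have "b * (m * (1 - \<kappa>) * (1 - \<epsilon>)) \<le> b * (C i * (1 + \<kappa>) * X)" by (simp add: mult_ac)
  then have 3: "m * ((1 - \<kappa>) * (1 - \<epsilon>)) \<le> C i * (1 + \<kappa>) * X"
    using bp by (subst (asm) mult_le_cancel_left_pos) (auto simp: mult_ac)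
  have "(1 - 2 * \<epsilon>) * (1 + \<kappa>) \<le> (1 - \<kappa>) * (1 - \<epsilon>)"
  proof -
    have "(1 - \<kappa>) * (1 - \<epsilon>) - (1 - 2 * \<epsilon>) * (1 + \<kappa>) = \<epsilon> - 2 * \<kappa> + 3 * (\<epsilon> * \<kappa>)" by (simp add: algebra_simps)
    moreover have "0 \<le> \<epsilon> * \<kappa>" using eps \<kappa>(1) by simp
    ultimately show ?thesis using \<kappa>(2) eps by linarith
  qed
  then have "m * ((1 - 2 * \<epsilon>) * (1 + \<kappa>)) \<le> m * ((1 - \<kappa>) * (1 - \<epsilon>))" using m_ge(3) by (intro mult_left_mono) auto
  with 3 have "(1 + \<kappa>) * (m * (1 - 2 * \<epsilon>)) \<le> (1 + \<kappa>) * (C i * X)" by (simp add: mult_ac)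
  then have "m * (1 - 2 * \<epsilon>) \<le> C i * X" using \<kappa>(1) by (subst (asm) mult_le_cancel_left_pos) auto
  then have "m * (1 - 2 * \<epsilon>) / C i \<le> X" using Ci by (simp add: pos_divide_le_eq mult.commute)
  then show ?thesis by (simp add: X_def)
qed

text \<open>The number \<open>m / s\<close> of periods before the first collision may be large, but
  \<open>meetp s * (m / s)\<close> is at most 3 by \<open>m_le\<close>. What remains is
  \<open>eta s\<close>, the chance of another meeting in the mixing period, times the number of
  pairs of pairs.\<close>

lemma recollision_penalty:
  assumes "2 \<le> i" "i \<le> k"
  shows "i * \<delta> + (C i)\<^sup>2 * (meetp s * eta s + i * \<delta>) * (2 + m / s) \<le> 2 * real k ^ 4 * eta s"
proof -
  define p where "p = meetp s"
  have p: "1 / n \<le> p" "p \<le> 1" "0 < p"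
    using meetp_ge[of s] meetp_pos[of s] hp_bounds by (auto simp: n_def p_def meetp_def intro!: expect_le fin\<pi>)
  have s: "0 < real s" using s_pos by simp
  have n: "1 \<le> n" using n_ge by simp
  have id: "i * \<delta> \<le> 1 / n ^ 7"
  proof -
    have "real i \<le> n" using assms k n_ge by linarith
    then have "i * \<delta> \<le> n * \<delta>" using \<delta>_nonneg by (intro mult_right_mono) auto
    also have "\<dots> \<le> 1 / n ^ 7" using \<delta>_le n_pos by (simp add: field_simps flip: power_Suc)
    finally show ?thesis .
  qed
  have inv: "1 / n ^ 7 \<le> 1 / n" using n power_increasing[of 1 7 n] by (intro divide_left_mono) auto
  have ms: "p * (m / s) \<le> 3"
  proof -
    have "m * p * (1 / 2) \<le> m * p * (1 - \<kappa>) * (2 / 3)"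
    proof -
      have "m * p * (1 / 2) \<le> m * p * ((1 - \<kappa>) * (2 / 3))" using m_ge(3) p \<kappa>_small by (intro mult_left_mono) auto
      then show ?thesis by (simp only: mult.assoc)
    qed
    also have "\<dots> \<le> real (s + s) * (2 / 3)"
      unfolding p_def by (intro mult_right_mono m_le) auto
    finally have "m * p \<le> 3 * s" by simp
    then show ?thesis using s by (simp add: field_simps)
  qed
  have ms2: "m / s \<le> 3 * n"
  proof -
    have "(1 / n) * (m / s) \<le> p * (m / s)" using p m_ge(3) by (intro mult_right_mono) auto
    then have "(1 / n) * (m / s) \<le> 3" using ms by linarith
    then have "n * ((1 / n) * (m / s)) \<le> n * 3" using n_pos by (intro mult_left_mono) auto
    then show ?thesis using n_pos by simp
  qed
  have 1: "(p * eta s + i * \<delta>) * (2 + m / s) \<le> 6 * eta s"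
  proof -
    have "(p * eta s + i * \<delta>) * (2 + m / s) = eta s * (2 * p + p * (m / s)) + i * \<delta> * (2 + m / s)"
      by (simp add: algebra_simps)
    also have "\<dots> \<le> eta s * (2 * 1 + 3) + 1 / n ^ 7 * (5 * n)"
      using p ms ms2 id eta_nonneg n m_ge(3) \<delta>_nonneg by (intro add_mono mult_mono) auto
    also have "1 / n ^ 7 * (5 * n) \<le> 1 / n"
    proof -
      have "5 * n * n \<le> n ^ 7"
      proof -
        have "5 * (n * n) \<le> n * (n * n)" using n_ge by (intro mult_right_mono) auto
        also have "\<dots> = n ^ 3" by (simp add: eval_nat_numeral)
        also have "\<dots> \<le> n ^ 7" using n by (intro power_increasing) auto
        finally show ?thesis by simp
      qed
      then show ?thesis using n_pos by (simp add: field_simps)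
    qed
    finally have "(p * eta s + i * \<delta>) * (2 + m / s) \<le> eta s * (2 * 1 + 3) + 1 / n" by simp
    also have "eta s * (2 * 1 + 3) + 1 / n \<le> 6 * eta s" using inv_n_le_eta by simp
    finally show ?thesis .
  qed
  have Ci: "1 \<le> C i" by (rule C_ge(1)[OF assms(1)])
  have "C i \<le> (real k)\<^sup>2 / 2"
  proof -
    have "(real i)\<^sup>2 \<le> (real k)\<^sup>2" using assms by (intro power_mono) auto
    then show ?thesis using C_le[of i] by linarith
  qed
  then have "(C i)\<^sup>2 \<le> ((real k)\<^sup>2 / 2)\<^sup>2" using Ci by (intro power_mono) auto
  also have "\<dots> = real k ^ 4 / 4" by (simp add: power_divide)
  finally have C2: "(C i)\<^sup>2 \<le> real k ^ 4 / 4" .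
  have C1: "1 \<le> (C i)\<^sup>2" using Ci by (simp add: one_le_power)
  have "i * \<delta> + (C i)\<^sup>2 * (p * eta s + i * \<delta>) * (2 + m / s) \<le> eta s + (C i)\<^sup>2 * (6 * eta s)"
    using id inv inv_n_le_eta mult_left_mono[OF 1, of "(C i)\<^sup>2"] by (simp add: mult.assoc)
  also have "\<dots> \<le> (C i)\<^sup>2 * eta s + (C i)\<^sup>2 * (6 * eta s)"
    using mult_right_mono[OF C1 eta_nonneg[of s]] by linarith
  also have "\<dots> = (C i)\<^sup>2 * (7 * eta s)" by simp
  also have "\<dots> \<le> real k ^ 4 / 4 * (7 * eta s)" using C2 eta_nonneg by (intro mult_right_mono) auto
  also have "\<dots> \<le> 2 * real k ^ 4 * eta s" using eta_nonneg[of s] by (simp add: mult_right_mono)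
  finally show ?thesis by (simp add: p_def)
qed

text \<open>When \<open>cost_recursion\<close> is summed from 2 to \<open>k\<close>, the main terms
  \<open>m / C i\<close> telescope to \<open>m * (2 - 2 / k)\<close>, and
  \<open>k >= 1 / \<epsilon>\<close> makes the missing part \<open>O(\<epsilon>)\<close>. The
  collision penalties amount to at most \<open>7680 * \<epsilon> * m\<close>, because
  \<open>k ^ 5\<close> is weighed against \<open>\<epsilon> ^ 6\<close>.\<close>

theorem cost_lower: "m * (2 - 10000 * \<epsilon>) \<le> cost V"
proof -
  define r where "r = (1 - 2 * \<epsilon>) * b / m"
  define M where "M = 4 * m * ln n"
  define D where "D = 2 * real \<tau> + M * (2 * real k ^ 4 * eta s)"
  have r: "0 < r" "r \<le> (1 - 2 * \<epsilon>) * b / m" using eps m_ge(3) s_pos by (auto simp: r_def add_pos_nonneg)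
  have M0: "0 \<le> M" using m_ge(3) ln_n by (simp add: M_def)
  have cost_M: "cost A \<le> M" if "A \<subseteq> V" for A
  proof -
    have br: "b / r \<le> 11/10 * m"
    proof -
      have "0 < real b" using s_pos by (simp add: add_pos_nonneg)
      then have "b / r = m / (1 - 2 * \<epsilon>)" unfolding r_def using m_ge(3) eps by simp
      also have "\<dots> \<le> 11/10 * m" using m_ge(3) eps by (simp add: field_simps)
      finally show ?thesis .
    qed
    have "cost A \<le> b * (ln n / r + 1 / r + 1)" by (rule cost_bound[OF r that])
    also have "\<dots> = (b / r) * (ln n + 1) + b" by (simp add: algebra_simps add_divide_distrib)
    also have "\<dots> \<le> (11/10 * m) * (ln n + ln n) + m * ln n"
    proof (intro add_mono mult_mono br)
      show "real b \<le> m * ln n" using b_le mult_left_mono[OF ln_n, of m] m_ge(3) by linarith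
    qed (use ln_n m_ge(3) in auto)
    also have "\<dots> \<le> M" using m_ge(3) ln_n by (simp add: M_def)
    finally show ?thesis .
  qed
  have "0 \<le> D" using M0 eta_nonneg by (simp add: D_def)
  have rec: "cbar i \<ge> m * (1 - 2 * \<epsilon>) * (2 - 2 / i) - real (i - 1) * D" if "1 \<le> i" "i \<le> k" for i
    using that
  proof (induction i rule: dec_induct)
    case base
    have "0 \<le> cbar 1" unfolding cbar_def
      using eqm_range[of "{..<1}"] by (intro expect_ge fin_eqm cost_nonneg[OF summable_v[OF r] cost_M sum_meetp_le]) auto
    then show ?case by simp
  next
    case (step i)
    define j where "j = Suc i"
    have j: "2 \<le> j" "j \<le> k" "j - 1 = i" using step by (auto simp: j_def)
    have "cbar j \<ge> ET j + cbar (j - 1) - M * (j * \<delta> + (C j)\<^sup>2 * (meetp s * eta s + j * \<delta>) * (2 + m / s))"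
      unfolding C_def by (rule cost_recursion[OF summable_v[OF r] cost_M sum_meetp_le j(1)])
    moreover have "M * (j * \<delta> + (C j)\<^sup>2 * (meetp s * eta s + j * \<delta>) * (2 + m / s)) \<le> M * (2 * real k ^ 4 * eta s)"
      using recollision_penalty[OF j(1,2)] M0 by (rule mult_left_mono)
    ultimately have "cbar j \<ge> m * (1 - 2 * \<epsilon>) / C j - D + cbar i"
      using ET_ge[OF j(1)] j(3) unfolding D_def by simp
    moreover have "m * (1 - 2 * \<epsilon>) / C j = m * (1 - 2 * \<epsilon>) * (2 - 2 / j) - m * (1 - 2 * \<epsilon>) * (2 - 2 / i)"
    proof -
      have "1 / C j = (2 - 2 / j) - (2 - 2 / i)" using step(1) unfolding C_eq j_def by (simp add: field_simps)
      then have "m * (1 - 2 * \<epsilon>) * (1 / C j) = m * (1 - 2 * \<epsilon>) * ((2 - 2 / j) - (2 - 2 / i))" by simp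
      then show ?thesis by (simp add: right_diff_distrib)
    qed
    moreover have "cbar i \<ge> m * (1 - 2 * \<epsilon>) * (2 - 2 / i) - real (i - 1) * D" using step by simp
    moreover have "real (j - 1) * D = real (i - 1) * D + D" using step(1) by (simp add: j_def of_nat_diff algebra_simps)
    ultimately show ?case unfolding j_def[symmetric] by linarith
  qed
  have k1: "1 \<le> k" using k eps by (metis Suc_leI One_nat_def divide_pos_pos less_le_trans of_nat_0_less_iff zero_less_one)
  have "real (k - 1) * D \<le> 8000 * \<epsilon> * m"
  proof -
    have "real (k - 1) * D \<le> 2 / \<epsilon> * D" using k \<open>0 \<le> D\<close> by (intro mult_right_mono) auto
    also have "\<dots> = 4 / \<epsilon> * real \<tau> + 16 / \<epsilon> * (m * ln n * (real k ^ 4 * eta s))" by (simp add: D_def M_def algebra_simps)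
    also have "4 / \<epsilon> * real \<tau> \<le> \<epsilon> * m"
    proof -
      have "real \<tau> \<le> 2 * (60 * \<epsilon> ^ 5) * m"
        using m_ge(2) mult_right_mono[OF eta_\<tau>(3), of m] m_ge(3) by linarith
      then have "4 / \<epsilon> * real \<tau> \<le> 4 / \<epsilon> * (2 * (60 * \<epsilon> ^ 5) * m)" using eps by (intro mult_left_mono) auto
      also have "\<dots> = 480 * \<epsilon> ^ 3 * (\<epsilon> * m)" using eps by (simp add: eval_nat_numeral)
      also have "\<dots> \<le> 1 * (\<epsilon> * m)" using eps4 eps m_ge(3) by (intro mult_right_mono) auto
      finally show ?thesis by simp
    qed
    also have "16 / \<epsilon> * (m * ln n * (real k ^ 4 * eta s)) \<le> 7680 * \<epsilon> * m"
    proof -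
      have "real k ^ 4 \<le> (2 / \<epsilon>) ^ 4" using k by (intro power_mono) auto
      also have "\<dots> = 16 / \<epsilon> ^ 4" by (simp add: power_divide)
      finally have k4: "real k ^ 4 \<le> 16 / \<epsilon> ^ 4" .
      have "ln n * 1 \<le> ln n * (ln n)\<^sup>2" using ln_n by (intro mult_left_mono one_le_power) auto
      then have "ln n \<le> ln n ^ 3" by (simp add: eval_nat_numeral)
      then have "eta s * ln n \<le> eta s * ln n ^ 3" using eta_nonneg by (rule mult_left_mono)
      then have e: "eta s * ln n \<le> 30 * \<epsilon> ^ 6" using small by linarith
      have "m * ln n * (real k ^ 4 * eta s) = m * (real k ^ 4 * (eta s * ln n))" by simp
      also have "\<dots> \<le> m * (16 / \<epsilon> ^ 4 * (30 * \<epsilon> ^ 6))"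
      proof (rule mult_left_mono)
        show "real k ^ 4 * (eta s * ln n) \<le> 16 / \<epsilon> ^ 4 * (30 * \<epsilon> ^ 6)"
          by (rule mult_mono[OF k4 e]) (use eta_nonneg ln_n eps in auto)
      qed (use m_ge(3) in simp)
      also have "\<dots> = 480 * \<epsilon>\<^sup>2 * m" using eps by (simp add: eval_nat_numeral)
      finally have "16 / \<epsilon> * (m * ln n * (real k ^ 4 * eta s)) \<le> 16 / \<epsilon> * (480 * \<epsilon>\<^sup>2 * m)"
        using eps by (intro mult_left_mono) auto
      then show ?thesis using eps by (simp add: power2_eq_square)
    qed
    finally show ?thesis using mult_pos_pos[OF eps(1) m_ge(3)] by (simp only: mult.assoc) linarith
  qed
  moreover have "m * (1 - 2 * \<epsilon>) * (2 - 2 / k) \<ge> m * (2 - 6 * \<epsilon>)"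
  proof -
    have "1 / real k \<le> \<epsilon>" using k1 k eps by (simp add: field_simps)
    then have "(1 - 2 * \<epsilon>) * (2 - 2 * \<epsilon>) \<le> (1 - 2 * \<epsilon>) * (2 - 2 / k)"
      using eps by (intro mult_left_mono) auto
    moreover have "2 - 6 * \<epsilon> \<le> (1 - 2 * \<epsilon>) * (2 - 2 * \<epsilon>)" by (simp add: algebra_simps)
    ultimately have "m * (2 - 6 * \<epsilon>) \<le> m * ((1 - 2 * \<epsilon>) * (2 - 2 / k))" using m_ge(3) by (intro mult_left_mono) auto
    then show ?thesis by (simp add: mult.assoc)
  qed
  ultimately have "m * (2 - 10000 * \<epsilon>) \<le> m * (1 - 2 * \<epsilon>) * (2 - 2 / k) - real (k - 1) * D"
    using mult_pos_pos[OF eps(1) m_ge(3)] by (simp add: algebra_simps)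
  also have "\<dots> \<le> cbar k" using rec[OF k1 order.refl] .
  \<comment> \<open>The sites of \<open>k\<close> equilibrium walkers form a subset of
    \<open>V\<close>, so this is the monotone coupling again.\<close>
  also have "cbar k \<le> cost V"
    unfolding cbar_def
  proof (intro expect_le fin_eqm)
    fix x assume "x \<in> set_pmf (eqm {..<k})"
    then have x: "x ` {..<k} \<subseteq> V" by (intro eqm_range) auto
    show "cost (x ` {..<k}) \<le> cost V" unfolding cost_def
      using x multiple_mono by (intro suminf_le summable_v[OF r] U_mono_set) auto
  qed auto
  finally show ?thesis .
qed

end


section \<open>The transition function of a finite chain\<close>

definition matrix_op :: "'s set \<Rightarrow> ('s \<Rightarrow> 's \<Rightarrow> real) \<Rightarrow> ('s \<Rightarrow> real) \<Rightarrow> 's \<Rightarrow> real" where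
  "matrix_op S M f x = (\<Sum>y\<in>S. M x y * f y)"

locale finite_rates =
  fixes S :: "'s set" and q :: "'s \<Rightarrow> 's \<Rightarrow> real"
  assumes finS: "finite S" and rates: "rates S q"
begin

abbreviation G :: "'s \<Rightarrow> 's \<Rightarrow> real" where "G \<equiv> generator S q"
abbreviation pow :: "nat \<Rightarrow> 's \<Rightarrow> 's \<Rightarrow> real" where "pow \<equiv> generator_power S q"
abbreviation tr :: "real \<Rightarrow> 's \<Rightarrow> 's \<Rightarrow> real" where "tr \<equiv> transition S q"

definition norm_bound :: real where "norm_bound = (\<Sum>x\<in>S. \<Sum>y\<in>S. \<bar>G x y\<bar>)"

lemma norm_bound_nonneg: "0 \<le> norm_bound" unfolding norm_bound_def by (intro sum_nonneg) auto

lemma row_le: "x \<in> S \<Longrightarrow> (\<Sum>y\<in>S. \<bar>G x y\<bar>) \<le> norm_bound"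
  unfolding norm_bound_def using finS by (intro member_le_sum[of x S "\<lambda>x. \<Sum>y\<in>S. \<bar>G x y\<bar>"] sum_nonneg) auto

lemma pow_bound: "x \<in> S \<Longrightarrow> \<bar>pow n x y\<bar> \<le> norm_bound ^ n"
proof (induction n arbitrary: x)
  case (Suc n)
  have "\<bar>pow (Suc n) x y\<bar> \<le> (\<Sum>z\<in>S. \<bar>G x z\<bar> * norm_bound ^ n)"
    unfolding generator_power.simps using Suc.IH
    by (intro order.trans[OF sum_abs] sum_mono) (auto simp: abs_mult intro!: mult_left_mono)
  also have "\<dots> \<le> norm_bound * norm_bound ^ n"
    unfolding sum_distrib_right[symmetric] using row_le[OF Suc.prems] norm_bound_nonneg by (intro mult_right_mono) auto
  finally show ?case by simp
qed auto

lemma summable_norm_transition: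
  assumes "x \<in> S" shows "summable (\<lambda>n. norm (t ^ n / fact n * pow n x y))"
proof (rule summable_comparison_test')
  show "summable (\<lambda>n. (\<bar>t\<bar> * norm_bound) ^ n / fact n)"
    using summable_exp[of "\<bar>t\<bar> * norm_bound"] by (simp add: field_simps)
  show "norm (norm (t ^ n / fact n * pow n x y)) \<le> (\<bar>t\<bar> * norm_bound) ^ n / fact n" for n
    using pow_bound[OF assms, of n y]
    by (simp add: abs_mult power_abs power_mult_distrib divide_right_mono mult_left_mono)
qed

lemma summable_transition: "x \<in> S \<Longrightarrow> summable (\<lambda>n. t ^ n / fact n * pow n x y)"
  using summable_norm_cancel[OF summable_norm_transition] .

lemma tr_0: "x \<in> S \<Longrightarrow> tr 0 x y = (if x = y then 1 else 0)"
  unfolding transition_def by (subst suminf_finite[of "{0}"]) auto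

lemma pow_add: "x \<in> S \<Longrightarrow> pow (i + j) x y = (\<Sum>z\<in>S. pow i x z * pow j z y)"
proof (induction i arbitrary: x)
  case 0
  then show ?case using finS by (simp add: if_distrib[of "\<lambda>u. u * _"] sum.delta' cong: if_cong)
next
  case (Suc i)
  have "pow (Suc i + j) x y = (\<Sum>w\<in>S. \<Sum>z\<in>S. G x w * pow i w z * pow j z y)"
    using Suc.IH by (simp add: sum_distrib_left mult.assoc)
  also have "\<dots> = (\<Sum>z\<in>S. \<Sum>w\<in>S. G x w * pow i w z * pow j z y)" by (rule sum.swap)
  finally show ?case by (simp add: sum_distrib_right)
qed

text \<open>The Cauchy product of the two exponential series, with the binomial theorem for the
  coefficients.\<close>

lemma tr_add:
  assumes "x \<in> S" shows "tr (s + t) x y = (\<Sum>z\<in>S. tr s x z * tr t z y)"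
proof -
  have coeff: "(\<Sum>z\<in>S. \<Sum>i\<le>n. (s ^ i / fact i * pow i x z) * (t ^ (n - i) / fact (n - i) * pow (n - i) z y))
    = (s + t) ^ n / fact n * pow n x y" for n
  proof -
    have "(\<Sum>z\<in>S. \<Sum>i\<le>n. (s ^ i / fact i * pow i x z) * (t ^ (n - i) / fact (n - i) * pow (n - i) z y))
      = (\<Sum>i\<le>n. (s ^ i / fact i) * (t ^ (n - i) / fact (n - i)) * (\<Sum>z\<in>S. pow i x z * pow (n - i) z y))"
      by (subst sum.swap) (simp add: sum_distrib_left mult_ac)
    also have "\<dots> = (\<Sum>i\<le>n. (s ^ i / fact i) * (t ^ (n - i) / fact (n - i)) * pow n x y)"
      using pow_add[OF assms, of _ "n - _" y] by (intro sum.cong refl) (simp flip: pow_add[OF assms])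
    also have "\<dots> = (\<Sum>i\<le>n. real (n choose i) * s ^ i * t ^ (n - i) / fact n * pow n x y)"
      by (intro sum.cong refl) (simp add: binomial_fact)
    also have "\<dots> = (s + t) ^ n / fact n * pow n x y"
      by (simp add: binomial_ring sum_distrib_right sum_divide_distrib)
    finally show ?thesis .
  qed
  have "(\<Sum>z\<in>S. tr s x z * tr t z y)
    = (\<Sum>z\<in>S. \<Sum>n. \<Sum>i\<le>n. (s ^ i / fact i * pow i x z) * (t ^ (n - i) / fact (n - i) * pow (n - i) z y))"
    unfolding transition_def using assms by (intro sum.cong refl Cauchy_product summable_norm_transition)
  also have "\<dots> = (\<Sum>n. \<Sum>z\<in>S. \<Sum>i\<le>n. (s ^ i / fact i * pow i x z) * (t ^ (n - i) / fact (n - i) * pow (n - i) z y))"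
    using assms by (intro suminf_sum[symmetric] summable_Cauchy_product summable_norm_transition)
  also have "\<dots> = tr (s + t) x y" by (simp only: coeff transition_def)
  finally show ?thesis by simp
qed

lemma generator_row: "x \<in> S \<Longrightarrow> (\<Sum>y\<in>S. G x y) = 0"
proof -
  assume x: "x \<in> S"
  have "(\<Sum>y\<in>S. G x y) = G x x + (\<Sum>y\<in>S - {x}. G x y)" by (rule sum.remove[OF finS x])
  also have "(\<Sum>y\<in>S - {x}. G x y) = (\<Sum>y\<in>S - {x}. q x y)" by (intro sum.cong) (auto simp: generator_def)
  finally show ?thesis by (simp add: generator_def)
qed

lemma pow_row: "x \<in> S \<Longrightarrow> (\<Sum>y\<in>S. pow n x y) = (if n = 0 then 1 else 0)"
proof (induction n arbitrary: x)
  case 0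
  then show ?case using finS by simp
next
  case (Suc n)
  have "(\<Sum>y\<in>S. pow (Suc n) x y) = (\<Sum>z\<in>S. G x z * (\<Sum>y\<in>S. pow n z y))"
    by (simp add: sum_distrib_left) (rule sum.swap)
  also have "\<dots> = (\<Sum>z\<in>S. G x z * (if n = 0 then 1 else 0))" by (intro sum.cong refl) (simp only: Suc.IH)
  also have "\<dots> = 0" using generator_row[OF Suc.prems] by (cases "n = 0") auto
  finally show ?case by simp
qed

lemma tr_row: assumes "x \<in> S" shows "(\<Sum>y\<in>S. tr t x y) = 1"
proof -
  have "(\<Sum>y\<in>S. tr t x y) = (\<Sum>n. \<Sum>y\<in>S. t ^ n / fact n * pow n x y)"
    unfolding transition_def by (intro suminf_sum[symmetric] summable_transition assms)
  also have "(\<lambda>n. \<Sum>y\<in>S. t ^ n / fact n * pow n x y) = (\<lambda>n. t ^ n / fact n * (if n = 0 then 1 else 0))"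
    using pow_row[OF assms] by (simp only: sum_distrib_left[symmetric])
  also have "(\<Sum>n. t ^ n / fact n * (if n = 0 then 1 else 0)) = (\<Sum>n\<in>{0}. t ^ n / fact n * (if n = 0 then 1 else 0))"
    by (intro suminf_finite) auto
  finally show ?thesis by simp
qed

lemma tr_bound:
  assumes "x \<in> S" "0 \<le> t" shows "\<bar>tr t x y\<bar> \<le> exp (t * norm_bound)"
proof -
  have "\<bar>tr t x y\<bar> \<le> (\<Sum>n. \<bar>t ^ n / fact n * pow n x y\<bar>)"
    unfolding transition_def using summable_rabs[of "\<lambda>n. t ^ n / fact n * pow n x y"] summable_norm_transition[OF assms(1), of t y] by simp
  also have "\<dots> \<le> (\<Sum>n. (t * norm_bound) ^ n /\<^sub>R fact n)"
  proof (intro suminf_le allI)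
    show "\<bar>t ^ n / fact n * pow n x y\<bar> \<le> (t * norm_bound) ^ n /\<^sub>R fact n" for n
      using pow_bound[OF assms(1), of n y] assms(2)
      by (simp add: abs_mult power_mult_distrib divide_inverse mult_ac mult_left_mono)
    show "summable (\<lambda>n. \<bar>t ^ n / fact n * pow n x y\<bar>)" using summable_norm_transition[OF assms(1), of t y] by simp
  qed (rule summable_exp_generic)
  also have "\<dots> = exp (t * norm_bound)" by (simp add: exp_def)
  finally show ?thesis .
qed

lemma tr_has_derivative:
  assumes "x \<in> S" shows "((\<lambda>t. tr t x y) has_field_derivative (\<Sum>n. diffs (\<lambda>n. pow n x y / fact n) n * t ^ n)) (at t)"
proof -
  have "(\<lambda>t. tr t x y) = (\<lambda>t. \<Sum>n. pow n x y / fact n * t ^ n)"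
    unfolding transition_def by (intro ext arg_cong[of _ _ suminf]) (simp add: mult.commute)
  moreover have "summable (\<lambda>n. pow n x y / fact n * t ^ n)" for t
    using summable_transition[OF assms, of t y] by (simp add: mult.commute)
  then have "((\<lambda>t. \<Sum>n. pow n x y / fact n * t ^ n) has_field_derivative (\<Sum>n. diffs (\<lambda>n. pow n x y / fact n) n * t ^ n)) (at t)"
    by (rule termdiffs_strong_converges_everywhere)
  ultimately show ?thesis by simp
qed

lemma tr_derivative_0:
  assumes "x \<in> S" "y \<in> S" shows "((\<lambda>t. tr t x y) has_field_derivative G x y) (at 0)"
proof -
  have "(\<Sum>n. diffs (\<lambda>n. pow n x y / fact n) n * 0 ^ n) = (\<Sum>n\<in>{0}. diffs (\<lambda>n. pow n x y / fact n) n * 0 ^ n)"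
    by (intro suminf_finite) auto
  also have "\<dots> = pow 1 x y" by (simp add: diffs_def)
  also have "\<dots> = G x y" using finS assms(2) by (simp add: if_distrib[of "\<lambda>u. _ * u"] cong: if_cong)
  finally show ?thesis using tr_has_derivative[OF assms(1), of y 0] by simp
qed

lemma tr_continuous: "x \<in> S \<Longrightarrow> continuous_on A (\<lambda>t. tr t x y)"
  by (intro continuous_at_imp_continuous_on ballI DERIV_isCont[OF tr_has_derivative])

lemma matrix_op_bound:
  assumes "\<And>x y. x \<in> S \<Longrightarrow> y \<in> S \<Longrightarrow> 0 \<le> M x y" "\<And>x. x \<in> S \<Longrightarrow> (\<Sum>y\<in>S. M x y) = 1"
    and "x \<in> S" "\<And>y. y \<in> S \<Longrightarrow> \<bar>f y\<bar> \<le> F"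
  shows "\<bar>matrix_op S M f x\<bar> \<le> F"
proof -
  have "\<bar>matrix_op S M f x\<bar> \<le> (\<Sum>y\<in>S. \<bar>M x y * f y\<bar>)" unfolding matrix_op_def by (rule sum_abs)
  also have "\<dots> \<le> (\<Sum>y\<in>S. M x y * F)" using assms by (intro sum_mono) (auto simp: abs_mult intro!: mult_mono)
  also have "\<dots> = F" using assms by (simp add: sum_distrib_right[symmetric])
  finally show ?thesis .
qed

lemma matrix_op_tr_add: "x \<in> S \<Longrightarrow> matrix_op S (tr (s + t)) f x = matrix_op S (tr s) (matrix_op S (tr t) f) x"
  unfolding matrix_op_def
  by (simp add: tr_add sum_distrib_left sum_distrib_right mult.assoc) (subst sum.swap, rule refl)

text \<open>Telescoping \<open>M\<^sup>N - e\<^sup>N\<^sup>h\<^sup>G\<close> into single-step differences; positivity of the exponential is not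
  yet available, so its norm is bounded crudely.\<close>

lemma matrix_power_error:
  assumes M: "\<And>x y. x \<in> S \<Longrightarrow> y \<in> S \<Longrightarrow> 0 \<le> M x y" "\<And>x. x \<in> S \<Longrightarrow> (\<Sum>y\<in>S. M x y) = 1"
    and "0 \<le> h" and e: "\<And>x y. x \<in> S \<Longrightarrow> y \<in> S \<Longrightarrow> \<bar>M x y - tr h x y\<bar> \<le> e" "0 \<le> e"
    and f: "\<And>y. y \<in> S \<Longrightarrow> \<bar>f y\<bar> \<le> 1" and "x \<in> S"
  shows "\<bar>(matrix_op S M ^^ N) f x - matrix_op S (tr (N * h)) f x\<bar>
    \<le> real N * (real (card S) * e) * (real (card S) * exp (N * h * norm_bound))"
  using \<open>x \<in> S\<close>
proof (induction N arbitrary: x)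
  case 0
  have "matrix_op S (tr 0) f x = (\<Sum>y\<in>S. if x = y then f y else 0)"
    unfolding matrix_op_def using 0 by (intro sum.cong refl) (auto simp: tr_0)
  then show ?case using 0 finS by simp
next
  case (Suc N)
  define c where "c = real (card S) * exp (N * h * norm_bound)"
  define g where "g = matrix_op S (tr (N * h)) f"
  have c: "\<bar>g y\<bar> \<le> c" if "y \<in> S" for y
  proof -
    have "\<bar>g y\<bar> \<le> (\<Sum>z\<in>S. \<bar>tr (N * h) y z * f z\<bar>)" unfolding g_def matrix_op_def by (rule sum_abs)
    also have "\<dots> \<le> (\<Sum>z\<in>S. exp (N * h * norm_bound) * 1)"
      unfolding abs_mult using that f tr_bound[OF that, of "N * h"] \<open>0 \<le> h\<close> by (intro sum_mono mult_mono) auto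
    finally show ?thesis by (simp add: c_def)
  qed
  have c0: "0 \<le> c" by (simp add: c_def)
  have "matrix_op S (tr (Suc N * h)) f x = matrix_op S (tr h) g x"
    unfolding g_def using matrix_op_tr_add[OF Suc.prems, of h "N * h" f] by (simp add: algebra_simps)
  then have "(matrix_op S M ^^ Suc N) f x - matrix_op S (tr (Suc N * h)) f x
    = matrix_op S M (\<lambda>y. (matrix_op S M ^^ N) f y - g y) x + (\<Sum>y\<in>S. (M x y - tr h x y) * g y)"
    by (simp add: matrix_op_def algebra_simps sum.distrib sum_subtractf)
  moreover have "\<bar>matrix_op S M (\<lambda>y. (matrix_op S M ^^ N) f y - g y) x\<bar> \<le> real N * (real (card S) * e) * c"
    unfolding c_def g_def by (intro matrix_op_bound[OF M] Suc)
  moreover have "\<bar>\<Sum>y\<in>S. (M x y - tr h x y) * g y\<bar> \<le> (real (card S) * e) * c"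
  proof -
    have "\<bar>\<Sum>y\<in>S. (M x y - tr h x y) * g y\<bar> \<le> (\<Sum>y\<in>S. \<bar>(M x y - tr h x y) * g y\<bar>)" by (rule sum_abs)
    also have "\<dots> \<le> (\<Sum>y\<in>S. e * c)"
      unfolding abs_mult using Suc.prems e c by (intro sum_mono mult_mono) auto
    finally show ?thesis by simp
  qed
  ultimately have "\<bar>(matrix_op S M ^^ Suc N) f x - matrix_op S (tr (Suc N * h)) f x\<bar> \<le> real (Suc N) * (real (card S) * e) * c"
    by (simp add: algebra_simps)
  also have "\<dots> \<le> real (Suc N) * (real (card S) * e) * (real (card S) * exp (Suc N * h * norm_bound))"
    unfolding c_def using e(2) \<open>0 \<le> h\<close> norm_bound_nonneg
    by (intro mult_left_mono) (auto intro!: mult_right_mono)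
  finally show ?case .
qed

text \<open>The local error is \<open>o(h)\<close> and about \<open>t / h\<close> steps are made.
  Applied to Euler steps this yields positivity of \<open>tr\<close>; applied to the coalescing
  kernel on a grid it yields the transition function of coalescing walks.\<close>

lemma chernoff:
  assumes M: "\<And>j x y. x \<in> S \<Longrightarrow> y \<in> S \<Longrightarrow> 0 \<le> M j x y" "\<And>j x. x \<in> S \<Longrightarrow> (\<Sum>y\<in>S. M j x y) = 1"
    and h: "\<And>j. 0 < h j" "h \<longlonglongrightarrow> 0" and N: "(\<lambda>j. real (N j) * h j) \<longlonglongrightarrow> t"
    and d: "\<And>x y. x \<in> S \<Longrightarrow> y \<in> S \<Longrightarrow> (\<lambda>j. (M j x y - tr (h j) x y) / h j) \<longlonglongrightarrow> 0"
    and f: "\<And>y. y \<in> S \<Longrightarrow> \<bar>f y\<bar> \<le> 1" and "x \<in> S"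
  shows "(\<lambda>j. (matrix_op S (M j) ^^ N j) f x) \<longlonglongrightarrow> matrix_op S (tr t) f x"
proof -
  define e where "e j = (\<Sum>x\<in>S. \<Sum>y\<in>S. \<bar>M j x y - tr (h j) x y\<bar>)" for j
  have e0: "0 \<le> e j" for j unfolding e_def by (intro sum_nonneg) auto
  have e: "\<bar>M j x y - tr (h j) x y\<bar> \<le> e j" if "x \<in> S" "y \<in> S" for j x y
  proof -
    have "\<bar>M j x y - tr (h j) x y\<bar> \<le> (\<Sum>y\<in>S. \<bar>M j x y - tr (h j) x y\<bar>)"
      using finS that by (intro member_le_sum[of y S "\<lambda>y. \<bar>M j x y - tr (h j) x y\<bar>"]) auto
    also have "\<dots> \<le> e j" unfolding e_def
      using finS that by (intro member_le_sum[of x S "\<lambda>x. \<Sum>y\<in>S. \<bar>M j x y - tr (h j) x y\<bar>"] sum_nonneg) auto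
    finally show ?thesis .
  qed
  have "(\<lambda>j. e j / h j) \<longlonglongrightarrow> 0"
  proof -
    have "e j / h j = (\<Sum>x\<in>S. \<Sum>y\<in>S. \<bar>(M j x y - tr (h j) x y) / h j\<bar>)" for j
      using h(1)[of j] by (simp add: e_def sum_divide_distrib abs_divide)
    moreover have "(\<lambda>j. \<Sum>x\<in>S. \<Sum>y\<in>S. \<bar>(M j x y - tr (h j) x y) / h j\<bar>) \<longlonglongrightarrow> (\<Sum>x\<in>S. \<Sum>y\<in>S. \<bar>0\<bar>)"
      by (intro tendsto_sum tendsto_rabs d)
    ultimately show ?thesis by simp
  qed
  then have "(\<lambda>j. (N j * h j) * (real (card S) * (e j / h j)) * (real (card S) * exp ((N j * h j) * norm_bound)))
    \<longlonglongrightarrow> t * (real (card S) * 0) * (real (card S) * exp (t * norm_bound))"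
    by (intro tendsto_intros N)
  moreover have "(N j * h j) * (real (card S) * (e j / h j)) = real (N j) * (real (card S) * e j)" for j
    using h(1)[of j] by simp
  ultimately have lim0: "(\<lambda>j. real (N j) * (real (card S) * e j) * (real (card S) * exp ((N j * h j) * norm_bound))) \<longlonglongrightarrow> 0" by simp
  have "\<bar>(matrix_op S (M j) ^^ N j) f x - matrix_op S (tr (N j * h j)) f x\<bar>
    \<le> real (N j) * (real (card S) * e j) * (real (card S) * exp (N j * h j * norm_bound))" for j
    using h(1)[of j] by (intro matrix_power_error M e e0 f \<open>x \<in> S\<close>) auto
  then have "(\<lambda>j. (matrix_op S (M j) ^^ N j) f x - matrix_op S (tr (N j * h j)) f x) \<longlonglongrightarrow> 0"
    by (intro Lim_null_comparison[OF _ lim0]) (auto intro: always_eventually)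
  moreover have "(\<lambda>j. matrix_op S (tr (N j * h j)) f x) \<longlonglongrightarrow> matrix_op S (tr t) f x"
    unfolding matrix_op_def
    by (intro tendsto_intros isCont_tendsto_compose[OF DERIV_isCont[OF tr_has_derivative[OF \<open>x \<in> S\<close>]] N])
  ultimately have "(\<lambda>j. ((matrix_op S (M j) ^^ N j) f x - matrix_op S (tr (N j * h j)) f x) + matrix_op S (tr (N j * h j)) f x)
    \<longlonglongrightarrow> 0 + matrix_op S (tr t) f x" by (rule tendsto_add)
  then show ?thesis by simp
qed

lemma tr_diff_quotient:
  assumes "x \<in> S" "y \<in> S" "\<And>j. 0 < h j" "h \<longlonglongrightarrow> 0"
  shows "(\<lambda>j. (tr (h j) x y - (if x = y then 1 else 0)) / h j) \<longlonglongrightarrow> G x y"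
proof -
  have "((\<lambda>s. (tr s x y - tr 0 x y) / s) \<longlongrightarrow> G x y) (at 0)"
    using tr_derivative_0[OF assms(1,2)] by (simp add: has_field_derivative_iff)
  moreover have "filterlim h (at 0) sequentially"
    using assms(3,4) by (intro filterlim_atI) (auto intro!: always_eventually simp: less_imp_neq[symmetric])
  ultimately show ?thesis using filterlim_compose assms(1) by (force simp: tr_0)
qed

text \<open>The power series has terms of both signs. For small \<open>h\<close>, however,
  \<open>1 + h * G\<close> is a stochastic matrix, and its powers converge to the exponential by
  \<open>chernoff\<close>.\<close>

lemma tr_nonneg:
  assumes "x \<in> S" "y \<in> S" "0 \<le> t" shows "0 \<le> tr t x y"
proof (cases "t = 0")
  case True
  then show ?thesis using assms by (simp add: tr_0)
next
  case False
  then have t: "0 < t" using assms by simp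
  \<comment> \<open>The offset \<open>J\<close> makes \<open>h j\<close> small enough for
    \<open>M j\<close> to be nonnegative already at \<open>j = 0\<close>.\<close>
  define J where "J = Suc (nat \<lceil>t * norm_bound\<rceil>)"
  have J: "t * norm_bound \<le> real J" "0 < J" unfolding J_def by linarith+
  define h where "h j = t / real (j + J)" for j
  define M where "M j x y = (if x = y then 1 else 0) + h j * G x y" for j x y
  define f where "f z = (if z = y then 1 else 0::real)" for z
  have h: "0 < h j" "h j * norm_bound \<le> 1" for j
  proof -
    show "0 < h j" using t J by (simp add: h_def)
    have "t * norm_bound \<le> real (j + J)" using J by simp
    then show "h j * norm_bound \<le> 1" using J by (simp add: h_def field_simps)
  qed
  have G_off: "0 \<le> G x y" if "x \<in> S" "y \<in> S" "x \<noteq> y" for x y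
    using rates that by (auto simp: rates_def generator_def)
  have M: "0 \<le> M j x y" if "x \<in> S" "y \<in> S" for j x y
  proof (cases "x = y")
    case True
    have "\<bar>G x x\<bar> \<le> norm_bound"
      using row_le[OF that(1)] member_le_sum[of x S "\<lambda>y. \<bar>G x y\<bar>"] finS that by auto
    then have "h j * \<bar>G x x\<bar> \<le> h j * norm_bound" using h(1)[of j] by (intro mult_left_mono) auto
    then have "h j * \<bar>G x x\<bar> \<le> 1" using h(2)[of j] by linarith
    moreover have "- (h j * G x x) \<le> h j * \<bar>G x x\<bar>" using h(1)[of j] by (simp add: abs_if)
    ultimately show ?thesis using True by (simp add: M_def)
  next
    case False
    then show ?thesis using G_off[OF that] h(1)[of j] by (simp add: M_def)
  qed
  have rows: "(\<Sum>y\<in>S. M j x y) = 1" if "x \<in> S" for j x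
    using that finS generator_row[OF that] by (simp add: M_def sum.distrib flip: sum_distrib_left)
  have h0: "h \<longlonglongrightarrow> 0"
    unfolding h_def using LIMSEQ_ignore_initial_segment[OF lim_const_over_n[of t], of J] .
  have N: "(\<lambda>j. real (j + J) * h j) \<longlonglongrightarrow> t" using J by (simp add: h_def)
  have d: "(\<lambda>j. (M j x y - tr (h j) x y) / h j) \<longlonglongrightarrow> 0" if "x \<in> S" "y \<in> S" for x y
  proof -
    have "(M j x y - tr (h j) x y) / h j = G x y - (tr (h j) x y - (if x = y then 1 else 0)) / h j" for j
      using h(1)[of j] by (simp add: M_def field_simps)
    then show ?thesis using tendsto_diff[OF tendsto_const tr_diff_quotient[OF that h(1) h0], of "G x y"] by simp
  qed
  have "(\<lambda>j. (matrix_op S (M j) ^^ (j + J)) f x) \<longlonglongrightarrow> matrix_op S (tr t) f x"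
    by (rule chernoff[OF M rows h(1) h0 N d _ assms(1)]) (auto simp: f_def)
  moreover have "0 \<le> (matrix_op S (M j) ^^ i) f x" if "x \<in> S" for i j x
    using that by (induction i arbitrary: x) (auto simp: f_def matrix_op_def intro!: sum_nonneg mult_nonneg_nonneg M)
  ultimately have "0 \<le> matrix_op S (tr t) f x" using assms(1) by (intro LIMSEQ_le_const) auto
  also have "\<dots> = tr t x y" using finS assms(2) by (simp add: matrix_op_def f_def if_distrib[of "\<lambda>u. _ * u"] cong: if_cong)
  finally show ?thesis .
qed

end

lemma steps_matrix_op:
  assumes "finite S" "\<And>x. x \<in> S \<Longrightarrow> set_pmf (\<kappa> x) \<subseteq> S" "x \<in> S" "\<And>x. finite (set_pmf (\<kappa> x))"
  shows "expect (steps \<kappa> N x) f = (matrix_op S (\<lambda>x y. pmf (\<kappa> x) y) ^^ N) f x"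
  using assms(3)
proof (induction N arbitrary: x)
  case (Suc N)
  interpret finite_kernel \<kappa> by unfold_locales (rule assms(4))
  have "expect (steps \<kappa> (Suc N) x) f = (\<Sum>y\<in>S. pmf (\<kappa> x) y * expect (steps \<kappa> N y) f)"
    unfolding expect_steps_Suc using assms Suc.prems by (intro expect_sum_set) auto
  also have "\<dots> = (\<Sum>y\<in>S. pmf (\<kappa> x) y * (matrix_op S (\<lambda>x y. pmf (\<kappa> x) y) ^^ N) f y)"
    by (intro sum.cong refl) (simp only: Suc.IH)
  also have "\<dots> = matrix_op S (\<lambda>x y. pmf (\<kappa> x) y) ((matrix_op S (\<lambda>x y. pmf (\<kappa> x) y) ^^ N) f) x"
    by (rule matrix_op_def[symmetric])
  finally show ?case by (simp only: funpow.simps o_def)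
qed simp


section \<open>Discretisation of a mixing chain\<close>

lemma pmf_embed_finite:
  assumes "finite V" "\<And>y. y \<in> V \<Longrightarrow> 0 \<le> f y" "(\<Sum>y\<in>V. f y) = 1"
  shows "pmf (embed_pmf (\<lambda>y. if y \<in> V then f y else 0)) x = (if x \<in> V then f x else (0::real))"
proof (rule pmf_embed_pmf)
  have "(\<integral>\<^sup>+y. ennreal (if y \<in> V then f y else 0) \<partial>count_space UNIV) = (\<integral>\<^sup>+y. ennreal (f y) * indicator V y \<partial>count_space UNIV)"
    by (intro nn_integral_cong) auto
  also have "\<dots> = (\<Sum>y\<in>V. ennreal (f y))"
    using assms(1) by (simp add: nn_integral_count_space_indicator[symmetric] nn_integral_count_space_finite)
  also have "\<dots> = ennreal (\<Sum>y\<in>V. f y)" using assms by (intro sum_ennreal) auto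
  finally show "(\<integral>\<^sup>+y. ennreal (if y \<in> V then f y else 0) \<partial>count_space UNIV) = 1" using assms by simp
qed (use assms in auto)

lemma expect_TV_le:
  assumes "finite V" "(\<Sum>y\<in>V. p y) = 1" "(\<Sum>y\<in>V. p' y) = 1" "\<And>y. 0 \<le> f y \<and> f y \<le> 1"
  shows "(\<Sum>y\<in>V. p y * f y) \<le> (\<Sum>y\<in>V. p' y * f y) + d_TV V p p'"
proof -
  \<comment> \<open>Both total masses are 1, so the constant 1/2 may be subtracted from
    \<open>f\<close>; this gains the factor 1/2 of \<open>d_TV\<close>.\<close>
  have "(\<Sum>y\<in>V. p y * f y) - (\<Sum>y\<in>V. p' y * f y) = (\<Sum>y\<in>V. (p y - p' y) * (f y - 1/2))"
    using assms(2,3) by (simp add: algebra_simps sum_subtractf sum.distrib flip: sum_divide_distrib)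
  also have "\<dots> \<le> (\<Sum>y\<in>V. \<bar>p y - p' y\<bar> * (1/2))"
  proof (rule sum_mono)
    fix y
    have "(p y - p' y) * (f y - 1/2) \<le> \<bar>p y - p' y\<bar> * \<bar>f y - 1/2\<bar>" by (simp flip: abs_mult)
    also have "\<dots> \<le> \<bar>p y - p' y\<bar> * (1/2)" using assms(4)[of y] by (intro mult_left_mono) linarith+
    finally show "(p y - p' y) * (f y - 1/2) \<le> \<bar>p y - p' y\<bar> * (1/2)" .
  qed
  finally show ?thesis unfolding d_TV_def by (simp add: sum_divide_distrib)
qed

locale mf_chain = finite_rates V q for V :: "nat set" and q :: "nat \<Rightarrow> nat \<Rightarrow> real" +
  fixes \<pi> :: "nat \<Rightarrow> real"
  assumes card_V: "2 \<le> card V" and mixing: "mixing V q \<pi>"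
begin

lemma \<pi>_nonneg: "x \<in> V \<Longrightarrow> 0 \<le> \<pi> x" and \<pi>_sum: "(\<Sum>x\<in>V. \<pi> x) = 1"
  and \<pi>_stat: "0 \<le> t \<Longrightarrow> y \<in> V \<Longrightarrow> (\<Sum>x\<in>V. \<pi> x * tr t x y) = \<pi> y"
  and \<pi>_lim: "x \<in> V \<Longrightarrow> y \<in> V \<Longrightarrow> ((\<lambda>t. tr t x y) \<longlongrightarrow> \<pi> y) at_top"
  using mixing unfolding mixing_def stationary_def by auto

lemma V_ne: "V \<noteq> {}" using card_V by auto

abbreviation T :: real where "T \<equiv> t_mix V q \<pi>"
abbreviation pmax :: real where "pmax \<equiv> (MAX x\<in>V. \<pi> x)"

lemma pmax: "x \<in> V \<Longrightarrow> \<pi> x \<le> pmax" using finS by (intro Max_ge) auto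

text \<open>\<open>LEAST\<close> over the reals is meaningful only if the minimum is attained. The
  admissible times form a closed set by continuity of \<open>tr\<close> in time, nonempty by
  convergence, so they contain their infimum.\<close>

lemma t_mix_props: "0 \<le> T" "x \<in> V \<Longrightarrow> d_TV V (tr T x) \<pi> \<le> 1/4"
proof -
  define A where "A = (\<Inter>x\<in>V. {t. 0 \<le> t \<and> d_TV V (tr t x) \<pi> \<le> 1/4})"
  have A_iff: "t \<in> A \<longleftrightarrow> 0 \<le> t \<and> (MAX x\<in>V. d_TV V (tr t x) \<pi>) \<le> 1/4" for t
  proof -
    have "(MAX x\<in>V. d_TV V (tr t x) \<pi>) \<le> 1/4 \<longleftrightarrow> (\<forall>x\<in>V. d_TV V (tr t x) \<pi> \<le> 1/4)"
      using finS V_ne by (subst Max_le_iff) auto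
    then show ?thesis using V_ne by (auto simp: A_def)
  qed
  have cont: "continuous_on UNIV (\<lambda>t. d_TV V (tr t x) \<pi>)" if "x \<in> V" for x
    unfolding d_TV_def using that by (intro continuous_intros tr_continuous)
  have "closed A" unfolding A_def
  proof (intro closed_INT ballI)
    fix x assume "x \<in> V"
    show "closed {t. 0 \<le> t \<and> d_TV V (tr t x) \<pi> \<le> 1/4}"
      using cont[OF \<open>x \<in> V\<close>] by (intro closed_Collect_conj closed_Collect_le) (auto intro: continuous_intros)
  qed
  moreover have "A \<noteq> {}"
  proof -
    have "\<forall>\<^sub>F t in at_top. \<forall>x\<in>V. d_TV V (tr t x) \<pi> < 1/4"
    proof (intro eventually_ball_finite finS ballI)
      fix x assume "x \<in> V"
      have "((\<lambda>t. d_TV V (tr t x) \<pi>) \<longlongrightarrow> d_TV V \<pi> \<pi>) at_top"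
        unfolding d_TV_def using \<open>x \<in> V\<close> by (intro tendsto_intros \<pi>_lim)
      then show "\<forall>\<^sub>F t in at_top. d_TV V (tr t x) \<pi> < 1/4"
        by (rule order_tendstoD) (simp add: d_TV_def)
    qed
    then have "\<forall>\<^sub>F t in at_top. 0 \<le> t \<and> (\<forall>x\<in>V. d_TV V (tr t x) \<pi> < 1/4)"
      by (intro eventually_conj eventually_ge_at_top)
    then obtain t where "0 \<le> t" "\<forall>x\<in>V. d_TV V (tr t x) \<pi> < 1/4"
      unfolding eventually_at_top_linorder by blast
    then have "t \<in> A" by (auto simp: A_def less_imp_le)
    then show ?thesis by auto
  qed
  moreover have "bdd_below A" using V_ne by (intro bdd_belowI[of _ 0]) (auto simp: A_def)
  ultimately have Inf: "Inf A \<in> A" by (intro closed_contains_Inf)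
  have "T = (LEAST t. t \<in> A)" unfolding t_mix_def A_iff ..
  also have "\<dots> = Inf A" using Inf \<open>bdd_below A\<close> by (intro Least_equality cInf_lower)
  finally have "T \<in> A" using Inf by simp
  then show "0 \<le> T" "x \<in> V \<Longrightarrow> d_TV V (tr T x) \<pi> \<le> 1/4" using V_ne by (auto simp: A_def)
qed

text \<open>For \<open>T = 0\<close> every point mass would be within 1/4 of \<open>\<pi>\<close>,
  giving at least two states mass 3/4 each. Positivity matters because the meshes are fractions of
  \<open>T\<close>.\<close>

lemma T_pos: "0 < T"
proof (rule ccontr)
  assume "\<not> 0 < T"
  then have T0: "T = 0" using t_mix_props(1) by simp
  have "3/4 \<le> \<pi> x" if x: "x \<in> V" for x
  proof -
    have "1 - \<pi> x \<le> d_TV V (tr 0 x) \<pi>"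
    proof -
      have "(\<Sum>y\<in>V. tr 0 x y * (if y = x then 1 else 0)) \<le> (\<Sum>y\<in>V. \<pi> y * (if y = x then 1 else 0)) + d_TV V (tr 0 x) \<pi>"
        by (intro expect_TV_le finS tr_row x \<pi>_sum) auto
      then show ?thesis using x finS by (simp add: tr_0 if_distrib[of "\<lambda>u. _ * u"] cong: if_cong)
    qed
    then show ?thesis using t_mix_props(2)[OF x] T0 by simp
  qed
  then have "(\<Sum>x\<in>V. 3/4) \<le> (\<Sum>x\<in>V. \<pi> x)" by (intro sum_mono)
  then show False using card_V by (simp add: \<pi>_sum)
qed

definition \<pi>p :: "nat pmf" where "\<pi>p = embed_pmf (\<lambda>y. if y \<in> V then \<pi> y else 0)"

text \<open>Outside \<open>V\<close> the chain jumps to equilibrium, so that range and mixing bounds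
  hold from every natural number.\<close>

definition Pk :: "real \<Rightarrow> nat \<Rightarrow> nat pmf" where
  "Pk h x = (if x \<in> V then embed_pmf (\<lambda>y. if y \<in> V then tr h x y else 0) else \<pi>p)"

lemma pmf_\<pi>p: "pmf \<pi>p y = (if y \<in> V then \<pi> y else 0)"
  unfolding \<pi>p_def by (intro pmf_embed_finite finS \<pi>_nonneg \<pi>_sum)

lemma pmf_Pk: "0 \<le> h \<Longrightarrow> x \<in> V \<Longrightarrow> pmf (Pk h x) y = (if y \<in> V then tr h x y else 0)"
  unfolding Pk_def by (simp add: pmf_embed_finite finS tr_nonneg tr_row)

lemma set_\<pi>p: "set_pmf \<pi>p \<subseteq> V" by (auto simp: set_pmf_eq pmf_\<pi>p split: if_splits)

lemma set_Pk: "0 \<le> h \<Longrightarrow> set_pmf (Pk h x) \<subseteq> V"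
proof (cases "x \<in> V")
  case True
  then show "0 \<le> h \<Longrightarrow> ?thesis" by (auto simp: set_pmf_eq pmf_Pk split: if_splits)
next
  case False
  then show "0 \<le> h \<Longrightarrow> ?thesis" using set_\<pi>p by (simp add: Pk_def)
qed

lemma expect_\<pi>p: "expect \<pi>p f = (\<Sum>y\<in>V. \<pi> y * f y)"
  using set_\<pi>p finS by (subst expect_sum_set[of V]) (auto simp: pmf_\<pi>p)

lemma expect_Pk: "0 \<le> h \<Longrightarrow> x \<in> V \<Longrightarrow> expect (Pk h x) f = (\<Sum>y\<in>V. tr h x y * f y)"
  using set_Pk[of h x] finS by (subst expect_sum_set[of V]) (auto simp: pmf_Pk)

lemma fin_Pk: "0 \<le> h \<Longrightarrow> finite (set_pmf (Pk h x))"
  using set_Pk finS finite_subset by blast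

lemma bind_\<pi>p: assumes "0 \<le> h" shows "bind_pmf \<pi>p (Pk h) = \<pi>p"
proof (rule pmf_eqI)
  fix y
  have "pmf (bind_pmf \<pi>p (Pk h)) y = (\<Sum>x\<in>V. \<pi> x * pmf (Pk h x) y)"
    by (simp add: pmf_bind expect_\<pi>p)
  also have "\<dots> = pmf \<pi>p y"
    using assms by (cases "y \<in> V") (simp_all add: pmf_Pk pmf_\<pi>p \<pi>_stat cong: sum.cong)
  finally show "pmf (bind_pmf \<pi>p (Pk h)) y = pmf \<pi>p y" .
qed

lemma expect_steps_Pk:
  assumes "0 \<le> h" "x \<in> V"
  shows "expect (steps (Pk h) N x) f = (\<Sum>y\<in>V. tr (N * h) x y * f y)"
  using assms(2)
proof (induction N arbitrary: x)
  case 0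
  have "(\<Sum>y\<in>V. tr 0 x y * f y) = (\<Sum>y\<in>V. if x = y then f y else 0)"
    using 0 by (intro sum.cong refl) (simp add: tr_0)
  then show ?case using 0 finS by simp
next
  case (Suc N)
  interpret fk: finite_kernel "Pk h" by unfold_locales (rule fin_Pk[OF assms(1)])
  have "expect (steps (Pk h) (Suc N) x) f = (\<Sum>z\<in>V. tr h x z * (\<Sum>y\<in>V. tr (N * h) z y * f y))"
    unfolding fk.expect_steps_Suc expect_Pk[OF assms(1) Suc.prems] by (intro sum.cong refl) (simp only: Suc.IH)
  also have "\<dots> = matrix_op V (tr h) (matrix_op V (tr (N * h)) f) x" by (simp add: matrix_op_def)
  also have "\<dots> = matrix_op V (tr (h + N * h)) f x" by (rule matrix_op_tr_add[OF Suc.prems, symmetric])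
  finally show ?case by (simp add: matrix_op_def algebra_simps)
qed

text \<open>Each period \<open>t_mix\<close> halves the oscillation of \<open>P\<^sub>t f\<close>.\<close>

lemma oscillation:
  assumes f: "\<And>y. 0 \<le> f y \<and> f y \<le> (1::real)" and "x \<in> V" "y \<in> V"
  shows "matrix_op V (tr (real J * T)) f x - matrix_op V (tr (real J * T)) f y \<le> (1/2) ^ J"
  using assms(2,3)
proof (induction J arbitrary: x y)
  case 0
  have "matrix_op V (tr 0) f x = f x" if "x \<in> V" for x
  proof -
    have "matrix_op V (tr 0) f x = (\<Sum>y\<in>V. if x = y then f y else 0)"
      unfolding matrix_op_def using that by (intro sum.cong refl) (simp add: tr_0)
    then show ?thesis using that finS by simp
  qed
  then show ?case using 0 f[of x] f[of y] by simp
next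
  case (Suc J)
  define g where "g = matrix_op V (tr (real J * T)) f"
  define lo where "lo = Min (g ` V)"
  have lo: "lo \<le> g z" if "z \<in> V" for z using finS that by (simp add: lo_def)
  obtain z0 where z0: "z0 \<in> V" "g z0 = lo"
  proof -
    have "lo \<in> g ` V" unfolding lo_def using finS V_ne by (intro Min_in) auto
    then show thesis using that by auto
  qed
  define c where "c = (1/2::real) ^ J"
  have c: "0 < c" by (simp add: c_def)
  \<comment> \<open>The oscillation of \<open>g\<close> rescaled to [0,1]; two averages within 1/4
    of the mean under \<open>\<pi>\<close> differ by at most 1/2.\<close>
  define f' where "f' z = (if z \<in> V then (g z - lo) / c else 0)" for z
  have f': "0 \<le> f' z \<and> f' z \<le> 1" for z
    using lo[of z] Suc.IH[of z z0] z0 c by (auto simp: f'_def g_def c_def)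
  have avg: "\<bar>(\<Sum>z\<in>V. tr T x z * f' z) - (\<Sum>z\<in>V. \<pi> z * f' z)\<bar> \<le> 1/4" if x: "x \<in> V" for x
  proof -
    have tv: "d_TV V (tr T x) \<pi> \<le> 1/4" "d_TV V \<pi> (tr T x) \<le> 1/4"
      using t_mix_props(2)[OF x] by (simp_all add: d_TV_def abs_minus_commute)
    show ?thesis
      using expect_TV_le[where f = f', OF finS tr_row[OF x, of T] \<pi>_sum f'] expect_TV_le[where f = f', OF finS \<pi>_sum tr_row[OF x, of T] f'] tv by linarith
  qed
  have gx: "matrix_op V (tr (real (Suc J) * T)) f x = lo + c * (\<Sum>z\<in>V. tr T x z * f' z)" if x: "x \<in> V" for x
  proof -
    have "matrix_op V (tr (real (Suc J) * T)) f x = matrix_op V (tr T) g x"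
      unfolding g_def using matrix_op_tr_add[OF x, of T "real J * T" f] by (simp add: algebra_simps)
    also have "\<dots> = (\<Sum>z\<in>V. tr T x z * (lo + c * f' z))"
      unfolding matrix_op_def using c by (intro sum.cong refl) (simp add: f'_def)
    also have "\<dots> = lo * (\<Sum>z\<in>V. tr T x z) + c * (\<Sum>z\<in>V. tr T x z * f' z)"
      by (simp add: algebra_simps sum.distrib sum_distrib_left)
    finally show ?thesis using tr_row[OF x] by simp
  qed
  have "matrix_op V (tr (real (Suc J) * T)) f x - matrix_op V (tr (real (Suc J) * T)) f y
    = c * ((\<Sum>z\<in>V. tr T x z * f' z) - (\<Sum>z\<in>V. tr T y z * f' z))"
    using gx Suc.prems by (simp add: algebra_simps)
  also have "\<dots> \<le> c * (1/2)" using avg[OF Suc.prems(1)] avg[OF Suc.prems(2)] c by (intro mult_left_mono) linarith+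
  finally show ?case by (simp add: c_def)
qed

text \<open>By stationarity the values at time \<open>s\<close> have mean
  \<open>expect \<pi>p f\<close> under \<open>\<pi>\<close>, and by \<open>oscillation\<close> no
  value on \<open>V\<close> exceeds another by more than \<open>(1/2) ^ J\<close>; hence none
  exceeds the mean by more.\<close>

lemma steps_mixing:
  assumes h: "0 < h" and sh: "real s * h = real J * T" "0 < s" and f: "\<And>y. 0 \<le> f y \<and> f y \<le> 1"
  shows "expect (steps (Pk h) s x) f \<le> expect \<pi>p f + (1/2) ^ J"
proof -
  interpret fk: finite_kernel "Pk h" by unfold_locales (rule fin_Pk, use h in simp)
  have stat: "expect \<pi>p (\<lambda>x. expect (Pk h x) f) = expect \<pi>p f" for f
    using expect_bind[of \<pi>p "Pk h" f] bind_\<pi>p[of h] h fk.fin set_\<pi>p finS by (simp add: finite_subset)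
  have stats: "expect \<pi>p (\<lambda>x. expect (steps (Pk h) N x) f) = expect \<pi>p f" for N
  proof (induction N)
    case (Suc N)
    have "expect \<pi>p (\<lambda>x. expect (steps (Pk h) (Suc N) x) f) = expect \<pi>p (\<lambda>x. expect (Pk h x) (\<lambda>y. expect (steps (Pk h) N y) f))"
      by (intro expect_cong fk.expect_steps_Suc)
    also have "\<dots> = expect \<pi>p (\<lambda>y. expect (steps (Pk h) N y) f)" by (rule stat)
    finally show ?case by (simp only: Suc)
  qed simp
  show ?thesis
  proof (cases "x \<in> V")
    case True
    define g where "g = matrix_op V (tr (real J * T)) f"
    have Eg: "expect (steps (Pk h) s x) f = g x" if "x \<in> V" for x
      using expect_steps_Pk[of h x s f] that h sh by (simp add: g_def matrix_op_def)
    have "g x - (1/2) ^ J = expect \<pi>p (\<lambda>_. g x - (1/2) ^ J)" by simp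
    also have "\<dots> \<le> expect \<pi>p (\<lambda>y. expect (steps (Pk h) s y) f)"
    proof (rule expect_mono)
      fix y assume "y \<in> set_pmf \<pi>p"
      then have y: "y \<in> V" using set_\<pi>p by auto
      show "g x - (1/2) ^ J \<le> expect (steps (Pk h) s y) f"
        using oscillation[where f = f, OF f True y, of J] Eg[OF y] by (simp add: g_def)
    qed (use set_\<pi>p finS finite_subset in blast)
    finally show ?thesis using stats[of s] Eg[OF True] by simp
  next
    case False
    obtain s' where s': "s = Suc s'" using sh(2) by (cases s) auto
    have "expect (steps (Pk h) s x) f = expect \<pi>p (\<lambda>y. expect (steps (Pk h) s' y) f)"
      unfolding s' fk.expect_steps_Suc using False by (simp add: Pk_def[of h x])
    then show ?thesis using stats[of s'] by simp
  qed
qed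

end


section \<open>The generator of the discretised coalescing walks\<close>

context mf_chain
begin

abbreviation Sc :: "nat set set" where "Sc \<equiv> Pow V - {{}}"
abbreviation cr :: "nat set \<Rightarrow> nat set \<Rightarrow> real" where "cr \<equiv> coalescing_rate V q"

sublocale cc: finite_rates Sc cr
proof
  show "rates Sc cr"
    using rates unfolding rates_def coalescing_rate_def by (auto intro!: sum_nonneg)
qed (use finS in simp)

text \<open>The entry is a finite sum of products over sites of transition probabilities. In the
  derivative at 0 the product rule lets one site move, at its rate, while all others stay put;
  single moves of occupied sites carrying \<open>A\<close> to \<open>B\<close> are exactly those
  counted by \<open>coalescing_rate\<close>.\<close>

lemma coal_derivative:
  assumes A: "A \<in> Sc" "B \<in> Sc" "A \<noteq> B" and h: "\<And>j. 0 < h j" "h \<longlonglongrightarrow> 0"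
  shows "(\<lambda>j. pmf (coal V (Pk (h j)) A) B / h j) \<longlonglongrightarrow> cr A B"
proof -
  define Z where "Z = PiE_dflt V (0::nat) (\<lambda>_. V)"
  have finZ: "finite Z" unfolding Z_def using finS by (intro finite_PiE_dflt) auto
  define ind where "ind z = (if z ` A = B then 1 else 0::real)" for z :: "nat \<Rightarrow> nat"
  define F where "F s = (\<Sum>z\<in>Z. ind z * (\<Prod>v\<in>V. tr s v (z v)))" for s
  \<comment> \<open>The configuration in which no site moves, with the default 0 outside
    \<open>V\<close> as in the product distribution.\<close>
  define i0 where "i0 u = (if u \<in> V then u else 0::nat)" for u
  have pmf_F: "pmf (coal V (Pk s) A) B = F s" if "0 \<le> s" for s
  proof -
    have sub: "set_pmf (Pi_pmf V 0 (Pk s)) \<subseteq> Z"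
      using set_Pk[OF that] unfolding set_Pi_pmf[OF finS] Z_def by (auto simp: PiE_dflt_def)
    have "pmf (coal V (Pk s) A) B = expect (coal V (Pk s) A) (indicator {B})" by (simp add: measure_pmf_single)
    also have "\<dots> = expect (Pi_pmf V 0 (Pk s)) ind"
      unfolding coal_def integral_map_pmf by (intro expect_cong) (simp add: ind_def indicator_def)
    also have "\<dots> = (\<Sum>z\<in>Z. pmf (Pi_pmf V 0 (Pk s)) z * ind z)" by (rule expect_sum_set[OF finZ sub])
    also have "\<dots> = F s" unfolding F_def
    proof (intro sum.cong refl)
      fix z assume z: "z \<in> Z"
      have "pmf (Pi_pmf V 0 (Pk s)) z = (\<Prod>v\<in>V. pmf (Pk s v) (z v))"
        using z finS by (intro pmf_Pi') (auto simp: Z_def PiE_dflt_def)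
      also have "\<dots> = (\<Prod>v\<in>V. tr s v (z v))"
        using z that by (intro prod.cong refl) (auto simp: pmf_Pk Z_def PiE_dflt_def)
      finally show "pmf (Pi_pmf V 0 (Pk s)) z * ind z = ind z * (\<Prod>v\<in>V. tr s v (z v))" by simp
    qed
    finally show ?thesis .
  qed
  have prod0: "(\<Prod>u\<in>W. tr 0 u (z u)) = (if \<forall>u\<in>W. z u = u then 1 else 0)" if "W \<subseteq> V" for W and z :: "nat \<Rightarrow> nat"
  proof (cases "\<forall>u\<in>W. z u = u")
    case True
    then show ?thesis using that by (auto simp: tr_0 intro!: prod.neutral)
  next
    case False
    then obtain u where "u \<in> W" "z u \<noteq> u" by auto
    then show ?thesis using that finS False by (auto simp: tr_0 intro!: prod_zero finite_subset[of W V] bexI[of _ u])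
  qed
  have F0: "F 0 = 0"
  proof -
    have "ind z * (\<Prod>v\<in>V. tr 0 v (z v)) = 0" for z
    proof (cases "\<forall>u\<in>V. z u = u")
      case True
      then have "z ` A = A" using A(1) by (force simp: image_def)
      then show ?thesis using A(3) by (simp add: ind_def)
    qed (auto simp: prod0)
    then show ?thesis unfolding F_def by (intro sum.neutral ballI)
  qed
  have "(F has_field_derivative (\<Sum>z\<in>Z. ind z * (\<Sum>v\<in>V. G v (z v) * (\<Prod>u\<in>V - {v}. tr 0 u (z u))))) (at 0)"
    unfolding F_def
  proof (intro DERIV_sum DERIV_cmult has_field_derivative_prod)
    fix z v assume "z \<in> Z" "v \<in> V"
    then show "((\<lambda>s. tr s v (z v)) has_real_derivative G v (z v)) (at 0)"
      by (intro tr_derivative_0) (auto simp: Z_def PiE_dflt_def)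
  qed
  moreover have "(\<Sum>z\<in>Z. ind z * (\<Sum>v\<in>V. G v (z v) * (\<Prod>u\<in>V - {v}. tr 0 u (z u)))) = cr A B"
  proof -
    have "(\<Sum>z\<in>Z. ind z * (\<Sum>v\<in>V. G v (z v) * (\<Prod>u\<in>V - {v}. tr 0 u (z u))))
      = (\<Sum>v\<in>V. \<Sum>z\<in>Z. ind z * (G v (z v) * (\<Prod>u\<in>V - {v}. tr 0 u (z u))))"
      by (simp only: sum_distrib_left) (rule sum.swap)
    also have "\<dots> = (\<Sum>v\<in>V. \<Sum>w\<in>V. ind (i0(v := w)) * G v w)"
    proof (rule sum.cong[OF refl])
      fix v assume v: "v \<in> V"
      have inj: "inj_on (\<lambda>w. i0(v := w)) V" by (auto simp: inj_on_def dest: fun_cong[of _ _ v])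
      have sub: "(\<lambda>w. i0(v := w)) ` V \<subseteq> Z" using v by (auto simp: Z_def PiE_dflt_def i0_def)
      have "(\<Sum>z\<in>Z. ind z * (G v (z v) * (\<Prod>u\<in>V - {v}. tr 0 u (z u))))
        = (\<Sum>z\<in>(\<lambda>w. i0(v := w)) ` V. ind z * (G v (z v) * (\<Prod>u\<in>V - {v}. tr 0 u (z u))))"
      proof (intro sum.mono_neutral_right finZ sub ballI)
        fix z assume z: "z \<in> Z - (\<lambda>w. i0(v := w)) ` V"
        have "\<not> (\<forall>u\<in>V - {v}. z u = u)"
        proof
          assume "\<forall>u\<in>V - {v}. z u = u"
          then have "z = i0(v := z v)" using z by (auto simp: fun_eq_iff i0_def Z_def PiE_dflt_def)
          moreover have "z v \<in> V" using z v by (auto simp: Z_def PiE_dflt_def)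
          ultimately show False using z by blast
        qed
        then show "ind z * (G v (z v) * (\<Prod>u\<in>V - {v}. tr 0 u (z u))) = 0" by (subst prod0) auto
      qed
      also have "\<dots> = (\<Sum>w\<in>V. ind (i0(v := w)) * (G v w * (\<Prod>u\<in>V - {v}. tr 0 u ((i0(v := w)) u))))"
        by (subst sum.reindex[OF inj]) simp
      also have "\<dots> = (\<Sum>w\<in>V. ind (i0(v := w)) * G v w)"
        by (intro sum.cong refl, subst prod0) (auto simp: i0_def)
      finally show "(\<Sum>z\<in>Z. ind z * (G v (z v) * (\<Prod>u\<in>V - {v}. tr 0 u (z u)))) = (\<Sum>w\<in>V. ind (i0(v := w)) * G v w)" .
    qed
    also have "\<dots> = (\<Sum>v\<in>A. \<Sum>w\<in>V. ind (i0(v := w)) * G v w)"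
    proof (rule sum.mono_neutral_right)
      \<comment> \<open>A move of an unoccupied site leaves the occupied set at \<open>A\<close>,
        which differs from \<open>B\<close>.\<close>
      show "\<forall>v\<in>V - A. (\<Sum>w\<in>V. ind (i0(v := w)) * G v w) = 0"
      proof (intro ballI sum.neutral)
        fix v w assume "v \<in> V - A"
        then have "(i0(v := w)) ` A = A" using A(1) by (force simp: image_def i0_def)
        then show "ind (i0(v := w)) * G v w = 0" using A(3) by (simp add: ind_def)
      qed
    qed (use A finS in auto)
    also have "\<dots> = cr A B"
      unfolding coalescing_rate_def
    proof (rule sum.cong[OF refl])
      fix v assume v: "v \<in> A"
      have im: "(i0(v := w)) ` A = insert w (A - {v})" for w
        using v A(1) by (force simp: image_def i0_def)
      have "(\<Sum>w\<in>V. ind (i0(v := w)) * G v w) = (\<Sum>w\<in>V - {v}. ind (i0(v := w)) * G v w)"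
      proof (rule sum.mono_neutral_right)
        show "\<forall>w\<in>V - (V - {v}). ind (i0(v := w)) * G v w = 0"
          unfolding ind_def im using A(3) v by (auto simp: insert_absorb)
      qed (use finS in auto)
      also have "\<dots> = (\<Sum>w\<in>V - {v}. if insert w (A - {v}) = B then q v w else 0)"
        unfolding ind_def im by (intro sum.cong refl) (auto simp: generator_def)
      also have "\<dots> = (\<Sum>w\<in>{w \<in> V - {v}. insert w (A - {v}) = B}. q v w)"
        using finS by (intro sum.inter_filter[symmetric]) auto
      finally show "(\<Sum>w\<in>V. ind (i0(v := w)) * G v w) = (\<Sum>w\<in>{w \<in> V - {v}. insert w (A - {v}) = B}. q v w)" .
    qed
    finally show ?thesis .
  qed
  ultimately have "((\<lambda>s. (F s - F 0) / s) \<longlongrightarrow> cr A B) (at 0)" by (simp add: has_field_derivative_iff)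
  moreover have "filterlim h (at 0) sequentially"
    using h by (intro filterlim_atI) (auto intro!: always_eventually simp: less_imp_neq[symmetric])
  ultimately have "(\<lambda>j. (F (h j) - F 0) / h j) \<longlonglongrightarrow> cr A B" by (rule filterlim_compose)
  then show ?thesis using F0 pmf_F h(1) by (simp add: less_imp_le)
qed

lemma set_coal:
  assumes "0 \<le> h" "A \<in> Sc" shows "set_pmf (coal V (Pk h) A) \<subseteq> Sc"
proof
  fix B assume "B \<in> set_pmf (coal V (Pk h) A)"
  then obtain z where z: "z \<in> set_pmf (Pi_pmf V 0 (Pk h))" "B = z ` A" by (auto simp: coal_def)
  have "z v \<in> V" if "v \<in> V" for v using Pi_pmf_range[OF finS z(1) that] set_Pk[OF assms(1)] by blast
  then show "B \<in> Sc" using z(2) assms(2) by blast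
qed

lemma fin_coal: "0 \<le> h \<Longrightarrow> finite (set_pmf (coal V (Pk h) A))"
  unfolding coal_def by (simp add: finite_set_Pi_pmf finS fin_Pk)

text \<open>Off the diagonal the condition of \<open>chernoff\<close> is
  \<open>coal_derivative\<close>; on the diagonal it follows because the rows of both matrices sum
  to 1.\<close>

lemma coal_limit:
  assumes h: "\<And>j. 0 < h j" "h \<longlonglongrightarrow> 0" and N: "(\<lambda>j. real (N j) * h j) \<longlonglongrightarrow> t"
    and f: "\<And>y. y \<in> Sc \<Longrightarrow> \<bar>f y\<bar> \<le> 1" and A: "A \<in> Sc"
  shows "(\<lambda>j. expect (steps (coal V (Pk (h j))) (N j) A) f) \<longlonglongrightarrow> matrix_op Sc (cc.tr t) f A"
proof -
  have h0: "0 \<le> h j" for j using h(1)[of j] by simp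
  define M where "M j A B = pmf (coal V (Pk (h j)) A) B" for j A B
  have rows: "(\<Sum>B\<in>Sc. M j A B) = 1" if "A \<in> Sc" for j A
    unfolding M_def using set_coal[OF h0 that] cc.finS by (intro sum_pmf_eq_1)
  have off: "(\<lambda>j. (M j A B - cc.tr (h j) A B) / h j) \<longlonglongrightarrow> 0" if "A \<in> Sc" "B \<in> Sc" "A \<noteq> B" for A B
  proof -
    have "cc.G A B = cr A B" using that by (simp add: generator_def)
    then have "(\<lambda>j. M j A B / h j - (cc.tr (h j) A B - (if A = B then 1 else 0)) / h j) \<longlonglongrightarrow> cr A B - cr A B"
      unfolding M_def using cc.tr_diff_quotient[OF that(1,2) h]
      by (intro tendsto_diff coal_derivative[OF that h]) simp
    then show ?thesis using that by (simp add: diff_divide_distrib)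
  qed
  have d: "(\<lambda>j. (M j A B - cc.tr (h j) A B) / h j) \<longlonglongrightarrow> 0" if AB: "A \<in> Sc" "B \<in> Sc" for A B
  proof (cases "A = B")
    case True
    have "(M j A A - cc.tr (h j) A A) / h j = - (\<Sum>B\<in>Sc - {A}. (M j A B - cc.tr (h j) A B) / h j)" for j
    proof -
      have "(\<Sum>B\<in>Sc. M j A B - cc.tr (h j) A B) = 0"
        using rows[OF AB(1)] cc.tr_row[OF AB(1)] by (simp add: sum_subtractf)
      then have "M j A A - cc.tr (h j) A A = - (\<Sum>B\<in>Sc - {A}. M j A B - cc.tr (h j) A B)"
        using sum.remove[OF cc.finS AB(1), of "\<lambda>B. M j A B - cc.tr (h j) A B"] by simp
      then show ?thesis by (simp add: sum_divide_distrib)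
    qed
    moreover have "(\<lambda>j. - (\<Sum>B\<in>Sc - {A}. (M j A B - cc.tr (h j) A B) / h j)) \<longlonglongrightarrow> - (\<Sum>B\<in>Sc - {A}. 0)"
      using AB(1) by (intro tendsto_minus tendsto_sum off) auto
    ultimately show ?thesis using True by simp
  qed (rule off[OF AB])
  have "(\<lambda>j. (matrix_op Sc (M j) ^^ N j) f A) \<longlonglongrightarrow> matrix_op Sc (cc.tr t) f A"
    by (rule cc.chernoff[OF _ rows h N d f A]) (simp_all add: M_def)
  moreover have "expect (steps (coal V (Pk (h j))) (N j) A) f = (matrix_op Sc (M j) ^^ N j) f A" for j
    unfolding M_def by (intro steps_matrix_op cc.finS set_coal h0 A fin_coal)
  ultimately show ?thesis by simp
qed

end


section \<open>Estimates in continuous time\<close>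

lemma nn_integral_step_function:
  fixes a :: "nat \<Rightarrow> real"
  assumes h: "0 < h"
  shows "(\<integral>\<^sup>+x. ennreal (a (nat \<lfloor>x / h\<rfloor>)) * indicator {0..} x \<partial>lborel) = (\<Sum>t. ennreal (a t) * ennreal h)"
    and "(\<lambda>x. ennreal (a (nat \<lfloor>x / h\<rfloor>)) * indicator {0..} x) \<in> borel_measurable borel"
proof -
  define I where "I t = {real t * h..<real (Suc t) * h}" for t
  have mem: "x \<in> I t \<longleftrightarrow> 0 \<le> x \<and> t = nat \<lfloor>x / h\<rfloor>" for x t
  proof -
    have "x \<in> I t \<longleftrightarrow> real t \<le> x / h \<and> x / h < real t + 1"
      using h by (simp add: I_def field_simps)
    also have "\<dots> \<longleftrightarrow> 0 \<le> x / h \<and> t = nat \<lfloor>x / h\<rfloor>" by linarith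
    finally show ?thesis using h by (simp add: zero_le_divide_iff)
  qed
  have eq: "ennreal (a (nat \<lfloor>x / h\<rfloor>)) * indicator {0..} x = (\<Sum>t. ennreal (a t) * indicator (I t) x)" for x
  proof (cases "0 \<le> x")
    case True
    have "(\<Sum>t. ennreal (a t) * indicator (I t) x) = (\<Sum>t\<in>{nat \<lfloor>x / h\<rfloor>}. ennreal (a t) * indicator (I t) x)"
      by (intro suminf_finite) (auto simp: mem indicator_def)
    then show ?thesis using True by (simp add: mem indicator_def)
  qed (simp add: mem indicator_def)
  have [measurable]: "I t \<in> sets borel" for t unfolding I_def by simp
  show "(\<lambda>x. ennreal (a (nat \<lfloor>x / h\<rfloor>)) * indicator {0..} x) \<in> borel_measurable borel"
    unfolding eq by measurable
  have "emeasure lborel (I t) = ennreal h" for t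
    unfolding I_def using h by (subst emeasure_lborel_Ico) (auto simp: algebra_simps)
  then show "(\<integral>\<^sup>+x. ennreal (a (nat \<lfloor>x / h\<rfloor>)) * indicator {0..} x \<partial>lborel) = (\<Sum>t. ennreal (a t) * ennreal h)"
    unfolding eq by (subst nn_integral_suminf) (auto simp: nn_integral_cmult_indicator)
qed

context mf_chain
begin

definition meetc :: "real \<Rightarrow> nat \<Rightarrow> real" where
  "meetc h t = expect \<pi>p (\<lambda>x. expect \<pi>p (pair_hit (Pk h) t x))"

text \<open>Repeated halving of \<open>T\<close> makes the mixing time a whole number of steps on
  every grid and each grid a refinement of the preceding one; the latter gives monotone
  approximations of meeting times.\<close>

definition mesh :: "nat \<Rightarrow> real" where "mesh j = T / 2 ^ j"

lemma mesh: "0 < mesh j" "mesh \<longlonglongrightarrow> 0"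
proof -
  show "0 < mesh j" using T_pos by (simp add: mesh_def)
  have "(\<lambda>j. T * (1 / 2) ^ j) \<longlonglongrightarrow> T * 0" by (intro tendsto_mult tendsto_const LIMSEQ_power_zero) auto
  then show "mesh \<longlonglongrightarrow> 0" by (simp add: mesh_def[abs_def] power_one_over)
qed

text \<open>The probability that several walkers are left at time \<open>t\<close>, computed from
  the transition function; \<open>coalescence_tail\<close> identifies it with the tail of the
  coalescence time.\<close>

definition F :: "real \<Rightarrow> real" where "F t = matrix_op Sc (cc.tr t) multiple V"

abbreviation vj :: "nat \<Rightarrow> nat \<Rightarrow> real" where
  "vj j t \<equiv> expect (steps (coal V (Pk (mesh j))) t V) multiple"

lemma V_in_Sc: "V \<in> Sc" using V_ne by auto

lemma F_limit:
  assumes "(\<lambda>j. real (N j) * mesh j) \<longlonglongrightarrow> t" shows "(\<lambda>j. vj j (N j)) \<longlonglongrightarrow> F t"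
  unfolding F_def by (rule coal_limit[OF mesh assms _ V_in_Sc]) (simp add: multiple_def)

lemma floor_mesh:
  assumes "0 \<le> t" shows "(\<lambda>j. real (nat \<lfloor>t / mesh j\<rfloor>) * mesh j) \<longlonglongrightarrow> t"
proof (rule tendsto_sandwich)
  have *: "t - mesh j \<le> real (nat \<lfloor>t / mesh j\<rfloor>) * mesh j \<and> real (nat \<lfloor>t / mesh j\<rfloor>) * mesh j \<le> t" for j
  proof -
    have m: "0 < mesh j" by (rule mesh)
    have "0 \<le> t / mesh j" using assms m by simp
    then have "t / mesh j - 1 \<le> real (nat \<lfloor>t / mesh j\<rfloor>)" "real (nat \<lfloor>t / mesh j\<rfloor>) \<le> t / mesh j" by linarith+
    from mult_right_mono[OF this(1), of "mesh j"] mult_right_mono[OF this(2), of "mesh j"] m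
    show ?thesis by (simp add: left_diff_distrib)
  qed
  show "\<forall>\<^sub>F j in sequentially. t - mesh j \<le> real (nat \<lfloor>t / mesh j\<rfloor>) * mesh j" using * by simp
  show "\<forall>\<^sub>F j in sequentially. real (nat \<lfloor>t / mesh j\<rfloor>) * mesh j \<le> t" using * by simp
  show "(\<lambda>j. t - mesh j) \<longlonglongrightarrow> t" using tendsto_diff[OF tendsto_const mesh(2), of t] by simp
qed simp

end

section \<open>Choice of the scales and passage to the limit in the mesh\<close>

locale mf_setting = mf_chain +
  assumes alpha_le: "alpha V q \<pi> \<le> exp (-1)" and error_le: "mf_error V q \<pi> \<le> 1/100"
begin

abbreviation \<alpha> :: real where "\<alpha> \<equiv> alpha V q \<pi>"
abbreviation \<epsilon> :: real where "\<epsilon> \<equiv> mf_error V q \<pi>"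
definition n :: real where "n = real (card V)"
text \<open>\<open>J\<close> mixing times bring the distance from equilibrium down to
  \<open>n ^ (-8)\<close>: with \<open>ln 2 >= 2/3\<close>, the factor 12 yields the exponent
  8.\<close>

definition J :: nat where "J = nat \<lceil>12 * ln n\<rceil>"
definition L :: nat where "L = nat \<lceil>1 / \<epsilon>\<rceil>"
definition g :: nat where "g = nat \<lceil>ln n / \<epsilon>\<rceil>"

lemma q_max: "x \<in> V \<Longrightarrow> (\<Sum>y\<in>V - {x}. q x y) \<le> q_max V q" and q_max_nonneg: "0 \<le> q_max V q"
proof -
  show *: "x \<in> V \<Longrightarrow> (\<Sum>y\<in>V - {x}. q x y) \<le> q_max V q" for x
    unfolding q_max_def using finS by (intro Max_ge) auto
  obtain x where x: "x \<in> V" using V_ne by auto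
  have "0 \<le> (\<Sum>y\<in>V - {x}. q x y)" using rates x by (intro sum_nonneg) (auto simp: rates_def)
  then show "0 \<le> q_max V q" using *[OF x] by linarith
qed

lemma pmax_le_\<alpha>: "pmax \<le> \<alpha>" and inv_n_le: "1 / n \<le> pmax"
proof -
  have n: "0 < n" using card_V by (simp add: n_def)
  have "1 \<le> (\<Sum>x\<in>V. pmax)" unfolding \<pi>_sum[symmetric] by (intro sum_mono pmax)
  then show p: "1 / n \<le> pmax" using n by (simp add: n_def field_simps)
  have "0 \<le> q_max V q * T" using q_max_nonneg T_pos by simp
  moreover have "0 \<le> pmax" using p n by (meson divide_nonneg_pos order.trans zero_le_one)
  ultimately have "0 \<le> q_max V q * T * pmax" by simp
  then show "pmax \<le> \<alpha>" by (simp add: alpha_def algebra_simps)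
qed

lemma n_pos: "0 < n" using card_V by (simp add: n_def)

lemma \<alpha>_pos: "0 < \<alpha>" using pmax_le_\<alpha> inv_n_le n_pos by (meson divide_pos_pos less_le_trans zero_less_one)

lemma ln_n: "1 \<le> ln n"
proof -
  have "1 / n \<le> exp (-1)" using pmax_le_\<alpha> inv_n_le alpha_le by linarith
  then have "exp 1 \<le> n" using n_pos by (simp add: exp_minus field_simps)
  then show ?thesis using n_pos by (subst ln_ge_iff) auto
qed

lemma ln_\<alpha>: "1 \<le> ln (1 / \<alpha>)"
  using alpha_le \<alpha>_pos by (subst ln_ge_iff) (auto simp: exp_minus field_simps)

lemma \<epsilon>_pos: "0 < \<epsilon>" and \<epsilon>_6: "\<alpha> * ln n ^ 4 \<le> \<epsilon> ^ 6"
proof -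
  have pos: "0 < \<alpha> * ln (1 / \<alpha>) * ln n ^ 4" using \<alpha>_pos ln_\<alpha> ln_n by (intro mult_pos_pos zero_less_power) linarith+
  then show "0 < \<epsilon>" unfolding mf_error_def n_def powr_gt_zero by (rule less_imp_neq[symmetric])
  have "\<epsilon> ^ 6 = \<alpha> * ln (1 / \<alpha>) * ln n ^ 4"
    unfolding mf_error_def n_def[symmetric] using pos by (simp flip: powr_numeral add: powr_powr)
  moreover have "\<alpha> * 1 * ln n ^ 4 \<le> \<alpha> * ln (1 / \<alpha>) * ln n ^ 4"
    using \<alpha>_pos ln_\<alpha> ln_n by (intro mult_right_mono mult_left_mono) auto
  ultimately show "\<alpha> * ln n ^ 4 \<le> \<epsilon> ^ 6" by simp
qed

lemma J_bounds: "12 * ln n \<le> J" "J \<le> 13 * ln n" "0 < J"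
proof -
  show 1: "12 * ln n \<le> J" "J \<le> 13 * ln n" unfolding J_def using ln_n by linarith+
  show "0 < J" using 1 ln_n by (metis le_less_trans less_irrefl mult_pos_pos not_gr0 of_nat_0 zero_less_numeral less_le_trans zero_less_one)
qed

lemma L_bounds: "1 / \<epsilon> \<le> L" "L \<le> 2 / \<epsilon>"
proof -
  have "1 \<le> 1 / \<epsilon>" using \<epsilon>_pos error_le by (simp add: field_simps)
  then show "1 / \<epsilon> \<le> L" "L \<le> 2 / \<epsilon>" unfolding L_def by linarith+
qed

lemma g_bounds: "ln n / \<epsilon> \<le> g" "g \<le> 2 * ln n / \<epsilon>"
proof -
  have "1 \<le> 1 / \<epsilon>" using \<epsilon>_pos error_le by (simp add: field_simps)
  also have "\<dots> \<le> ln n / \<epsilon>" using ln_n \<epsilon>_pos by (intro divide_right_mono) auto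
  finally show "ln n / \<epsilon> \<le> g" "g \<le> 2 * ln n / \<epsilon>" unfolding g_def by linarith+
qed

lemma small_\<delta>: "(1/2) ^ J * n ^ 8 \<le> 1"
proof -
  have "8 * ln n \<le> real J * ln 2"
  proof -
    have "8 * ln n \<le> (12 * ln n) * (2 / 3)" using ln_n by simp
    also have "\<dots> \<le> real J * ln 2" using J_bounds ln_n ln2_ge_two_thirds by (intro mult_mono) auto
    finally show ?thesis .
  qed
  then have "ln (n ^ 8) \<le> ln (2 ^ J)" using n_pos by (simp add: ln_realpow)
  then have "n ^ 8 \<le> 2 ^ J" using n_pos by simp
  then show ?thesis by (simp add: power_one_over field_simps)
qed

text \<open>The summand \<open>1 / T\<close> is slack in the jump rate, needed because on a grid the
  rate is reached only in the limit. Multiplied by \<open>T\<close> it gives the 1 in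
  \<open>1 + q_max * T\<close>, so the bracket becomes exactly
  \<open>pmax + 2 * J * \<alpha>\<close>. With \<open>J <= 13 * ln n\<close> this is at most 27
  times \<open>\<alpha> * ln n\<close>.\<close>

lemma small_eta: "pmax * (1 + 2 * (q_max V q + 1 / T) * (J * T)) * ln n ^ 3 \<le> 30 * \<epsilon> ^ 6"
proof -
  have "pmax * (1 + 2 * (q_max V q + 1 / T) * (J * T)) = pmax + 2 * J * \<alpha>"
    using T_pos by (simp add: alpha_def field_simps)
  also have "\<dots> \<le> \<alpha> * ln n + 2 * (13 * ln n) * \<alpha>"
  proof (intro add_mono mult_right_mono mult_left_mono)
    show "pmax \<le> \<alpha> * ln n" using pmax_le_\<alpha> mult_left_mono[OF ln_n, of \<alpha>] \<alpha>_pos by linarith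
  qed (use \<alpha>_pos J_bounds(2) in auto)
  also have "\<dots> \<le> 30 * (\<alpha> * ln n)" using \<alpha>_pos ln_n by simp
  finally have "pmax * (1 + 2 * (q_max V q + 1 / T) * (J * T)) * ln n ^ 3 \<le> 30 * (\<alpha> * ln n) * ln n ^ 3"
    using ln_n by (intro mult_right_mono) auto
  also have "\<dots> = 30 * (\<alpha> * ln n ^ 4)" by (simp add: eval_nat_numeral)
  finally show ?thesis using \<epsilon>_6 by linarith
qed

lemma eventually_rate: "\<forall>\<^sub>F j in sequentially. \<forall>x\<in>V. 1 - tr (mesh j) x x \<le> (q_max V q + 1 / T) * mesh j"
proof (intro eventually_ball_finite finS ballI)
  fix x assume x: "x \<in> V"
  have "(\<lambda>j. (tr (mesh j) x x - 1) / mesh j) \<longlonglongrightarrow> G x x"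
    using tr_diff_quotient[OF x x mesh] by simp
  moreover have "- (q_max V q + 1 / T) < G x x"
  proof -
    have "0 < 1 / T" using T_pos by simp
    moreover have "G x x = - (\<Sum>y\<in>V - {x}. q x y)" by (simp add: generator_def)
    ultimately show ?thesis using q_max[OF x] by linarith
  qed
  ultimately have "\<forall>\<^sub>F j in sequentially. - (q_max V q + 1 / T) < (tr (mesh j) x x - 1) / mesh j"
    by (rule order_tendstoD)
  then show "\<forall>\<^sub>F j in sequentially. 1 - tr (mesh j) x x \<le> (q_max V q + 1 / T) * mesh j"
  proof (rule eventually_mono)
    fix j assume "- (q_max V q + 1 / T) < (tr (mesh j) x x - 1) / mesh j"
    then have "- (q_max V q + 1 / T) * mesh j < tr (mesh j) x x - 1"
      using mesh(1)[of j] by (simp only: pos_less_divide_eq)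
    then show "1 - tr (mesh j) x x \<le> (q_max V q + 1 / T) * mesh j" by (simp only: mult_minus_left)
  qed
qed

lemma mf_walk_mesh:
  assumes "\<forall>x\<in>V. 1 - tr (mesh j) x x \<le> (q_max V q + 1 / T) * mesh j"
  shows "mf_walk V (Pk (mesh j)) \<pi>p pmax ((q_max V q + 1 / T) * mesh j) (J * 2 ^ j) ((1/2) ^ J) \<epsilon> L g L n"
proof -
  have h: "0 \<le> mesh j" using mesh(1)[of j] by simp
  have sh: "real (J * 2 ^ j) * mesh j = J * T" by (simp add: mesh_def)
  interpret walk V "Pk (mesh j)" \<pi>p pmax "(q_max V q + 1 / T) * mesh j"
  proof
    show "pmf \<pi>p x \<le> pmax" for x
      using pmax[of x] inv_n_le n_pos by (auto simp: pmf_\<pi>p intro: order.trans[of 0 "1 / n"])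
    show "x \<in> V \<Longrightarrow> 1 - pmf (Pk (mesh j) x) x \<le> (q_max V q + 1 / T) * mesh j" for x
      using assms h by (simp add: pmf_Pk)
  qed (use finS set_Pk[OF h] set_\<pi>p bind_\<pi>p[OF h] in auto)
  show ?thesis
  proof
    show "eta (J * 2 ^ j) * ln n ^ 3 \<le> 30 * \<epsilon> ^ 6"
    proof -
      have "eta (J * 2 ^ j) = pmax * (1 + 2 * (q_max V q + 1 / T) * (real (J * 2 ^ j) * mesh j))"
        unfolding eta_def by (simp add: algebra_simps)
      then show ?thesis using small_eta unfolding sh by simp
    qed
    show "expect (steps (Pk (mesh j)) (J * 2 ^ j) x) f \<le> expect \<pi>p f + (1/2) ^ J" if "\<And>y. 0 \<le> f y \<and> f y \<le> 1" for f x
      using J_bounds(3) by (intro steps_mixing mesh sh that) auto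
  qed (use J_bounds(3) n_def \<epsilon>_pos error_le ln_n small_\<delta> L_bounds g_bounds in auto)
qed

text \<open>Monotonicity is inherited from the grids, where the number of walkers cannot
  grow.\<close>

lemma F_antimono: "0 \<le> s \<Longrightarrow> s \<le> t \<Longrightarrow> F t \<le> F s"
proof -
  assume st: "0 \<le> s" "s \<le> t"
  have "\<forall>\<^sub>F j in sequentially. vj j (nat \<lfloor>t / mesh j\<rfloor>) \<le> vj j (nat \<lfloor>s / mesh j\<rfloor>)"
    using eventually_rate
  proof (rule eventually_mono)
    fix j assume "\<forall>x\<in>V. 1 - tr (mesh j) x x \<le> (q_max V q + 1 / T) * mesh j"
    then interpret mf_walk V "Pk (mesh j)" \<pi>p pmax "(q_max V q + 1 / T) * mesh j" "J * 2 ^ j" "(1/2) ^ J" \<epsilon> L g L n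
      by (rule mf_walk_mesh)
    have "nat \<lfloor>s / mesh j\<rfloor> \<le> nat \<lfloor>t / mesh j\<rfloor>"
      using st mesh(1)[of j] by (intro nat_mono floor_mono divide_right_mono) auto
    then show "vj j (nat \<lfloor>t / mesh j\<rfloor>) \<le> vj j (nat \<lfloor>s / mesh j\<rfloor>)"
      using v_antimono[OF order.refl] by (auto simp: antimono_def)
  qed
  then show "F t \<le> F s"
    using st by (intro tendsto_le[OF _ F_limit[OF floor_mesh] F_limit[OF floor_mesh]]) auto
qed

lemma F_bounds: "0 \<le> t \<Longrightarrow> 0 \<le> F t" "0 \<le> t \<Longrightarrow> F t \<le> 1"
proof -
  assume t: "0 \<le> t"
  have nn: "0 \<le> cc.tr t V B" if "B \<in> Sc" for B using cc.tr_nonneg[OF V_in_Sc that t] .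
  show "0 \<le> F t" unfolding F_def matrix_op_def
    using nn by (intro sum_nonneg) (auto simp: multiple_def)
  have "F t \<le> (\<Sum>B\<in>Sc. cc.tr t V B)" unfolding F_def matrix_op_def
    using nn by (intro sum_mono) (auto simp: multiple_def)
  then show "F t \<le> 1" using cc.tr_row[OF V_in_Sc] by simp
qed

lemma eventually_summable_meetc: "\<forall>\<^sub>F j in sequentially. summable (\<lambda>t. 1 - meetc (mesh j) t)"
  using eventually_rate
proof (rule eventually_mono)
  fix j assume "\<forall>x\<in>V. 1 - tr (mesh j) x x \<le> (q_max V q + 1 / T) * mesh j"
  then interpret W: mf_walk V "Pk (mesh j)" \<pi>p pmax "(q_max V q + 1 / T) * mesh j" "J * 2 ^ j" "(1/2) ^ J" \<epsilon> L g L n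
    by (rule mf_walk_mesh)
  show "summable (\<lambda>t. 1 - meetc (mesh j) t)"
    using W.summable_meetp unfolding meetc_def W.meetp_def .
qed

lemma F_measurable: "F \<in> borel_measurable borel"
proof (rule borel_measurable_continuous_onI)
  show "continuous_on UNIV F" unfolding F_def matrix_op_def
    by (intro continuous_intros cc.tr_continuous V_in_Sc)
qed

text \<open>The length of a block in continuous time, the same for all meshes.\<close>

definition bc :: real where "bc = (1 + L) * J * T"

lemma bc_pos: "0 < bc"
proof -
  have "0 < (1 + L) * J" using J_bounds(3) by simp
  then show ?thesis unfolding bc_def using T_pos by (intro mult_pos_pos) (auto simp only: of_nat_0_less_iff)
qed

context
  fixes mc r :: real
  assumes mc: "(\<lambda>j. mesh j * (\<Sum>t. 1 - meetc (mesh j) t)) \<longlonglongrightarrow> mc"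
    and r: "r = (1 - 3 * \<epsilon>) * bc / mc"
begin

text \<open>Everything that the limit needs from one grid, expressed in continuous time. The bounds
  depend on the grid only through its mean meeting time \<open>mj\<close>.\<close>

lemma mesh_walk_facts:
  assumes "\<forall>x\<in>V. 1 - tr (mesh j) x x \<le> (q_max V q + 1 / T) * mesh j"
  defines "mj \<equiv> mesh j * (\<Sum>t. 1 - meetc (mesh j) t)"
  shows "g * bc \<le> \<epsilon> / 10 * mj"
    "0 < r \<Longrightarrow> r \<le> (1 - 2 * \<epsilon>) * bc / mj \<Longrightarrow> 24 * ln n / g \<le> real K * r \<Longrightarrow>
      vj j ((K + i) * ((1 + L) * J * 2 ^ j)) \<le> (1 - r) ^ i / n + death r i (2 * g)"
    "0 < r \<Longrightarrow> r \<le> (1 - 2 * \<epsilon>) * bc / mj \<Longrightarrow> vj j (i * ((1 + L) * J * 2 ^ j)) \<le> n * (1 - r) ^ i"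
    "0 < r \<Longrightarrow> r \<le> (1 - 2 * \<epsilon>) * bc / mj \<Longrightarrow> summable (vj j)"
    "mj * (2 - 10000 * \<epsilon>) \<le> mesh j * (\<Sum>t. vj j t)"
    "antimono (vj j)"
    "0 < r \<Longrightarrow> r \<le> (1 - 2 * \<epsilon>) * bc / mj \<Longrightarrow> i \<le> 2 * g \<Longrightarrow> r * real (i choose 2) \<le> 1"
proof -
  interpret W: mf_walk V "Pk (mesh j)" \<pi>p pmax "(q_max V q + 1 / T) * mesh j" "J * 2 ^ j" "(1/2) ^ J" \<epsilon> L g L n
    by (rule mf_walk_mesh[OF assms(1)])
  have meetc: "meetc (mesh j) t = W.meetp t" for t
    unfolding meetc_def W.meetp_def ..
  have mj: "mj = mesh j * W.m" unfolding mj_def W.m_def meetc ..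
  have h: "0 < mesh j" by (rule mesh)
  have b: "W.b = (1 + L) * J * 2 ^ j" by (simp add: algebra_simps)
  have bh: "real W.b * mesh j = bc" by (simp add: b bc_def mesh_def algebra_simps)
  have bm: "(1 - 2 * \<epsilon>) * bc / mj = (1 - 2 * \<epsilon>) * W.b / W.m"
    unfolding bh[symmetric] mj using h by simp
  show "g * bc \<le> \<epsilon> / 10 * mj"
  proof -
    have ln: "1 \<le> ln n" by (rule ln_n)
    have "real W.b \<le> 2 * real W.\<tau>" using W.\<tau>_pos(2) unfolding of_nat_add by linarith
    also have "\<dots> \<le> 4 * W.eta W.\<tau> * W.m" using W.m_ge(2) by linarith
    also have "\<dots> \<le> 4 * (60 * \<epsilon> ^ 5 / ln n ^ 3) * W.m"
      using W.eta_\<tau>(2) W.m_ge(3) ln by (intro mult_right_mono mult_left_mono) (auto simp: field_simps)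
    finally have "g * real W.b \<le> g * (4 * (60 * \<epsilon> ^ 5 / ln n ^ 3) * W.m)" by (intro mult_left_mono) auto
    also have "\<dots> \<le> (2 * ln n / \<epsilon>) * (4 * (60 * \<epsilon> ^ 5 / ln n ^ 3) * W.m)"
      using g_bounds(2) W.m_ge(3) ln \<epsilon>_pos by (intro mult_right_mono) auto
    also have "\<dots> = 480 * \<epsilon> ^ 3 * \<epsilon> / ln n ^ 2 * W.m"
      using ln \<epsilon>_pos by (simp add: field_simps eval_nat_numeral)
    also have "\<dots> \<le> 480 * \<epsilon> ^ 3 * \<epsilon> * W.m"
    proof (rule mult_right_mono)
      have "1 \<le> ln n ^ 2" using ln by (rule one_le_power)
      then show "480 * \<epsilon> ^ 3 * \<epsilon> / ln n ^ 2 \<le> 480 * \<epsilon> ^ 3 * \<epsilon>"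
        using \<epsilon>_pos mult_left_mono[of 1 "ln n ^ 2" "480 * \<epsilon> ^ 3 * \<epsilon>"] by (auto simp: divide_le_eq)
    qed (use W.m_ge(3) in simp)
    also have "\<dots> \<le> 1 / 10 * \<epsilon> * W.m"
    proof (intro mult_right_mono)
      have "\<epsilon> ^ 3 \<le> (1 / 100) ^ 3" using error_le \<epsilon>_pos by (intro power_mono) auto
      then show "480 * \<epsilon> ^ 3 \<le> 1 / 10" by (simp add: eval_nat_numeral)
    qed (use W.m_ge(3) \<epsilon>_pos in auto)
    finally have "g * real W.b * mesh j \<le> 1 / 10 * \<epsilon> * W.m * mesh j" using h by (intro mult_right_mono) auto
    moreover have "g * real W.b * mesh j = g * bc" unfolding bh[symmetric] by (simp only: mult.assoc)
    ultimately have "g * bc \<le> 1 / 10 * \<epsilon> * W.m * mesh j" by (simp only:)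
    then show ?thesis unfolding mj by (simp add: mult_ac)
  qed
  show "vj j ((K + i) * ((1 + L) * J * 2 ^ j)) \<le> (1 - r) ^ i / n + death r i (2 * g)"
    if "0 < r" "r \<le> (1 - 2 * \<epsilon>) * bc / mj" "24 * ln n / g \<le> real K * r"
    using W.v_upper[OF that(1) that(2)[unfolded bm] that(3), of i] unfolding b by simp
  show "vj j (i * ((1 + L) * J * 2 ^ j)) \<le> n * (1 - r) ^ i" if "0 < r" "r \<le> (1 - 2 * \<epsilon>) * bc / mj"
    using W.v_geometric[OF that(1) that(2)[unfolded bm] order.refl, of i] unfolding b by simp
  show "summable (vj j)" if "0 < r" "r \<le> (1 - 2 * \<epsilon>) * bc / mj"
    using W.summable_v[OF that(1) that(2)[unfolded bm] order.refl] .
  show "mj * (2 - 10000 * \<epsilon>) \<le> mesh j * (\<Sum>t. vj j t)"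
    using mult_left_mono[OF W.cost_lower, of "mesh j"] h unfolding W.cost_def mj by (simp add: mult_ac)
  show "antimono (vj j)" using W.v_antimono[OF order.refl] .
  show "r * real (i choose 2) \<le> 1" if "0 < r" "r \<le> (1 - 2 * \<epsilon>) * bc / mj" "i \<le> 2 * g"
    using W.r_le(2)[OF that(1) that(2)[unfolded bm] that(3)] by (simp add: W.C_def)
qed

lemma bc_le: "g * bc \<le> \<epsilon> / 10 * mc" and mc_pos: "0 < mc" and r_pos: "0 < r"
proof -
  have "\<forall>\<^sub>F j in sequentially. g * bc \<le> \<epsilon> / 10 * (mesh j * (\<Sum>t. 1 - meetc (mesh j) t))"
    using eventually_rate by (rule eventually_mono) (rule mesh_walk_facts(1))
  then show 1: "g * bc \<le> \<epsilon> / 10 * mc"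
    by (intro tendsto_lowerbound[OF tendsto_mult[OF tendsto_const mc]]) auto
  have "0 < ln n / \<epsilon>" using ln_n \<epsilon>_pos by (intro divide_pos_pos) linarith+
  then have "0 < g * bc" using g_bounds(1) bc_pos by (intro mult_pos_pos) linarith+
  then have "0 < \<epsilon> / 10 * mc" using 1 by linarith
  then show "0 < mc" using \<epsilon>_pos by (simp add: zero_less_mult_iff)
  then show "0 < r" using bc_pos error_le by (simp add: r)
qed

text \<open>\<open>r\<close> is defined with \<open>3 * \<epsilon>\<close> and the limit
  \<open>mc\<close>, while the grid estimates ask for \<open>2 * \<epsilon>\<close> and the mean on
  the grid; the difference leaves room for convergence, so one \<open>r\<close> serves all fine
  grids.\<close>

lemma eventually_r: "\<forall>\<^sub>F j in sequentially. (\<forall>x\<in>V. 1 - tr (mesh j) x x \<le> (q_max V q + 1 / T) * mesh j)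
  \<and> r \<le> (1 - 2 * \<epsilon>) * bc / (mesh j * (\<Sum>t. 1 - meetc (mesh j) t))"
proof (intro eventually_conj eventually_rate)
  have "(\<lambda>j. (1 - 2 * \<epsilon>) * bc / (mesh j * (\<Sum>t. 1 - meetc (mesh j) t))) \<longlonglongrightarrow> (1 - 2 * \<epsilon>) * bc / mc"
    using mc_pos by (intro tendsto_intros mc) auto
  moreover have "r < (1 - 2 * \<epsilon>) * bc / mc"
    unfolding r using \<epsilon>_pos bc_pos mc_pos by (intro divide_strict_right_mono mult_strict_right_mono) auto
  ultimately have "\<forall>\<^sub>F j in sequentially. r < (1 - 2 * \<epsilon>) * bc / (mesh j * (\<Sum>t. 1 - meetc (mesh j) t))"
    by (rule order_tendstoD)
  then show "\<forall>\<^sub>F j in sequentially. r \<le> (1 - 2 * \<epsilon>) * bc / (mesh j * (\<Sum>t. 1 - meetc (mesh j) t))"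
    by (rule eventually_mono) simp
qed

lemma r_choose_le: "i \<le> 2 * g \<Longrightarrow> r * real (i choose 2) \<le> 1"
proof -
  assume "i \<le> 2 * g"
  obtain j where "\<forall>x\<in>V. 1 - tr (mesh j) x x \<le> (q_max V q + 1 / T) * mesh j"
    "r \<le> (1 - 2 * \<epsilon>) * bc / (mesh j * (\<Sum>t. 1 - meetc (mesh j) t))"
    using eventually_r unfolding eventually_sequentially by blast
  then show ?thesis using mesh_walk_facts(7) r_pos \<open>i \<le> 2 * g\<close> by blast
qed

lemma g_ge_1: "1 \<le> g"
proof -
  have "0 < ln n / \<epsilon>" using ln_n \<epsilon>_pos by (intro divide_pos_pos) linarith+
  then have "0 < real g" using g_bounds(1) by linarith
  then show ?thesis by simp
qed

lemma r_le_1: "r \<le> 1" using r_choose_le[of 2] g_ge_1 by simp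

lemma mesh_blocks: "(\<lambda>j. real (i * ((1 + L) * J * 2 ^ j)) * mesh j) \<longlonglongrightarrow> i * bc"
proof -
  have "real (i * ((1 + L) * J * 2 ^ j)) * mesh j = i * bc" for j
    by (simp add: mesh_def bc_def)
  then show ?thesis by (simp only: tendsto_const)
qed

lemma F_upper:
  assumes "24 * ln n / g \<le> real K * r"
  shows "F (real (K + i) * bc) \<le> (1 - r) ^ i / n + death r i (2 * g)"
proof (rule tendsto_upperbound[OF F_limit[OF mesh_blocks]])
  show "\<forall>\<^sub>F j in sequentially. vj j ((K + i) * ((1 + L) * J * 2 ^ j)) \<le> (1 - r) ^ i / n + death r i (2 * g)"
    using eventually_r by (rule eventually_mono) (use mesh_walk_facts(2) r_pos assms in blast)
qed simp

lemma F_geometric: "F (real i * bc) \<le> n * (1 - r) ^ i"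
proof (rule tendsto_upperbound[OF F_limit[OF mesh_blocks]])
  show "\<forall>\<^sub>F j in sequentially. vj j (i * ((1 + L) * J * 2 ^ j)) \<le> n * (1 - r) ^ i"
    using eventually_r by (rule eventually_mono) (use mesh_walk_facts(3) r_pos in blast)
qed simp

text \<open>The bound on the mean passes to the limit by dominated convergence. The geometric bound
  over blocks, whose length does not depend on the mesh, provides the dominating step function
  \<open>w\<close>.\<close>

lemma F_lower: "ennreal ((2 - 10000 * \<epsilon>) * mc) \<le> (\<integral>\<^sup>+x. ennreal (F x) * indicator {0..} x \<partial>lborel)"
proof -
  define good where "good j \<longleftrightarrow> (\<forall>x\<in>V. 1 - tr (mesh j) x x \<le> (q_max V q + 1 / T) * mesh j)
    \<and> r \<le> (1 - 2 * \<epsilon>) * bc / (mesh j * (\<Sum>t. 1 - meetc (mesh j) t))" for j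
  obtain j0 where j0: "\<And>j. j0 \<le> j \<Longrightarrow> good j"
    using eventually_r unfolding good_def eventually_sequentially by blast
  define u where "u j x = ennreal (vj j (nat \<lfloor>x / mesh j\<rfloor>)) * indicator {0..} x" for j x
  define w where "w x = ennreal (n * (1 - r) ^ nat \<lfloor>x / bc\<rfloor>) * indicator {0..} x" for x
  have vj_nonneg: "0 \<le> vj j t" for j t
    by (intro expect_ge finite_kernel.finite_steps finite_kernel.intro fin_coal) (use mesh(1)[of j] in \<open>auto simp: multiple_def\<close>)
  have u_int: "(\<integral>\<^sup>+x. u j x \<partial>lborel) = (\<Sum>t. ennreal (vj j t) * ennreal (mesh j))" for j
    unfolding u_def by (rule nn_integral_step_function(1)[OF mesh(1)])
  have "(\<lambda>j. \<integral>\<^sup>+x. u (j + j0) x \<partial>lborel) \<longlonglongrightarrow> (\<integral>\<^sup>+x. ennreal (F x) * indicator {0..} x \<partial>lborel)"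
  proof (rule nn_integral_dominated_convergence[where w = w])
    show "(\<lambda>x. u (j + j0) x) \<in> borel_measurable lborel" for j
      unfolding u_def using nn_integral_step_function(2)[OF mesh(1)[of "j + j0"]] by simp
    show "w \<in> borel_measurable lborel"
      unfolding w_def using nn_integral_step_function(2)[OF bc_pos, of "\<lambda>i. n * (1 - r) ^ i"] by simp
    note [measurable] = F_measurable
    show "(\<lambda>x. ennreal (F x) * indicator {0..} x) \<in> borel_measurable lborel" by measurable
    have "(\<integral>\<^sup>+x. w x \<partial>lborel) = (\<Sum>t. ennreal (n * (1 - r) ^ t) * ennreal bc)"
      unfolding w_def by (rule nn_integral_step_function(1)[OF bc_pos])
    also have "\<dots> = (\<Sum>t. ennreal (n * (1 - r) ^ t * bc))"
      using n_pos r_le_1 bc_pos by (intro arg_cong[of _ _ suminf] ext) (simp add: ennreal_mult')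
    also have "\<dots> = ennreal (\<Sum>t. n * (1 - r) ^ t * bc)"
      using n_pos r_le_1 r_pos bc_pos by (intro suminf_ennreal2 summable_mult summable_mult2 summable_geometric) auto
    finally show "(\<integral>\<^sup>+x. w x \<partial>lborel) < \<infinity>" by simp
    show "AE x in lborel. u (j + j0) x \<le> w x" for j
    proof (intro AE_I2)
      fix x :: real
      define i where "i = nat \<lfloor>x / bc\<rfloor>"
      have good: "good (j + j0)" by (rule j0) simp
      show "u (j + j0) x \<le> w x"
      proof (cases "0 \<le> x")
        case True
        have "real i * bc \<le> x"
        proof -
          have "real i \<le> x / bc" unfolding i_def using True bc_pos by simp
          then show ?thesis using bc_pos by (simp add: field_simps)
        qed
        moreover have "real (i * ((1 + L) * J * 2 ^ (j + j0))) * mesh (j + j0) = real i * bc"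
          by (simp add: mesh_def bc_def)
        ultimately have "real (i * ((1 + L) * J * 2 ^ (j + j0))) \<le> x / mesh (j + j0)"
          using mesh(1)[of "j + j0"] by (simp only: pos_le_divide_eq)
        then have le: "i * ((1 + L) * J * 2 ^ (j + j0)) \<le> nat \<lfloor>x / mesh (j + j0)\<rfloor>"
          by (simp only: le_nat_floor)
        have "vj (j + j0) (nat \<lfloor>x / mesh (j + j0)\<rfloor>) \<le> vj (j + j0) (i * ((1 + L) * J * 2 ^ (j + j0)))"
          using mesh_walk_facts(6)[of "j + j0"] good le unfolding good_def by (auto simp: antimono_def)
        also have "\<dots> \<le> n * (1 - r) ^ i"
          using good r_pos unfolding good_def by (intro mesh_walk_facts(3)) auto
        finally show ?thesis using True by (simp add: u_def w_def i_def ennreal_leI)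
      qed (simp add: u_def)
    qed
    show "AE x in lborel. (\<lambda>j. u (j + j0) x) \<longlonglongrightarrow> ennreal (F x) * indicator {0..} x"
    proof (intro AE_I2)
      fix x :: real
      show "(\<lambda>j. u (j + j0) x) \<longlonglongrightarrow> ennreal (F x) * indicator {0..} x"
      proof (cases "0 \<le> x")
        case True
        have "(\<lambda>j. ennreal (vj (j + j0) (nat \<lfloor>x / mesh (j + j0)\<rfloor>))) \<longlonglongrightarrow> ennreal (F x)"
          using LIMSEQ_ignore_initial_segment[OF F_limit[OF floor_mesh[OF True]], of j0] by (rule tendsto_ennrealI)
        then show ?thesis using True by (simp add: u_def)
      qed (simp add: u_def)
    qed
  qed
  moreover have "(\<lambda>j. ennreal (mesh (j + j0) * (\<Sum>t. 1 - meetc (mesh (j + j0)) t) * (2 - 10000 * \<epsilon>)))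
    \<longlonglongrightarrow> ennreal (mc * (2 - 10000 * \<epsilon>))"
    by (intro tendsto_ennrealI tendsto_mult tendsto_const LIMSEQ_ignore_initial_segment[OF mc])
  moreover have "ennreal (mesh (j + j0) * (\<Sum>t. 1 - meetc (mesh (j + j0)) t) * (2 - 10000 * \<epsilon>)) \<le> (\<integral>\<^sup>+x. u (j + j0) x \<partial>lborel)" for j
  proof -
    have good: "good (j + j0)" by (rule j0) simp
    have summ: "summable (vj (j + j0))" using good r_pos unfolding good_def by (intro mesh_walk_facts(4)) auto
    have "(\<integral>\<^sup>+x. u (j + j0) x \<partial>lborel) = (\<Sum>t. ennreal (vj (j + j0) t * mesh (j + j0)))"
      unfolding u_int using vj_nonneg mesh(1)[of "j + j0"] by (intro arg_cong[of _ _ suminf] ext) (simp add: ennreal_mult')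
    also have "\<dots> = ennreal (\<Sum>t. vj (j + j0) t * mesh (j + j0))"
      using vj_nonneg mesh(1)[of "j + j0"] by (intro suminf_ennreal2 summable_mult2 summ) auto
    also have "(\<Sum>t. vj (j + j0) t * mesh (j + j0)) = mesh (j + j0) * (\<Sum>t. vj (j + j0) t)"
      using suminf_mult2[OF summ, of "mesh (j + j0)"] by (simp add: mult.commute)
    finally show ?thesis using mesh_walk_facts(5)[of "j + j0"] good unfolding good_def by (simp add: ennreal_leI)
  qed
  ultimately have "ennreal (mc * (2 - 10000 * \<epsilon>)) \<le> (\<integral>\<^sup>+x. ennreal (F x) * indicator {0..} x \<partial>lborel)"
    by (intro LIMSEQ_le[of _ _ "\<lambda>j. \<integral>\<^sup>+x. u (j + j0) x \<partial>lborel"]) auto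
  then show ?thesis by (simp add: mult.commute)
qed

end
end


section \<open>Path laws\<close>

lemma (in sigma_finite_measure) nn_integral_layer_cake:
  assumes [measurable]: "C \<in> borel_measurable M"
  shows "(\<integral>\<^sup>+\<eta>. C \<eta> \<partial>M) = (\<integral>\<^sup>+t. emeasure M {\<eta> \<in> space M. ennreal t < C \<eta>} * indicator {0..} t \<partial>lborel)"
proof -
  interpret pair_sigma_finite M lborel by unfold_locales
  have C: "C \<eta> = (\<integral>\<^sup>+t. indicator {t. 0 \<le> t \<and> ennreal t < C \<eta>} t \<partial>lborel)" for \<eta>
  proof (cases "C \<eta>")
    case (real c)
    then have "{t. 0 \<le> t \<and> ennreal t < C \<eta>} = {0..<c}" by (auto simp: ennreal_less_iff)
    then show ?thesis using real by simp
  next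
    case top
    then have "{t. 0 \<le> t \<and> ennreal t < C \<eta>} = {0..}" by auto
    moreover have "emeasure lborel {0::real..} = \<top>"
    proof (rule ccontr)
      assume "emeasure lborel {0::real..} \<noteq> \<top>"
      then obtain k where k: "emeasure lborel {0::real..} < of_nat k"
        using ennreal_Ex_less_of_nat less_top by blast
      have "of_nat k = emeasure lborel {0..real k}" by (simp add: ennreal_of_nat_eq_real_of_nat)
      also have "\<dots> \<le> emeasure lborel {0::real..}" by (rule emeasure_mono) auto
      finally show False using k by simp
    qed
    ultimately show ?thesis using top by simp
  qed
  have "(\<integral>\<^sup>+\<eta>. C \<eta> \<partial>M) = (\<integral>\<^sup>+\<eta>. \<integral>\<^sup>+t. indicator {t. 0 \<le> t \<and> ennreal t < C \<eta>} t \<partial>lborel \<partial>M)"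
    by (subst C) simp
  also have "\<dots> = (\<integral>\<^sup>+t. \<integral>\<^sup>+\<eta>. indicator {t. 0 \<le> t \<and> ennreal t < C \<eta>} t \<partial>M \<partial>lborel)"
    by (rule Fubini'[symmetric]) measurable
  also have "\<dots> = (\<integral>\<^sup>+t. emeasure M {\<eta> \<in> space M. ennreal t < C \<eta>} * indicator {0..} t \<partial>lborel)"
  proof (intro nn_integral_cong)
    fix t :: real
    have "(\<integral>\<^sup>+\<eta>. indicator {t. 0 \<le> t \<and> ennreal t < C \<eta>} t \<partial>M)
      = (\<integral>\<^sup>+\<eta>. indicator {\<eta> \<in> space M. ennreal t < C \<eta>} \<eta> * indicator {0..} t \<partial>M)"
      by (intro nn_integral_cong) (auto simp: indicator_def)
    also have "\<dots> = emeasure M {\<eta> \<in> space M. ennreal t < C \<eta>} * indicator {0..} t"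
      by (subst nn_integral_multc) auto
    finally show "(\<integral>\<^sup>+\<eta>. indicator {t. 0 \<le> t \<and> ennreal t < C \<eta>} t \<partial>M)
      = emeasure M {\<eta> \<in> space M. ennreal t < C \<eta>} * indicator {0..} t" .
  qed
  finally show ?thesis .
qed

definition grid_hit :: "(nat \<Rightarrow> bool) \<Rightarrow> real \<Rightarrow> ennreal" where
  "grid_hit D h = (INF i. if D i then ennreal (real i * h) else \<top>)"

text \<open>Written as a sum over the steps before the hit, the hitting time can be integrated term
  by term, and its mean becomes a sum of survival probabilities.\<close>

lemma grid_hit_eq_suminf:
  assumes "0 < h"
  shows "grid_hit D h = (\<Sum>t. if \<forall>i\<le>t. \<not> D i then ennreal h else 0)"
proof (cases "\<exists>i. D i")
  case False
  have "(\<Sum>t. ennreal h) = \<top>"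
  proof (rule ccontr)
    assume "(\<Sum>t. ennreal h) \<noteq> \<top>"
    then have "summable (\<lambda>t::nat. h)" using assms by (intro summable_suminf_not_top) auto
    then show False using assms by (simp add: summable_const_iff)
  qed
  then show ?thesis using False by (simp add: grid_hit_def)
next
  case True
  define k where "k = (LEAST i. D i)"
  have k: "D k" "\<And>i. D i \<Longrightarrow> k \<le> i" using True LeastI_ex[of D] Least_le[of D] by (auto simp: k_def)
  have "grid_hit D h = ennreal (real k * h)" unfolding grid_hit_def
  proof (rule antisym)
    show "(INF i. if D i then ennreal (real i * h) else \<top>) \<le> ennreal (real k * h)"
      using k(1) by (intro INF_lower2[of k]) auto
    show "ennreal (real k * h) \<le> (INF i. if D i then ennreal (real i * h) else \<top>)"
      using k(2) assms by (intro INF_greatest) (auto intro!: ennreal_leI mult_right_mono)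
  qed
  also have "\<dots> = (\<Sum>t<k. ennreal h)"
    using assms by (simp add: ennreal_mult' ennreal_of_nat_eq_real_of_nat)
  also have "\<dots> = (\<Sum>t<k. if \<forall>i\<le>t. \<not> D i then ennreal h else 0)"
    using k(2) by (intro sum.cong refl) force
  also have "\<dots> = (\<Sum>t. if \<forall>i\<le>t. \<not> D i then ennreal h else 0)"
    using k(1) by (intro suminf_finite[symmetric]) auto
  finally show ?thesis .
qed

lemma grid_hit_refine:
  assumes "h = real c * h'"
  shows "grid_hit (\<lambda>i. real i * h' \<in> D) h' \<le> grid_hit (\<lambda>i. real i * h \<in> D) h"
  unfolding grid_hit_def
proof (intro INF_greatest)
  fix i
  have eq: "real (i * c) * h' = real i * h" using assms by simp
  show "(INF i. if real i * h' \<in> D then ennreal (real i * h') else \<top>) \<le> (if real i * h \<in> D then ennreal (real i * h) else \<top>)"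
    by (intro INF_lower2[of "i * c"]) (simp_all only: eq UNIV_I order.refl)
qed

text \<open>A set of times that contains with each point a right neighbourhood has the same infimum as
  its restrictions to finer and finer grids.\<close>

lemma grid_hit_limit:
  assumes D: "\<And>t. t \<in> D \<Longrightarrow> 0 \<le> t \<and> (\<exists>e>0. {t..<t + e} \<subseteq> D)"
    and h: "\<And>j. 0 < h j" "h \<longlonglongrightarrow> 0"
  shows "(\<lambda>j. grid_hit (\<lambda>i. real i * h j \<in> D) (h j)) \<longlonglongrightarrow> (INF t\<in>D. ennreal t)"
proof (rule order_tendstoI)
  fix a assume a: "a < (INF t\<in>D. ennreal t)"
  have "(INF t\<in>D. ennreal t) \<le> grid_hit (\<lambda>i. real i * h j \<in> D) (h j)" for j
    unfolding grid_hit_def by (intro INF_greatest) (auto intro: INF_lower)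
  then show "\<forall>\<^sub>F j in sequentially. a < grid_hit (\<lambda>i. real i * h j \<in> D) (h j)"
    using a by (intro always_eventually allI) (rule less_le_trans)
next
  fix a assume "(INF t\<in>D. ennreal t) < a"
  then obtain t where t: "t \<in> D" "ennreal t < a" by (auto simp: INF_less_iff)
  obtain e where e: "0 < e" "{t..<t + e} \<subseteq> D" "0 \<le> t" using D[OF t(1)] by blast
  have "(\<lambda>j. ennreal (t + h j)) \<longlonglongrightarrow> ennreal (t + 0)" by (intro tendsto_ennrealI tendsto_intros h)
  then have "\<forall>\<^sub>F j in sequentially. ennreal (t + h j) < a" using t(2) by (intro order_tendstoD(2)) auto
  moreover have "\<forall>\<^sub>F j in sequentially. h j < e" using h(2) e(1) by (rule order_tendstoD)
  ultimately show "\<forall>\<^sub>F j in sequentially. grid_hit (\<lambda>i. real i * h j \<in> D) (h j) < a"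
  proof eventually_elim
    case (elim j)
    define i where "i = nat \<lceil>t / h j\<rceil>"
    have "0 \<le> t / h j" using e(3) h(1)[of j] by simp
    then have "t / h j \<le> real i" "real i < t / h j + 1" unfolding i_def by linarith+
    then have i: "t \<le> real i * h j" "real i * h j < t + h j"
      using h(1)[of j] by (simp_all add: pos_divide_le_eq pos_less_divide_eq field_simps)
    then have "real i * h j \<in> D" using e(2) elim(2) by auto
    then have "grid_hit (\<lambda>i. real i * h j \<in> D) (h j) \<le> ennreal (real i * h j)"
      unfolding grid_hit_def by (intro INF_lower2[of i]) auto
    also have "\<dots> \<le> ennreal (t + h j)" using i by (intro ennreal_leI) simp
    finally show ?case using elim(1) by simp
  qed
qed

lemma sum_PiE_insert:
  assumes "finite I" "i \<notin> I" "finite V"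
  shows "(\<Sum>x\<in>insert i I \<rightarrow>\<^sub>E V. f x) = (\<Sum>a\<in>V. \<Sum>x\<in>I \<rightarrow>\<^sub>E V. f (x(i := a)))"
proof -
  have "(\<Sum>x\<in>insert i I \<rightarrow>\<^sub>E V. f x) = (\<Sum>(a, x)\<in>V \<times> (I \<rightarrow>\<^sub>E V). f (x(i := a)))"
    unfolding PiE_insert_eq
    by (subst sum.reindex[OF inj_combinator[OF assms(2)]]) (simp add: case_prod_unfold)
  then show ?thesis by (simp add: sum.cartesian_product)
qed

definition path_set :: "'s set \<Rightarrow> (real \<Rightarrow> 's) set" where
  "path_set S = {\<omega> \<in> {0..} \<rightarrow>\<^sub>E S. \<forall>t\<ge>0. \<exists>e>0. \<forall>s\<in>{t..<t + e}. \<omega> s = \<omega> t}"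

locale path_law =
  fixes S :: "'s set" and q :: "'s \<Rightarrow> 's \<Rightarrow> real" and \<mu> :: "'s \<Rightarrow> real" and P :: "(real \<Rightarrow> 's) measure"
  assumes finS: "finite S" and law: "chain_law S q \<mu> P"
begin

sublocale prob_space P using law unfolding chain_law_def by simp

lemma sets_P: "sets P = sets (path_space S)" using law unfolding chain_law_def by simp

lemma space_P: "space P = path_set S"
  using sets_eq_imp_space_eq[OF sets_P]
  by (auto simp: path_space_def space_restrict_space space_PiM path_set_def)

lemma coord [measurable]: "0 \<le> t \<Longrightarrow> (\<lambda>\<omega>. \<omega> t) \<in> measurable P (count_space S)"
  unfolding measurable_cong_sets[OF sets_P refl] path_space_def
  by (intro measurable_restrict_space1 measurable_component_singleton) auto

lemma coord_pred: "0 \<le> t \<Longrightarrow> {\<omega> \<in> space P. Q (\<omega> t)} \<in> sets P"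
proof -
  assume t: "0 \<le> t"
  have "(\<lambda>\<omega>. \<omega> t) -` {x \<in> S. Q x} \<inter> space P \<in> sets P"
    by (rule measurable_sets[OF coord[OF t]]) auto
  also have "(\<lambda>\<omega>. \<omega> t) -` {x \<in> S. Q x} \<inter> space P = {\<omega> \<in> space P. Q (\<omega> t)}"
    using t by (auto simp: space_P path_set_def)
  finally show ?thesis .
qed

lemma path_in: "\<omega> \<in> space P \<Longrightarrow> 0 \<le> t \<Longrightarrow> \<omega> t \<in> S"
  by (auto simp: space_P path_set_def)

lemma right_cont: "\<omega> \<in> space P \<Longrightarrow> 0 \<le> t \<Longrightarrow> \<exists>e>0. \<forall>s\<in>{t..<t + e}. \<omega> s = \<omega> t"
  by (auto simp: space_P path_set_def)

lemma fdd:
  assumes "t 0 = 0" "\<And>i. i < k \<Longrightarrow> t i \<le> t (Suc i)" "\<And>i. i \<le> k \<Longrightarrow> x i \<in> S"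
  shows "prob {\<omega> \<in> space P. \<forall>i\<le>k. \<omega> (t i) = x i}
    = \<mu> (x 0) * (\<Prod>i<k. transition S q (t (Suc i) - t i) (x i) (x (Suc i)))"
  by (rule law[unfolded chain_law_def, THEN conjunct2, THEN conjunct2, rule_format]) (use assms in auto)

definition weight :: "real \<Rightarrow> nat \<Rightarrow> (nat \<Rightarrow> 's) \<Rightarrow> real" where
  "weight h k x = \<mu> (x 0) * (\<Prod>i<k. transition S q h (x i) (x (Suc i)))"

definition cyl :: "real \<Rightarrow> nat \<Rightarrow> (nat \<Rightarrow> 's) \<Rightarrow> (real \<Rightarrow> 's) set" where
  "cyl h k x = {\<omega> \<in> space P. \<forall>i\<le>k. \<omega> (real i * h) = x i}"

lemma prob_cyl:
  assumes "0 \<le> h" "x \<in> {..k} \<rightarrow>\<^sub>E S" shows "prob (cyl h k x) = weight h k x"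
proof -
  have "prob (cyl h k x) = \<mu> (x 0) * (\<Prod>i<k. transition S q (real (Suc i) * h - real i * h) (x i) (x (Suc i)))"
    unfolding cyl_def using assms by (intro fdd) (auto intro: mult_right_mono)
  then show ?thesis by (simp add: weight_def algebra_simps)
qed

lemma cyl_sets: "0 \<le> h \<Longrightarrow> cyl h k x \<in> sets P"
proof -
  assume h: "0 \<le> h"
  have "cyl h k x = (\<Inter>i\<in>{..k}. {\<omega> \<in> space P. \<omega> (real i * h) = x i})" by (auto simp: cyl_def)
  then show ?thesis using h by (simp add: coord_pred sets.finite_INT)
qed

end

section \<open>The meeting time of two paths\<close>

context mf_chain
begin

definition kp :: "real \<Rightarrow> nat \<times> nat \<Rightarrow> (nat \<times> nat) pmf" where
  "kp h = (\<lambda>(x, y). pair_pmf (Pk h x) (Pk h y))"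

abbreviation diag :: "(nat \<times> nat) set" where "diag \<equiv> {(x, y). x = y}"

lemma finite_kernel_kp: "0 \<le> h \<Longrightarrow> finite_kernel (kp h)"
  by unfold_locales (auto simp: kp_def fin_Pk split: prod.splits)

lemma expect_pair:
  assumes "finite (set_pmf p)" "finite (set_pmf r)"
  shows "expect (pair_pmf p r) f = expect p (\<lambda>x. expect r (\<lambda>y. f (x, y)))"
proof -
  have "expect (pair_pmf p r) f = (\<Sum>z\<in>set_pmf p \<times> set_pmf r. pmf (pair_pmf p r) z * f z)"
    using assms by (intro expect_sum_set) auto
  also have "\<dots> = (\<Sum>x\<in>set_pmf p. \<Sum>y\<in>set_pmf r. pmf p x * pmf r y * f (x, y))"
    by (subst sum.cartesian_product) (auto simp: pmf_pair intro!: sum.cong)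
  also have "\<dots> = expect p (\<lambda>x. expect r (\<lambda>y. f (x, y)))"
    using assms by (simp add: expect_sum_set[OF _ order.refl] sum_distrib_left mult.assoc)
  finally show ?thesis .
qed

lemma surv_kp:
  assumes "0 \<le> h" shows "surv (kp h) diag t (x, y) = 1 - pair_hit (Pk h) t x y"
proof -
  interpret fk: finite_kernel "kp h" by (rule finite_kernel_kp[OF assms])
  have "hit (kp h) diag t (x, y) = pair_hit (Pk h) t x y"
  proof (induction t arbitrary: x y)
    case (Suc t)
    have "hit (kp h) diag t = (\<lambda>(x, y). pair_hit (Pk h) t x y)" using Suc by auto
    then show ?case using assms by (simp add: kp_def expect_pair fin_Pk)
  qed simp
  then show ?thesis using fk.hit_add_surv[of diag t "(x, y)"] by simp
qed

lemma expect_\<pi>p_surv: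
  assumes "0 \<le> h" shows "expect \<pi>p (\<lambda>x. expect \<pi>p (\<lambda>y. surv (kp h) diag t (x, y))) = 1 - meetc h t"
proof -
  have f: "finite (set_pmf \<pi>p)" using set_\<pi>p finS finite_subset by blast
  show ?thesis unfolding surv_kp[OF assms] meetc_def by (simp add: expect_diff f)
qed

definition weightp :: "real \<Rightarrow> nat \<Rightarrow> (nat \<Rightarrow> nat) \<Rightarrow> real" where
  "weightp h k x = \<pi> (x 0) * (\<Prod>i<k. tr h (x i) (x (Suc i)))"

text \<open>A terminal function \<open>f\<close> is carried along because the induction removes the
  last step of both paths, whereas \<open>alive\<close> recurs on the first step;
  \<open>alive_add\<close> moves the last step into \<open>f\<close>.\<close>

lemma sum_paths:
  assumes h: "0 \<le> h"
  shows "(\<Sum>x\<in>{..k} \<rightarrow>\<^sub>E V. \<Sum>y\<in>{..k} \<rightarrow>\<^sub>E V. weightp h k x * weightp h k y * (if \<forall>i\<le>k. x i \<noteq> y i then f (x k, y k) else 0))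
    = expect \<pi>p (\<lambda>x. expect \<pi>p (\<lambda>y. alive (kp h) diag f k (x, y)))"
proof (induction k arbitrary: f)
  case 0
  have "{..0::nat} = insert 0 {}" by auto
  have "(\<Sum>x\<in>insert 0 {} \<rightarrow>\<^sub>E V. \<Sum>y\<in>insert 0 {} \<rightarrow>\<^sub>E V. weightp h 0 x * weightp h 0 y * (if \<forall>i\<le>0. x i \<noteq> y i then f (x 0, y 0) else 0))
    = (\<Sum>a\<in>V. \<Sum>b\<in>V. \<pi> a * \<pi> b * (if a \<noteq> b then f (a, b) else 0))"
  proof -
    have "(\<Sum>x\<in>insert 0 {} \<rightarrow>\<^sub>E V. g x) = (\<Sum>a\<in>V. g (\<lambda>b. if b = 0 then a else undefined))" for g :: "(nat \<Rightarrow> nat) \<Rightarrow> real"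
      using sum_PiE_insert[of "{}" 0 V g] finS by (simp only: PiE_empty_domain) simp
    then show ?thesis by (simp add: weightp_def cong: if_cong)
  qed
  also have "\<dots> = expect \<pi>p (\<lambda>x. expect \<pi>p (\<lambda>y. alive (kp h) diag f 0 (x, y)))"
    unfolding expect_\<pi>p sum_distrib_left by (intro sum.cong refl) simp
  finally show ?case using \<open>{..0::nat} = insert 0 {}\<close> by simp
next
  case (Suc k)
  interpret fk: finite_kernel "kp h" by (rule finite_kernel_kp[OF h])
  define f1 where "f1 = (\<lambda>(x, y). \<Sum>a\<in>V. \<Sum>b\<in>V. tr h x a * tr h y b * (if a \<noteq> b then f (a, b) else 0))"
  have ins: "{..Suc k} = insert (Suc k) {..k}" by auto
  have w: "weightp h (Suc k) (x(Suc k := a)) = weightp h k x * tr h (x k) a" for x a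
  proof -
    have "(\<Prod>i<k. tr h ((x(Suc k := a)) i) ((x(Suc k := a)) (Suc i))) = (\<Prod>i<k. tr h (x i) (x (Suc i)))"
      by (intro prod.cong) auto
    then show ?thesis by (simp add: weightp_def)
  qed
  have avoid: "(\<forall>i\<le>Suc k. (x(Suc k := a)) i \<noteq> (y(Suc k := b)) i) \<longleftrightarrow> (\<forall>i\<le>k. x i \<noteq> y i) \<and> a \<noteq> b"
    for x y :: "nat \<Rightarrow> nat" and a b
    by (auto simp: le_Suc_eq)
  have "(\<Sum>x\<in>{..Suc k} \<rightarrow>\<^sub>E V. \<Sum>y\<in>{..Suc k} \<rightarrow>\<^sub>E V. weightp h (Suc k) x * weightp h (Suc k) y * (if \<forall>i\<le>Suc k. x i \<noteq> y i then f (x (Suc k), y (Suc k)) else 0))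
    = (\<Sum>a\<in>V. \<Sum>x\<in>{..k} \<rightarrow>\<^sub>E V. \<Sum>b\<in>V. \<Sum>y\<in>{..k} \<rightarrow>\<^sub>E V. (weightp h k x * tr h (x k) a) * (weightp h k y * tr h (y k) b) * (if (\<forall>i\<le>k. x i \<noteq> y i) \<and> a \<noteq> b then f (a, b) else 0))"
    unfolding ins by (simp only: sum_PiE_insert finite_atMost finS atMost_iff Suc_n_not_le_n not_False_eq_True w avoid[unfolded ins] fun_upd_same)
  also have "\<dots> = (\<Sum>x\<in>{..k} \<rightarrow>\<^sub>E V. \<Sum>y\<in>{..k} \<rightarrow>\<^sub>E V. \<Sum>a\<in>V. \<Sum>b\<in>V. (weightp h k x * tr h (x k) a) * (weightp h k y * tr h (y k) b) * (if (\<forall>i\<le>k. x i \<noteq> y i) \<and> a \<noteq> b then f (a, b) else 0))"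
  proof -
    have "(\<Sum>a\<in>V. \<Sum>x\<in>X. \<Sum>b\<in>V. \<Sum>y\<in>X. g a x b y) = (\<Sum>x\<in>X. \<Sum>y\<in>X. \<Sum>a\<in>V. \<Sum>b\<in>V. g a x b y)"
      for g :: "nat \<Rightarrow> (nat \<Rightarrow> nat) \<Rightarrow> nat \<Rightarrow> (nat \<Rightarrow> nat) \<Rightarrow> real" and X
    proof -
      have "(\<Sum>a\<in>V. \<Sum>x\<in>X. \<Sum>b\<in>V. \<Sum>y\<in>X. g a x b y) = (\<Sum>x\<in>X. \<Sum>a\<in>V. \<Sum>b\<in>V. \<Sum>y\<in>X. g a x b y)" by (rule sum.swap)
      also have "\<dots> = (\<Sum>x\<in>X. \<Sum>a\<in>V. \<Sum>y\<in>X. \<Sum>b\<in>V. g a x b y)" by (intro sum.cong refl sum.swap)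
      also have "\<dots> = (\<Sum>x\<in>X. \<Sum>y\<in>X. \<Sum>a\<in>V. \<Sum>b\<in>V. g a x b y)" by (intro sum.cong refl sum.swap)
      finally show ?thesis .
    qed
    then show ?thesis by simp
  qed
  also have "\<dots> = (\<Sum>x\<in>{..k} \<rightarrow>\<^sub>E V. \<Sum>y\<in>{..k} \<rightarrow>\<^sub>E V. weightp h k x * weightp h k y * (if \<forall>i\<le>k. x i \<noteq> y i then f1 (x k, y k) else 0))"
  proof (intro sum.cong refl)
    fix x y
    show "(\<Sum>a\<in>V. \<Sum>b\<in>V. (weightp h k x * tr h (x k) a) * (weightp h k y * tr h (y k) b) * (if (\<forall>i\<le>k. x i \<noteq> y i) \<and> a \<noteq> b then f (a, b) else 0))
      = weightp h k x * weightp h k y * (if \<forall>i\<le>k. x i \<noteq> y i then f1 (x k, y k) else 0)"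
    proof (cases "\<forall>i\<le>k. x i \<noteq> y i")
      case True
      then show ?thesis by (simp add: f1_def sum_distrib_left mult_ac)
    next
      case False
      then show ?thesis by (simp only: simp_thms if_False mult_zero_right sum.neutral_const)
    qed
  qed
  also have "\<dots> = expect \<pi>p (\<lambda>x. expect \<pi>p (\<lambda>y. alive (kp h) diag f1 k (x, y)))" by (rule Suc)
  also have "\<dots> = expect \<pi>p (\<lambda>x. expect \<pi>p (\<lambda>y. alive (kp h) diag (alive (kp h) diag f 1) k (x, y)))"
  proof (intro expect_cong)
    fix x y assume xy: "x \<in> set_pmf \<pi>p" "y \<in> set_pmf \<pi>p"
    have f1: "alive (kp h) diag f 1 (x, y) = f1 (x, y)" if "x \<in> V" "y \<in> V" "x \<noteq> y" for x y
      using that h by (simp add: f1_def kp_def expect_pair fin_Pk expect_Pk sum_distrib_left mult.assoc)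
        (intro sum.cong refl, simp)
    show "alive (kp h) diag f1 k (x, y) = alive (kp h) diag (alive (kp h) diag f 1) k (x, y)"
    proof -
      \<comment> \<open>\<open>f1\<close> is known to agree with one further step of
        \<open>alive\<close> only at distinct points of \<open>V\<close>. This is enough: the kernel
        stays in \<open>V\<close>, and on the diagonal both sides vanish.\<close>
      have "x \<in> V \<Longrightarrow> y \<in> V \<Longrightarrow> alive (kp h) diag f1 k (x, y) = alive (kp h) diag (alive (kp h) diag f 1) k (x, y)" for x y
      proof (induction k arbitrary: x y)
        case 0
        then show ?case using f1[of x y] by simp
      next
        case (Suc k)
        have "expect (kp h (x, y)) (alive (kp h) diag f1 k) = expect (kp h (x, y)) (alive (kp h) diag (alive (kp h) diag f 1) k)"
        proof (rule expect_cong)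
          fix z assume "z \<in> set_pmf (kp h (x, y))"
          then have "fst z \<in> V" "snd z \<in> V" using set_Pk[OF h, of x] set_Pk[OF h, of y] by (auto simp: kp_def)
          then show "alive (kp h) diag f1 k z = alive (kp h) diag (alive (kp h) diag f 1) k z"
            using Suc.IH[of "fst z" "snd z"] by (simp only: prod.collapse)
        qed
        then show ?case by (simp only: alive.simps(2))
      qed
      then show ?thesis using xy set_\<pi>p by blast
    qed
  qed
  also have "\<dots> = expect \<pi>p (\<lambda>x. expect \<pi>p (\<lambda>y. alive (kp h) diag f (Suc k) (x, y)))"
    by (simp only: fk.alive_add[of diag f k 1, symmetric] Suc_eq_plus1)
  finally show ?case .
qed

context
  fixes P :: "(real \<Rightarrow> nat) measure"
  assumes P: "chain_law V q \<pi> P"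
begin

interpretation PL: path_law V q \<pi> P using finS P by unfold_locales

interpretation PP: pair_prob_space P P ..

definition avoid :: "real \<Rightarrow> nat \<Rightarrow> ((real \<Rightarrow> nat) \<times> (real \<Rightarrow> nat)) set" where
  "avoid h k = {(\<omega>, \<omega>') \<in> space P \<times> space P. \<forall>i\<le>k. \<omega> (real i * h) \<noteq> \<omega>' (real i * h)}"

text \<open>The event is a finite disjoint union of products of cylinders, one for each pair of grid
  paths that never agree; independence gives product weights, which \<open>sum_paths\<close> adds
  up.\<close>

lemma avoid_measure:
  assumes h: "0 \<le> h"
  shows "avoid h k \<in> sets (P \<Otimes>\<^sub>M P)" "emeasure (P \<Otimes>\<^sub>M P) (avoid h k) = ennreal (1 - meetc h k)"
proof -
  define X where "X = {..k} \<rightarrow>\<^sub>E V"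
  define Y where "Y = {(x, y) \<in> X \<times> X. \<forall>i\<le>k. x i \<noteq> y i}"
  define A where "A = (\<lambda>(x, y). PL.cyl h k x \<times> PL.cyl h k y)"
  have finX: "finite X" unfolding X_def using finS by (intro finite_PiE) auto
  have finY: "finite Y" unfolding Y_def using finX by (auto intro: finite_subset[of _ "X \<times> X"])
  have A: "A ` Y \<subseteq> sets (P \<Otimes>\<^sub>M P)" unfolding A_def using PL.cyl_sets[OF h] by auto
  have U: "avoid h k = (\<Union>z\<in>Y. A z)"
  proof (intro equalityI subsetI)
    fix z assume z: "z \<in> avoid h k"
    obtain \<omega> \<omega>' where [simp]: "z = (\<omega>, \<omega>')" by (cases z)
    define x where "x = (\<lambda>i\<in>{..k}. \<omega> (real i * h))"
    define y where "y = (\<lambda>i\<in>{..k}. \<omega>' (real i * h))"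
    have "(x, y) \<in> Y" "z \<in> A (x, y)" using z h
      by (auto simp: Y_def X_def avoid_def x_def y_def A_def PL.cyl_def intro!: PL.path_in)
    then show "z \<in> (\<Union>z\<in>Y. A z)" by blast
  qed (auto simp: Y_def A_def avoid_def PL.cyl_def)
  show "avoid h k \<in> sets (P \<Otimes>\<^sub>M P)" unfolding U using A finY by blast
  have disj: "disjoint_family_on A Y"
  proof (unfold disjoint_family_on_def, intro ballI impI)
    fix z z' assume z: "z \<in> Y" "z' \<in> Y" "z \<noteq> z'"
    obtain x y where "z = (x, y)" by (cases z)
    obtain x' y' where "z' = (x', y')" by (cases z')
    have X: "x \<in> X" "y \<in> X" "x' \<in> X" "y' \<in> X" using z \<open>z = (x, y)\<close> \<open>z' = (x', y')\<close> by (simp_all add: Y_def)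
    have "PL.cyl h k x \<inter> PL.cyl h k x' = {} \<or> PL.cyl h k y \<inter> PL.cyl h k y' = {}"
    proof -
      have "PL.cyl h k u \<inter> PL.cyl h k u' = {}" if "u \<in> X" "u' \<in> X" "u \<noteq> u'" for u u'
      proof -
        have "\<exists>i\<in>{..k}. u i \<noteq> u' i"
        proof (rule ccontr)
          assume "\<not> ?thesis"
          then have "u = u'" using that(1,2) unfolding X_def by (intro PiE_ext) auto
          then show False using that(3) by simp
        qed
        then obtain i where i: "i \<le> k" "u i \<noteq> u' i" by blast
        have "\<omega> (real i * h) = u i" if "\<omega> \<in> PL.cyl h k u" for \<omega> u using that i(1) by (simp add: PL.cyl_def)
        then show ?thesis using i(2) by (metis disjoint_iff)
      qed
      moreover have "x \<noteq> x' \<or> y \<noteq> y'" using z(3) \<open>z = (x, y)\<close> \<open>z' = (x', y')\<close> by blast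
      ultimately show ?thesis using X by blast
    qed
    then show "A z \<inter> A z' = {}" by (simp only: A_def \<open>z = (x, y)\<close> \<open>z' = (x', y')\<close> prod.case Times_Int_Times Times_empty)
  qed
  have wpos: "0 \<le> weightp h k x" if "x \<in> X" for x
    unfolding weightp_def using that h by (intro mult_nonneg_nonneg prod_nonneg \<pi>_nonneg tr_nonneg) (auto simp: X_def)
  have em: "emeasure P (PL.cyl h k x) = ennreal (weightp h k x)" if "x \<in> X" for x
    using PL.prob_cyl[OF h, of x k] that by (simp add: PL.emeasure_eq_measure X_def PL.weight_def weightp_def)
  have "emeasure (P \<Otimes>\<^sub>M P) (avoid h k) = (\<Sum>z\<in>Y. emeasure (P \<Otimes>\<^sub>M P) (A z))"
    unfolding U by (rule sum_emeasure[symmetric, OF A disj finY])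
  also have "\<dots> = (\<Sum>z\<in>Y. ennreal (weightp h k (fst z) * weightp h k (snd z)))"
  proof (intro sum.cong refl)
    fix z assume "z \<in> Y"
    then show "emeasure (P \<Otimes>\<^sub>M P) (A z) = ennreal (weightp h k (fst z) * weightp h k (snd z))"
      using PL.cyl_sets[OF h] by (auto simp: A_def Y_def PL.emeasure_pair_measure_Times em ennreal_mult wpos)
  qed
  also have "\<dots> = ennreal (\<Sum>z\<in>Y. weightp h k (fst z) * weightp h k (snd z))"
    by (intro sum_ennreal) (auto simp: Y_def intro!: mult_nonneg_nonneg wpos)
  also have "(\<Sum>z\<in>Y. weightp h k (fst z) * weightp h k (snd z))
    = (\<Sum>x\<in>X. \<Sum>y\<in>X. weightp h k x * weightp h k y * (if \<forall>i\<le>k. x i \<noteq> y i then 1 else 0))"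
  proof -
    have "(\<Sum>x\<in>X. \<Sum>y\<in>X. weightp h k x * weightp h k y * (if \<forall>i\<le>k. x i \<noteq> y i then 1 else 0))
      = (\<Sum>z\<in>X \<times> X. weightp h k (fst z) * weightp h k (snd z) * (if \<forall>i\<le>k. fst z i \<noteq> snd z i then 1 else 0))"
      by (simp add: sum.cartesian_product case_prod_unfold)
    also have "\<dots> = (\<Sum>z\<in>Y. weightp h k (fst z) * weightp h k (snd z) * (if \<forall>i\<le>k. fst z i \<noteq> snd z i then 1 else 0))"
      using finX by (intro sum.mono_neutral_right) (auto simp: Y_def)
    also have "\<dots> = (\<Sum>z\<in>Y. weightp h k (fst z) * weightp h k (snd z))"
      by (intro sum.cong refl) (auto simp: Y_def)
    finally show ?thesis by simp
  qed
  also have "\<dots> = 1 - meetc h k"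
    unfolding X_def using sum_paths[OF h, of k "\<lambda>_. 1"] expect_\<pi>p_surv[OF h] by simp
  finally show "emeasure (P \<Otimes>\<^sub>M P) (avoid h k) = ennreal (1 - meetc h k)" .
qed

text \<open>Grid meeting times decrease along the nested grids to the meeting time, since
  right-continuous paths that meet stay together for a moment. The mean on the grid
  \<open>j0\<close> is finite and dominates the rest.\<close>

lemma mean_meeting_limit:
  assumes summ: "\<And>j. j0 \<le> j \<Longrightarrow> summable (\<lambda>t. 1 - meetc (mesh j) t)"
  shows "(\<lambda>j. mesh j * (\<Sum>t. 1 - meetc (mesh j) t)) \<longlonglongrightarrow> mean_meeting_time P"
proof -
  let ?PP = "P \<Otimes>\<^sub>M P"
  define D where "D z = {t. 0 \<le> t \<and> fst z t = snd z t}" for z :: "(real \<Rightarrow> nat) \<times> (real \<Rightarrow> nat)"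
  define M where "M j z = grid_hit (\<lambda>i. real i * mesh j \<in> D z) (mesh j)" for j z
  have spPP: "space ?PP = space P \<times> space P" by (simp add: space_pair_measure)
  have meetc_le: "meetc (mesh j) t \<le> 1" for j t
  proof -
    interpret fk: finite_kernel "kp (mesh j)" by (rule finite_kernel_kp) (use mesh(1)[of j] in simp)
    have "0 \<le> 1 - meetc (mesh j) t" using set_\<pi>p finS finite_subset mesh(1)[of j]
      by (subst expect_\<pi>p_surv[symmetric]) (auto intro!: expect_ge fk.surv_nonneg)
    then show ?thesis by simp
  qed
  have M_eq: "M j z = (\<Sum>t. ennreal (mesh j) * indicator (avoid (mesh j) t) z)" if "z \<in> space ?PP" for j z
  proof -
    have nn: "0 \<le> real i * mesh j" for i using mesh(1)[of j] by simp
    show ?thesis unfolding M_def grid_hit_eq_suminf[OF mesh(1)]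
      using that nn by (intro arg_cong[of _ _ suminf] ext) (auto simp: D_def avoid_def spPP indicator_def split: prod.splits)
  qed
  have M_meas: "M j \<in> borel_measurable ?PP" for j
  proof -
    have "avoid (mesh j) t \<in> sets ?PP" for t using avoid_measure(1) mesh(1)[of j] by simp
    then have "(\<lambda>z. \<Sum>t. ennreal (mesh j) * indicator (avoid (mesh j) t) z) \<in> borel_measurable ?PP" by measurable
    then show ?thesis by (subst measurable_cong[OF M_eq])
  qed
  have M_int: "(\<integral>\<^sup>+z. M j z \<partial>?PP) = ennreal (mesh j * (\<Sum>t. 1 - meetc (mesh j) t))" if "j0 \<le> j" for j
  proof -
    have h: "0 \<le> mesh j" using mesh(1)[of j] by simp
    have "(\<integral>\<^sup>+z. M j z \<partial>?PP) = (\<integral>\<^sup>+z. (\<Sum>t. ennreal (mesh j) * indicator (avoid (mesh j) t) z) \<partial>?PP)"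
      by (intro nn_integral_cong M_eq)
    also have "\<dots> = (\<Sum>t. ennreal (mesh j) * ennreal (1 - meetc (mesh j) t))"
      using avoid_measure[OF h] by (subst nn_integral_suminf) (auto simp: nn_integral_cmult_indicator)
    also have "\<dots> = (\<Sum>t. ennreal (mesh j * (1 - meetc (mesh j) t)))"
      using h meetc_le by (intro arg_cong[of _ _ suminf] ext) (simp add: ennreal_mult)
    also have "\<dots> = ennreal (\<Sum>t. mesh j * (1 - meetc (mesh j) t))"
      using h meetc_le by (intro suminf_ennreal2 summable_mult summ that) auto
    finally show ?thesis using summ[OF that] by (simp add: suminf_mult)
  qed
  have lim: "(\<lambda>j. M j z) \<longlonglongrightarrow> meeting_time (fst z) (snd z)" if z: "z \<in> space ?PP" for z
  proof -
    have "(\<lambda>j. M j z) \<longlonglongrightarrow> (INF t\<in>D z. ennreal t)"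
      unfolding M_def
    proof (rule grid_hit_limit[OF _ mesh])
      fix t assume t: "t \<in> D z"
      then have t0: "0 \<le> t" by (simp add: D_def)
      have sp: "fst z \<in> space P" "snd z \<in> space P" using z by (auto simp: spPP)
      obtain e where e: "e > 0" "\<forall>s\<in>{t..<t + e}. fst z s = fst z t"
        using PL.right_cont[OF sp(1) t0] by blast
      obtain e' where e': "e' > 0" "\<forall>s\<in>{t..<t + e'}. snd z s = snd z t"
        using PL.right_cont[OF sp(2) t0] by blast
      have "s \<in> D z" if "s \<in> {t..<t + min e e'}" for s
      proof -
        have "s \<in> {t..<t + e}" "s \<in> {t..<t + e'}" using that by auto
        then have "fst z s = fst z t" "snd z s = snd z t" using e(2) e'(2) by blast+
        then show ?thesis using t that by (simp add: D_def)
      qed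
      then have "{t..<t + min e e'} \<subseteq> D z" by blast
      moreover have "0 < min e e'" using e(1) e'(1) by simp
      ultimately show "0 \<le> t \<and> (\<exists>e>0. {t..<t + e} \<subseteq> D z)" using t0 by blast
    qed
    then show ?thesis by (simp add: meeting_time_def D_def)
  qed
  have mono: "M (j + j0) z \<le> M j0 z" for j z
    unfolding M_def by (rule grid_hit_refine[of _ "2 ^ j"]) (simp add: mesh_def power_add)
  have INF: "meeting_time (fst z) (snd z) = (INF j. M j z)" if "z \<in> space ?PP" for z
  proof (rule LIMSEQ_unique[OF lim[OF that] LIMSEQ_INF])
    show "decseq (\<lambda>j. M j z)"
    proof (rule decseq_SucI)
      show "M (Suc j) z \<le> M j z" for j
        unfolding M_def by (rule grid_hit_refine[of _ 2]) (simp add: mesh_def)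
    qed
  qed
  have "(\<lambda>j. \<integral>\<^sup>+z. M (j + j0) z \<partial>?PP) \<longlonglongrightarrow> (\<integral>\<^sup>+z. meeting_time (fst z) (snd z) \<partial>?PP)"
  proof (rule nn_integral_dominated_convergence[where w = "M j0"])
    show "(\<lambda>z. meeting_time (fst z) (snd z)) \<in> borel_measurable ?PP"
    proof -
      have "(\<lambda>z. INF j. M j z) \<in> borel_measurable ?PP" by (intro borel_measurable_INF M_meas) auto
      then show ?thesis by (subst measurable_cong[OF INF])
    qed
    show "AE z in ?PP. (\<lambda>j. M (j + j0) z) \<longlonglongrightarrow> meeting_time (fst z) (snd z)"
      using lim by (intro AE_I2 LIMSEQ_ignore_initial_segment)
    show "integral\<^sup>N ?PP (M j0) < \<infinity>" by (simp add: M_int)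
  qed (auto simp: mono M_meas)
  moreover have "(\<integral>\<^sup>+z. meeting_time (fst z) (snd z) \<partial>?PP) \<noteq> \<top>"
  proof -
    have "(\<integral>\<^sup>+z. meeting_time (fst z) (snd z) \<partial>?PP) \<le> (\<integral>\<^sup>+z. M j0 z \<partial>?PP)"
    proof (intro nn_integral_mono)
      fix z assume "z \<in> space ?PP"
      then show "meeting_time (fst z) (snd z) \<le> M j0 z"
        unfolding INF[OF \<open>z \<in> space ?PP\<close>] by (intro INF_lower) simp
    qed
    then show ?thesis using M_int[of j0] by (auto simp: top_unique)
  qed
  ultimately have "(\<lambda>j. enn2real (\<integral>\<^sup>+z. M (j + j0) z \<partial>?PP)) \<longlonglongrightarrow> mean_meeting_time P"
    unfolding mean_meeting_time_def by (intro tendsto_enn2real) (auto simp: less_top)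
  moreover have "enn2real (\<integral>\<^sup>+z. M (j + j0) z \<partial>?PP) = mesh (j + j0) * (\<Sum>t. 1 - meetc (mesh (j + j0)) t)" for j
  proof -
    have "0 \<le> (\<Sum>t. 1 - meetc (mesh (j + j0)) t)" using meetc_le by (intro suminf_nonneg summ) auto
    then have "0 \<le> mesh (j + j0) * (\<Sum>t. 1 - meetc (mesh (j + j0)) t)"
      using mesh(1)[of "j + j0"] by (intro mult_nonneg_nonneg) auto
    then show ?thesis unfolding M_int[OF le_add2] by (rule enn2real_ennreal)
  qed
  ultimately have "(\<lambda>j. mesh (j + j0) * (\<Sum>t. 1 - meetc (mesh (j + j0)) t)) \<longlonglongrightarrow> mean_meeting_time P"
    by (simp only:)
  then show ?thesis by (rule LIMSEQ_offset)
qed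

end
end


lemma steps_coal_card:
  assumes "finite V" "finite A" "B \<in> set_pmf (steps (coal V P) t A)"
  shows "card B \<le> card A"
  using assms(2,3)
proof (induction t arbitrary: A)
  case (Suc t)
  then obtain A' where A': "A' \<in> set_pmf (coal V P A)" "B \<in> set_pmf (steps (coal V P) t A')" by auto
  then obtain z where z: "A' = z ` A" by (auto simp: coal_def)
  have "card B \<le> card A'" using Suc.prems(1) A' z by (intro Suc.IH) auto
  also have "\<dots> \<le> card A" unfolding z by (rule card_image_le[OF Suc.prems(1)])
  finally show ?case .
qed simp

section \<open>The coalescence time as a function on paths\<close>

context mf_chain
begin

text \<open>On a grid the number of walkers never increases, so the probability is 0 for every mesh
  and hence in the limit.\<close>

lemma coal_absorbed:
  assumes "A \<in> Sc" "card A = 1" "B \<in> Sc" "card B \<noteq> 1" "0 \<le> u"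
  shows "cc.tr u A B = 0"
proof -
  define f where "f C = (if C = B then 1 else 0::real)" for C
  have A: "finite A" using assms(2) by (simp add: card_ge_0_finite)
  have B: "card B \<noteq> 0" using assms(3) finS by (auto simp: finite_subset)
  have "expect (steps (coal V (Pk (mesh j))) N A) f = 0" for j N
  proof -
    have "expect (steps (coal V (Pk (mesh j))) N A) f = expect (steps (coal V (Pk (mesh j))) N A) (\<lambda>_. 0)"
    proof (rule expect_cong)
      fix C assume "C \<in> set_pmf (steps (coal V (Pk (mesh j))) N A)"
      then have "card C \<le> 1" using steps_coal_card[OF finS A] assms(2) by metis
      then show "f C = 0" using assms(4) B by (auto simp: f_def)
    qed
    then show ?thesis by simp
  qed
  then have "matrix_op Sc (cc.tr u) f A = 0"
    using coal_limit[OF mesh floor_mesh[OF assms(5)] _ assms(1), of f] by (simp add: f_def LIMSEQ_const_iff)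
  then show ?thesis
    using cc.finS assms(3) by (simp add: matrix_op_def f_def if_distrib[of "\<lambda>u. _ * u"] cong: if_cong)
qed

context
  fixes P :: "(real \<Rightarrow> nat set) measure"
  assumes P: "coalescing_law V q P"
begin

interpretation CL: path_law Sc cr "\<lambda>A. if A = V then 1 else 0" P
  using cc.finS P unfolding coalescing_law_def by unfold_locales

lemma coal_start: "AE \<eta> in P. \<eta> 0 = V"
proof -
  note CL.fdd[where k = 0 and t = "\<lambda>_. 0" and x = "\<lambda>_. V"]
  then have "CL.prob {\<eta> \<in> space P. \<eta> 0 = V} = 1" using V_in_Sc by simp
  then have "AE \<eta> in P. \<eta> \<in> {\<eta> \<in> space P. \<eta> 0 = V}" by (rule CL.AE_prob_1)
  then show ?thesis by eventually_elim simp
qed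

lemma coal_two_times:
  assumes "A \<in> Sc" "B \<in> Sc" "0 \<le> s" "s \<le> t"
  shows "CL.prob {\<eta> \<in> space P. \<eta> s = A \<and> \<eta> t = B} = cc.tr s V A * cc.tr (t - s) A B"
proof -
  \<comment> \<open>Finite-dimensional distributions are given for times starting at 0, so 0 is put
    in front; there the path is at \<open>V\<close> almost surely.\<close>
  define T where "T i = (if i = 0 then 0 else if i = 1 then s else t)" for i :: nat
  define x where "x i = (if i = 0 then V else if i = 1 then A else B)" for i :: nat
  have lt2: "{..<2::nat} = {0, 1}" by auto
  have "CL.prob {\<eta> \<in> space P. \<forall>i\<le>2. \<eta> (T i) = x i}
    = (if x 0 = V then 1 else 0) * (\<Prod>i<2. cc.tr (T (Suc i) - T i) (x i) (x (Suc i)))"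
    by (rule CL.fdd) (use assms V_in_Sc in \<open>auto simp: T_def x_def less_2_cases_iff\<close>)
  also have "\<dots> = cc.tr s V A * cc.tr (t - s) A B" by (simp add: lt2 T_def x_def)
  also have "{\<eta> \<in> space P. \<forall>i\<le>2. \<eta> (T i) = x i} = {\<eta> \<in> space P. \<eta> 0 = V \<and> \<eta> s = A \<and> \<eta> t = B}"
  proof -
    have "(\<forall>i\<le>2. \<eta> (T i) = x i) \<longleftrightarrow> \<eta> 0 = V \<and> \<eta> s = A \<and> \<eta> t = B" for \<eta>
    proof -
      have "(\<forall>i\<le>2. \<eta> (T i) = x i) \<longleftrightarrow> (\<forall>i\<in>{0, 1, 2}. \<eta> (T i) = x i)" by (auto simp: numeral_2_eq_2 le_Suc_eq)
      then show ?thesis by (simp add: T_def x_def)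
    qed
    then show ?thesis by simp
  qed
  also have "CL.prob {\<eta> \<in> space P. \<eta> 0 = V \<and> \<eta> s = A \<and> \<eta> t = B} = CL.prob {\<eta> \<in> space P. \<eta> s = A \<and> \<eta> t = B}"
  proof (rule CL.finite_measure_eq_AE)
    have [measurable]: "{\<eta> \<in> space P. \<eta> u = C} \<in> sets P" if "0 \<le> u" for u C
      using CL.coord_pred[OF that, of "\<lambda>y. y = C"] .
    have "{\<eta> \<in> space P. \<eta> 0 = V \<and> \<eta> s = A \<and> \<eta> t = B} = {\<eta> \<in> space P. \<eta> 0 = V} \<inter> {\<eta> \<in> space P. \<eta> s = A} \<inter> {\<eta> \<in> space P. \<eta> t = B}" by auto
    then show "{\<eta> \<in> space P. \<eta> 0 = V \<and> \<eta> s = A \<and> \<eta> t = B} \<in> sets P"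
      using CL.coord_pred[of 0 "\<lambda>y. y = V"] CL.coord_pred[of s "\<lambda>y. y = A"] CL.coord_pred[of t "\<lambda>y. y = B"] assms by auto
    have "{\<eta> \<in> space P. \<eta> s = A \<and> \<eta> t = B} = {\<eta> \<in> space P. \<eta> s = A} \<inter> {\<eta> \<in> space P. \<eta> t = B}" by auto
    then show "{\<eta> \<in> space P. \<eta> s = A \<and> \<eta> t = B} \<in> sets P"
      using CL.coord_pred[of s "\<lambda>y. y = A"] CL.coord_pred[of t "\<lambda>y. y = B"] assms by auto
  qed (use coal_start in auto)
  finally show ?thesis .
qed

lemma coal_marginal:
  assumes "B \<in> Sc" "0 \<le> t" shows "CL.prob {\<eta> \<in> space P. \<eta> t = B} = cc.tr t V B"
proof -
  have "CL.prob {\<eta> \<in> space P. \<eta> t = B} = CL.prob {\<eta> \<in> space P. \<eta> 0 = V \<and> \<eta> t = B}"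
  proof (rule CL.finite_measure_eq_AE)
    have "{\<eta> \<in> space P. \<eta> 0 = V \<and> \<eta> t = B} = {\<eta> \<in> space P. \<eta> 0 = V} \<inter> {\<eta> \<in> space P. \<eta> t = B}" by auto
    then show "{\<eta> \<in> space P. \<eta> 0 = V \<and> \<eta> t = B} \<in> sets P"
      using CL.coord_pred[of 0 "\<lambda>y. y = V"] CL.coord_pred[of t "\<lambda>y. y = B"] assms by auto
  qed (use coal_start CL.coord_pred[of t "\<lambda>y. y = B"] assms in auto)
  also have "\<dots> = cc.tr 0 V V * cc.tr (t - 0) V B" by (rule coal_two_times) (use assms V_in_Sc in auto)
  finally show ?thesis using V_in_Sc by (simp add: cc.tr_0)
qed

lemma prob_multiple: "0 \<le> t \<Longrightarrow> CL.prob {\<eta> \<in> space P. card (\<eta> t) \<noteq> 1} = F t"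
proof -
  assume t: "0 \<le> t"
  define X where "X = {B \<in> Sc. card B \<noteq> 1}"
  have finX: "finite X" using cc.finS by (simp add: X_def)
  have card0: "card B \<noteq> 0" if "B \<in> Sc" for B using that finS by (auto simp: finite_subset)
  have eq: "{\<eta> \<in> space P. card (\<eta> t) \<noteq> 1} = (\<Union>B\<in>X. {\<eta> \<in> space P. \<eta> t = B})"
    using CL.path_in[OF _ t] by (auto simp: X_def)
  have "CL.prob {\<eta> \<in> space P. card (\<eta> t) \<noteq> 1} = (\<Sum>B\<in>X. CL.prob {\<eta> \<in> space P. \<eta> t = B})"
    unfolding eq using CL.coord_pred[OF t] by (intro CL.finite_measure_finite_Union finX) (auto simp: disjoint_family_on_def)
  also have "\<dots> = (\<Sum>B\<in>X. cc.tr t V B)" using t by (intro sum.cong refl coal_marginal) (auto simp: X_def)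
  also have "\<dots> = (\<Sum>B\<in>X. cc.tr t V B * multiple B)"
  proof (intro sum.cong refl)
    fix B assume "B \<in> X"
    then have "2 \<le> card B" using card0[of B] unfolding X_def by simp
    then show "cc.tr t V B = cc.tr t V B * multiple B" by (simp add: multiple_def)
  qed
  also have "\<dots> = F t" unfolding F_def matrix_op_def
    using cc.finS by (intro sum.mono_neutral_left) (auto simp: X_def multiple_def)
  finally show ?thesis .
qed

text \<open>For two fixed times the exceptional set is null; a countable set of times keeps it null,
  hence the rationals. Right continuity extends the property to all times in
  \<open>coalescence_gt_iff\<close>.\<close>

lemma coal_absorbing:
  "AE \<eta> in P. \<forall>s\<in>\<rat>. \<forall>t\<in>\<rat>. 0 \<le> s \<longrightarrow> s \<le> t \<longrightarrow> card (\<eta> s) = 1 \<longrightarrow> card (\<eta> t) = 1"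
proof -
  have one: "AE \<eta> in P. card (\<eta> s) = 1 \<longrightarrow> card (\<eta> t) = 1" if "0 \<le> s" "s \<le> t" for s t
  proof -
    define X where "X = {(A, B) \<in> Sc \<times> Sc. card A = 1 \<and> card B \<noteq> 1}"
    have finX: "finite X" using cc.finS by (auto simp: X_def intro: finite_subset[of _ "Sc \<times> Sc"])
    have "{\<eta> \<in> space P. \<not> (card (\<eta> s) = 1 \<longrightarrow> card (\<eta> t) = 1)} \<subseteq> (\<Union>(A, B)\<in>X. {\<eta> \<in> space P. \<eta> s = A \<and> \<eta> t = B})"
      using CL.path_in[of _ s] CL.path_in[of _ t] that by (auto simp: X_def)
    moreover have "(\<Union>(A, B)\<in>X. {\<eta> \<in> space P. \<eta> s = A \<and> \<eta> t = B}) \<in> null_sets P"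
    proof (intro null_sets.finite_UN finX)
      fix z assume z: "z \<in> X"
      obtain A B where AB: "z = (A, B)" by (cases z)
      have m: "{\<eta> \<in> space P. \<eta> s = A \<and> \<eta> t = B} \<in> sets P"
      proof -
        have "{\<eta> \<in> space P. \<eta> s = A \<and> \<eta> t = B} = {\<eta> \<in> space P. \<eta> s = A} \<inter> {\<eta> \<in> space P. \<eta> t = B}" by auto
        then show ?thesis using CL.coord_pred[of s "\<lambda>y. y = A"] CL.coord_pred[of t "\<lambda>y. y = B"] that by auto
      qed
      have "CL.prob {\<eta> \<in> space P. \<eta> s = A \<and> \<eta> t = B} = 0"
        using z AB that by (subst coal_two_times) (auto simp: X_def coal_absorbed)
      then show "(case z of (A, B) \<Rightarrow> {\<eta> \<in> space P. \<eta> s = A \<and> \<eta> t = B}) \<in> null_sets P"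
        unfolding AB using m by (simp add: null_sets_def CL.emeasure_eq_measure)
    qed
    ultimately show ?thesis by (rule AE_I'[rotated])
  qed
  show ?thesis
    by (intro AE_ball_countable[THEN iffD2] ballI countable_rat) (use one in auto)
qed

text \<open>By right continuity the infimum over uncountably many times is the limit of the infima
  over grids, each of which involves countably many coordinates.\<close>

lemma coalescence_measurable: "coalescence_time \<in> borel_measurable P"
proof -
  define D where "D \<eta> = {t. 0 \<le> t \<and> card (\<eta> t) = 1}" for \<eta> :: "real \<Rightarrow> nat set"
  define M where "M j \<eta> = grid_hit (\<lambda>i. real i * mesh j \<in> D \<eta>) (mesh j)" for j \<eta>
  have M: "M j \<in> borel_measurable P" for j
  proof -
    have "(\<lambda>\<eta>. if real i * mesh j \<in> D \<eta> then ennreal (real i * mesh j) else \<top>) \<in> borel_measurable P" for i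
    proof (rule measurable_If)
      have "0 \<le> real i * mesh j" using mesh(1)[of j] by simp
      then show "{\<eta> \<in> space P. real i * mesh j \<in> D \<eta>} \<in> sets P"
        using CL.coord_pred[of "real i * mesh j" "\<lambda>y. card y = 1"] by (simp add: D_def)
    qed auto
    then show ?thesis unfolding M_def[abs_def] grid_hit_def by (intro borel_measurable_INF) auto
  qed
  have "coalescence_time \<eta> = (INF j. M j \<eta>)" if \<eta>: "\<eta> \<in> space P" for \<eta>
  proof -
    have "(\<lambda>j. M j \<eta>) \<longlonglongrightarrow> (INF t\<in>D \<eta>. ennreal t)" unfolding M_def
    proof (rule grid_hit_limit[OF _ mesh])
      fix t assume t: "t \<in> D \<eta>"
      then have t0: "0 \<le> t" by (simp add: D_def)
      obtain e where e: "e > 0" "\<forall>s\<in>{t..<t + e}. \<eta> s = \<eta> t" using CL.right_cont[OF \<eta> t0] by blast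
      have "s \<in> D \<eta>" if "s \<in> {t..<t + e}" for s using e(2)[rule_format, OF that] t that by (simp add: D_def)
      then show "0 \<le> t \<and> (\<exists>e>0. {t..<t + e} \<subseteq> D \<eta>)" using e(1) t0 by blast
    qed
    moreover have "decseq (\<lambda>j. M j \<eta>)"
    proof (rule decseq_SucI)
      show "M (Suc j) \<eta> \<le> M j \<eta>" for j
        unfolding M_def by (rule grid_hit_refine[of _ 2]) (simp add: mesh_def)
    qed
    ultimately have "(INF t\<in>D \<eta>. ennreal t) = (INF j. M j \<eta>)" by (metis LIMSEQ_unique LIMSEQ_INF)
    then show ?thesis by (simp add: coalescence_time_def D_def)
  qed
  moreover have "(\<lambda>\<eta>. INF j. M j \<eta>) \<in> borel_measurable P" by (intro borel_measurable_INF M) auto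
  ultimately show ?thesis by (subst measurable_cong[of P _ "\<lambda>\<eta>. INF j. M j \<eta>"]) auto
qed

text \<open>If one walker were left at some time before \<open>t + e\<close>, right continuity would
  move that time to a slightly later rational one, and a still later rational time, at which the
  path has its value at \<open>t\<close>, would contradict \<open>abs\<close>.\<close>

lemma coalescence_gt_iff:
  assumes \<eta>: "\<eta> \<in> space P" and abs: "\<forall>s\<in>\<rat>. \<forall>t\<in>\<rat>. 0 \<le> s \<longrightarrow> s \<le> t \<longrightarrow> card (\<eta> s) = 1 \<longrightarrow> card (\<eta> t) = 1"
    and t: "0 \<le> t"
  shows "ennreal t < coalescence_time \<eta> \<longleftrightarrow> card (\<eta> t) \<noteq> 1"
proof
  assume "ennreal t < coalescence_time \<eta>"
  moreover have "coalescence_time \<eta> \<le> ennreal t" if "card (\<eta> t) = 1"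
    unfolding coalescence_time_def using t that by (intro INF_lower) simp
  ultimately show "card (\<eta> t) \<noteq> 1" by auto
next
  assume nt: "card (\<eta> t) \<noteq> 1"
  obtain e where e: "e > 0" "\<forall>s\<in>{t..<t + e}. \<eta> s = \<eta> t" using CL.right_cont[OF \<eta> t] by blast
  have "ennreal (t + e) \<le> coalescence_time \<eta>"
    unfolding coalescence_time_def
  proof (rule INF_greatest)
    fix s assume "s \<in> {t. 0 \<le> t \<and> card (\<eta> t) = 1}"
    then have s: "0 \<le> s" "card (\<eta> s) = 1" by auto
    show "ennreal (t + e) \<le> ennreal s"
    proof (rule ccontr)
      assume "\<not> ennreal (t + e) \<le> ennreal s"
      then have "s < t + e" using s(1) by (simp add: not_le ennreal_less_iff)
      obtain e' where e': "e' > 0" "\<forall>u\<in>{s..<s + e'}. \<eta> u = \<eta> s" using CL.right_cont[OF \<eta> s(1)] by blast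
      obtain s' where s': "s' \<in> \<rat>" "s < s'" "s' < min (t + e) (s + e')"
        using Rats_dense_in_real[of s "min (t + e) (s + e')"] \<open>s < t + e\<close> e'(1) by auto
      obtain t' where t': "t' \<in> \<rat>" "max t s' < t'" "t' < t + e"
        using Rats_dense_in_real[of "max t s'" "t + e"] s' e(1) by auto
      have "card (\<eta> s') = 1" using e'(2)[rule_format, of s'] s'(2,3) s(2) by simp
      moreover have "0 \<le> s'" "s' \<le> t'" using s(1) s'(2) t'(2) by simp_all
      ultimately have "card (\<eta> t') = 1" using abs[rule_format, OF s'(1) t'(1)] by blast
      moreover have "\<eta> t' = \<eta> t" using e(2)[rule_format, of t'] t'(2,3) by simp
      ultimately show False using nt by simp
    qed
  qed
  moreover have "ennreal t < ennreal (t + e)" using t e(1) by (simp add: ennreal_less_iff)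
  ultimately show "ennreal t < coalescence_time \<eta>" by (rule less_le_trans[rotated])
qed

lemma coalescence_tail:
  assumes "0 \<le> t" shows "CL.prob {\<eta> \<in> space P. ennreal t < coalescence_time \<eta>} = F t"
proof -
  note [measurable] = coalescence_measurable
  have "CL.prob {\<eta> \<in> space P. ennreal t < coalescence_time \<eta>} = CL.prob {\<eta> \<in> space P. card (\<eta> t) \<noteq> 1}"
  proof (rule CL.finite_measure_eq_AE)
    show "AE \<eta> in P. (\<eta> \<in> {\<eta> \<in> space P. ennreal t < coalescence_time \<eta>}) = (\<eta> \<in> {\<eta> \<in> space P. card (\<eta> t) \<noteq> 1})"
      using coal_absorbing AE_space
    proof eventually_elim
      case (elim \<eta>)
      then show ?case using coalescence_gt_iff[OF elim(2,1) assms] by simp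
    qed
    show "{\<eta> \<in> space P. card (\<eta> t) \<noteq> 1} \<in> sets P" by (rule CL.coord_pred[OF assms])
  qed measurable
  then show ?thesis using prob_multiple[OF assms] by simp
qed

lemma coalescence_mean: "(\<integral>\<^sup>+\<eta>. coalescence_time \<eta> \<partial>P) = (\<integral>\<^sup>+t. ennreal (F t) * indicator {0..} t \<partial>lborel)"
  unfolding CL.nn_integral_layer_cake[OF coalescence_measurable]
  by (intro nn_integral_cong) (auto simp: indicator_def CL.emeasure_eq_measure coalescence_tail)

lemma coalescence_finite:
  assumes "(\<lambda>i::nat. F (x i)) \<longlonglongrightarrow> 0" "\<And>i. 0 \<le> x i"
  shows "AE \<eta> in P. coalescence_time \<eta> \<noteq> \<top>"
proof -
  note [measurable] = coalescence_measurable
  have "CL.prob {\<eta> \<in> space P. coalescence_time \<eta> = \<top>} \<le> F (x i)" for i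
    unfolding coalescence_tail[OF assms(2), symmetric]
    by (intro CL.finite_measure_mono) (auto simp: less_top[symmetric], measurable)
  then have "CL.prob {\<eta> \<in> space P. coalescence_time \<eta> = \<top>} \<le> 0"
    using assms(1) by (intro LIMSEQ_le_const) auto
  then have "CL.prob {\<eta> \<in> space P. coalescence_time \<eta> = \<top>} = 0" by (simp add: measure_le_0_iff)
  then have "{\<eta> \<in> space P. coalescence_time \<eta> = \<top>} \<in> null_sets P"
    by (intro null_setsI) (auto simp: CL.emeasure_eq_measure, measurable)
  then show ?thesis by (intro AE_I'[OF _]) auto
qed

lemma scaled_tail:
  assumes fin: "AE \<eta> in P. coalescence_time \<eta> \<noteq> \<top>" and m: "0 < m"
  shows "measure (scaled_coalescence_law P m) {x<..} = (if 0 \<le> x then F (m * x) else 1)"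
proof -
  note [measurable] = coalescence_measurable
  have "measure (scaled_coalescence_law P m) {x<..}
    = CL.prob {\<eta> \<in> space P. x < enn2real (coalescence_time \<eta>) / m}"
    unfolding scaled_coalescence_law_def
    by (subst measure_distr) (measurable, auto intro!: arg_cong[of _ _ CL.prob])
  also have "\<dots> = (if 0 \<le> x then F (m * x) else 1)"
  proof (cases "0 \<le> x")
    case True
    have "CL.prob {\<eta> \<in> space P. x < enn2real (coalescence_time \<eta>) / m}
      = CL.prob {\<eta> \<in> space P. ennreal (m * x) < coalescence_time \<eta>}"
    proof (rule CL.finite_measure_eq_AE)
      show "AE \<eta> in P. (\<eta> \<in> {\<eta> \<in> space P. x < enn2real (coalescence_time \<eta>) / m}) = (\<eta> \<in> {\<eta> \<in> space P. ennreal (m * x) < coalescence_time \<eta>})"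
        using fin
      proof eventually_elim
        case (elim \<eta>)
        then obtain c where c: "coalescence_time \<eta> = ennreal c" "0 \<le> c" by (cases "coalescence_time \<eta>") auto
        show ?case using m True c by (simp add: ennreal_less_iff pos_less_divide_eq mult.commute)
      qed
    qed measurable
    then show ?thesis using True m by (simp add: coalescence_tail)
  next
    case False
    have "x < enn2real c / m" for c
    proof -
      have "0 \<le> enn2real c / m" using m by simp
      then show ?thesis using False by linarith
    qed
    then show ?thesis using False CL.prob_space by simp
  qed
  finally show ?thesis .
qed

end
end


section \<open>The limit law\<close>

definition exp_law :: "nat \<Rightarrow> real measure" where
  "exp_law i = density lborel (exponential_density (real (i choose 2)))"

definition exp_prod :: "(nat \<Rightarrow> real) measure" where "exp_prod = (\<Pi>\<^sub>M i\<in>{2..}. exp_law i)"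

lemma choose_2_pos: "2 \<le> i \<Longrightarrow> 0 < real (i choose 2)" by (simp add: zero_less_binomial)

lemma prob_space_exp_law: "2 \<le> i \<Longrightarrow> prob_space (exp_law i)"
  unfolding exp_law_def by (intro prob_space_exponential_density choose_2_pos)

lemma sets_exp_law [simp, measurable_cong]: "sets (exp_law i) = sets borel" and space_exp_law [simp]: "space (exp_law i) = UNIV"
  by (simp_all add: exp_law_def)

interpretation EP: prob_space exp_prod
  unfolding exp_prod_def by (intro prob_space_PiM prob_space_exp_law) simp

lemma exp_coord: "2 \<le> i \<Longrightarrow> (\<lambda>z. z i) \<in> borel_measurable exp_prod"
  using measurable_component_singleton[of i "{2..}" exp_law] unfolding exp_prod_def
  by (simp cong: measurable_cong_sets)

lemma exp_coord_shift: "(\<lambda>z. z (i + 2)) \<in> borel_measurable exp_prod" by (rule exp_coord) simp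

lemma exp_law_tail:
  assumes "2 \<le> i" shows "emeasure (exp_law i) {v<..} = ennreal (exp (- real (i choose 2) * max v 0))"
proof -
  have l: "0 < real (i choose 2)" using assms by (rule choose_2_pos)
  interpret prob_space "exp_law i" using assms by (rule prob_space_exp_law)
  have "emeasure (exp_law i) {v<..} = emeasure (exp_law i) (space (exp_law i) - {..v})"
    by (intro arg_cong[of _ _ "emeasure (exp_law i)"]) auto
  also have "\<dots> = 1 - emeasure (exp_law i) {..v}"
    by (subst emeasure_compl) (auto simp: emeasure_space_1[simplified])
  also have "emeasure (exp_law i) {..v} = ennreal (1 - exp (- real (i choose 2) * max v 0))"
    unfolding exp_law_def by (subst emeasure_erlang_density[OF l]) (auto simp: erlang_CDF_def max_def)
  also have "1 - \<dots> = ennreal (exp (- real (i choose 2) * max v 0))"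
    unfolding ennreal_1[symmetric] using l by (subst ennreal_minus) auto
  finally show ?thesis .
qed

lemma exp_law_mean:
  assumes "2 \<le> i" shows "(\<integral>\<^sup>+x. ennreal x \<partial>exp_law i) = ennreal (1 / real (i choose 2))"
proof -
  have l: "0 < real (i choose 2)" using assms by (rule choose_2_pos)
  have "(\<integral>\<^sup>+x. ennreal x \<partial>exp_law i) = (\<integral>\<^sup>+x. ennreal (exponential_density (real (i choose 2)) x * x ^ 1) \<partial>lborel)"
    unfolding exp_law_def using exponential_density_nonneg[OF l]
    by (subst nn_integral_density) (auto simp: ennreal_mult' intro!: nn_integral_cong)
  also have "\<dots> = ennreal (1 / real (i choose 2))"
    by (subst nn_integral_erlang_ith_moment[OF l]) simp
  finally show ?thesis .
qed

lemma exp_coord_nonneg: "AE z in exp_prod. \<forall>i. 0 \<le> z (i + 2)"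
proof (rule AE_all_countable[THEN iffD2], rule allI)
  fix i
  interpret prob_space "exp_law (i + 2)" by (rule prob_space_exp_law) simp
  have "AE x in exp_law (i + 2). 0 \<le> x"
    unfolding exp_law_def by (subst AE_density) (auto simp: exponential_density_def)
  then show "AE z in exp_prod. 0 \<le> z (i + 2)"
    unfolding exp_prod_def by (intro AE_PiM_component prob_space_exp_law) auto
qed

lemma exp_coord_mean:
  assumes "2 \<le> i" shows "(\<integral>\<^sup>+z. ennreal (z i) \<partial>exp_prod) = ennreal (1 / real (i choose 2))"
proof -
  have "exp_law i = distr exp_prod (exp_law i) (\<lambda>z. z i)"
    unfolding exp_prod_def using assms by (intro distr_PiM_component[symmetric] prob_space_exp_law) auto
  then have "(\<integral>\<^sup>+x. ennreal x \<partial>exp_law i) = (\<integral>\<^sup>+x. ennreal x \<partial>distr exp_prod (exp_law i) (\<lambda>z. z i))" by simp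
  also have "\<dots> = (\<integral>\<^sup>+z. ennreal (z i) \<partial>exp_prod)"
    using exp_coord[OF assms] by (intro nn_integral_distr) (auto cong: measurable_cong_sets)
  finally show ?thesis using exp_law_mean[OF assms] by simp
qed

lemma sum_inverse_choose: "(\<lambda>i. 1 / real ((i + 2) choose 2)) sums 2"
proof -
  have "(\<lambda>i. 2 / real (i + 1) - 2 / real (Suc i + 1)) sums (2 / real (0 + 1) - 0)"
    by (rule telescope_sums') real_asymp
  moreover have "1 / real ((i + 2) choose 2) = 2 / real (i + 1) - 2 / real (Suc i + 1)" for i
  proof -
    have "even ((i + 2) * (i + 1))" by simp
    then have "real ((i + 2) choose 2) = real ((i + 2) * (i + 1)) / 2"
      unfolding choose_two by (subst real_of_nat_div) auto
    moreover have "0 < 2 + (real i * real i + real i * 3)" by (intro add_pos_nonneg) auto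
    then have "2 + (real i * real i + real i * 3) \<noteq> 0" by linarith
    ultimately show ?thesis by (simp add: field_simps)
  qed
  ultimately show ?thesis by simp
qed

definition exp_total :: "(nat \<Rightarrow> real) \<Rightarrow> real" where "exp_total z = (\<Sum>i. z (i + 2))"

lemma exp_total_measurable [measurable]: "exp_total \<in> borel_measurable exp_prod"
  unfolding exp_total_def[abs_def] by (intro borel_measurable_suminf exp_coord) simp

lemma exp_total_mean: "(\<integral>\<^sup>+z. (\<Sum>i. ennreal (z (i + 2))) \<partial>exp_prod) = 2"
proof -
  have "(\<integral>\<^sup>+z. (\<Sum>i. ennreal (z (i + 2))) \<partial>exp_prod) = (\<Sum>i. \<integral>\<^sup>+z. ennreal (z (i + 2)) \<partial>exp_prod)"
    by (intro nn_integral_suminf measurable_compose[OF exp_coord measurable_ennreal]) simp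
  also have "\<dots> = (\<Sum>i. ennreal (1 / real ((i + 2) choose 2)))" by (subst exp_coord_mean) simp_all
  also have "\<dots> = ennreal (\<Sum>i. 1 / real ((i + 2) choose 2))"
    using sum_inverse_choose by (intro suminf_ennreal2) (auto simp: sums_iff)
  also have "\<dots> = 2" using sum_inverse_choose by (simp add: sums_iff)
  finally show ?thesis .
qed

lemma exp_summable: "AE z in exp_prod. summable (\<lambda>i. z (i + 2))"
proof -
  note [measurable] = exp_coord_shift
  have "(\<lambda>z. \<Sum>i. ennreal (z (i + 2))) \<in> borel_measurable exp_prod"
    by measurable
  then have "AE z in exp_prod. (\<Sum>i. ennreal (z (i + 2))) \<noteq> \<infinity>"
    by (rule nn_integral_PInf_AE) (unfold exp_total_mean, simp)
  then show ?thesis using exp_coord_nonneg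
    by eventually_elim (auto intro!: summable_suminf_not_top)
qed

definition exp_tail :: "real \<Rightarrow> real" where "exp_tail t = measure exponential_sum_law {t<..}"

lemma exp_tail_eq: "exp_tail t = measure exp_prod {z \<in> space exp_prod. t < exp_total z}"
proof -
  have "exponential_sum_law = distr exp_prod borel exp_total"
    unfolding exponential_sum_law_def exp_prod_def exp_law_def exp_total_def[abs_def] ..
  then have "exp_tail t = measure (distr exp_prod borel exp_total) {t<..}" by (simp add: exp_tail_def)
  also have "\<dots> = measure exp_prod (exp_total -` {t<..} \<inter> space exp_prod)" by (rule measure_distr) auto
  also have "exp_total -` {t<..} \<inter> space exp_prod = {z \<in> space exp_prod. t < exp_total z}" by auto
  finally show ?thesis .
qed

lemma exp_tail_bounds: "0 \<le> exp_tail t" "exp_tail t \<le> 1"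
  unfolding exp_tail_eq by (simp_all add: EP.prob_le_1)

lemma exp_tail_antimono: "s \<le> t \<Longrightarrow> exp_tail t \<le> exp_tail s"
  unfolding exp_tail_eq by (intro EP.finite_measure_mono) auto

lemma exp_tail_measurable [measurable]: "exp_tail \<in> borel_measurable borel"
proof -
  have "(\<lambda>t. - exp_tail t) \<in> borel_measurable borel"
    by (intro borel_measurable_mono) (auto simp: mono_def exp_tail_antimono)
  then have "(\<lambda>t. - (- exp_tail t)) \<in> borel_measurable borel" by measurable
  then show ?thesis by simp
qed

lemma exp_tail_neg: "t < 0 \<Longrightarrow> exp_tail t = 1"
proof -
  assume t: "t < 0"
  have "AE z in exp_prod. t < exp_total z"
    using exp_coord_nonneg exp_summable
  proof eventually_elim
    case (elim z)
    then have "0 \<le> exp_total z" unfolding exp_total_def by (intro suminf_nonneg) auto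
    then show ?case using t by simp
  qed
  then show ?thesis unfolding exp_tail_eq by (subst EP.prob_eq_1) auto
qed

lemma exp_tail_integral: "(\<integral>\<^sup>+t. ennreal (exp_tail t) * indicator {0..} t \<partial>lborel) = 2"
proof -
  have "2 = (\<integral>\<^sup>+z. (\<Sum>i. ennreal (z (i + 2))) \<partial>exp_prod)" by (rule exp_total_mean[symmetric])
  also have "\<dots> = (\<integral>\<^sup>+z. ennreal (exp_total z) \<partial>exp_prod)"
  proof (rule nn_integral_cong_AE)
    show "AE z in exp_prod. (\<Sum>i. ennreal (z (i + 2))) = ennreal (exp_total z)"
      using exp_coord_nonneg exp_summable
      by eventually_elim (auto simp: exp_total_def intro!: suminf_ennreal2)
  qed
  also have "\<dots> = (\<integral>\<^sup>+t. emeasure exp_prod {z \<in> space exp_prod. ennreal t < ennreal (exp_total z)} * indicator {0..} t \<partial>lborel)"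
    by (rule EP.nn_integral_layer_cake) measurable
  also have "\<dots> = (\<integral>\<^sup>+t. ennreal (exp_tail t) * indicator {0..} t \<partial>lborel)"
    by (intro nn_integral_cong) (auto simp: indicator_def exp_tail_eq EP.emeasure_eq_measure ennreal_less_iff)
  finally show ?thesis by simp
qed

section \<open>Comparison of the death chain with partial sums of exponential variables\<close>

definition exp_partial :: "nat \<Rightarrow> (nat \<Rightarrow> real) \<Rightarrow> real" where
  "exp_partial i z = (\<Sum>l\<in>{2..i}. z l)"

lemma exp_partial_measurable [measurable]: "exp_partial i \<in> borel_measurable exp_prod"
  unfolding exp_partial_def[abs_def] by (intro borel_measurable_sum exp_coord) simp

definition partial_tail :: "nat \<Rightarrow> real \<Rightarrow> real" where
  "partial_tail i t = measure exp_prod {z \<in> space exp_prod. t < exp_partial i z}"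

lemma partial_tail_le: "partial_tail i t \<le> exp_tail t"
  unfolding partial_tail_def exp_tail_eq
proof (rule EP.finite_measure_mono_AE)
  show "AE z in exp_prod. z \<in> {z \<in> space exp_prod. t < exp_partial i z} \<longrightarrow> z \<in> {z \<in> space exp_prod. t < exp_total z}"
    using exp_coord_nonneg exp_summable
  proof eventually_elim
    case (elim z)
    have shift: "Suc (Suc (a - 2)) = a" if "2 \<le> a" for a using that by simp
    have "exp_partial i z = (\<Sum>l\<in>{..<i - 1}. z (l + 2))"
      unfolding exp_partial_def
      by (rule sum.reindex_bij_witness[where i = "\<lambda>l. l + 2" and j = "\<lambda>l. l - 2"]) (auto simp: shift)
    also have "\<dots> \<le> exp_total z" unfolding exp_total_def using elim by (intro sum_le_suminf) auto
    finally show ?case by auto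
  qed
qed measurable

lemma partial_tail_neg: "t < 0 \<Longrightarrow> partial_tail i t = 1"
proof -
  assume t: "t < 0"
  have "AE z in exp_prod. t < exp_partial i z"
    using exp_coord_nonneg
  proof eventually_elim
    case (elim z)
    have "0 \<le> z l" if "2 \<le> l" for l using elim[rule_format, of "l - 2"] that by (simp only: le_add_diff_inverse2)
    then have "0 \<le> exp_partial i z" unfolding exp_partial_def by (intro sum_nonneg) auto
    then show ?case using t by simp
  qed
  then show ?thesis unfolding partial_tail_def by (subst EP.prob_eq_1) auto
qed

lemma partial_tail_antimono: "s \<le> t \<Longrightarrow> partial_tail i t \<le> partial_tail i s"
  unfolding partial_tail_def by (intro EP.finite_measure_mono) auto

text \<open>An exponential time of rate \<open>c\<close> dominates \<open>r\<close> times a geometric time with success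
  probability \<open>c r\<close>, here in the form of one step of the recursion for the geometric time.\<close>

lemma exp_convex:
  fixes c r v :: real
  assumes "0 \<le> c" "0 \<le> r" "c * r \<le> 1"
  shows "(1 - c * r) * exp (- c * max v 0) + c * r * (if v + r < 0 then 1 else 0) \<le> exp (- c * max (v + r) 0)"
proof -
  consider "v + r < 0" | "0 \<le> v + r" by linarith
  then show ?thesis
  proof cases
    case 1
    then show ?thesis using assms by simp
  next
    case 2
    have "1 - c * r \<le> exp (- (c * r))" using exp_ge_add_one_self[of "- (c * r)"] by simp
    then have "(1 - c * r) * exp (- c * max v 0) \<le> exp (- (c * r)) * exp (- c * max v 0)"
      by (rule mult_right_mono) simp
    also have "\<dots> = exp (- (c * (r + max v 0)))" by (simp add: exp_add[symmetric] algebra_simps)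
    also have "\<dots> \<le> exp (- (c * max (v + r) 0))" using assms by (auto intro!: mult_left_mono)
    finally show ?thesis using 2 by simp
  qed
qed

text \<open>Given the variables other than \<open>z i\<close>, the partial sum up to
  \<open>i\<close> has an explicit exponential tail and the one up to \<open>i - 1\<close> is a
  constant, so the claim is \<open>exp_convex\<close> under the integral.\<close>

lemma partial_tail_step:
  assumes i: "2 \<le> i" and r: "0 \<le> r" "r * real (i choose 2) \<le> 1"
  shows "(1 - r * real (i choose 2)) * partial_tail i u + r * real (i choose 2) * partial_tail (i - 1) (u + r)
    \<le> partial_tail i (u + r)"
proof -
  let ?c = "real (i choose 2)"
  let ?R = "Pi\<^sub>M ({2..} - {i}) exp_law"
  interpret I: prob_space "exp_law i" using i by (rule prob_space_exp_law)
  interpret R: prob_space ?R by (intro prob_space_PiM prob_space_exp_law) auto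
  interpret pair_sigma_finite "exp_law i" ?R by unfold_locales
  have ins: "insert i ({2..} - {i}) = {2..}" using i by auto
  have ps: "\<And>l. l \<in> {2..} - {i} \<Longrightarrow> prob_space (exp_law l)" by (simp add: prob_space_exp_law)
  have decomp: "exp_prod = distr (exp_law i \<Otimes>\<^sub>M ?R) exp_prod (\<lambda>(x, X). X(i := x))"
    using distr_pair_PiM_eq_PiM[where M = exp_law and i' = i and I = "{2..} - {i}", OF ps prob_space_exp_law[OF i], unfolded ins] by (simp only: exp_prod_def)
  have "(\<lambda>(x, X). X(i := x)) \<in> measurable (exp_law i \<Otimes>\<^sub>M ?R) (Pi\<^sub>M (insert i ({2..} - {i})) exp_law)"
    by measurable
  then have upd [measurable]: "(\<lambda>(x, X). X(i := x)) \<in> measurable (exp_law i \<Otimes>\<^sub>M ?R) exp_prod"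
    by (simp only: ins exp_prod_def)
  define S where "S X = (\<Sum>l\<in>{2..i - 1}. X l)" for X :: "nat \<Rightarrow> real"
  have S_meas [measurable]: "S \<in> borel_measurable ?R"
    unfolding S_def[abs_def]
  proof (intro borel_measurable_sum)
    fix l assume "l \<in> {2..i - 1}"
    then have "l \<in> {2..} - {i}" using i by auto
    then show "(\<lambda>X. X l) \<in> borel_measurable ?R"
      using measurable_component_singleton[of l "{2..} - {i}" exp_law] by (simp cong: measurable_cong_sets)
  qed
  have split: "{2..i} = insert i {2..i - 1}" using i by auto
  have part: "exp_partial i (X(i := x)) = x + S X" "exp_partial (i - 1) (X(i := x)) = S X" for X x
    using i by (auto simp: exp_partial_def S_def split intro!: sum.cong)
  have int: "(\<integral>\<^sup>+z. f z \<partial>exp_prod) = (\<integral>\<^sup>+X. \<integral>\<^sup>+x. f (X(i := x)) \<partial>exp_law i \<partial>?R)"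
    if [measurable]: "f \<in> borel_measurable exp_prod" for f
  proof -
    have "(\<integral>\<^sup>+z. f z \<partial>exp_prod) = (\<integral>\<^sup>+z. f z \<partial>distr (exp_law i \<Otimes>\<^sub>M ?R) exp_prod (\<lambda>(x, X). X(i := x)))"
      by (simp only: decomp[symmetric])
    also have "\<dots> = (\<integral>\<^sup>+p. f ((\<lambda>(x, X). X(i := x)) p) \<partial>(exp_law i \<Otimes>\<^sub>M ?R))"
      by (rule nn_integral_distr[OF upd]) (simp add: that)
    also have "\<dots> = (\<integral>\<^sup>+X. \<integral>\<^sup>+x. f ((\<lambda>(x, X). X(i := x)) (x, X)) \<partial>exp_law i \<partial>?R)"
      by (rule nn_integral_snd[symmetric]) measurable
    finally show ?thesis by simp
  qed
  have tail: "ennreal (partial_tail k t) = (\<integral>\<^sup>+z. (if t < exp_partial k z then 1 else 0) \<partial>exp_prod)" for k t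
  proof -
    have "ennreal (partial_tail k t) = (\<integral>\<^sup>+z. indicator {z \<in> space exp_prod. t < exp_partial k z} z \<partial>exp_prod)"
      unfolding partial_tail_def by (simp add: EP.emeasure_eq_measure)
    also have "\<dots> = (\<integral>\<^sup>+z. (if t < exp_partial k z then 1 else 0) \<partial>exp_prod)"
      by (intro nn_integral_cong) auto
    finally show ?thesis .
  qed
  have tail_i: "ennreal (partial_tail i t) = (\<integral>\<^sup>+X. ennreal (exp (- ?c * max (t - S X) 0)) \<partial>?R)" for t
  proof -
    have inner: "(\<integral>\<^sup>+x. (if t < x + s then 1 else 0) \<partial>exp_law i) = ennreal (exp (- ?c * max (t - s) 0))" for s
    proof -
      have "(\<integral>\<^sup>+x. (if t < x + s then 1 else 0) \<partial>exp_law i) = (\<integral>\<^sup>+x. indicator {t - s<..} x \<partial>exp_law i)"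
        by (intro nn_integral_cong) (auto simp: indicator_def)
      then show ?thesis using exp_law_tail[OF i] by simp
    qed
    show ?thesis unfolding tail by (subst int) (simp_all add: part inner)
  qed
  have tail_pred: "ennreal (partial_tail (i - 1) t) = (\<integral>\<^sup>+X. (if t < S X then 1 else 0) \<partial>?R)" for t
    unfolding tail by (subst int) (simp_all add: part(2)[simplified] I.emeasure_space_1[simplified])
  have "ennreal ((1 - r * ?c) * partial_tail i u + r * ?c * partial_tail (i - 1) (u + r))
    = ennreal (1 - r * ?c) * ennreal (partial_tail i u) + ennreal (r * ?c) * ennreal (partial_tail (i - 1) (u + r))"
    using r by (simp add: ennreal_plus ennreal_mult partial_tail_def)
  also have "\<dots> = (\<integral>\<^sup>+X. ennreal (1 - r * ?c) * ennreal (exp (- ?c * max (u - S X) 0))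
      + ennreal (r * ?c) * (if u + r < S X then 1 else 0) \<partial>?R)"
    unfolding tail_i tail_pred by (subst nn_integral_add) (auto simp: nn_integral_cmult)
  also have "\<dots> \<le> (\<integral>\<^sup>+X. ennreal (exp (- ?c * max (u + r - S X) 0)) \<partial>?R)"
  proof (intro nn_integral_mono)
    fix X
    have "ennreal (1 - r * ?c) * ennreal (exp (- ?c * max (u - S X) 0)) + ennreal (r * ?c) * (if u + r < S X then 1 else 0)
      = ennreal ((1 - ?c * r) * exp (- ?c * max (u - S X) 0) + ?c * r * (if u - S X + r < 0 then 1 else 0))"
      using r by (auto simp: ennreal_plus ennreal_mult mult.commute)
    also have "\<dots> \<le> ennreal (exp (- ?c * max (u - S X + r) 0))"
      using r by (intro ennreal_leI exp_convex) (auto simp: mult.commute)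
    finally show "ennreal (1 - r * ?c) * ennreal (exp (- ?c * max (u - S X) 0)) + ennreal (r * ?c) * (if u + r < S X then 1 else 0)
      \<le> ennreal (exp (- ?c * max (u + r - S X) 0))" by (simp add: algebra_simps)
  qed
  also have "\<dots> = ennreal (partial_tail i (u + r))" unfolding tail_i ..
  finally show ?thesis by (simp add: partial_tail_def)
qed

text \<open>A geometric number of steps, less one, times \<open>r\<close> is dominated by the
  exponential variable of the same stage. The \<open>i - 1\<close> stages account for the shift by
  \<open>i - 1\<close> steps.\<close>

lemma death_le_partial_tail:
  assumes r: "0 < r" and rK: "\<And>i. i \<le> K \<Longrightarrow> r * real (i choose 2) \<le> 1"
  shows "i \<le> K \<Longrightarrow> death r j i \<le> partial_tail i (r * (real j - real i + 1))"
proof (induction j arbitrary: i)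
  case 0
  show ?case
  proof (cases "2 \<le> i")
    case True
    then have "r * (real 0 - real i + 1) < 0" using r by (intro mult_pos_neg) auto
    then show ?thesis using True by (simp add: partial_tail_neg)
  qed (simp add: partial_tail_def)
next
  case (Suc j)
  show ?case
  proof (cases "2 \<le> i")
    case True
    let ?u = "r * (real j - real i + 1)"
    have i1: "real (i - 1) = real i - 1" using True by simp
    have "death r j (i - 1) \<le> partial_tail (i - 1) (r * (real j - real (i - 1) + 1))" using Suc.prems by (intro Suc.IH) simp
    then have "death r j (i - 1) \<le> partial_tail (i - 1) (?u + r)" unfolding i1 by (simp add: algebra_simps)
    then have "death r (Suc j) i \<le> (1 - r * real (i choose 2)) * partial_tail i ?u + r * real (i choose 2) * partial_tail (i - 1) (?u + r)"
      unfolding death.simps using Suc r rK[OF Suc.prems] by (intro add_mono mult_left_mono) auto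
    also have "\<dots> \<le> partial_tail i (?u + r)" using True r rK[OF Suc.prems] by (intro partial_tail_step) auto
    finally show ?thesis by (simp add: algebra_simps)
  next
    case False
    then have "death r (Suc j) i = 0" by (intro death_1[where K = K]) (use r rK in auto)
    then show ?thesis by (simp add: partial_tail_def)
  qed
qed

lemma death_le_exp_tail:
  assumes "0 < r" "\<And>i. i \<le> k \<Longrightarrow> r * real (i choose 2) \<le> 1"
  shows "death r j k \<le> exp_tail (r * (real j - real k))"
proof -
  have "death r j k \<le> partial_tail k (r * (real j - real k + 1))"
    by (rule death_le_partial_tail[where K = k]) (use assms in auto)
  also have "\<dots> \<le> partial_tail k (r * (real j - real k))" using assms(1) by (intro partial_tail_antimono mult_left_mono) auto
  also have "\<dots> \<le> exp_tail (r * (real j - real k))" by (rule partial_tail_le)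
  finally show ?thesis .
qed


section \<open>The mean-field limit\<close>

context mf_setting
begin

context
  fixes mc r :: real
  assumes mc: "(\<lambda>j. mesh j * (\<Sum>t. 1 - meetc (mesh j) t)) \<longlonglongrightarrow> mc"
    and r: "r = (1 - 3 * \<epsilon>) * bc / mc"
begin

text \<open>The delay in units of the mean meeting time: \<open>K\<close> blocks for thinning out
  the crowd, \<open>2 * g\<close> for rounding in the death chain, and one because times are rounded
  down to whole blocks.\<close>

definition shift :: "nat \<Rightarrow> real" where "shift K = bc / mc * (1 + real K + 2 * real g)"

lemma scaled_upper:
  assumes K: "24 * ln n / g \<le> real K * r" and x: "0 \<le> x"
  shows "F (mc * x) \<le> exp_tail ((1 - 3 * \<epsilon>) * (x - shift K))
    + (if nat \<lfloor>x / (bc / mc)\<rfloor> < K then 0 else (1 - r) ^ (nat \<lfloor>x / (bc / mc)\<rfloor> - K) / n)"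
proof -
  note pos = bc_pos mc_pos[OF mc r] r_pos[OF mc r]
  have eps: "0 < \<epsilon>" "0 < 1 - 3 * \<epsilon>" using \<epsilon>_pos error_le by auto
  define h where "h = bc / mc"
  have h: "0 < h" unfolding h_def using pos by simp
  have r_h: "r = (1 - 3 * \<epsilon>) * h" unfolding r h_def by simp
  define N where "N = nat \<lfloor>x / h\<rfloor>"
  have N: "real N \<le> x / h" "x / h < real N + 1" unfolding N_def using x h by (auto simp: floor_less_cancel)
  show ?thesis
  proof (cases "N < K")
    case True
    then have "real N + 1 \<le> real K" by simp
    then have "x / h < 1 + real K + 2 * real g" using N(2) by simp
    then have "x < shift K" using h unfolding shift_def h_def[symmetric] by (simp add: field_simps)
    \<comment> \<open>Before the end of the delay the limit tail is taken at a negative argument,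
      where it is 1, so the trivial bound on \<open>F\<close> suffices.\<close>
    then have "exp_tail ((1 - 3 * \<epsilon>) * (x - shift K)) = 1" using eps by (intro exp_tail_neg mult_pos_neg) auto
    moreover have "F (mc * x) \<le> 1" using pos x by (intro F_bounds) auto
    ultimately show ?thesis using True unfolding N_def h_def by simp
  next
    case False
    define i where "i = N - K"
    have Ki: "N = K + i" using False by (simp add: i_def)
    have "real N * h \<le> x" using N(1) h by (simp add: field_simps)
    then have "mc * (real N * h) \<le> mc * x" using pos by (intro mult_left_mono) auto
    moreover have "mc * (real N * h) = real N * bc" unfolding h_def using pos by simp
    ultimately have "F (mc * x) \<le> F (real N * bc)" using pos by (intro F_antimono) auto
    also have "\<dots> \<le> (1 - r) ^ i / n + death r i (2 * g)"
      unfolding Ki by (rule F_upper[OF mc r K])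
    also have "death r i (2 * g) \<le> exp_tail (r * (real i - real (2 * g)))"
      by (rule death_le_exp_tail[OF pos(3) r_choose_le[OF mc r]])
    also have "exp_tail (r * (real i - real (2 * g))) \<le> exp_tail ((1 - 3 * \<epsilon>) * (x - shift K))"
    proof (rule exp_tail_antimono)
      have "x / h - (1 + real K + 2 * real g) \<le> real i - real (2 * g)"
        using N(2) Ki by simp
      then have "r * (x / h - (1 + real K + 2 * real g)) \<le> r * (real i - real (2 * g))"
        using pos by (intro mult_left_mono) auto
      moreover have "h * (x / h - (1 + real K + 2 * real g)) = x - shift K"
        unfolding shift_def h_def[symmetric] using h by (simp add: right_diff_distrib)
      then have "r * (x / h - (1 + real K + 2 * real g)) = (1 - 3 * \<epsilon>) * (x - shift K)"
        unfolding r_h by (simp only: mult.assoc)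
      ultimately show "(1 - 3 * \<epsilon>) * (x - shift K) \<le> r * (real i - real (2 * g))" by simp
    qed
    finally have "F (mc * x) \<le> (1 - r) ^ i / n + exp_tail ((1 - 3 * \<epsilon>) * (x - shift K))" by simp
    then show ?thesis using False unfolding i_def N_def h_def by simp
  qed
qed

text \<open>The choice \<open>g >= ln n / \<epsilon>\<close> pays off here: in units of the mean
  meeting time the \<open>K\<close> blocks last about \<open>24 * ln n / g\<close>, hence at most
  about \<open>24 * \<epsilon>\<close>, and \<open>bc_le\<close> bounds the other
  \<open>1 + 2 * g\<close> blocks by a fraction of \<open>\<epsilon>\<close>.\<close>

lemma shift_bounds:
  obtains K where "24 * ln n / g \<le> real K * r" "0 \<le> shift K" "shift K \<le> 30 * \<epsilon>"
proof
  note pos = bc_pos mc_pos[OF mc r] r_pos[OF mc r]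
  have eps: "0 < \<epsilon>" "0 < 1 - 3 * \<epsilon>" "\<epsilon> \<le> 1 / 100" using \<epsilon>_pos error_le by auto
  define h where "h = bc / mc"
  have h: "0 < h" unfolding h_def using pos by simp
  have r_h: "r = (1 - 3 * \<epsilon>) * h" unfolding r h_def by simp
  define K where "K = nat \<lceil>24 * ln n / g / r\<rceil>"
  have g: "1 \<le> real g" using g_ge_1[OF mc r] by simp
  have q0: "0 \<le> 24 * ln n / g / r" using ln_n g pos by simp
  have K: "24 * ln n / g / r \<le> real K" "real K \<le> 24 * ln n / g / r + 1" unfolding K_def using q0 by linarith+
  show "24 * ln n / g \<le> real K * r" using K(1) unfolding pos_divide_le_eq[OF pos(3)] .
  show "0 \<le> shift K" using h unfolding shift_def h_def[symmetric] by simp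
  have gh: "real g * h \<le> \<epsilon> / 10" using bc_le[OF mc r] pos unfolding h_def by (simp add: field_simps)
  have "h * 1 \<le> h * real g" using g h by (intro mult_left_mono) auto
  then have h_le: "h \<le> \<epsilon> / 10" using gh by (simp add: mult.commute)
  have "ln n / g \<le> \<epsilon>" using g_bounds(1) eps g by (simp add: field_simps)
  have "h * real K \<le> h * (24 * ln n / g / r + 1)" using K(2) h by (intro mult_left_mono) auto
  also have "\<dots> = 24 * (ln n / g) / (1 - 3 * \<epsilon>) + h" unfolding r_h using h eps g by (simp add: field_simps)
  also have "24 * (ln n / g) / (1 - 3 * \<epsilon>) \<le> 24 * \<epsilon> / (97 / 100)"
    using \<open>ln n / g \<le> \<epsilon>\<close> eps by (intro frac_le) auto
  finally have "h * real K \<le> 25 * \<epsilon> + h" using eps by simp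
  then show "shift K \<le> 30 * \<epsilon>"
    using h_le gh eps unfolding shift_def h_def[symmetric] by (simp add: algebra_simps)
qed

text \<open>A linear change of variables in the tail integral of the limit law, whose mean is 2;
  during the delay the tail is bounded by 1.\<close>

lemma shifted_tail_integral:
  assumes "0 \<le> \<kappa>"
  shows "(\<integral>\<^sup>+x. ennreal (exp_tail ((1 - 3 * \<epsilon>) * (x - \<kappa>))) * indicator {0..} x \<partial>lborel) \<le> ennreal (\<kappa> + 2 / (1 - 3 * \<epsilon>))"
proof -
  define c where "c = 1 - 3 * \<epsilon>"
  have c: "0 < c" using error_le \<epsilon>_pos by (simp add: c_def)
  have "2 = (\<integral>\<^sup>+t. ennreal (exp_tail t) * indicator {0..} t \<partial>lborel)" by (rule exp_tail_integral[symmetric])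
  also have "\<dots> = ennreal \<bar>c\<bar> * (\<integral>\<^sup>+x. ennreal (exp_tail (- c * \<kappa> + c * x)) * indicator {0..} (- c * \<kappa> + c * x) \<partial>lborel)"
    using c by (intro nn_integral_real_affine) auto
  also have "(\<lambda>x. ennreal (exp_tail (- c * \<kappa> + c * x)) * indicator {0..} (- c * \<kappa> + c * x))
    = (\<lambda>x. ennreal (exp_tail (c * (x - \<kappa>))) * indicator {\<kappa>..} x)"
    using c by (auto simp: fun_eq_iff indicator_def algebra_simps)
  finally have two: "ennreal c * (\<integral>\<^sup>+x. ennreal (exp_tail (c * (x - \<kappa>))) * indicator {\<kappa>..} x \<partial>lborel) = 2" (is "_ * ?I = _")
    using c by simp
  have "?I = ennreal (1 / c) * (ennreal c * ?I)"
    using c by (simp add: mult.assoc[symmetric] ennreal_mult[symmetric])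
  also have "\<dots> = ennreal (2 / c)" unfolding two using c by (simp add: ennreal_mult'[symmetric] flip: ennreal_numeral)
  finally have I: "?I = ennreal (2 / c)" .
  have "(\<integral>\<^sup>+x. ennreal (exp_tail (c * (x - \<kappa>))) * indicator {0..} x \<partial>lborel)
    \<le> (\<integral>\<^sup>+x. indicator {0..\<kappa>} x + ennreal (exp_tail (c * (x - \<kappa>))) * indicator {\<kappa>..} x \<partial>lborel)"
    using exp_tail_bounds by (intro nn_integral_mono) (auto simp: indicator_def)
  also have "\<dots> = ennreal \<kappa> + ennreal (2 / c)"
    using assms by (subst nn_integral_add) (auto simp: I)
  also have "\<dots> = ennreal (\<kappa> + 2 / c)" using assms c by (simp add: ennreal_plus)
  finally show ?thesis unfolding c_def .
qed

lemma delayed_geometric_integral: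
  "(\<integral>\<^sup>+x. ennreal (if nat \<lfloor>x / (bc / mc)\<rfloor> < K then 0 else (1 - r) ^ (nat \<lfloor>x / (bc / mc)\<rfloor> - K) / n) * indicator {0..} x \<partial>lborel)
    = ennreal (1 / (n * (1 - 3 * \<epsilon>)))"
proof -
  note pos = bc_pos mc_pos[OF mc r] r_pos[OF mc r]
  define h where "h = bc / mc"
  have h: "0 < h" unfolding h_def using pos by simp
  define a where "a N = (if N < K then 0 else (1 - r) ^ (N - K) / n)" for N
  have r1: "r \<le> 1" by (rule r_le_1[OF mc r])
  have "(\<lambda>i. (1 - r) ^ i / n) sums (1 / (1 - (1 - r)) / n)"
    using pos r1 by (intro sums_divide geometric_sums) auto
  then have "(\<lambda>i. a (i + K)) sums (1 / r / n)" by (simp add: a_def)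
  then have "a sums (1 / r / n)" by (subst (asm) sums_iff_shift) (simp add: a_def)
  then have "(\<lambda>N. a N * h) sums (1 / r / n * h)" by (rule sums_mult2)
  moreover have "1 / r / n * h = 1 / (n * (1 - 3 * \<epsilon>))"
    using h error_le \<epsilon>_pos unfolding r h_def[symmetric] times_divide_eq_right[symmetric] by simp
  ultimately have s: "(\<lambda>N. a N * h) sums (1 / (n * (1 - 3 * \<epsilon>)))" by simp
  have "(\<integral>\<^sup>+x. ennreal (a (nat \<lfloor>x / h\<rfloor>)) * indicator {0..} x \<partial>lborel) = (\<Sum>N. ennreal (a N) * ennreal h)"
    by (rule nn_integral_step_function(1)[OF h])
  also have "\<dots> = (\<Sum>N. ennreal (a N * h))" using h by (simp only: ennreal_mult'' less_imp_le)
  also have "\<dots> = ennreal (1 / (n * (1 - 3 * \<epsilon>)))"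
  proof (rule suminf_ennreal_eq[OF _ s])
    show "0 \<le> a N * h" for N using h r1 n_pos by (simp add: a_def)
  qed
  finally show ?thesis unfolding a_def h_def .
qed

text \<open>\<open>u + w\<close> dominates both tails. The absolute difference plus the two tails is
  twice their maximum, so integration gives \<open>D + G + 2 <= 2 * B\<close>. With
  \<open>B <= 2 + 50 * \<epsilon>\<close> and \<open>G >= 2 - 10000 * \<epsilon>\<close> this forces
  \<open>D <= 10100 * \<epsilon>\<close>.\<close>

lemma limit_comparison:
  assumes small: "\<epsilon> \<le> 1 / 10000"
  defines "I \<equiv> (\<integral>\<^sup>+x. ennreal (F x) * indicator {0..} x \<partial>lborel)"
  shows "(\<integral>\<^sup>+x. ennreal \<bar>F (mc * x) - exp_tail x\<bar> * indicator {0..} x \<partial>lborel) \<le> ennreal (20000 * \<epsilon>)"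
    "\<bar>enn2real I / mc - 2\<bar> \<le> 20000 * \<epsilon>"
proof -
  note [measurable] = F_measurable
  note pos = bc_pos mc_pos[OF mc r] r_pos[OF mc r]
  obtain K where K: "24 * ln n / g \<le> real K * r" "0 \<le> shift K" "shift K \<le> 30 * \<epsilon>"
    using shift_bounds by blast
  define c where "c = 1 - 3 * \<epsilon>"
  have c: "9/10 \<le> c" "c \<le> 1" using small \<epsilon>_pos by (auto simp: c_def)
  define u where "u x = exp_tail (c * (x - shift K))" for x
  define w where "w x = (if nat \<lfloor>x / (bc / mc)\<rfloor> < K then 0 else (1 - r) ^ (nat \<lfloor>x / (bc / mc)\<rfloor> - K) / n)" for x
  have w0: "0 \<le> w x" for x using n_pos r_le_1[OF mc r] by (simp add: w_def)
  have u0: "0 \<le> u x" for x by (simp add: u_def exp_tail_bounds)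
  have up: "F (mc * x) \<le> u x + w x" if "0 \<le> x" for x
    using scaled_upper[OF K(1) that] by (simp add: u_def w_def c_def)
  have zu: "exp_tail x \<le> u x + w x" if "0 \<le> x" for x
  proof -
    have "c * (x - shift K) \<le> c * x" using c K(2) by (intro mult_left_mono) auto
    also have "\<dots> \<le> 1 * x" using c that by (intro mult_right_mono) auto
    finally have "exp_tail x \<le> u x" unfolding u_def by (intro exp_tail_antimono) simp
    then show ?thesis using w0[of x] by simp
  qed
  have F0: "0 \<le> F (mc * x)" if "0 \<le> x" for x using pos that by (intro F_bounds) auto
  define B where "B = shift K + 2 / c + 1 / (n * c)"
  have [measurable]: "(\<lambda>x. ennreal (w x) * indicator {0..} x) \<in> borel_measurable borel"
    using nn_integral_step_function(2)[of "bc / mc" "\<lambda>N. if N < K then 0 else (1 - r) ^ (N - K) / n"] pos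
    unfolding w_def by simp
  have [measurable]: "u \<in> borel_measurable borel" unfolding u_def[abs_def] by measurable
  have "(\<integral>\<^sup>+x. ennreal (u x + w x) * indicator {0..} x \<partial>lborel)
    = (\<integral>\<^sup>+x. ennreal (u x) * indicator {0..} x + ennreal (w x) * indicator {0..} x \<partial>lborel)"
    using u0 w0 by (intro nn_integral_cong) (simp add: ennreal_plus distrib_right)
  also have "\<dots> = (\<integral>\<^sup>+x. ennreal (u x) * indicator {0..} x \<partial>lborel) + (\<integral>\<^sup>+x. ennreal (w x) * indicator {0..} x \<partial>lborel)"
    by (rule nn_integral_add) measurable
  also have "\<dots> \<le> ennreal (shift K + 2 / c) + ennreal (1 / (n * c))"
    using shifted_tail_integral[OF K(2)] delayed_geometric_integral[of K]
    unfolding u_def w_def c_def by (intro add_mono) auto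
  also have "\<dots> = ennreal B" using K(2) c n_pos by (simp add: B_def ennreal_plus)
  finally have UB: "(\<integral>\<^sup>+x. ennreal (u x + w x) * indicator {0..} x \<partial>lborel) \<le> ennreal B" .
  have B_le: "B \<le> 2 + 50 * \<epsilon>"
  proof -
    have "1 / n \<le> \<alpha> * 1" using inv_n_le pmax_le_\<alpha> by simp
    also have "\<dots> \<le> \<alpha> * ln n ^ 4" using ln_n \<alpha>_pos by (intro mult_left_mono one_le_power) auto
    also have "\<dots> \<le> \<epsilon> ^ 6" by (rule \<epsilon>_6)
    also have "\<dots> \<le> \<epsilon> ^ 1" using \<epsilon>_pos small by (intro power_decreasing) auto
    finally have n: "1 / n \<le> \<epsilon>" by simp
    have "1 / (n * c) = 1 / n / c" by simp
    also have "\<dots> \<le> \<epsilon> / (9/10)" using n \<epsilon>_pos c by (intro frac_le) auto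
    finally have 1: "1 / (n * c) \<le> 2 * \<epsilon>" using \<epsilon>_pos by simp
    have "2 \<le> (2 + 7 * \<epsilon>) * c"
    proof -
      have "\<epsilon> * \<epsilon> \<le> \<epsilon> * (1 / 10000)" using small \<epsilon>_pos by (intro mult_left_mono) auto
      then show ?thesis using \<epsilon>_pos by (simp add: c_def algebra_simps)
    qed
    then have "2 / c \<le> 2 + 7 * \<epsilon>" using c by (simp add: pos_divide_le_eq)
    then show ?thesis using 1 K(3) \<epsilon>_pos by (simp add: B_def)
  qed
  define G where "G = (\<integral>\<^sup>+x. ennreal (F (mc * x)) * indicator {0..} x \<partial>lborel)"
  have I_G: "I = ennreal mc * G"
  proof -
    have "I = ennreal \<bar>mc\<bar> * (\<integral>\<^sup>+x. ennreal (F (0 + mc * x)) * indicator {0..} (0 + mc * x) \<partial>lborel)"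
      unfolding I_def using pos by (intro nn_integral_real_affine) auto
    also have "(\<lambda>x. ennreal (F (0 + mc * x)) * indicator {0..} (0 + mc * x)) = (\<lambda>x. ennreal (F (mc * x)) * indicator {0..} x)"
      using pos by (auto simp: fun_eq_iff indicator_def zero_le_mult_iff)
    finally show ?thesis using pos by (simp add: G_def)
  qed
  have "G \<le> (\<integral>\<^sup>+x. ennreal (u x + w x) * indicator {0..} x \<partial>lborel)"
    unfolding G_def using up by (intro nn_integral_mono) (auto simp: indicator_def intro!: ennreal_leI)
  then have G_le: "G \<le> ennreal B" using UB by (rule order.trans)
  then obtain G' where G': "G = ennreal G'" "0 \<le> G'" by (cases G) (auto simp: top_unique)
  have B0: "0 \<le> B" using K(2) c n_pos by (simp add: B_def)
  have G'_le: "G' \<le> B" using G_le G' B0 by simp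
  have "ennreal ((2 - 10000 * \<epsilon>) * mc) \<le> ennreal (mc * G')"
    using F_lower[OF mc r] I_G pos G' unfolding I_def by (simp add: ennreal_mult)
  then have "(2 - 10000 * \<epsilon>) * mc \<le> mc * G'" using pos G' by (subst (asm) ennreal_le_iff) auto
  then have G'_ge: "2 - 10000 * \<epsilon> \<le> G'" using pos by (simp add: mult.commute)
  have I_eq: "I = ennreal (mc * G')" unfolding I_G G' using pos G' by (simp add: ennreal_mult)
  show "\<bar>enn2real I / mc - 2\<bar> \<le> 20000 * \<epsilon>"
    using G'_ge G'_le B_le pos G' \<epsilon>_pos by (simp add: I_eq abs_le_iff)
  define D where "D = (\<integral>\<^sup>+x. ennreal \<bar>F (mc * x) - exp_tail x\<bar> * indicator {0..} x \<partial>lborel)"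
  have "D + G + 2 = (\<integral>\<^sup>+x. (ennreal \<bar>F (mc * x) - exp_tail x\<bar> * indicator {0..} x
      + ennreal (F (mc * x)) * indicator {0..} x) + ennreal (exp_tail x) * indicator {0..} x \<partial>lborel)"
    unfolding D_def G_def exp_tail_integral[symmetric]
    by (simp add: nn_integral_add)
  also have "\<dots> \<le> (\<integral>\<^sup>+x. 2 * (ennreal (u x + w x) * indicator {0..} x) \<partial>lborel)"
  proof (intro nn_integral_mono)
    fix x :: real
    show "(ennreal \<bar>F (mc * x) - exp_tail x\<bar> * indicator {0..} x + ennreal (F (mc * x)) * indicator {0..} x)
        + ennreal (exp_tail x) * indicator {0..} x \<le> 2 * (ennreal (u x + w x) * indicator {0..} x)"
    proof (cases "0 \<le> x")
      case True
      have "\<bar>F (mc * x) - exp_tail x\<bar> + F (mc * x) + exp_tail x \<le> 2 * (u x + w x)"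
        using up[OF True] zu[OF True] by (cases "F (mc * x) \<le> exp_tail x") (simp_all add: abs_if)
      then have "ennreal (\<bar>F (mc * x) - exp_tail x\<bar> + F (mc * x) + exp_tail x) \<le> ennreal (2 * (u x + w x))"
        by (rule ennreal_leI)
      then show ?thesis using True F0[OF True] exp_tail_bounds[of x] u0[of x] w0[of x]
        by (simp add: ennreal_plus ennreal_mult del: ennreal_plus[symmetric])
    qed simp
  qed
  also have "\<dots> = 2 * (\<integral>\<^sup>+x. ennreal (u x + w x) * indicator {0..} x \<partial>lborel)"
  proof (rule nn_integral_cmult)
    have "(\<lambda>x. ennreal (u x + w x) * indicator {0..} x) = (\<lambda>x. ennreal (u x) * indicator {0..} x + ennreal (w x) * indicator {0..} x)"
      using u0 w0 by (simp add: fun_eq_iff ennreal_plus distrib_right)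
    then show "(\<lambda>x. ennreal (u x + w x) * indicator {0..} x) \<in> borel_measurable lborel" by simp
  qed
  also have "\<dots> \<le> 2 * ennreal B" using UB by (intro mult_left_mono) auto
  also have "\<dots> = ennreal (2 * B)" using B0 by (simp add: ennreal_mult)
  finally have DB: "D + G + 2 \<le> ennreal (2 * B)" .
  then have "D \<noteq> \<top>" by (auto simp: top_unique)
  then obtain D' where D': "D = ennreal D'" "0 \<le> D'" by (cases D) auto
  have "ennreal (D' + G' + 2) \<le> ennreal (2 * B)" using DB D' G' by (simp add: ennreal_plus)
  then have "D' + G' + 2 \<le> 2 * B" using B0 by (subst (asm) ennreal_le_iff) auto
  then have "D' \<le> 20000 * \<epsilon>" using G'_ge B_le \<epsilon>_pos by linarith
  then show "(\<integral>\<^sup>+x. ennreal \<bar>F (mc * x) - exp_tail x\<bar> * indicator {0..} x \<partial>lborel) \<le> ennreal (20000 * \<epsilon>)"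
    unfolding D_def[symmetric] D' by (rule ennreal_leI)
qed

lemma F_tendsto_0: "(\<lambda>i. F (real i * bc)) \<longlonglongrightarrow> 0"
proof (rule tendsto_sandwich[OF _ _ tendsto_const])
  show "\<forall>\<^sub>F i in sequentially. 0 \<le> F (real i * bc)" using bc_pos by (simp add: F_bounds)
  show "\<forall>\<^sub>F i in sequentially. F (real i * bc) \<le> n * (1 - r) ^ i" by (simp add: F_geometric[OF mc r])
  have "(\<lambda>i. n * (1 - r) ^ i) \<longlonglongrightarrow> n * 0"
    using r_pos[OF mc r] r_le_1[OF mc r] by (intro tendsto_mult tendsto_const LIMSEQ_power_zero) auto
  then show "(\<lambda>i. n * (1 - r) ^ i) \<longlonglongrightarrow> 0" by simp
qed

end

lemma mean_field_limit:
  assumes P: "chain_law V q \<pi> P" and Pc: "coalescing_law V q P\<^sub>c" and small: "\<epsilon> \<le> 1 / 10000"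
  shows "d_W (scaled_coalescence_law P\<^sub>c (mean_meeting_time P)) exponential_sum_law \<le> ennreal (20000 * \<epsilon>)"
    and "\<bar>mean_coalescence_time P\<^sub>c / mean_meeting_time P - 2\<bar> \<le> 20000 * \<epsilon>"
proof -
  define m where "m = mean_meeting_time P"
  obtain j0 where "\<And>j. j0 \<le> j \<Longrightarrow> summable (\<lambda>t. 1 - meetc (mesh j) t)"
    using eventually_summable_meetc unfolding eventually_sequentially by blast
  then have mc: "(\<lambda>j. mesh j * (\<Sum>t. 1 - meetc (mesh j) t)) \<longlonglongrightarrow> m"
    unfolding m_def by (rule mean_meeting_limit[OF P])
  have m: "0 < m" by (rule mc_pos[OF mc refl])
  have "AE \<eta> in P\<^sub>c. coalescence_time \<eta> \<noteq> \<top>"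
    by (rule coalescence_finite[OF Pc F_tendsto_0[OF mc refl]]) (use bc_pos in simp)
  note tail = scaled_tail[OF Pc this m]
  have "d_W (scaled_coalescence_law P\<^sub>c m) exponential_sum_law
    = (\<integral>\<^sup>+x. ennreal \<bar>F (m * x) - exp_tail x\<bar> * indicator {0..} x \<partial>lborel)"
    unfolding d_W_def tail exp_tail_def[symmetric]
    by (intro nn_integral_cong) (auto simp: indicator_def exp_tail_neg)
  then show "d_W (scaled_coalescence_law P\<^sub>c (mean_meeting_time P)) exponential_sum_law \<le> ennreal (20000 * \<epsilon>)"
    using limit_comparison(1)[OF mc refl small] by (simp add: m_def)
  show "\<bar>mean_coalescence_time P\<^sub>c / mean_meeting_time P - 2\<bar> \<le> 20000 * \<epsilon>"
    using limit_comparison(2)[OF mc refl small] coalescence_mean[OF Pc] by (simp add: mean_coalescence_time_def m_def)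
qed

end

theorem theorem1p2:
  "\<exists>C::real. C > 0 \<and> (\<exists>\<xi>::real. \<xi> > 0 \<and>
    (\<forall>(V :: nat set) (q :: nat \<Rightarrow> nat \<Rightarrow> real) (\<pi> :: nat \<Rightarrow> real)
       (P :: (real \<Rightarrow> nat) measure) (P\<^sub>c :: (real \<Rightarrow> nat set) measure).
      finite V \<longrightarrow> card V \<ge> 2 \<longrightarrow> rates V q \<longrightarrow> mixing V q \<pi> \<longrightarrow>
      chain_law V q \<pi> P \<longrightarrow> coalescing_law V q P\<^sub>c \<longrightarrow>
      alpha V q \<pi> \<le> exp (-1) \<longrightarrow> mf_error V q \<pi> \<le> \<xi> \<longrightarrow>
        d_W (scaled_coalescence_law P\<^sub>c (mean_meeting_time P)) exponential_sum_law
          \<le> ennreal (C * mf_error V q \<pi>) \<and>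
        \<bar>mean_coalescence_time P\<^sub>c / mean_meeting_time P - 2\<bar> \<le> C * mf_error V q \<pi>))"
\<comment> \<open>20000 leaves room over the \<open>10100 * \<epsilon>\<close> obtained for the
  distance, and the threshold \<open>1 / 10000\<close> implies the \<open>1 / 100\<close> assumed by
  the grid estimates.\<close>
proof (rule exI[of _ 20000], rule conjI, simp, rule exI[of _ "1 / 10000"], rule conjI, simp, intro allI impI)
  fix V q \<pi> and P :: "(real \<Rightarrow> nat) measure" and P\<^sub>c :: "(real \<Rightarrow> nat set) measure"
  assume "finite V" "card V \<ge> 2" "rates V q" "mixing V q \<pi>" and P: "chain_law V q \<pi> P" "coalescing_law V q P\<^sub>c"
    and "alpha V q \<pi> \<le> exp (-1)" and error: "mf_error V q \<pi> \<le> 1 / 10000"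
  then interpret mf_setting V q \<pi> by unfold_locales auto
  show "d_W (scaled_coalescence_law P\<^sub>c (mean_meeting_time P)) exponential_sum_law \<le> ennreal (20000 * mf_error V q \<pi>)
    \<and> \<bar>mean_coalescence_time P\<^sub>c / mean_meeting_time P - 2\<bar> \<le> 20000 * mf_error V q \<pi>"
    using mean_field_limit[OF P error] by blast
qed

end
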